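(* Let $(R,\mathfrak{m})$ be a Cohen-Macaulay local ring of dimension $d\ge 2$ with infinite residue field, and let $I$ be an $\mathfrak{m}$-primary ideal of minimal mixed multiplicity. Let $x\in\mathfrak{m}$ and $a_1,\dots,a_{d-1}\in I$ be such that $x,a_1,\dots,a_{d-1}$ is a joint reduction of the multi-set of ideals consisting of one copy of $\mathfrak{m}$ and $d-1$ copies of $I$. Let $1\le t\le d-1$. If $a_1^{*},\dots,a_t^{*}$ is a regular sequence in $G(I)$, then $a_1^{o},\dots,a_t^{o}$ is a regular sequence in $F(I)$. In particular, if $\operatorname{depth} G(I)\ge d-1$, then $\operatorname{depth} F(I)\ge d-1$.
   Context: For an $\mathfrak{m}$-primary ideal $I$ of a Noetherian local ring $(R,\mathfrak{m})$ of dimension $d$: $G(I)=\bigoplus_{n\ge 0} I^n/I^{n+1}$ is the associated graded ring and $F(I)=\bigoplus_{n\ge 0} I^n/\mathfrak{m}I^n$ is the fiber cone; depths of these graded rings are taken with respect to the maximal homogeneous ideal. For $a\in I$, $a^{*}$ denotes the image of $a$ in $I/I^2=G(I)_1$ and $a^{o}$ the image of $a$ in $I/\mathfrak{m}I=F(I)_1$. Mixed multiplicities: for all large $r,s$ the length $\ell(R/\mathfrak{m}^rI^s)$ is given by a polynomial which can be written as $\sum_{i+j\le d} e_{ij}\binom{r+i}{i}\binom{s+j}{j}$ with integers $e_{ij}$; for $i+j=d$ put $e_j(\mathfrak{m}|I)=e_{ij}$, $j=0,\dots,d$. The ideal $I$ has minimal mixed multiplicity if $\mu(I)=e_{d-1}(\mathfrak{m}|I)+d-1$,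 where $\mu(I)=\ell(I/\mathfrak{m}I)$ is the minimal number of generators of $I$. Joint reductions: elements $x_1,\dots,x_d$ form a joint reduction of ideals $I_1,\dots,I_d$ if $x_i\in I_i$ for all $i$ and there is a positive integer $n$ with $\left[\sum_{j=1}^d x_j I_1\cdots\widehat{I_j}\cdots I_d\right](I_1\cdots I_d)^{n-1}=(I_1\cdots I_d)^n$ (the hat denotes omission). *)

theory Defs
  imports "HOL-Algebra.Algebra" "HOL-Library.Extended_Nat"
begin

section \<open>Noetherian local rings and length\<close>

definition noetherian_local_ring :: "('a, 'b) ring_scheme \<Rightarrow> 'a set \<Rightarrow> bool"
  where "noetherian_local_ring R \<mm> \<longleftrightarrow>
    cring R \<and> noetherian_ring R \<and> maximalideal \<mm> R \<and> (\<forall>J. maximalideal J R \<longrightarrow> J = \<mm>)"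

definition krull_dim :: "('a, 'b) ring_scheme \<Rightarrow> enat"
  where "krull_dim R = Sup {enat n | n. \<exists>P :: nat \<Rightarrow> 'a set.
    (\<forall>i\<le>n. primeideal (P i) R) \<and> (\<forall>i<n. P i \<subset> P (Suc i))}"

definition module_length :: "('a, 'c) ring_scheme \<Rightarrow> ('a, 'b, 'd) module_scheme \<Rightarrow> enat"
  where "module_length R M = Sup {enat n | n. \<exists>N :: nat \<Rightarrow> 'b set.
    (\<forall>i\<le>n. submodule (N i) R M) \<and> (\<forall>i<n. N i \<subset> N (Suc i))}"

text \<open>The \<open>R\<close>-module \<open>A/B\<close> for ideals \<open>B \<subseteq> A\<close> of \<open>R\<close>. The fields \<open>mult\<close> and \<open>one\<close> are
  required by the record type only and play no role in the module structure.\<close>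

definition quot_module :: "('a, 'b) ring_scheme \<Rightarrow> 'a set \<Rightarrow> 'a set \<Rightarrow> ('a, 'a set) module"
  where "quot_module R A B =
    \<lparr>carrier = (\<lambda>a. B +>\<^bsub>R\<^esub> a) ` A, monoid.mult = rcoset_mult R B, monoid.one = B +>\<^bsub>R\<^esub> \<one>\<^bsub>R\<^esub>,
     ring.zero = B, ring.add = set_add R,
     module.smult = (\<lambda>r C. rcoset_mult R B (B +>\<^bsub>R\<^esub> r) C)\<rparr>"

definition radical_ideal :: "('a, 'b) ring_scheme \<Rightarrow> 'a set \<Rightarrow> 'a set"
  where "radical_ideal R I = {a \<in> carrier R. \<exists>n::nat. a [^]\<^bsub>R\<^esub> n \<in> I}"

definition primary_ideal :: "('a, 'b) ring_scheme \<Rightarrow> 'a set \<Rightarrow> bool"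
  where "primary_ideal R I \<longleftrightarrow> ideal I R \<and> I \<noteq> carrier R \<and>
    (\<forall>a\<in>carrier R. \<forall>b\<in>carrier R. a \<otimes>\<^bsub>R\<^esub> b \<in> I \<longrightarrow> a \<in> I \<or> b \<in> radical_ideal R I)"

definition primary_to :: "('a, 'b) ring_scheme \<Rightarrow> 'a set \<Rightarrow> 'a set \<Rightarrow> bool"
  where "primary_to R \<mm> I \<longleftrightarrow> primary_ideal R I \<and> radical_ideal R I = \<mm>"

abbreviation ideal_power :: "('a, 'b) ring_scheme \<Rightarrow> 'a set \<Rightarrow> nat \<Rightarrow> 'a set"
  where "ideal_power R I n \<equiv> I [^]\<^bsub>ideals_set R\<^esub> n"


section \<open>Regular sequences and depth\<close>

definition nonzerodivisor :: "('a, 'b) ring_scheme \<Rightarrow> 'a \<Rightarrow> bool"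
  where "nonzerodivisor S y \<longleftrightarrow>
    y \<in> carrier S \<and> (\<forall>z\<in>carrier S. y \<otimes>\<^bsub>S\<^esub> z = \<zero>\<^bsub>S\<^esub> \<longrightarrow> z = \<zero>\<^bsub>S\<^esub>)"

definition regular_sequence :: "('a, 'b) ring_scheme \<Rightarrow> 'a list \<Rightarrow> bool"
  where "regular_sequence S ys \<longleftrightarrow>
    set ys \<subseteq> carrier S \<and>
    (\<forall>i<length ys. let J = Idl\<^bsub>S\<^esub> (set (take i ys))
       in nonzerodivisor (S Quot J) (J +>\<^bsub>S\<^esub> (ys ! i))) \<and>
    Idl\<^bsub>S\<^esub> (set ys) \<noteq> carrier S"

definition depth :: "('a, 'b) ring_scheme \<Rightarrow> 'a set \<Rightarrow> enat"
  where "depth S J = Sup {enat (length ys) | ys. set ys \<subseteq> J \<and> regular_sequence S ys}"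

definition cohen_macaulay_local_ring :: "('a, 'b) ring_scheme \<Rightarrow> 'a set \<Rightarrow> bool"
  where "cohen_macaulay_local_ring R \<mm> \<longleftrightarrow>
    noetherian_local_ring R \<mm> \<and> depth R \<mm> = krull_dim R"


section \<open>The associated graded ring and the fiber cone\<close>

text \<open>The graded ring \<open>\<Oplus>\<^sub>n I\<^sup>n/K\<^sub>n\<close> for ideals \<open>K\<^sub>n \<subseteq> I\<^sup>n\<close> with \<open>I\<^sup>i K\<^sub>j \<subseteq> K\<^bsub>i+j\<^esub>\<close>. An element is
  the sequence of its homogeneous components, with only finitely many nonzero; the
  \<open>n\<close>-th component is a coset in \<open>I\<^sup>n/K\<^sub>n \<subseteq> R/K\<^sub>n\<close>. The product of \<open>u + K\<^sub>i\<close> and \<open>v + K\<^sub>j\<close>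
  is \<open>uv + K\<^bsub>i+j\<^esub>\<close>.\<close>

definition graded_ring ::
    "('a, 'b) ring_scheme \<Rightarrow> 'a set \<Rightarrow> (nat \<Rightarrow> 'a set) \<Rightarrow> (nat \<Rightarrow> 'a set) ring"
  where "graded_ring R I K =
    \<lparr>carrier = {f. (\<forall>n. f n \<in> (\<lambda>a. K n +>\<^bsub>R\<^esub> a) ` ideal_power R I n) \<and>
                   finite {n. f n \<noteq> K n}},
     monoid.mult = (\<lambda>f g n. \<Oplus>\<^bsub>R Quot K n\<^esub>i\<in>{..n}. rcoset_mult R (K n) (f i) (g (n - i))),
     monoid.one = (\<lambda>n. if n = 0 then K 0 +>\<^bsub>R\<^esub> \<one>\<^bsub>R\<^esub> else K n),
     ring.zero = K,
     ring.add = (\<lambda>f g n. f n \<oplus>\<^bsub>R Quot K n\<^esub> g n)\<rparr>"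

text \<open>The element of degree one given by the image of \<open>a \<in> I\<close> in \<open>I/K\<^sub>1\<close>.\<close>

definition degree_one_form ::
    "('a, 'b) ring_scheme \<Rightarrow> (nat \<Rightarrow> 'a set) \<Rightarrow> 'a \<Rightarrow> nat \<Rightarrow> 'a set"
  where "degree_one_form R K a = (\<lambda>n. if n = 1 then K 1 +>\<^bsub>R\<^esub> a else K n)"

text \<open>For a local ring \<open>(R,\<mm>)\<close> and \<open>K\<^sub>0 \<subseteq> \<mm>\<close>, the maximal homogeneous ideal is
  \<open>\<mm>/K\<^sub>0 \<oplus> \<Oplus>\<^bsub>n>0\<^esub> I\<^sup>n/K\<^sub>n\<close>; a coset of \<open>K\<^sub>0\<close> lies in \<open>\<mm>/K\<^sub>0\<close> iff it is contained in \<open>\<mm>\<close>.\<close>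

definition max_homogeneous_ideal ::
    "('a, 'b) ring_scheme \<Rightarrow> 'a set \<Rightarrow> 'a set \<Rightarrow> (nat \<Rightarrow> 'a set) \<Rightarrow> (nat \<Rightarrow> 'a set) set"
  where "max_homogeneous_ideal R \<mm> I K = {f \<in> carrier (graded_ring R I K). f 0 \<subseteq> \<mm>}"

definition assoc_filtration :: "('a, 'b) ring_scheme \<Rightarrow> 'a set \<Rightarrow> nat \<Rightarrow> 'a set"
  where "assoc_filtration R I n = ideal_power R I (n + 1)"

definition fiber_filtration ::
    "('a, 'b) ring_scheme \<Rightarrow> 'a set \<Rightarrow> 'a set \<Rightarrow> nat \<Rightarrow> 'a set"
  where "fiber_filtration R \<mm> I n = \<mm> \<cdot>\<^bsub>R\<^esub> ideal_power R I n"

definition assoc_graded_ring :: "('a, 'b) ring_scheme \<Rightarrow> 'a set \<Rightarrow> (nat \<Rightarrow> 'a set) ring"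
  where "assoc_graded_ring R I = graded_ring R I (assoc_filtration R I)"

definition fiber_cone :: "('a, 'b) ring_scheme \<Rightarrow> 'a set \<Rightarrow> 'a set \<Rightarrow> (nat \<Rightarrow> 'a set) ring"
  where "fiber_cone R \<mm> I = graded_ring R I (fiber_filtration R \<mm> I)"

definition assoc_form :: "('a, 'b) ring_scheme \<Rightarrow> 'a set \<Rightarrow> 'a \<Rightarrow> nat \<Rightarrow> 'a set"
  where "assoc_form R I a = degree_one_form R (assoc_filtration R I) a"

definition fiber_form :: "('a, 'b) ring_scheme \<Rightarrow> 'a set \<Rightarrow> 'a set \<Rightarrow> 'a \<Rightarrow> nat \<Rightarrow> 'a set"
  where "fiber_form R \<mm> I a = degree_one_form R (fiber_filtration R \<mm> I) a"

definition depth_assoc_graded :: "('a, 'b) ring_scheme \<Rightarrow> 'a set \<Rightarrow> 'a set \<Rightarrow> enat"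
  where "depth_assoc_graded R \<mm> I =
    depth (assoc_graded_ring R I) (max_homogeneous_ideal R \<mm> I (assoc_filtration R I))"

definition depth_fiber_cone :: "('a, 'b) ring_scheme \<Rightarrow> 'a set \<Rightarrow> 'a set \<Rightarrow> enat"
  where "depth_fiber_cone R \<mm> I =
    depth (fiber_cone R \<mm> I) (max_homogeneous_ideal R \<mm> I (fiber_filtration R \<mm> I))"


section \<open>Mixed multiplicities\<close>

text \<open>\<open>e\<close> lists the coefficients of the polynomial giving \<open>\<ell>(R/\<mm>\<^sup>r I\<^sup>s)\<close> for all large \<open>r\<close>, \<open>s\<close>.
  Such integers exist when \<open>(R,\<mm>)\<close> is Noetherian local of dimension \<open>d\<close> and \<open>I\<close> is \<open>\<mm>\<close>-primary,
  and the \<open>e i j\<close> with \<open>i + j \<le> d\<close> are uniquely determined.\<close>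

definition bhattacharya_coeffs ::
    "('a, 'b) ring_scheme \<Rightarrow> 'a set \<Rightarrow> 'a set \<Rightarrow> nat \<Rightarrow> (nat \<Rightarrow> nat \<Rightarrow> int) \<Rightarrow> bool"
  where "bhattacharya_coeffs R \<mm> I d e \<longleftrightarrow>
    (\<exists>N. \<forall>r\<ge>N. \<forall>s\<ge>N. \<exists>l.
       module_length R (quot_module R (carrier R) (ideal_power R \<mm> r \<cdot>\<^bsub>R\<^esub> ideal_power R I s)) = enat l \<and>
       int l = (\<Sum>i\<le>d. \<Sum>j\<le>d - i. e i j * int ((r + i) choose i) * int ((s + j) choose j)))"

text \<open>The relation \<open>e\<^sub>j(\<mm>|I) = c\<close>; the index \<open>j\<close> belongs to the exponent \<open>s\<close> of \<open>I\<close>. It is kept as a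
  relation (determining \<open>c\<close> uniquely) so that no value has to be chosen by description.\<close>

definition has_mixed_multiplicity ::
    "('a, 'b) ring_scheme \<Rightarrow> 'a set \<Rightarrow> 'a set \<Rightarrow> nat \<Rightarrow> nat \<Rightarrow> int \<Rightarrow> bool"
  where "has_mixed_multiplicity R \<mm> I d j c \<longleftrightarrow>
    j \<le> d \<and> (\<exists>e. bhattacharya_coeffs R \<mm> I d e \<and> e (d - j) j = c)"

definition num_gens :: "('a, 'b) ring_scheme \<Rightarrow> 'a set \<Rightarrow> 'a set \<Rightarrow> enat"
  where "num_gens R \<mm> I = module_length R (quot_module R I (\<mm> \<cdot>\<^bsub>R\<^esub> I))"

definition minimal_mixed_multiplicity ::
    "('a, 'b) ring_scheme \<Rightarrow> 'a set \<Rightarrow> 'a set \<Rightarrow> nat \<Rightarrow> bool"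
  where "minimal_mixed_multiplicity R \<mm> I d \<longleftrightarrow>
    (\<exists>c \<mu>. has_mixed_multiplicity R \<mm> I d (d - 1) c \<and> num_gens R \<mm> I = enat \<mu> \<and>
           int \<mu> = c + int d - 1)"


section \<open>Joint reductions\<close>

text \<open>\<open>P A\<close> is the product of the ideals \<open>I\<^sub>i\<close> with \<open>i \<in> A\<close>; indices start at \<open>0\<close>.
  The sum of the ideals \<open>x\<^sub>j P (D - {j})\<close> is written as the ideal generated by their union.\<close>

definition joint_reduction :: "('a, 'b) ring_scheme \<Rightarrow> 'a set list \<Rightarrow> 'a list \<Rightarrow> bool"
  where "joint_reduction R Is xs \<longleftrightarrow>
    length xs = length Is \<and> (\<forall>i<length Is. xs ! i \<in> Is ! i) \<and>
    (let P = (\<lambda>A. finprod (ideals_set R) (\<lambda>i. Is ! i) A); D = {..<length Is} in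
     \<exists>n\<ge>1. (Idl\<^bsub>R\<^esub> (\<Union>j\<in>D. (\<lambda>b. xs ! j \<otimes>\<^bsub>R\<^esub> b) ` P (D - {j}))) \<cdot>\<^bsub>R\<^esub> ideal_power R (P D) (n - 1)
            = ideal_power R (P D) n)"

end

theory Submission
  imports Defs Complex_Main "HOL-Library.Product_Plus"
begin

text \<open>A joint reduction \<open>(x, a\<^sub>1, \<dots>, a\<^bsub>d-1\<^esub>)\<close> is a permutable regular sequence, and counting
  lengths of \<open>\<mm>\<^sup>r I\<^sup>s/(x\<mm>\<^sup>r I\<^sup>s + \<dots>)\<close> bounds \<open>\<ell>(R/(x, a\<^sub>1, \<dots>, a\<^bsub>d-1\<^esub>))\<close> by \<open>e\<^bsub>d-1\<^esub>(\<mm>|I)\<close>.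
  Minimality of \<open>\<mu>(I)\<close> then forces \<open>\<mm>I = xI + \<mm>J\<close> with \<open>J = (a\<^sub>1, \<dots>, a\<^bsub>d-1\<^esub>)\<close>, hence
  \<open>\<mm>I\<^sup>n = xI\<^sup>n + \<mm>J\<^sup>n\<close>. If \<open>a\<^bsub>i+1\<^esub> b \<in> \<mm>I\<^bsup>n+1\<^esup> + (a\<^sub>1, \<dots>, a\<^sub>i)I\<^sup>n\<close>, this identity and the fact that
  \<open>x\<close> is a nonzerodivisor modulo powers of ideals generated by part of the sequence reduce the claim
  on \<open>b\<close> to the regularity of the forms in \<open>G(I)\<close>.

  For the depth statement one needs a joint reduction whose forms in \<open>G(I)\<close> are regular. It is
  built one element at a time: a degree-one form avoiding finitely many zero-divisor ideals exists
  because \<open>G(I)\<close> modulo a shorter regular sequence has no socle and the residue field is infinite.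
  Superficiality for the bigraded modules \<open>\<mm>\<^sup>r I\<^sup>s/\<mm>\<^bsup>r+1\<^esup> I\<^sup>s\<close> can be imposed simultaneously, and
  differences of the Bhattacharya polynomial show that the elements form a joint reduction.\<close>

no_notation Sum_Type.Plus (infixr \<open><+>\<close> 65)

section \<open>Ideals and regular sequences\<close>

text \<open>Cohen-Macaulayness enters through one regular sequence of length d in the maximal ideal
  M. To pass from it to x, a_1, ..., a_(d-1), depth is measured by socles: whether R modulo a
  regular sequence in M has a nonzero element killed by M depends only on the length of the sequence
  (an Ext group in disguise), so regular sequences can be exchanged and extended by elementary
  means. Finitely many maximal annihilators and an infinite set with unit differences allow
  arbitrary ideals, not just primes, to be avoided.

  Lengths are counted by chains of ideals of R between two given ones, which turns exact sequences
  into identities between colengths.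

  The difficulty of the depth statement is that one element must be regular on G(I) and superficial
  for the powers of M and I at once, which are conditions on different graded modules. Both are
  encoded by graded submodules of the bigraded algebra with components M^r I^s. Its component of
  degree (0, 1) is I itself, so one avoidance argument inside I serves both conditions.\<close>

locale noetherian_cring = noetherian_ring R + cring R for R (structure)

text \<open>Regularity modulo K is stated by membership in R, so that no quotient ring has to be
  formed along a regular sequence; \<open>nonzerodivisor_Quot_iff\<close> links it to
  cosets.\<close>

definition nzd_mod :: "('a, 'b) ring_scheme \<Rightarrow> 'a set \<Rightarrow> 'a \<Rightarrow> bool"
  where "nzd_mod R K y \<longleftrightarrow> (\<forall>z\<in>carrier R. y \<otimes>\<^bsub>R\<^esub> z \<in> K \<longrightarrow> z \<in> K)"

definition ipow :: "('a, 'b) ring_scheme \<Rightarrow> 'a set \<Rightarrow> nat \<Rightarrow> 'a set"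
  where "ipow R A n = ideal_power R A n"

text \<open>Adding one generator at a time keeps the recursion parallel to that of
  \<open>regular_mod\<close>; the result depends only on the set of generators by
  \<open>adjoin_cong_set\<close>.\<close>

fun adjoin :: "('a, 'b) ring_scheme \<Rightarrow> 'a set \<Rightarrow> 'a list \<Rightarrow> 'a set"
  where "adjoin R K [] = K"
  | "adjoin R K (y # ys) = adjoin R (K <+>\<^bsub>R\<^esub> PIdl\<^bsub>R\<^esub> y) ys"

fun regular_mod :: "('a, 'b) ring_scheme \<Rightarrow> 'a set \<Rightarrow> 'a list \<Rightarrow> bool"
  where "regular_mod R K [] \<longleftrightarrow> True"
  | "regular_mod R K (y # ys) \<longleftrightarrow> nzd_mod R K y \<and> regular_mod R (K <+>\<^bsub>R\<^esub> PIdl\<^bsub>R\<^esub> y) ys"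

lemma nzd_modD: "nzd_mod R K y \<Longrightarrow> z \<in> carrier R \<Longrightarrow> y \<otimes>\<^bsub>R\<^esub> z \<in> K \<Longrightarrow> z \<in> K"
  by (simp add: nzd_mod_def)

section \<open>Sums, products and colons of ideals\<close>

context cring
begin


lemma ideal_mem_carrier: "ideal A R \<Longrightarrow> x \<in> A \<Longrightarrow> x \<in> carrier R"
  by (rule ideal.Icarr)

lemma ideal_subset_carrier: "ideal A R \<Longrightarrow> A \<subseteq> carrier R"
  by (rule subsetI) (rule ideal_mem_carrier)

lemma ideal_zero_mem: "ideal A R \<Longrightarrow> \<zero> \<in> A"
  by (simp add: additive_subgroup.zero_closed ideal.axioms(1))

lemma ideal_add_mem: "ideal A R \<Longrightarrow> x \<in> A \<Longrightarrow> y \<in> A \<Longrightarrow> x \<oplus> y \<in> A"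
  by (simp add: additive_subgroup.a_closed ideal.axioms(1))

lemma ideal_inv_mem: "ideal A R \<Longrightarrow> x \<in> A \<Longrightarrow> \<ominus> x \<in> A"
  by (simp add: additive_subgroup.a_inv_closed ideal.axioms(1))

lemma ideal_diff_mem: "ideal A R \<Longrightarrow> x \<in> A \<Longrightarrow> y \<in> A \<Longrightarrow> x \<ominus> y \<in> A"
  by (simp add: a_minus_def ideal_add_mem ideal_inv_mem)

lemma ideal_mult_mem: "ideal A R \<Longrightarrow> x \<in> A \<Longrightarrow> r \<in> carrier R \<Longrightarrow> r \<otimes> x \<in> A"
  by (rule ideal.I_l_closed)

lemma ideal_mult_mem': "ideal A R \<Longrightarrow> x \<in> A \<Longrightarrow> r \<in> carrier R \<Longrightarrow> x \<otimes> r \<in> A"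
  by (rule ideal.I_r_closed)

lemma ideal_finsum_mem: "ideal A R \<Longrightarrow> (\<And>i. i \<in> S \<Longrightarrow> f i \<in> A) \<Longrightarrow> finsum R f S \<in> A"
proof (induction S rule: infinite_finite_induct)
  case (insert x F)
  then have "f \<in> F \<rightarrow> carrier R" "f x \<in> carrier R"
    using ideal_mem_carrier[of A] by auto
  then have "finsum R f (insert x F) = f x \<oplus> finsum R f F"
    using insert.hyps by simp
  then show ?case
    using insert by (simp add: ideal_add_mem)
qed (simp_all add: ideal_zero_mem finsum_infinite)

lemma ideal_ofI:
  assumes "A \<subseteq> carrier R" "\<zero> \<in> A" "\<And>x y. x \<in> A \<Longrightarrow> y \<in> A \<Longrightarrow> x \<oplus> y \<in> A"
    "\<And>x r. x \<in> A \<Longrightarrow> r \<in> carrier R \<Longrightarrow> r \<otimes> x \<in> A"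
  shows "ideal A R"
proof (rule idealI)
  show "ring R" by (rule ring_axioms)
  show "subgroup A (add_monoid R)"
  proof (rule add.subgroupI)
    show "A \<subseteq> carrier R" "A \<noteq> {}" using assms by auto
    show "\<ominus> a \<in> A" if "a \<in> A" for a
    proof -
      have "\<ominus> a = (\<ominus> \<one>) \<otimes> a"
        using that assms(1) by (simp add: l_minus subset_iff)
      then show ?thesis using assms(4)[OF that, of "\<ominus> \<one>"] by simp
    qed
    show "a \<oplus> b \<in> A" if "a \<in> A" "b \<in> A" for a b
      using assms(3) that .
  qed
  fix a x assume "a \<in> A" "x \<in> carrier R"
  then show "x \<otimes> a \<in> A" "a \<otimes> x \<in> A"
    using assms(1,4) m_comm[of a x] by auto
qed

lemmas ideal_mems = ideal_zero_mem ideal_add_mem ideal_inv_mem ideal_diff_mem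
  ideal_mult_mem ideal_mult_mem'

lemma mem_set_add: "z \<in> A <+> B \<longleftrightarrow> (\<exists>a\<in>A. \<exists>b\<in>B. z = a \<oplus> b)"
  by (auto simp: set_add_def')

lemma set_addI: "a \<in> A \<Longrightarrow> b \<in> B \<Longrightarrow> a \<oplus> b \<in> A <+> B"
  by (auto simp: mem_set_add)

lemma set_add_left: "ideal A R \<Longrightarrow> ideal B R \<Longrightarrow> x \<in> A \<Longrightarrow> x \<in> A <+> B"
  using set_addI[of x A \<zero> B] by (simp add: ideal_zero_mem ideal_mem_carrier)

lemma set_add_right: "ideal A R \<Longrightarrow> ideal B R \<Longrightarrow> x \<in> B \<Longrightarrow> x \<in> A <+> B"
  using set_addI[of \<zero> A x B] by (simp add: ideal_zero_mem ideal_mem_carrier)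

lemma set_add_upper1: "ideal A R \<Longrightarrow> ideal B R \<Longrightarrow> A \<subseteq> A <+> B"
  and set_add_upper2: "ideal A R \<Longrightarrow> ideal B R \<Longrightarrow> B \<subseteq> A <+> B"
  by (simp_all add: subset_iff set_add_left set_add_right)

lemma set_add_least: "ideal C R \<Longrightarrow> A \<subseteq> C \<Longrightarrow> B \<subseteq> C \<Longrightarrow> A <+> B \<subseteq> C"
  unfolding set_add_def' by (auto intro!: ideal_add_mem)

lemma set_add_mono: "A \<subseteq> A' \<Longrightarrow> B \<subseteq> B' \<Longrightarrow> A <+> B \<subseteq> A' <+> B'"
  unfolding set_add_def' by blast

lemma ideal_set_add_comm: "ideal A R \<Longrightarrow> ideal B R \<Longrightarrow> A <+> B = B <+> A"
  by (simp add: set_add_comm ideal_subset_carrier)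

lemma ideal_set_add_assoc:
  "ideal A R \<Longrightarrow> ideal B R \<Longrightarrow> ideal C R \<Longrightarrow> (A <+> B) <+> C = A <+> (B <+> C)"
  by (simp add: add.set_mult_assoc ideal_subset_carrier set_add_defs(1))

lemma ideal_set_add_left_comm:
  "ideal A R \<Longrightarrow> ideal B R \<Longrightarrow> ideal C R \<Longrightarrow> A <+> (B <+> C) = B <+> (A <+> C)"
  by (metis ideal_set_add_assoc ideal_set_add_comm)

lemmas ideal_add_ac = ideal_set_add_assoc ideal_set_add_comm ideal_set_add_left_comm

lemma ideal_prod_least:
  "ideal C R \<Longrightarrow> (\<And>a b. a \<in> A \<Longrightarrow> b \<in> B \<Longrightarrow> a \<otimes> b \<in> C) \<Longrightarrow> A \<cdot> B \<subseteq> C"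
proof
  fix x assume *: "ideal C R" "\<And>a b. a \<in> A \<Longrightarrow> b \<in> B \<Longrightarrow> a \<otimes> b \<in> C" and "x \<in> A \<cdot> B"
  from this(3) show "x \<in> C"
    by (induction rule: ideal_prod.induct) (auto simp: * intro: ideal_add_mem)
qed

lemma ideal_prod_mono: "A \<subseteq> A' \<Longrightarrow> B \<subseteq> B' \<Longrightarrow> A \<cdot> B \<subseteq> A' \<cdot> B'"
proof
  fix x assume "A \<subseteq> A'" "B \<subseteq> B'" "x \<in> A \<cdot> B"
  from this(3) this(1,2) show "x \<in> A' \<cdot> B'"
    by (induction rule: ideal_prod.induct) (auto intro: ideal_prod.intros)
qed

lemma ideal_prod_subset_right: "ideal A R \<Longrightarrow> ideal B R \<Longrightarrow> A \<cdot> B \<subseteq> B"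
  and ideal_prod_subset_left: "ideal A R \<Longrightarrow> ideal B R \<Longrightarrow> A \<cdot> B \<subseteq> A"
  using ideal_prod_inter by auto

lemma ideal_prod_left_comm:
  "ideal A R \<Longrightarrow> ideal B R \<Longrightarrow> ideal C R \<Longrightarrow> A \<cdot> (B \<cdot> C) = B \<cdot> (A \<cdot> C)"
  by (metis ideal_prod_assoc ideal_prod_commute)

lemmas ideal_prod_ac = ideal_prod_assoc ideal_prod_commute ideal_prod_left_comm

lemma ideal_prod_one': "ideal A R \<Longrightarrow> carrier R \<cdot> A = A"
  by (metis ideal_prod_commute ideal_prod_one oneideal)

lemma mem_cgenideal: "z \<in> PIdl x \<longleftrightarrow> (\<exists>r\<in>carrier R. z = r \<otimes> x)"
  by (auto simp: cgenideal_def)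

text \<open>The multiples x a with a in A already form an ideal, so sums of products collapse to a
  single product.\<close>

lemma mem_cgenideal_prod:
  assumes "ideal A R" "x \<in> carrier R"
  shows "z \<in> (PIdl x) \<cdot> A \<longleftrightarrow> (\<exists>a\<in>A. z = x \<otimes> a)"
proof
  have *: "ideal {x \<otimes> a |a. a \<in> A} R"
  proof (rule ideal_ofI)
    show "{x \<otimes> a |a. a \<in> A} \<subseteq> carrier R"
      using assms by (auto dest: ideal_mem_carrier)
    show "\<zero> \<in> {x \<otimes> a |a. a \<in> A}"
      using assms ideal_zero_mem[of A] r_null by force
    fix y y' r assume "y \<in> {x \<otimes> a |a. a \<in> A}"
    then obtain a where a: "a \<in> A" "y = x \<otimes> a" by auto
    then have ac: "a \<in> carrier R" using assms by (auto dest: ideal_mem_carrier)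
    show "y \<oplus> y' \<in> {x \<otimes> a |a. a \<in> A}" if "y' \<in> {x \<otimes> a |a. a \<in> A}"
    proof -
      obtain b where b: "b \<in> A" "y' = x \<otimes> b" using \<open>y' \<in> _\<close> by auto
      then have "y \<oplus> y' = x \<otimes> (a \<oplus> b)"
        using a ac assms by (auto simp: r_distr dest: ideal_mem_carrier)
      then show ?thesis using a b assms ideal_add_mem by blast
    qed
    show "r \<otimes> y \<in> {x \<otimes> a |a. a \<in> A}" if "r \<in> carrier R"
    proof -
      have "r \<otimes> y = x \<otimes> (r \<otimes> a)"
        using a ac assms that by (simp add: m_lcomm)
      then show ?thesis using a assms that ideal_mult_mem by blast
    qed
  qed
  assume "z \<in> (PIdl x) \<cdot> A"
  moreover have "(PIdl x) \<cdot> A \<subseteq> {x \<otimes> a |a. a \<in> A}"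
  proof (rule ideal_prod_least[OF *])
    fix u a assume "u \<in> PIdl x" "a \<in> A"
    then obtain r where "r \<in> carrier R" "u = r \<otimes> x" by (auto simp: mem_cgenideal)
    then have "u \<otimes> a = x \<otimes> (r \<otimes> a)"
      using assms \<open>a \<in> A\<close> ideal_mem_carrier[of A a] by (simp add: m_ac)
    then show "u \<otimes> a \<in> {x \<otimes> a |a. a \<in> A}"
      using \<open>a \<in> A\<close> \<open>r \<in> carrier R\<close> assms ideal_mult_mem by blast
  qed
  ultimately show "\<exists>a\<in>A. z = x \<otimes> a" by blast
next
  assume "\<exists>a\<in>A. z = x \<otimes> a"
  then show "z \<in> (PIdl x) \<cdot> A"
    using assms by (auto intro!: ideal_prod.prod simp: cgenideal_self)
qed

lemma mem_add_cgenideal: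
  assumes "ideal K R" "x \<in> carrier R"
  shows "z \<in> K <+> PIdl x \<longleftrightarrow> (\<exists>k\<in>K. \<exists>r\<in>carrier R. z = k \<oplus> x \<otimes> r)"
proof
  assume "z \<in> K <+> PIdl x"
  then obtain k r where "k \<in> K" "r \<in> carrier R" "z = k \<oplus> r \<otimes> x"
    by (auto simp: mem_set_add cgenideal_def)
  then show "\<exists>k\<in>K. \<exists>r\<in>carrier R. z = k \<oplus> x \<otimes> r"
    using assms by (metis m_comm)
next
  assume "\<exists>k\<in>K. \<exists>r\<in>carrier R. z = k \<oplus> x \<otimes> r"
  then obtain k r where "k \<in> K" "r \<in> carrier R" "z = k \<oplus> r \<otimes> x"
    using assms m_comm by metis
  then show "z \<in> K <+> PIdl x"
    by (auto simp: cgenideal_def intro!: set_addI)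
qed

lemma add_cgenideal_mem: "ideal K R \<Longrightarrow> x \<in> carrier R \<Longrightarrow> x \<in> K <+> PIdl x"
  by (simp add: set_add_right cgenideal_ideal cgenideal_self)


section \<open>Powers of ideals\<close>

lemma ipow_0 [simp]: "ipow R A 0 = carrier R"
  by (simp add: ipow_def ideals_set_def)

lemma ipow_Suc: "ipow R A (Suc n) = ipow R A n \<cdot> A"
  by (simp add: ipow_def ideals_set_def)

lemma ipow_ideal: "ideal A R \<Longrightarrow> ideal (ipow R A n) R"
  by (induction n) (simp_all add: ipow_Suc oneideal ideal_prod_is_ideal)

lemmas ideal_ops = ipow_ideal add_ideals ideal_prod_is_ideal cgenideal_ideal oneideal

lemma ipow_1 [simp]: "ideal A R \<Longrightarrow> ipow R A (Suc 0) = A"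
  by (simp add: ipow_Suc ideal_prod_one')

lemma ipow_add: "ideal A R \<Longrightarrow> ipow R A (m + n) = ipow R A m \<cdot> ipow R A n"
  by (induction n) (simp_all add: ipow_Suc ideal_prod_one ipow_ideal ideal_prod_assoc)

lemma ipow_Suc2: "ideal A R \<Longrightarrow> ipow R A (Suc n) = A \<cdot> ipow R A n"
  by (simp add: ipow_Suc ideal_prod_commute ipow_ideal)

lemma ipow_antimono:
  assumes "ideal A R" "m \<le> n" shows "ipow R A n \<subseteq> ipow R A m"
  using assms by (metis ipow_add ipow_ideal ideal_prod_subset_left le_add_diff_inverse)

lemma ipow_mult: "ideal A R \<Longrightarrow>
    a \<in> ipow R A m \<Longrightarrow> b \<in> ipow R A n \<Longrightarrow> a \<otimes> b \<in> ipow R A (m + n)"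
  by (simp add: ipow_add ideal_prod.prod)

lemma ipow_prod:
  "ideal A R \<Longrightarrow> ideal B R \<Longrightarrow> ipow R (A \<cdot> B) n = ipow R A n \<cdot> ipow R B n"
  by (induction n) (simp_all add: ipow_Suc ideal_prod_ac ideal_ops ideal_prod_one)

lemma ipow_ipow: "ideal A R \<Longrightarrow> ipow R (ipow R A m) n = ipow R A (m * n)"
  by (induction n) (simp_all add: ipow_Suc ipow_add[symmetric] add.commute)

lemma ipow_mono: "A \<subseteq> B \<Longrightarrow> ipow R A n \<subseteq> ipow R B n"
  by (induction n) (simp_all add: ipow_Suc ideal_prod_mono)

lemma pow_mem_ipow: "ideal A R \<Longrightarrow> a \<in> A \<Longrightarrow> a [^] n \<in> ipow R A n"
  by (induction n) (simp_all add: ipow_Suc ideal_prod.prod)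

text \<open>Among k + n factors from A or B, at least k come from A or at least n from B. The
  induction splits off one factor of A + B and lowers k or n accordingly.\<close>

lemma ipow_set_add:
  assumes "ideal A R" "ideal B R"
  shows "ipow R (A <+> B) (k + n) \<subseteq> ipow R A k <+> ipow R B n"
proof (induction "k + n" arbitrary: k n)
  case 0
  then show ?case
    using assms by (simp add: set_add_upper1 oneideal)
next
  case (Suc l)
  show ?case
  proof (cases "k = 0 \<or> n = 0")
    case True
    have "ipow R A k \<subseteq> ipow R A k <+> ipow R B n" "ipow R B n \<subseteq> ipow R A k <+> ipow R B n"
      using assms by (simp_all add: set_add_upper1 set_add_upper2 ipow_ideal)
    with True have "carrier R \<subseteq> ipow R A k <+> ipow R B n"
      by auto
    moreover have "ipow R (A <+> B) (k + n) \<subseteq> carrier R"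
      by (intro ideal_subset_carrier ideal_ops assms)
    ultimately show ?thesis by blast
  next
    case False
    then obtain k' n' where kn: "k = Suc k'" "n = Suc n'" by (meson not0_implies_Suc)
    have l: "l = k' + n" "l = k + n'" using Suc kn by auto
    let ?X = "ipow R (A <+> B) l"
    have "ipow R (A <+> B) (k + n) = (A <+> B) \<cdot> ?X"
      using Suc(2)[symmetric] assms by (simp add: ipow_Suc2 ideal_ops)
    also have "\<dots> = A \<cdot> ?X <+> B \<cdot> ?X"
      by (intro ideal_prod_distr ideal_ops assms)
    also have "\<dots> \<subseteq> A \<cdot> (ipow R A k' <+> ipow R B n) <+> B \<cdot> (ipow R A k <+> ipow R B n')"
      using Suc(1)[OF l(1)] Suc(1)[OF l(2)] l
      by (intro set_add_mono ideal_prod_mono) auto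
    also have "\<dots> = (A \<cdot> ipow R A k' <+> A \<cdot> ipow R B n) <+> (B \<cdot> ipow R A k <+> B \<cdot> ipow R B n')"
      using assms by (simp add: ideal_prod_distr ideal_ops)
    also have "\<dots> \<subseteq> ipow R A k <+> ipow R B n"
    proof (intro set_add_least)
      have up: "ipow R A k \<subseteq> ipow R A k <+> ipow R B n" "ipow R B n \<subseteq> ipow R A k <+> ipow R B n"
        using assms by (simp_all add: set_add_upper1 set_add_upper2 ipow_ideal)
      have "A \<cdot> ipow R B n \<subseteq> ipow R B n" "B \<cdot> ipow R A k \<subseteq> ipow R A k"
        using assms by (simp_all add: ideal_prod_subset_right ideal_ops)
      moreover have "A \<cdot> ipow R A k' = ipow R A k" "B \<cdot> ipow R B n' = ipow R B n"
        using assms kn by (simp_all add: ipow_Suc2)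
      ultimately show "A \<cdot> ipow R A k' \<subseteq> ipow R A k <+> ipow R B n"
        "A \<cdot> ipow R B n \<subseteq> ipow R A k <+> ipow R B n"
        "B \<cdot> ipow R A k \<subseteq> ipow R A k <+> ipow R B n"
        "B \<cdot> ipow R B n' \<subseteq> ipow R A k <+> ipow R B n"
        using up by auto
    qed (use assms in \<open>simp_all add: ideal_ops\<close>)
    finally show ?thesis .
  qed
qed

lemma ideal_colon: "ideal K R \<Longrightarrow> y \<in> carrier R \<Longrightarrow> ideal {z \<in> carrier R. y \<otimes> z \<in> K} R"
  by (rule ideal_ofI) (auto simp: ideal_mems r_distr m_lcomm[of y])

section \<open>Ideals generated by a list of elements\<close>

lemma adjoin_ideal:
  "ideal K R \<Longrightarrow> set ys \<subseteq> carrier R \<Longrightarrow> ideal (adjoin R K ys) R"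
  by (induction ys arbitrary: K) (auto simp: add_ideals cgenideal_ideal)

lemma adjoin_append: "adjoin R K (xs @ ys) = adjoin R (adjoin R K xs) ys"
  by (induction xs arbitrary: K) auto

lemma regular_mod_append:
  "regular_mod R K (xs @ ys) \<longleftrightarrow> regular_mod R K xs \<and> regular_mod R (adjoin R K xs) ys"
  by (induction xs arbitrary: K) auto

lemma adjoin_swap:
  assumes "ideal K R" "ideal L R" "set ys \<subseteq> carrier R"
  shows "adjoin R (K <+> L) ys = adjoin R K ys <+> L"
  using assms
proof (induction ys arbitrary: K)
  case (Cons y ys)
  then have "(K <+> L) <+> PIdl y = (K <+> PIdl y) <+> L"
    by (simp add: ideal_add_ac cgenideal_ideal)
  with Cons show ?case by (simp add: add_ideals cgenideal_ideal)
qed simp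

lemma adjoin_eq_Idl:
  assumes "ideal K R" "set ys \<subseteq> carrier R"
  shows "adjoin R K ys = K <+> Idl (set ys)"
  using assms
proof (induction ys arbitrary: K)
  case Nil
  have "Idl {} = {\<zero>}"
    using genideal_minimal[OF zeroideal, of "{}"] ideal_zero_mem[OF genideal_ideal, of "{}"] by auto
  moreover have "K <+> {\<zero>} = K"
  proof -
    have "k \<oplus> \<zero> = k" if "k \<in> K" for k
      using that Nil(1) by (simp add: ideal_mem_carrier)
    then show ?thesis unfolding set_add_def' by force
  qed
  ultimately show ?case by simp
next
  case (Cons y ys)
  have i: "ideal (PIdl y) R" "ideal (Idl (set ys)) R" "ideal (Idl (set (y # ys))) R"
    using Cons by (auto intro: cgenideal_ideal genideal_ideal)
  have "Idl (set (y # ys)) = PIdl y <+> Idl (set ys)"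
  proof
    show "Idl (set (y # ys)) \<subseteq> PIdl y <+> Idl (set ys)"
    proof (intro genideal_minimal add_ideals i)
      have "y \<in> PIdl y <+> Idl (set ys)"
        using Cons i by (intro set_add_left) (auto simp: cgenideal_self)
      moreover have "z \<in> PIdl y <+> Idl (set ys)" if "z \<in> set ys" for z
        using Cons i that genideal_self[of "set ys"] by (intro set_add_right) auto
      ultimately show "set (y # ys) \<subseteq> PIdl y <+> Idl (set ys)" by auto
    qed
    show "PIdl y <+> Idl (set ys) \<subseteq> Idl (set (y # ys))"
      using Cons i genideal_self[of "set (y # ys)"] 
      by (intro set_add_least i cgenideal_minimal genideal_minimal) auto
  qed
  then show ?case
    using Cons i by (simp add: add_ideals ideal_set_add_assoc)
qed

lemma adjoin_cong_set:
  "ideal K R \<Longrightarrow> set ys \<subseteq> carrier R \<Longrightarrow> set ys = set zs \<Longrightarrow> adjoin R K ys = adjoin R K zs"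
  by (simp add: adjoin_eq_Idl)

lemma adjoin_superset:
  assumes "ideal K R" "set ys \<subseteq> carrier R" shows "K \<subseteq> adjoin R K ys"
  using set_add_left[OF assms(1) genideal_ideal[OF assms(2)]] assms
  by (simp add: adjoin_eq_Idl subset_iff)

lemma adjoin_mem:
  assumes "ideal K R" "set ys \<subseteq> carrier R" "y \<in> set ys" shows "y \<in> adjoin R K ys"
  using set_add_right[OF assms(1) genideal_ideal[OF assms(2)], of y] genideal_self[OF assms(2)] assms
  by (simp add: adjoin_eq_Idl subset_iff)

lemma adjoin_least:
  "ideal K R \<Longrightarrow> set ys \<subseteq> L \<Longrightarrow> K \<subseteq> L \<Longrightarrow> ideal L R \<Longrightarrow> adjoin R K ys \<subseteq> L"
  using ideal_subset_carrier[of L] adjoin_eq_Idl[of K ys] genideal_minimal[of L "set ys"]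
    set_add_least[of L K "Idl (set ys)"] by (simp add: subset_trans)

end

context noetherian_cring
begin


text \<open>In a Noetherian ring a nonempty chain of ideals contains its own union, which is the
  upper bound that Zorn's lemma asks for.\<close>

lemma exists_maximal_ideal_in:
  assumes "Cs \<noteq> {}" "\<And>A. A \<in> Cs \<Longrightarrow> ideal A R"
  shows "\<exists>M\<in>Cs. \<forall>Z\<in>Cs. M \<subseteq> Z \<longrightarrow> Z = M"
proof (rule subset_Zorn_nonempty[OF assms(1)])
    fix C assume C: "C \<noteq> {}" "subset.chain Cs C"
    then have "subset.chain {I. ideal I R} C"
      using assms(2) unfolding subset_chain_def by blast
    then have "\<Union>C \<in> C"
      using ideal_chain_is_trivial[OF C(1)] by blast
    then show "\<Union>C \<in> Cs"
      using C(2) unfolding subset_chain_def by blast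
qed

end

section \<open>Nonzerodivisors and prime-free avoidance\<close>

text \<open>Maximal annihilators take the place of associated primes. The statement is about a
  commutative monoid acting on itself so that it covers both elements of a ring and homogeneous
  elements of a graded algebra.\<close>

lemma finitely_many_maximal_annihilators:
  fixes f :: "'x \<Rightarrow> 'x \<Rightarrow> 'x" and e :: 'x
  defines "ann \<equiv> \<lambda>S N A. {c \<in> S. \<forall>u\<in>A. f c u \<in> N}"
  assumes closed: "\<And>a b. a \<in> S \<Longrightarrow> b \<in> S \<Longrightarrow> f a b \<in> S"
    and assoc: "\<And>a b c. a \<in> S \<Longrightarrow> b \<in> S \<Longrightarrow> c \<in> S \<Longrightarrow> f (f a b) c = f a (f b c)"
    and comm: "\<And>a b. a \<in> S \<Longrightarrow> b \<in> S \<Longrightarrow> f a b = f b a"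
    and unit: "e \<in> S" "\<And>a. a \<in> S \<Longrightarrow> f e a = a"
    and absorb: "N \<subseteq> S" "\<And>a b. a \<in> S \<Longrightarrow> b \<in> N \<Longrightarrow> f a b \<in> N"
    and acc: "\<And>As. As \<noteq> {} \<Longrightarrow> As \<subseteq> Pow S \<Longrightarrow>
      \<exists>A\<in>As. \<forall>B\<in>As. ann S N A \<subseteq> ann S N B \<longrightarrow> ann S N B = ann S N A"
  obtains T where "finite T" "T \<subseteq> S - N"
    "\<And>b c. b \<in> S - N \<Longrightarrow> c \<in> S \<Longrightarrow> f c b \<in> N \<Longrightarrow> \<exists>u\<in>T. f c u \<in> N"
proof -
  define D where "D = ann S N"
  have D: "c \<in> D A \<longleftrightarrow> c \<in> S \<and> (\<forall>u\<in>A. f c u \<in> N)" for c A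
    by (simp add: D_def ann_def)
  have DS: "D A \<subseteq> S" for A by (auto simp: D)
  have DD: "A \<subseteq> D (D A)" if "A \<subseteq> S" for A
    using that by (auto simp: D subset_iff) (metis comm)
  have anti: "A \<subseteq> B \<Longrightarrow> D B \<subseteq> D A" for A B unfolding subset_iff D by blast
  \<comment> \<open>Taking annihilators is an antitone Galois connection.\<close>
  have DDD: "D (D (D A)) = D A" if "A \<subseteq> S" for A
    using DD[OF that] DD[OF DS] anti by blast
  \<comment> \<open>The annihilators of members of U are maximal among those of single elements
    outside N, and by \<open>prime\<close> they behave like prime ideals: these are the substitutes
    for associated primes.\<close>
  define U where "U = {u \<in> S - N. \<forall>v\<in>S - N. D {u} \<subseteq> D {v} \<longrightarrow> D {v} = D {u}}"
  have prime: "c \<in> D {u} \<or> c' \<in> D {u}" if "u \<in> U" "c \<in> S" "c' \<in> S" "f c c' \<in> D {u}" for u c c'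
  proof (rule disjCI)
    assume "c' \<notin> D {u}"
    have u: "u \<in> S" using that by (auto simp: U_def)
    have *: "f c' u \<in> S - N" using that u \<open>c' \<notin> D {u}\<close> closed by (auto simp: D)
    have "D {u} \<subseteq> D {f c' u}"
    proof
      fix a assume "a \<in> D {u}"
      then have a: "a \<in> S" "f a u \<in> N" by (auto simp: D)
      have "f a (f c' u) = f c' (f a u)"
        using a(1) u that(3) assoc comm by metis
      then show "a \<in> D {f c' u}" using a absorb that by (auto simp: D)
    qed
    then have "D {f c' u} = D {u}" using * that(1) by (auto simp: U_def)
    moreover have "c \<in> D {f c' u}" using that u assoc[of c c' u] by (auto simp: D)
    ultimately show "c \<in> D {u}" by simp
  qed
  have below: "\<exists>u\<in>U. D {b} \<subseteq> D {u}" if "b \<in> S - N" for b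
  proof -
    let ?As = "(\<lambda>v. {v}) ` {v \<in> S - N. D {b} \<subseteq> D {v}}"
    have "?As \<noteq> {}" "?As \<subseteq> Pow S" using that by auto
    then have "\<exists>A\<in>?As. \<forall>B\<in>?As. D A \<subseteq> D B \<longrightarrow> D B = D A"
      by (rule acc[folded D_def])
    then obtain u where "u \<in> S - N" "D {b} \<subseteq> D {u}"
      "\<forall>v\<in>S - N. D {b} \<subseteq> D {v} \<longrightarrow> D {u} \<subseteq> D {v} \<longrightarrow> D {v} = D {u}"
      by auto
    then show ?thesis unfolding U_def by (intro bexI[of _ u] CollectI conjI) auto
  qed
  \<comment> \<open>A maximal double annihilator D (D F) means a minimal D F among finite F
    \<subseteq> U: adjoining any u of U no longer shrinks it, so D F lies in every D {u}.\<close>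
  obtain F where F: "finite F" "F \<subseteq> U" "\<And>u. u \<in> U \<Longrightarrow> D F \<subseteq> D {u}"
  proof -
    let ?As = "D ` {F. finite F \<and> F \<subseteq> U}"
    have "?As \<noteq> {}" "?As \<subseteq> Pow S" using DS by auto
    then have "\<exists>A\<in>?As. \<forall>B\<in>?As. D A \<subseteq> D B \<longrightarrow> D B = D A"
      by (rule acc[folded D_def])
    then obtain F where F: "finite F" "F \<subseteq> U"
      "\<And>F'. finite F' \<Longrightarrow> F' \<subseteq> U \<Longrightarrow> D (D F) \<subseteq> D (D F') \<Longrightarrow> D (D F') = D (D F)"
      by auto
    have "D F \<subseteq> D {u}" if "u \<in> U" for u
    proof -
      have US: "U \<subseteq> S" by (auto simp: U_def)
      have "D (D (insert u F)) = D (D F)"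
        using F that by (intro F(3) anti) auto
      then have "D (insert u F) = D F"
        using DDD[of F] DDD[of "insert u F"] F(2) that US by auto
      then show ?thesis using anti[of "{u}" "insert u F"] by auto
    qed
    with F that show ?thesis by blast
  qed
  \<comment> \<open>A prime containing a finite intersection contains one of its members; D G is the
    intersection of the D {g}.\<close>
  have *: "\<exists>g\<in>G. D {g} \<subseteq> D {u}" if "finite G" "G \<subseteq> U" "D G \<subseteq> D {u}" "u \<in> U" for u G
    using that
  proof (induction G rule: finite_induct)
    case empty
    then have "e \<in> D {u}" using unit by (auto simp: D)
    then show ?case using unit empty by (auto simp: D U_def)
  next
    case (insert g G)
    show ?case
    proof (rule ccontr)
      assume no: "\<not> ?case"
      then obtain c where c: "c \<in> D {g}" "c \<notin> D {u}" by auto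
      obtain c' where c': "c' \<in> D G" "c' \<notin> D {u}" using insert no by auto
      have "f c c' \<in> D (insert g G)"
      proof -
        have "f (f c c') h \<in> N" if "h \<in> G" for h
        proof -
          have "h \<in> S" using that insert by (auto simp: U_def)
          then show ?thesis
            using c c' that absorb assoc by (auto simp: D)
        qed
        moreover have "f (f c c') g \<in> N"
        proof -
          have "g \<in> S" using insert by (auto simp: U_def)
          then have "f (f c c') g = f c' (f c g)" using c c' assoc comm by (metis D)
          then show ?thesis using c c' absorb by (auto simp: D)
        qed
        ultimately show ?thesis using c c' closed by (auto simp: D)
      qed
      then have "f c c' \<in> D {u}" using insert.prems(2) by blast
      moreover have "c \<in> S" "c' \<in> S" using c c' by (auto simp: D)
      ultimately show False using insert.prems(3) prime[of u c c'] c c' by blast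
    qed
  qed
  show ?thesis
  proof (rule that[OF F(1)])
    show "F \<subseteq> S - N" using F(2) by (auto simp: U_def)
    fix b c assume bc: "b \<in> S - N" "c \<in> S" "f c b \<in> N"
    then obtain u where u: "u \<in> U" "D {b} \<subseteq> D {u}" using below by blast
    then obtain g where g: "g \<in> F" "D {g} \<subseteq> D {u}" using * F by blast
    have "g \<in> S - N" "u \<in> S - N" using u g F(2) by (auto simp: U_def)
    \<comment> \<open>Maximality of D {g} turns the inclusion into an equality, so F exhibits all
      maximal annihilators.\<close>
    then have "D {u} = D {g}" using g F(2) by (auto simp: U_def)
    moreover have "c \<in> D {b}" using bc by (auto simp: D)
    ultimately have "c \<in> D {g}" using u(2) by blast
    with g(1) show "\<exists>u\<in>F. f c u \<in> N" by (auto simp: D)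
  qed
qed

text \<open>Representatives of distinct residue classes; an infinite such set makes avoidance work for
  arbitrary ideals instead of primes.\<close>

definition unit_differences :: "('a, 'b) ring_scheme \<Rightarrow> 'a set \<Rightarrow> bool"
  where "unit_differences R U \<longleftrightarrow> U \<subseteq> carrier R \<and>
    (\<forall>r\<in>U. \<forall>r'\<in>U. r \<noteq> r' \<longrightarrow> (\<exists>v\<in>carrier R. v \<otimes>\<^bsub>R\<^esub> (r \<ominus>\<^bsub>R\<^esub> r') = \<one>\<^bsub>R\<^esub>))"

context cring
begin

text \<open>Two values r, r' that put x + r q into the same ideal A put (r - r') q into A, hence q,
  because r - r' is a unit. So each A excludes at most one r.\<close>

lemma finite_bad_combinations:
  assumes U: "unit_differences R U" and "finite As" "\<And>A. A \<in> As \<Longrightarrow> ideal A R"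
    and "x \<in> carrier R" "q \<in> carrier R" "q \<notin> \<Union>As"
  shows "finite {r \<in> U. x \<oplus> r \<otimes> q \<in> \<Union>As}"
proof -
  have same: "r = r'" if "A \<in> As" "r \<in> U" "r' \<in> U" "x \<oplus> r \<otimes> q \<in> A" "x \<oplus> r' \<otimes> q \<in> A" for A r r'
  proof (rule ccontr)
    assume "r \<noteq> r'"
    then obtain v where v: "v \<in> carrier R" "v \<otimes> (r \<ominus> r') = \<one>"
      using U \<open>r \<in> U\<close> \<open>r' \<in> U\<close> unfolding unit_differences_def by blast
    have c: "r \<in> carrier R" "r' \<in> carrier R" using U that by (auto simp: unit_differences_def)
    have "(x \<oplus> r \<otimes> q) \<ominus> (x \<oplus> r' \<otimes> q) = (r \<ominus> r') \<otimes> q"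
      using c assms(4,5) by algebra
    moreover have "(x \<oplus> r \<otimes> q) \<ominus> (x \<oplus> r' \<otimes> q) \<in> A"
      using that assms(3) by (intro ideal_diff_mem) auto
    ultimately have "v \<otimes> ((r \<ominus> r') \<otimes> q) \<in> A"
      using that assms(3) v ideal_mult_mem by auto
    moreover have "v \<otimes> ((r \<ominus> r') \<otimes> q) = q"
      using v c assms(5) by (simp flip: m_assoc)
    ultimately show False using assms(6) that by auto
  qed
  have "finite {r \<in> U. x \<oplus> r \<otimes> q \<in> A}" if "A \<in> As" for A
  proof (cases "{r \<in> U. x \<oplus> r \<otimes> q \<in> A} = {}")
    case False
    then obtain r where "r \<in> U" "x \<oplus> r \<otimes> q \<in> A" by blast
    then have "{r \<in> U. x \<oplus> r \<otimes> q \<in> A} \<subseteq> {r}" using same[OF that] by blast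
    then show ?thesis using finite_subset by blast
  next
    case True
    then show ?thesis by (simp only: finite.emptyI)
  qed
  moreover have "{r \<in> U. x \<oplus> r \<otimes> q \<in> \<Union>As} = (\<Union>A\<in>As. {r \<in> U. x \<oplus> r \<otimes> q \<in> A})"
    by auto
  ultimately show ?thesis using assms(2) by auto
qed

text \<open>If q avoids the earlier ideals but lies in the new ideal A, take x in M outside A: x + r
  q stays outside A for every r, and outside the earlier ideals for all but finitely many r.\<close>

lemma ideal_avoidance:
  assumes U: "unit_differences R U" "infinite U" and "finite As" "\<And>A. A \<in> As \<Longrightarrow> ideal A R"
    and M: "ideal M R" "\<And>A. A \<in> As \<Longrightarrow> \<not> M \<subseteq> A"
  obtains q where "q \<in> M" "q \<notin> \<Union>As"
proof -
  have "\<exists>q\<in>M. q \<notin> \<Union>As" using assms(3-) 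
  proof (induction As rule: finite_induct)
    case empty
    then show ?case using ideal_zero_mem by auto
  next
    case (insert A As)
    then obtain q where q: "q \<in> M" "q \<notin> \<Union>As" by auto
    obtain x where x: "x \<in> M" "x \<notin> A" using insert.prems by blast
    show ?case
    proof (cases "q \<in> A")
      case False
      then show ?thesis using q by auto
    next
      case True
      have c: "x \<in> carrier R" "q \<in> carrier R" using x q M ideal_mem_carrier by auto
      have "infinite (U - {r \<in> U. x \<oplus> r \<otimes> q \<in> \<Union>As})"
        using finite_bad_combinations[OF U(1), of As x q] insert c q U(2)
        by (intro Diff_infinite_finite) auto
      from infinite_imp_nonempty[OF this]
      obtain r where r: "r \<in> U" "x \<oplus> r \<otimes> q \<notin> \<Union>As" by auto
      then have rc: "r \<in> carrier R" using U by (auto simp: unit_differences_def)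
      have "x \<oplus> r \<otimes> q \<notin> A"
      proof
        assume "x \<oplus> r \<otimes> q \<in> A"
        then have "(x \<oplus> r \<otimes> q) \<ominus> r \<otimes> q \<in> A"
          using True rc insert.prems by (intro ideal_diff_mem ideal_mult_mem) auto
        moreover have "(x \<oplus> r \<otimes> q) \<ominus> r \<otimes> q = x" using rc c by algebra
        ultimately show False using x by simp
      qed
      moreover have "x \<oplus> r \<otimes> q \<in> M"
        using x q rc M by (intro ideal_add_mem ideal_mult_mem) auto
      ultimately show ?thesis using r by auto
    qed
  qed
  then show ?thesis using that by auto
qed

end

text \<open>Says that Hom(R/M, R/K) is nonzero: the elements of M are zero divisors modulo K with
  one common witness.\<close>

definition socle_nonzero :: "('a, 'b) ring_scheme \<Rightarrow> 'a set \<Rightarrow> 'a set \<Rightarrow> bool"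
  where "socle_nonzero R M K \<longleftrightarrow> (\<exists>u\<in>carrier R - K. \<forall>c\<in>M. c \<otimes>\<^bsub>R\<^esub> u \<in> K)"

context noetherian_cring
begin

text \<open>The ideals (K : u) with u in T act as the associated primes of R/K: finitely many ideals
  whose union is the set of zero divisors modulo K.\<close>

lemma finitely_many_zero_divisor_ideals:
  assumes K: "ideal K R"
  shows "\<exists>T. finite T \<and> T \<subseteq> carrier R - K \<and>
    (\<forall>c\<in>carrier R. \<not> nzd_mod R K c \<longrightarrow> (\<exists>u\<in>T. c \<otimes> u \<in> K))"
proof (rule finitely_many_maximal_annihilators[of "carrier R" "(\<otimes>)" \<one> K])
  show "K \<subseteq> carrier R" using K by (rule ideal_subset_carrier)
  show "a \<otimes> b \<in> K" if "a \<in> carrier R" "b \<in> K" for a b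
    using that K by (simp add: ideal_mult_mem)
  show "\<exists>A\<in>As. \<forall>B\<in>As. {c \<in> carrier R. \<forall>u\<in>A. c \<otimes> u \<in> K} \<subseteq> {c \<in> carrier R. \<forall>u\<in>B. c \<otimes> u \<in> K} \<longrightarrow>
      {c \<in> carrier R. \<forall>u\<in>B. c \<otimes> u \<in> K} = {c \<in> carrier R. \<forall>u\<in>A. c \<otimes> u \<in> K}"
    if As: "As \<noteq> {}" "As \<subseteq> Pow (carrier R)" for As
  proof -
    let ?D = "\<lambda>A. {c \<in> carrier R. \<forall>u\<in>A. c \<otimes> u \<in> K}"
    have "ideal (?D A) R" if "A \<in> As" for A
    proof (rule ideal_ofI)
      have A: "\<And>u. u \<in> A \<Longrightarrow> u \<in> carrier R" using that As by auto
      show "?D A \<subseteq> carrier R" by auto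
      show "\<zero> \<in> ?D A" using A K by (auto simp: ideal_zero_mem)
      show "x \<oplus> y \<in> ?D A" if "x \<in> ?D A" "y \<in> ?D A" for x y
        using that A K by (auto simp: l_distr ideal_add_mem)
      show "r \<otimes> x \<in> ?D A" if "x \<in> ?D A" "r \<in> carrier R" for x r
        using that A K by (auto simp: m_assoc ideal_mult_mem)
    qed
    then have "\<And>B. B \<in> ?D ` As \<Longrightarrow> ideal B R" by (elim imageE) simp
    moreover have "?D ` As \<noteq> {}" using As(1) by simp
    ultimately have "\<exists>M\<in>?D ` As. \<forall>Z\<in>?D ` As. M \<subseteq> Z \<longrightarrow> Z = M"
      by (intro exists_maximal_ideal_in)
    then show ?thesis by simp
  qed
  fix T assume "finite T" "T \<subseteq> carrier R - K"
    "\<And>b c. b \<in> carrier R - K \<Longrightarrow> c \<in> carrier R \<Longrightarrow> c \<otimes> b \<in> K \<Longrightarrow> \<exists>u\<in>T. c \<otimes> u \<in> K"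
  then show ?thesis by (intro exI[of _ T]) (auto simp: nzd_mod_def)
qed (simp_all add: m_ac)

lemma nzd_mod_socle: "w \<in> M \<Longrightarrow> nzd_mod R K w \<Longrightarrow> \<not> socle_nonzero R M K"
  by (auto simp: nzd_mod_def socle_nonzero_def)

text \<open>It suffices to avoid the finitely many ideals (K : u) inside M; if M were contained in
  one of them, u would be a socle element modulo K.\<close>

lemma exists_nzd_mod:
  assumes U: "unit_differences R U" "infinite U" and M: "ideal M R"
    and Ks: "finite Ks" "\<And>K. K \<in> Ks \<Longrightarrow> ideal K R" "\<And>K. K \<in> Ks \<Longrightarrow> \<not> socle_nonzero R M K"
  shows "\<exists>w\<in>M. \<forall>K\<in>Ks. nzd_mod R K w"
proof -
  have "\<forall>K\<in>Ks. \<exists>T. finite T \<and> T \<subseteq> carrier R - K \<and>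
    (\<forall>c\<in>carrier R. \<not> nzd_mod R K c \<longrightarrow> (\<exists>u\<in>T. c \<otimes> u \<in> K))"
    using finitely_many_zero_divisor_ideals Ks(2) by simp
  from bchoice[OF this] obtain T where T0: "\<forall>K\<in>Ks. finite (T K) \<and> T K \<subseteq> carrier R - K \<and>
    (\<forall>c\<in>carrier R. \<not> nzd_mod R K c \<longrightarrow> (\<exists>u\<in>T K. c \<otimes> u \<in> K))" by (elim exE)
  have T: "finite (T K)" "T K \<subseteq> carrier R - K"
    "\<And>c. c \<in> carrier R \<Longrightarrow> \<not> nzd_mod R K c \<Longrightarrow> \<exists>u\<in>T K. c \<otimes> u \<in> K" if "K \<in> Ks" for K
    using bspec[OF T0 that] by simp_all
  define As where "As = (\<Union>K\<in>Ks. (\<lambda>u. {c \<in> carrier R. u \<otimes> c \<in> K}) ` T K)"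
  obtain q where q: "q \<in> M" "q \<notin> \<Union>As"
  proof (rule ideal_avoidance[OF U _ _ M])
    show "finite As" using Ks T unfolding As_def by auto
    show "ideal A R" if "A \<in> As" for A
      using that Ks(2) T(2) unfolding As_def by (auto intro!: ideal_colon)
    show "\<not> M \<subseteq> A" if A: "A \<in> As" for A
    proof
      assume MA: "M \<subseteq> A"
      obtain K u where "K \<in> Ks" "u \<in> T K" "A = {c \<in> carrier R. u \<otimes> c \<in> K}"
        using A unfolding As_def by blast
      moreover then have "u \<in> carrier R - K" using T(2) by auto
      ultimately have "socle_nonzero R M K"
        using MA m_comm[of u] unfolding socle_nonzero_def by (intro bexI[of _ u]) force+
      then show False using Ks(3) \<open>K \<in> Ks\<close> by auto
    qed
  qed
  show ?thesis
  proof (rule bexI[OF _ q(1)], rule ballI, rule ccontr)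
    fix K assume K: "K \<in> Ks" "\<not> nzd_mod R K q"
    have qc: "q \<in> carrier R" using q M ideal_mem_carrier by auto
    then obtain u where u: "u \<in> T K" "q \<otimes> u \<in> K" using T(3)[OF K(1) _ K(2)] by auto
    then have "u \<otimes> q \<in> K" using m_comm[of q u] qc T(2)[OF K(1)] by auto
    then have "q \<in> \<Union>As" unfolding As_def using u K qc by blast
    then show False using q by simp
  qed
qed

end

section \<open>Depth through socles: exchanging regular sequences\<close>

context cring
begin

lemma mem_add_cgenideal':
  assumes "ideal K R" "x \<in> carrier R" "z \<in> carrier R"
  shows "z \<in> K <+> PIdl x \<longleftrightarrow> (\<exists>r\<in>carrier R. z \<ominus> x \<otimes> r \<in> K)"
proof
  assume "z \<in> K <+> PIdl x"
  then obtain k r where kr: "k \<in> K" "r \<in> carrier R" "z = k \<oplus> x \<otimes> r"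
    using assms by (auto simp: mem_add_cgenideal)
  have "k \<in> carrier R" using kr assms ideal_mem_carrier by auto
  then have "z \<ominus> x \<otimes> r = k" using kr(2,3) assms(2) by algebra
  then have "z \<ominus> x \<otimes> r \<in> K" using kr by simp
  then show "\<exists>r\<in>carrier R. z \<ominus> x \<otimes> r \<in> K" using kr by blast
next
  assume "\<exists>r\<in>carrier R. z \<ominus> x \<otimes> r \<in> K"
  then obtain r where r: "r \<in> carrier R" "z \<ominus> x \<otimes> r \<in> K" by auto
  moreover have "z = (z \<ominus> x \<otimes> r) \<oplus> x \<otimes> r" using r(1) assms by algebra
  ultimately show "z \<in> K <+> PIdl x" using assms by (auto simp: mem_add_cgenideal)
qed

text \<open>From y z = w t modulo K, regularity of w modulo K + (y) gives t = y s modulo K; then y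
  (z - w s) lies in K and y is cancelled.\<close>

lemma nzd_mod_swap:
  assumes K: "ideal K R" and c: "y \<in> carrier R" "w \<in> carrier R"
    and "nzd_mod R K y" "nzd_mod R (K <+> PIdl y) w" "nzd_mod R K w"
  shows "nzd_mod R (K <+> PIdl w) y"
  unfolding nzd_mod_def
proof (intro ballI impI)
  fix z assume z: "z \<in> carrier R" "y \<otimes> z \<in> K <+> PIdl w"
  then obtain t where t: "t \<in> carrier R" "y \<otimes> z \<ominus> w \<otimes> t \<in> K"
    using K c by (auto simp: mem_add_cgenideal')
  have "w \<otimes> t \<ominus> y \<otimes> z = \<ominus> (y \<otimes> z \<ominus> w \<otimes> t)" using z t c by algebra
  then have "w \<otimes> t \<ominus> y \<otimes> z \<in> K" using ideal_inv_mem[OF K t(2)] by simp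
  then have "w \<otimes> t \<in> K <+> PIdl y" using K c z t by (auto simp: mem_add_cgenideal')
  then have "t \<in> K <+> PIdl y" using nzd_modD[OF assms(5)] t by simp
  then obtain s where s: "s \<in> carrier R" "t \<ominus> y \<otimes> s \<in> K"
    using K c t by (auto simp: mem_add_cgenideal')
  have "y \<otimes> (z \<ominus> w \<otimes> s) = (y \<otimes> z \<ominus> w \<otimes> t) \<oplus> w \<otimes> (t \<ominus> y \<otimes> s)"
    using z(1) t(1) s(1) c by algebra
  also have "\<dots> \<in> K" using K t s c by (simp add: ideal_mems)
  finally have "z \<ominus> w \<otimes> s \<in> K" using nzd_modD[OF assms(4)] z(1) s(1) c by simp
  then show "z \<in> K <+> PIdl w" using z s K c by (auto simp: mem_add_cgenideal')
qed

text \<open>Both socles are instances of Ext^1(R/M, R/K) when M is an ideal. Concretely, w u = g v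
  modulo K turns a socle element u modulo K + (g) into a socle element v modulo K + (w): regularity
  of w keeps v nonzero, regularity of g makes M annihilate it.\<close>

lemma socle_nonzero_exchange:
  assumes K: "ideal K R" and M: "M \<subseteq> carrier R" "g \<in> M" "w \<in> M"
    and nzd: "nzd_mod R K g" "nzd_mod R K w" and soc: "socle_nonzero R M (K <+> PIdl g)"
  shows "socle_nonzero R M (K <+> PIdl w)"
proof -
  have gw: "g \<in> carrier R" "w \<in> carrier R" using M by auto
  obtain u where u: "u \<in> carrier R" "u \<notin> K <+> PIdl g" "\<And>c. c \<in> M \<Longrightarrow> c \<otimes> u \<in> K <+> PIdl g"
    using soc by (auto simp: socle_nonzero_def)
  obtain v where v: "v \<in> carrier R" "w \<otimes> u \<ominus> g \<otimes> v \<in> K"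
    using u(3)[OF M(3)] K gw u(1) by (auto simp: mem_add_cgenideal')
  have "v \<notin> K <+> PIdl w"
  proof
    assume "v \<in> K <+> PIdl w"
    then obtain t where t: "t \<in> carrier R" "v \<ominus> w \<otimes> t \<in> K"
      using K gw v(1) by (auto simp: mem_add_cgenideal')
    have "w \<otimes> (u \<ominus> g \<otimes> t) = (w \<otimes> u \<ominus> g \<otimes> v) \<oplus> g \<otimes> (v \<ominus> w \<otimes> t)"
      using u(1) v(1) t(1) gw by algebra
    also have "\<dots> \<in> K" using K v t gw by (simp add: ideal_mems)
    finally have "u \<ominus> g \<otimes> t \<in> K" using nzd_modD[OF nzd(2)] u(1) t(1) gw by simp
    then show False using u t gw K by (auto simp: mem_add_cgenideal')
  qed
  moreover have "c \<otimes> v \<in> K <+> PIdl w" if c: "c \<in> M" for c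
  proof -
    have cc: "c \<in> carrier R" using c M by auto
    obtain s where s: "s \<in> carrier R" "c \<otimes> u \<ominus> g \<otimes> s \<in> K"
      using u(3)[OF c] K gw u(1) cc by (auto simp: mem_add_cgenideal')
    have "g \<otimes> (c \<otimes> v \<ominus> w \<otimes> s) = w \<otimes> (c \<otimes> u \<ominus> g \<otimes> s) \<ominus> c \<otimes> (w \<otimes> u \<ominus> g \<otimes> v)"
      using u(1) v(1) s(1) gw cc by algebra
    also have "\<dots> \<in> K" using K v s gw cc by (simp add: ideal_mems)
    finally have "c \<otimes> v \<ominus> w \<otimes> s \<in> K" using nzd_modD[OF nzd(1)] v(1) s(1) gw cc by simp
    then show ?thesis using v s gw cc K by (auto simp: mem_add_cgenideal')
  qed
  ultimately show ?thesis using v(1) by (auto simp: socle_nonzero_def)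
qed

lemma regular_mod_nth:
  assumes "regular_mod R K ys" "j < length ys"
  shows "nzd_mod R (adjoin R K (take j ys)) (ys ! j)"
proof -
  have "ys = take j ys @ ys ! j # drop (Suc j) ys" using assms(2) by (rule id_take_nth_drop)
  then have "regular_mod R K (take j ys @ ys ! j # drop (Suc j) ys)" using assms(1) by simp
  then show ?thesis unfolding regular_mod_append by simp
qed

lemma regular_mod_iff_nth:
  "regular_mod R K ys \<longleftrightarrow> (\<forall>j<length ys. nzd_mod R (adjoin R K (take j ys)) (ys ! j))"
proof (induction ys arbitrary: K)
  case (Cons y ys)
  have *: "(\<forall>j<Suc n. P j) \<longleftrightarrow> P 0 \<and> (\<forall>j<n. P (Suc j))" for n and P :: "nat \<Rightarrow> bool"
    using less_Suc_eq_0_disj by auto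
  show ?case by (simp add: Cons *)
qed simp

text \<open>Iterated \<open>nzd_mod_swap\<close>: w travels from behind the sequence to its front,
  which requires its regularity modulo every initial segment.\<close>

lemma regular_mod_add_cgenideal:
  assumes "ideal K R" "w \<in> carrier R" "set ys \<subseteq> carrier R" "regular_mod R K ys"
    and "\<And>j. j \<le> length ys \<Longrightarrow> nzd_mod R (adjoin R K (take j ys)) w"
  shows "regular_mod R (K <+> PIdl w) ys"
  using assms
proof (induction ys arbitrary: K)
  case (Cons y ys)
  have w: "nzd_mod R K w" using Cons.prems(5)[of 0] by simp
  have w': "nzd_mod R (adjoin R (K <+> PIdl y) (take j ys)) w" if "j \<le> length ys" for j
    using Cons.prems(5)[of "Suc j"] that by simp
  have "nzd_mod R (K <+> PIdl w) y"
    using Cons.prems(1-4) w w'[of 0] nzd_mod_swap[of K y w] by simp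
  moreover have "regular_mod R (K <+> PIdl y <+> PIdl w) ys"
    using Cons.prems(1-4) w' by (intro Cons.IH) (simp_all add: ideal_ops)
  moreover have "K <+> PIdl y <+> PIdl w = K <+> PIdl w <+> PIdl y"
    using Cons.prems(1-3) by (simp add: ideal_add_ac ideal_ops)
  ultimately show ?case by simp
qed simp

end

context noetherian_cring
begin

text \<open>Induction on the length. One w in M, regular modulo all proper initial segments of both
  sequences, replaces their last entries by \<open>socle_nonzero_exchange\<close>; moved to the
  front it joins K, and the shorter sequences are compared modulo K + (w).\<close>

lemma socle_nonzero_regular_exchange:
  assumes U: "unit_differences R U" "infinite U" and M: "ideal M R"
    and "ideal K R" "length fs = length gs" "set fs \<subseteq> M" "set gs \<subseteq> M"
    "regular_mod R K fs" "regular_mod R K gs" "socle_nonzero R M (adjoin R K gs)"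
  shows "socle_nonzero R M (adjoin R K fs)"
  using assms(4-)
proof (induction "length fs" arbitrary: fs gs K)
  case 0
  then show ?case by simp
next
  case (Suc n)
  note K = Suc.prems(1)
  have Mc: "M \<subseteq> carrier R" using M by (rule ideal_subset_carrier)
  obtain fs' f where fs: "fs = fs' @ [f]" using Suc(2) by (metis length_0_conv nat.distinct(1) rev_exhaust)
  obtain gs' g where gs: "gs = gs' @ [g]"
    using Suc(2) Suc.prems(2) by (metis length_0_conv nat.distinct(1) rev_exhaust)
  have car: "set fs \<subseteq> carrier R" "set gs \<subseteq> carrier R" using Suc.prems(3,4) Mc by auto
  \<comment> \<open>Only proper initial segments occur: each has zero socle because the next entry
    of its sequence is regular modulo it, so a common w exists.\<close>
  define Ks where "Ks = (\<lambda>j. adjoin R K (take j fs)) ` {..<length fs} \<union> (\<lambda>j. adjoin R K (take j gs)) ` {..<length gs}"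
  have idj: "ideal (adjoin R K (take j fs)) R" "ideal (adjoin R K (take j gs)) R" for j
    using car set_take_subset[of j fs] set_take_subset[of j gs] by (auto intro!: adjoin_ideal K)
  have "\<exists>w\<in>M. \<forall>L\<in>Ks. nzd_mod R L w"
  proof (rule exists_nzd_mod[OF U M, of Ks])
    show "finite Ks" by (simp add: Ks_def)
    show "ideal L R" if "L \<in> Ks" for L using that idj by (auto simp: Ks_def)
    show "\<not> socle_nonzero R M L" if "L \<in> Ks" for L
    proof -
      from that consider j where "j < length fs" "L = adjoin R K (take j fs)"
        | j where "j < length gs" "L = adjoin R K (take j gs)" by (auto simp: Ks_def)
      then show ?thesis
      proof cases
        case 1
        then show ?thesis using regular_mod_nth[OF Suc.prems(5)] Suc.prems(3) nzd_mod_socle nth_mem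
          by (metis subsetD)
      next
        case 2
        then show ?thesis using regular_mod_nth[OF Suc.prems(6)] Suc.prems(4) nzd_mod_socle nth_mem
          by (metis subsetD)
      qed
    qed
  qed
  then obtain w where w: "w \<in> M" "\<forall>L\<in>Ks. nzd_mod R L w" by blast
  have wc: "w \<in> carrier R" using w Mc by auto
  have wf: "nzd_mod R (adjoin R K (take j fs')) w" if "j \<le> length fs'" for j
    using bspec[OF w(2), of "adjoin R K (take j fs)"] that by (force simp: Ks_def fs)
  have wg: "nzd_mod R (adjoin R K (take j gs')) w" if "j \<le> length gs'" for j
    using bspec[OF w(2), of "adjoin R K (take j gs)"] that by (force simp: Ks_def gs)
  have rf: "regular_mod R K fs'" "nzd_mod R (adjoin R K fs') f"
    and rg: "regular_mod R K gs'" "nzd_mod R (adjoin R K gs') g"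
    using Suc.prems(5,6) by (simp_all add: fs gs regular_mod_append)
  have car': "set fs' \<subseteq> carrier R" "set gs' \<subseteq> carrier R" using car fs gs by auto
  have eq: "adjoin R (K <+> PIdl w) ys = adjoin R K ys <+> PIdl w" if "set ys \<subseteq> carrier R" for ys
    using that K wc by (intro adjoin_swap) (auto intro: ideal_ops)
  have "socle_nonzero R M (adjoin R K gs' <+> PIdl g)"
    using Suc.prems(7) by (simp add: gs adjoin_append)
  then have "socle_nonzero R M (adjoin R K gs' <+> PIdl w)"
    using socle_nonzero_exchange[OF adjoin_ideal[OF K car'(2)] Mc, of g w] w(1) rg(2) wg[of "length gs'"]
      Suc.prems(4) gs by simp
  then have "socle_nonzero R M (adjoin R (K <+> PIdl w) gs')" using eq car' by simp
  moreover have "regular_mod R (K <+> PIdl w) gs'" "regular_mod R (K <+> PIdl w) fs'"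
    using rf rg wf wg K wc car' by (auto intro: regular_mod_add_cgenideal)
  ultimately have "socle_nonzero R M (adjoin R (K <+> PIdl w) fs')"
    using Suc.prems(2,3,4) Suc(2) K wc by (intro Suc(1)[of fs' "K <+> PIdl w" gs']) (auto simp: fs gs intro: ideal_ops)
  then have "socle_nonzero R M (adjoin R K fs' <+> PIdl w)" using eq car' by simp
  then have "socle_nonzero R M (adjoin R K fs' <+> PIdl f)"
    using socle_nonzero_exchange[OF adjoin_ideal[OF K car'(1)] Mc, of w f] w(1) rf(2) wf[of "length fs'"]
      Suc.prems(3) fs by simp
  then show ?case by (simp add: fs adjoin_append)
qed

text \<open>A socle modulo gs would be carried to the initial segment of fs of the same length, but
  the next entry of fs is regular modulo that segment.\<close>

lemma shorter_regular_no_socle: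
  assumes U: "unit_differences R U" "infinite U" and M: "ideal M R"
    and K: "ideal K R" and fs: "set fs \<subseteq> M" "regular_mod R K fs"
    and gs: "set gs \<subseteq> M" "regular_mod R K gs" and len: "length gs < length fs"
  shows "\<not> socle_nonzero R M (adjoin R K gs)"
proof
  assume soc: "socle_nonzero R M (adjoin R K gs)"
  let ?n = "length gs"
  have "fs = take ?n fs @ drop ?n fs" by simp
  then have reg: "regular_mod R K (take ?n fs)" using fs(2) regular_mod_append by metis
  have "socle_nonzero R M (adjoin R K (take ?n fs))"
    using len fs(1) gs set_take_subset[of ?n fs] soc K
    by (intro socle_nonzero_regular_exchange[OF U M K _ _ gs(1) reg]) auto
  moreover have "nzd_mod R (adjoin R K (take ?n fs)) (fs ! ?n)"
    using regular_mod_nth[OF fs(2) len] .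
  moreover have "fs ! ?n \<in> M" using fs(1) len by auto
  ultimately show False using nzd_mod_socle by blast
qed

text \<open>As long as the sequence is shorter than fs there is no socle modulo it, hence M contains
  a further regular element.\<close>

lemma regular_mod_extend:
  assumes U: "unit_differences R U" "infinite U" and M: "ideal M R"
    and K: "ideal K R" and fs: "set fs \<subseteq> M" "regular_mod R K fs"
    and gs: "set gs \<subseteq> M" "regular_mod R K gs" "length gs \<le> length fs"
  shows "\<exists>hs. set hs \<subseteq> M \<and> regular_mod R K (gs @ hs) \<and> length (gs @ hs) = length fs"
proof -
  have Mc: "M \<subseteq> carrier R" using M by (rule ideal_subset_carrier)
  show ?thesis
    using gs
  proof (induction "length fs - length gs" arbitrary: gs)
    case 0
    then show ?case by (intro exI[of _ "[]"]) auto
  next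
    case (Suc k)
    have "\<not> socle_nonzero R M (adjoin R K gs)"
      using Suc by (intro shorter_regular_no_socle[OF U M K fs]) auto
    moreover have "ideal (adjoin R K gs) R"
      using Suc.prems(1) Mc K by (intro adjoin_ideal) auto
    ultimately have "\<exists>w\<in>M. \<forall>L\<in>{adjoin R K gs}. nzd_mod R L w"
      by (intro exists_nzd_mod[OF U M]) auto
    then obtain w where w: "w \<in> M" "nzd_mod R (adjoin R K gs) w" by blast
    have "\<exists>hs. set hs \<subseteq> M \<and> regular_mod R K ((gs @ [w]) @ hs) \<and> length ((gs @ [w]) @ hs) = length fs"
      using Suc w by (intro Suc(1)) (auto simp: regular_mod_append)
    then obtain hs where "set hs \<subseteq> M \<and> regular_mod R K ((gs @ [w]) @ hs) \<and> length ((gs @ [w]) @ hs) = length fs" ..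
    then show ?case using w by (intro exI[of _ "w # hs"]) auto
  qed
qed

end

section \<open>Local rings: Nakayama, reordering regular sequences, parameters\<close>

locale noetherian_local = noetherian_cring R for R (structure) +
  fixes M
  assumes maximal: "maximalideal M R" and unique_maximal: "\<And>J. maximalideal J R \<Longrightarrow> J = M"
begin

lemma M_ideal: "ideal M R"
  using maximal by (rule maximalideal.axioms(1))

lemma one_notin_M: "\<one> \<notin> M"
  using maximalideal.I_notcarr[OF maximal] ideal.one_imp_carrier[OF M_ideal] by auto

lemma proper_ideal_subset_M:
  assumes "ideal A R" "A \<noteq> carrier R"
  shows "A \<subseteq> M"
proof -
  let ?Cs = "{B. ideal B R \<and> A \<subseteq> B \<and> \<one> \<notin> B}"
  have "A \<in> ?Cs" using assms ideal.one_imp_carrier by auto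
  then have "\<exists>B\<in>?Cs. \<forall>Z\<in>?Cs. B \<subseteq> Z \<longrightarrow> Z = B"
    by (intro exists_maximal_ideal_in) auto
  then obtain B where B: "ideal B R" "A \<subseteq> B" "\<one> \<notin> B"
    "\<forall>Z\<in>?Cs. B \<subseteq> Z \<longrightarrow> Z = B" by blast
  have "maximalideal B R"
  proof (rule maximalidealI)
    show "carrier R \<noteq> B" using B(3) by auto
    fix J assume J: "ideal J R" "B \<subseteq> J"
    show "J = B \<or> J = carrier R"
    proof (cases "\<one> \<in> J")
      case True
      then show ?thesis using ideal.one_imp_carrier[OF J(1)] by simp
    next
      case False
      then show ?thesis using B(4) J B(2) by auto
    qed
  qed (rule B(1))
  then show ?thesis using unique_maximal B(2) by auto
qed

lemma unit_outside_M:
  assumes "a \<in> carrier R" "a \<notin> M"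
  obtains b where "b \<in> carrier R" "b \<otimes> a = \<one>"
proof -
  have "PIdl a = carrier R"
    using proper_ideal_subset_M[of "PIdl a"] cgenideal_self[of a] assms cgenideal_ideal[of a] by auto
  then have "\<one> \<in> PIdl a" by simp
  then show ?thesis using that by (auto simp: mem_cgenideal)
qed

lemma mem_of_one_minus:
  assumes "ideal A R" "c \<in> M" "a \<in> carrier R" "a \<ominus> c \<otimes> a \<in> A"
  shows "a \<in> A"
proof -
  have c: "c \<in> carrier R" using assms(2) ideal_mem_carrier[OF M_ideal] by auto
  have "\<one> \<ominus> c \<notin> M"
  proof
    assume "\<one> \<ominus> c \<in> M"
    then have "(\<one> \<ominus> c) \<oplus> c \<in> M" using assms(2) M_ideal by (intro ideal_add_mem)
    moreover have "(\<one> \<ominus> c) \<oplus> c = \<one>" using c by algebra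
    ultimately show False using one_notin_M by simp
  qed
  then obtain b where b: "b \<in> carrier R" "b \<otimes> (\<one> \<ominus> c) = \<one>"
    using unit_outside_M[of "\<one> \<ominus> c"] c by auto
  have "b \<otimes> (a \<ominus> c \<otimes> a) = (b \<otimes> (\<one> \<ominus> c)) \<otimes> a" using b(1) c assms(3) by algebra
  then have "a = b \<otimes> (a \<ominus> c \<otimes> a)" using b assms(3) by simp
  also have "\<dots> \<in> A" using assms b by (intro ideal_mult_mem)
  finally show ?thesis .
qed

text \<open>Instead of a list of generators of N, a maximal ideal B between K and K + N not
  containing N is used. Adjoining any a in N outside B swallows N, so a = b + a c with b in B and c
  in M, and 1 - c is a unit.\<close>

lemma nakayama:
  assumes N: "ideal N R" and K: "ideal K R" and sub: "N \<subseteq> K <+> M \<cdot> N"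
  shows "N \<subseteq> K"
proof (rule ccontr)
  assume no: "\<not> N \<subseteq> K"
  let ?N = "K <+> N"
  have idN: "ideal ?N R" using N K by (intro ideal_ops)
  let ?Cs = "{B. ideal B R \<and> K \<subseteq> B \<and> B \<subseteq> ?N \<and> \<not> N \<subseteq> B}"
  have "K \<in> ?Cs" using K N no by (auto intro: set_add_upper1[THEN subsetD])
  then have "\<exists>B\<in>?Cs. \<forall>Z\<in>?Cs. B \<subseteq> Z \<longrightarrow> Z = B"
    by (intro exists_maximal_ideal_in) auto
  then obtain B where B: "ideal B R" "K \<subseteq> B" "B \<subseteq> ?N" "\<not> N \<subseteq> B"
    "\<forall>Z\<in>?Cs. B \<subseteq> Z \<longrightarrow> Z = B" by blast
  obtain a where a: "a \<in> N" "a \<notin> B" using B(4) by auto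
  have ac: "a \<in> carrier R" using a N ideal_mem_carrier by auto
  let ?Z = "B <+> PIdl a"
  have Z: "ideal ?Z R" using B ac by (intro ideal_ops)
  have BZ: "B \<subseteq> ?Z" "a \<in> ?Z" using set_add_upper1[OF B(1) cgenideal_ideal[OF ac]] add_cgenideal_mem[OF B(1) ac] by simp_all
  have "?Z \<subseteq> ?N"
    using B(3) a N idN set_add_upper2[OF K N] by (intro set_add_least cgenideal_minimal) auto
  then have "?Z \<in> ?Cs" if "\<not> N \<subseteq> ?Z" using that B(2) BZ(1) Z by auto
  then have NZ: "N \<subseteq> ?Z" using B(5) BZ a(2) by auto
  have "M \<cdot> N \<subseteq> M \<cdot> ?Z" using NZ by (intro ideal_prod_mono) auto
  also have "\<dots> = M \<cdot> B <+> M \<cdot> (PIdl a)"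
    using M_ideal B ac by (intro ideal_prod_distr) (auto intro: ideal_ops)
  also have "\<dots> \<subseteq> B <+> (PIdl a) \<cdot> M"
    using ideal_prod_subset_right[OF M_ideal B(1)] ideal_prod_commute[OF M_ideal cgenideal_ideal[OF ac]]
    by (intro set_add_mono) simp_all
  finally have "K <+> M \<cdot> N \<subseteq> B <+> (PIdl a) \<cdot> M"
    using B(2) set_add_upper1[OF B(1) ideal_prod_is_ideal[OF cgenideal_ideal[OF ac] M_ideal]]
    by (intro set_add_least add_ideals B(1) ideal_prod_is_ideal cgenideal_ideal ac M_ideal) blast+
  then have "a \<in> B <+> (PIdl a) \<cdot> M" using sub a by auto
  then obtain b c where bc: "b \<in> B" "c \<in> M" "a = b \<oplus> a \<otimes> c"
    using M_ideal ac by (auto simp: mem_set_add mem_cgenideal_prod)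
  have bcc: "b \<in> carrier R" "c \<in> carrier R"
    using bc ideal_mem_carrier[OF B(1)] ideal_mem_carrier[OF M_ideal] by auto
  have "(b \<oplus> a \<otimes> c) \<ominus> c \<otimes> a = b" using bcc ac by algebra
  then have "a \<ominus> c \<otimes> a = b" using bc(3) by simp
  then show False using mem_of_one_minus[OF B(1) bc(2) ac] bc a by simp
qed

text \<open>Every z in (K : w) is y z' modulo K with z' again in (K : w), so Nakayama gives (K : w)
  \<subseteq> K; after that \<open>nzd_mod_swap\<close> applies.\<close>

lemma nzd_mod_local_swap:
  assumes K: "ideal K R" and yw: "y \<in> M" "w \<in> M"
    and "nzd_mod R K y" "nzd_mod R (K <+> PIdl y) w"
  shows "nzd_mod R K w" "nzd_mod R (K <+> PIdl w) y"
proof -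
  have c: "y \<in> carrier R" "w \<in> carrier R" using yw ideal_mem_carrier[OF M_ideal] by auto
  let ?N = "{z \<in> carrier R. w \<otimes> z \<in> K}"
  have idN: "ideal ?N R" using K c by (intro ideal_colon)
  have "?N \<subseteq> K <+> M \<cdot> ?N"
  proof
    fix z assume "z \<in> ?N"
    then have z: "z \<in> carrier R" "w \<otimes> z \<in> K" by auto
    have "w \<otimes> z \<in> K <+> PIdl y" using set_add_left[OF K cgenideal_ideal[OF c(1)] z(2)] .
    then have "z \<in> K <+> PIdl y" using nzd_modD[OF assms(5)] z by simp
    then obtain z' where z': "z' \<in> carrier R" "z \<ominus> y \<otimes> z' \<in> K"
      using K c z mem_add_cgenideal'[of K y z] by auto
    have "y \<otimes> (w \<otimes> z') = w \<otimes> z \<ominus> w \<otimes> (z \<ominus> y \<otimes> z')" using c z(1) z'(1) by algebra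
    also have "\<dots> \<in> K" using K z z' c by (simp add: ideal_mems)
    finally have "z' \<in> ?N" using nzd_modD[OF assms(4)] z' c by simp
    moreover have "z = (z \<ominus> y \<otimes> z') \<oplus> y \<otimes> z'" using z z'(1) c by algebra
    ultimately show "z \<in> K <+> M \<cdot> ?N"
      using set_addI[OF z'(2) ideal_prod.prod[OF yw(1), of z' ?N R]] by simp
  qed
  then have "?N \<subseteq> K" by (rule nakayama[OF idN K])
  then show w: "nzd_mod R K w" by (auto simp: nzd_mod_def)
  show "nzd_mod R (K <+> PIdl w) y" using K c assms(4,5) w by (rule nzd_mod_swap)
qed

lemma regular_mod_to_back:
  assumes "ideal K R" "p \<in> M" "set ys \<subseteq> M" "nzd_mod R K p" "regular_mod R (K <+> PIdl p) ys"
  shows "regular_mod R K ys \<and> nzd_mod R (adjoin R K ys) p"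
  using assms
proof (induction ys arbitrary: K)
  case (Cons y ys)
  have c: "p \<in> carrier R" "y \<in> carrier R" using Cons.prems ideal_mem_carrier[OF M_ideal] by auto
  have "nzd_mod R K y" "nzd_mod R (K <+> PIdl y) p"
    using nzd_mod_local_swap[of K p y] Cons.prems by auto
  moreover have "K <+> PIdl p <+> PIdl y = K <+> PIdl y <+> PIdl p"
    using Cons.prems c by (simp add: ideal_add_ac ideal_ops)
  ultimately show ?case
    using Cons.IH[of "K <+> PIdl y"] Cons.prems c by (auto intro: ideal_ops)
qed simp

lemma regular_mod_to_front:
  assumes "ideal K R" "p \<in> M" "set ys \<subseteq> M" "regular_mod R K ys" "nzd_mod R (adjoin R K ys) p"
  shows "nzd_mod R K p \<and> regular_mod R (K <+> PIdl p) ys"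
  using assms
proof (induction ys arbitrary: K)
  case (Cons y ys)
  have c: "p \<in> carrier R" "y \<in> carrier R" using Cons.prems ideal_mem_carrier[OF M_ideal] by auto
  have "nzd_mod R (K <+> PIdl y) p" "regular_mod R (K <+> PIdl y <+> PIdl p) ys"
    using Cons.IH[of "K <+> PIdl y"] Cons.prems c by (auto intro: ideal_ops)
  moreover have "K <+> PIdl p <+> PIdl y = K <+> PIdl y <+> PIdl p"
    using Cons.prems c by (simp add: ideal_add_ac ideal_ops)
  ultimately show ?case
    using nzd_mod_local_swap[of K y p] Cons.prems by auto
qed simp

lemma finite_nonunits:
  assumes U: "unit_differences R U" and c: "c \<in> carrier R"
  shows "finite {r \<in> U. \<one> \<oplus> r \<otimes> c \<in> M}"
proof (cases "c \<in> M")
  case True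
  have "\<one> \<oplus> r \<otimes> c \<notin> M" if "r \<in> U" for r
  proof
    have r: "r \<in> carrier R" using U that by (auto simp: unit_differences_def)
    assume "\<one> \<oplus> r \<otimes> c \<in> M"
    then have "(\<one> \<oplus> r \<otimes> c) \<ominus> r \<otimes> c \<in> M"
      using True r M_ideal by (simp add: ideal_mems)
    moreover have "(\<one> \<oplus> r \<otimes> c) \<ominus> r \<otimes> c = \<one>" using r c by algebra
    ultimately show False using one_notin_M by simp
  qed
  then have "{r \<in> U. \<one> \<oplus> r \<otimes> c \<in> M} = {}" by blast
  then show ?thesis by (simp only: finite.emptyI)
next
  case False
  then show ?thesis
    using finite_bad_combinations[OF U, of "{M}" \<one> c] c M_ideal by simp
qed

lemma add_cgenideal_cong:
  assumes "ideal L R" "x \<in> carrier R" "p \<in> carrier R" "p \<in> L <+> PIdl x" "x \<in> L <+> PIdl p"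
  shows "L <+> PIdl p = L <+> PIdl x"
  using assms by (intro equalityI set_add_least set_add_upper1 cgenideal_minimal ideal_ops)

text \<open>The head x is replaced by p = x + r q with q in the generated ideal, chosen regular
  modulo K and equal to a unit times x modulo K and the remaining generators. Since p generates the
  same ideal together with the rest, the induction can proceed modulo K + (p).\<close>

lemma regular_mod_generators:
  assumes U: "unit_differences R U" "infinite U"
    and "ideal K R" "set xs \<subseteq> M" "set fs \<subseteq> adjoin R K xs" "regular_mod R K fs" "length fs = length xs" "K \<subseteq> M"
  shows "regular_mod R K xs"
  using assms(3-)
proof (induction xs arbitrary: K fs)
  case (Cons x xs)
  note K = Cons.prems(1)
  let ?Q = "adjoin R K (x # xs)"
  let ?L = "adjoin R K xs"
  have c: "x \<in> carrier R" "set xs \<subseteq> carrier R" "x \<in> M" "set xs \<subseteq> M"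
    using Cons.prems ideal_mem_carrier[OF M_ideal] by auto
  have idL: "ideal ?L R" using K c by (intro adjoin_ideal)
  have idQ: "ideal ?Q R" using K c by (intro adjoin_ideal) auto
  have Q: "?Q = ?L <+> PIdl x" using K c by (simp add: adjoin_swap ideal_ops)
  obtain f fs' where fs: "fs = f # fs'" using Cons.prems(5) by (cases fs) auto
  then have f: "f \<in> ?Q" "nzd_mod R K f" using Cons.prems by auto
  obtain T where T: "finite T" "T \<subseteq> carrier R - K"
    "\<forall>c\<in>carrier R. \<not> nzd_mod R K c \<longrightarrow> (\<exists>u\<in>T. c \<otimes> u \<in> K)"
    using finitely_many_zero_divisor_ideals[OF K] by (elim exE conjE)
  let ?A = "\<lambda>u. {c \<in> carrier R. u \<otimes> c \<in> K}"
  have idA: "ideal A R" if "A \<in> ?A ` T" for A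
    using that T(2) K by (auto intro!: ideal_colon)
  obtain q where q: "q \<in> ?Q" "q \<notin> \<Union>(?A ` T)"
  proof (rule ideal_avoidance[OF U _ _ idQ])
    show "finite (?A ` T)" using T by simp
    show "ideal A R" if "A \<in> ?A ` T" for A using idA that .
    show "\<not> ?Q \<subseteq> A" if A: "A \<in> ?A ` T" for A
    proof
      assume "?Q \<subseteq> A"
      then have "f \<in> A" using f(1) by blast
      then obtain u where u: "u \<in> T" "f \<in> carrier R" "u \<otimes> f \<in> K" using A by auto
      then have "f \<otimes> u \<in> K" "u \<in> carrier R" "u \<notin> K" using T(2) m_comm[of u f] by auto
      then show False using nzd_modD[OF f(2)] by simp
    qed
  qed
  have qc: "q \<in> carrier R" using q(1) idQ ideal_mem_carrier by auto
  obtain e where e: "e \<in> carrier R" "q \<ominus> x \<otimes> e \<in> ?L"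
    using q(1) qc idL c unfolding Q by (auto simp: mem_add_cgenideal')
  \<comment> \<open>Almost every r keeps x + r q outside the zero-divisor ideals and makes 1 + r e a
    unit.\<close>
  have "infinite (U - ({r \<in> U. x \<oplus> r \<otimes> q \<in> \<Union>(?A ` T)} \<union> {r \<in> U. \<one> \<oplus> r \<otimes> e \<in> M}))"
    using finite_bad_combinations[OF U(1), of "?A ` T" x q] finite_nonunits[OF U(1) e(1)] T(1) idA c(1) qc q(2) U(2)
    by (intro Diff_infinite_finite) simp_all
  from infinite_imp_nonempty[OF this]
  obtain r where r: "r \<in> U" "x \<oplus> r \<otimes> q \<notin> \<Union>(?A ` T)" "\<one> \<oplus> r \<otimes> e \<notin> M" by blast
  have rc: "r \<in> carrier R" using r U by (auto simp: unit_differences_def)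
  define p where "p = x \<oplus> r \<otimes> q"
  have pc: "p \<in> carrier R" using c rc qc by (simp add: p_def)
  have pQ: "p \<in> ?Q"
    unfolding p_def using ideal_mult_mem[OF idQ q(1) rc] adjoin_mem[OF K, of "x # xs" x] c idQ
    by (simp add: ideal_add_mem)
  have "?Q \<subseteq> M" using Cons.prems(1,2) M_ideal Cons.prems(6) by (intro adjoin_least) auto
  then have pM: "p \<in> M" using pQ by blast
  have nzd_p: "nzd_mod R K p"
  proof (rule ccontr)
    assume "\<not> nzd_mod R K p"
    then obtain u where u: "u \<in> T" "p \<otimes> u \<in> K" using T(3) pc by auto
    then have "u \<otimes> p \<in> K" using m_comm[of p u] pc T(2) by auto
    then show False using r(2) u(1) pc by (auto simp: p_def)
  qed
  obtain v where v: "v \<in> carrier R" "v \<otimes> (\<one> \<oplus> r \<otimes> e) = \<one>"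
    using unit_outside_M[OF _ r(3)] rc e by auto
  have pL: "p \<ominus> (\<one> \<oplus> r \<otimes> e) \<otimes> x \<in> ?L"
  proof -
    have "p \<ominus> (\<one> \<oplus> r \<otimes> e) \<otimes> x = r \<otimes> (q \<ominus> x \<otimes> e)"
      unfolding p_def using c(1) rc qc e(1) by algebra
    then show ?thesis using idL e rc by (simp add: ideal_mult_mem)
  qed
  have eq: "?L <+> PIdl p = ?L <+> PIdl x"
  proof (rule add_cgenideal_cong[OF idL c(1) pc])
    show "p \<in> ?L <+> PIdl x" using pQ Q by simp
    have "x \<ominus> p \<otimes> v \<in> ?L"
    proof -
      have "\<ominus> v \<otimes> (p \<ominus> (\<one> \<oplus> r \<otimes> e) \<otimes> x) = (v \<otimes> (\<one> \<oplus> r \<otimes> e)) \<otimes> x \<ominus> p \<otimes> v"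
        using v(1) pc rc e(1) c(1) by algebra
      then have "x \<ominus> p \<otimes> v = \<ominus> v \<otimes> (p \<ominus> (\<one> \<oplus> r \<otimes> e) \<otimes> x)" using v(2) c(1) by simp
      then show ?thesis using ideal_mult_mem[OF idL pL, of "\<ominus> v"] v by simp
    qed
    then show "x \<in> ?L <+> PIdl p" using idL c pc v by (auto simp: mem_add_cgenideal')
  qed
  then have Qp: "adjoin R K (p # xs) = ?Q" using K c pc Q by (simp add: adjoin_swap ideal_ops)
  \<comment> \<open>The regular sequence [p] is extended inside Q to full length; its tail is what
    the induction hypothesis asks for modulo K + (p).\<close>
  have "\<exists>hs. set hs \<subseteq> ?Q \<and> regular_mod R K ([p] @ hs) \<and> length ([p] @ hs) = length fs"
    using pQ nzd_p fs by (intro regular_mod_extend[OF U idQ K Cons.prems(3,4)]) simp_all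
  then obtain hs where hs: "set hs \<subseteq> ?Q" "regular_mod R (K <+> PIdl p) hs" "length hs = length xs"
    using Cons.prems(5) by auto
  have "K <+> PIdl p \<subseteq> M"
    using Cons.prems(6) pM M_ideal by (intro set_add_least cgenideal_minimal)
  then have "regular_mod R (K <+> PIdl p) xs"
    using hs c K pc Qp by (intro Cons.IH[of "K <+> PIdl p" hs]) (simp_all add: ideal_ops)
  \<comment> \<open>First p is moved behind xs. There it differs from x by a unit, so x is regular
    in its place and can be moved to the front.\<close>
  then have reg: "regular_mod R K xs \<and> nzd_mod R ?L p"
    using K c nzd_p pM by (intro regular_mod_to_back)
  moreover have "nzd_mod R ?L x"
    unfolding nzd_mod_def
  proof (intro ballI impI)
    fix z assume z: "z \<in> carrier R" "x \<otimes> z \<in> ?L"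
    have "p \<otimes> z = (p \<ominus> (\<one> \<oplus> r \<otimes> e) \<otimes> x) \<otimes> z \<oplus> (\<one> \<oplus> r \<otimes> e) \<otimes> (x \<otimes> z)"
      using z(1) pc rc e(1) c(1) by algebra
    also have "\<dots> \<in> ?L" using idL pL z rc e(1) by (simp add: ideal_mems)
    finally show "z \<in> ?L" using nzd_modD[OF conjunct2[OF reg]] z(1) by simp
  qed
  ultimately show ?case using regular_mod_to_front[OF K c(3,4)] by simp
qed simp

lemma nzd_mod_power:
  assumes "nzd_mod R K w" "w \<in> carrier R"
  shows "nzd_mod R K (w [^] (n::nat))"
proof (induction n)
  case (Suc n)
  show ?case
    unfolding nzd_mod_def
  proof (intro ballI impI)
    fix z assume z: "z \<in> carrier R" "w [^] Suc n \<otimes> z \<in> K"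
    then have "w [^] n \<otimes> (w \<otimes> z) \<in> K" using assms by (simp add: m_assoc)
    then have "w \<otimes> z \<in> K" using nzd_modD[OF Suc] z assms by simp
    then show "z \<in> K" using nzd_modD[OF assms(1)] z by simp
  qed
qed (simp add: nzd_mod_def)

text \<open>The ideal Q of xs contains w^N for every w in M, so it contains a regular sequence as
  long as ys; \<open>regular_mod_generators\<close> transfers regularity to the generators
  xs.\<close>

lemma parameters_regular:
  assumes U: "unit_differences R U" "infinite U"
    and ys: "set ys \<subseteq> M" "regular_mod R {\<zero>} ys"
    and xs: "set xs \<subseteq> M" "length xs = length ys" "ipow R M N \<subseteq> adjoin R {\<zero>} xs"
  shows "regular_mod R {\<zero>} xs"
proof -
  let ?Q = "adjoin R {\<zero>} xs"
  have Mc: "M \<subseteq> carrier R" using M_ideal by (rule ideal_subset_carrier)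
  have idQ: "ideal ?Q R" using xs Mc by (intro adjoin_ideal zeroideal) auto
  have "{\<zero>} \<subseteq> M" using ideal_zero_mem[OF M_ideal] by simp
  then have QM: "?Q \<subseteq> M" using xs M_ideal by (intro adjoin_least zeroideal)
  have "\<exists>fs. set fs \<subseteq> ?Q \<and> regular_mod R {\<zero>} fs \<and> length fs = k" if "k \<le> length xs" for k
    using that
  proof (induction k)
    case (Suc k)
    then obtain fs where fs: "set fs \<subseteq> ?Q" "regular_mod R {\<zero>} fs" "length fs = k" by auto
    have "\<not> socle_nonzero R M (adjoin R {\<zero>} fs)"
      using fs QM Suc xs(2) by (intro shorter_regular_no_socle[OF U M_ideal zeroideal ys]) auto
    moreover have "ideal (adjoin R {\<zero>} fs) R"
      using fs QM Mc by (intro adjoin_ideal zeroideal) auto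
    ultimately have "\<exists>w\<in>M. \<forall>L\<in>{adjoin R {\<zero>} fs}. nzd_mod R L w"
      by (intro exists_nzd_mod[OF U M_ideal]) auto
    then obtain w where w: "w \<in> M" "nzd_mod R (adjoin R {\<zero>} fs) w" by blast
    \<comment> \<open>The regular element w is only known to lie in M; its N-th power lies in Q and
      is still regular.\<close>
    have "w [^] N \<in> ?Q" using subsetD[OF xs(3) pow_mem_ipow[OF M_ideal w(1)]] .
    moreover have "nzd_mod R (adjoin R {\<zero>} fs) (w [^] N)" using w Mc by (intro nzd_mod_power) auto
    ultimately show ?case
      using fs by (intro exI[of _ "fs @ [w [^] N]"]) (auto simp: regular_mod_append)
  qed simp
  then obtain fs where fs: "set fs \<subseteq> ?Q" "regular_mod R {\<zero>} fs" "length fs = length xs" by auto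
  show ?thesis
    using regular_mod_generators[OF U zeroideal xs(1) fs \<open>{\<zero>} \<subseteq> M\<close>] .
qed

end

section \<open>Permutable regular sequences and colength\<close>

text \<open>Later arguments place x behind different parts of a_1, ..., a_(d-1), so regularity is
  recorded for all orders together.\<close>

definition permutable_mod :: "('a, 'b) ring_scheme \<Rightarrow> 'a set \<Rightarrow> 'a list \<Rightarrow> bool"
  where "permutable_mod R K xs \<longleftrightarrow> (\<forall>ys. mset ys = mset xs \<longrightarrow> regular_mod R K ys)"

abbreviation ideal_of :: "('a, 'b) ring_scheme \<Rightarrow> 'a list \<Rightarrow> 'a set"
  where "ideal_of R xs \<equiv> adjoin R {\<zero>\<^bsub>R\<^esub>} xs"

context cring
begin

lemma permutable_mod_left:
  assumes "permutable_mod R K xs" "mset xs = mset (us @ vs)"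
  shows "permutable_mod R K us"
  unfolding permutable_mod_def
proof (intro allI impI)
  fix ys assume "mset ys = mset us"
  then have "mset (ys @ vs) = mset xs" using assms(2) by simp
  then have "regular_mod R K (ys @ vs)" using assms(1) unfolding permutable_mod_def by simp
  then show "regular_mod R K ys" by (simp add: regular_mod_append)
qed

lemma permutable_mod_right:
  assumes "permutable_mod R K xs" "mset xs = mset (us @ vs)"
  shows "permutable_mod R (adjoin R K us) vs"
  unfolding permutable_mod_def
proof (intro allI impI)
  fix ys assume "mset ys = mset vs"
  then have "mset (us @ ys) = mset xs" using assms(2) by simp
  then have "regular_mod R K (us @ ys)" using assms(1) unfolding permutable_mod_def by simp
  then show "regular_mod R (adjoin R K us) ys" by (simp add: regular_mod_append)
qed

lemma permutable_mod_nzd: "permutable_mod R K (y # ys) \<Longrightarrow> nzd_mod R K y"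
  unfolding permutable_mod_def by (metis regular_mod.simps(2))

lemma ideal_of_ideal: "set xs \<subseteq> carrier R \<Longrightarrow> ideal (ideal_of R xs) R"
  by (intro adjoin_ideal zeroideal)

lemma zero_add_ideal: "ideal K R \<Longrightarrow> {\<zero>} <+> K = K"
proof -
  assume K: "ideal K R"
  have "\<zero> \<oplus> k = k" if "k \<in> K" for k
    using that K by (simp add: ideal_mem_carrier)
  then show ?thesis unfolding set_add_def' by force
qed

lemma ideal_add_zero: "ideal K R \<Longrightarrow> K <+> {\<zero>} = K"
  using zero_add_ideal ideal_set_add_comm zeroideal by simp

lemma adjoin_eq_add_ideal_of:
  "ideal K R \<Longrightarrow> set xs \<subseteq> carrier R \<Longrightarrow> adjoin R K xs = K <+> ideal_of R xs"
  using adjoin_swap[OF zeroideal, of K xs] by (simp add: zero_add_ideal ideal_set_add_comm ideal_of_ideal)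

lemma ideal_of_Cons:
  "x \<in> carrier R \<Longrightarrow> set xs \<subseteq> carrier R \<Longrightarrow> ideal_of R (x # xs) = PIdl x <+> ideal_of R xs"
  using adjoin_swap[OF zeroideal, of "PIdl x" xs]
  by (simp add: ideal_set_add_comm ideal_of_ideal cgenideal_ideal)

lemma ideal_of_append:
  "set us \<subseteq> carrier R \<Longrightarrow> set vs \<subseteq> carrier R \<Longrightarrow> ideal_of R (us @ vs) = ideal_of R us <+> ideal_of R vs"
  by (simp add: adjoin_append adjoin_eq_add_ideal_of ideal_of_ideal)

lemma ipow_zero_Suc: "ipow R {\<zero>} (Suc n) = {\<zero>}"
  by (simp add: ipow_Suc ideal_prod_zero ipow_ideal zeroideal)

text \<open>Either some factor of a product comes from P, or all of them come from B.\<close>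

lemma ipow_add_Suc:
  assumes "ideal P R" "ideal B R"
  shows "ipow R (P <+> B) (Suc n) = P \<cdot> ipow R (P <+> B) n <+> ipow R B (Suc n)"
proof
  note ids = assms ideal_ops
  let ?Q = "P <+> B"
  show "ipow R ?Q (Suc n) \<subseteq> P \<cdot> ipow R ?Q n <+> ipow R B (Suc n)"
  proof (induction n)
    case 0
    then show ?case using assms by (simp add: ideal_prod_one ideal_ops)
  next
    case (Suc n)
    let ?C = "P \<cdot> ipow R ?Q (Suc n) <+> ipow R B (Suc (Suc n))"
    have C: "ideal ?C R" by (intro ids)
    have up: "P \<cdot> ipow R ?Q (Suc n) \<subseteq> ?C" "ipow R B (Suc (Suc n)) \<subseteq> ?C"
      using assms by (simp_all add: set_add_upper1 set_add_upper2 ideal_ops)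
    have "ipow R ?Q (Suc (Suc n)) = ?Q \<cdot> ipow R ?Q (Suc n)"
      using assms by (intro ipow_Suc2 ids)
    also have "\<dots> = P \<cdot> ipow R ?Q (Suc n) <+> B \<cdot> ipow R ?Q (Suc n)"
      using assms by (intro ideal_prod_distr ids)
    also have "\<dots> \<subseteq> ?C"
    proof (rule set_add_least[OF C up(1)])
      have "B \<cdot> ipow R ?Q (Suc n) \<subseteq> B \<cdot> (P \<cdot> ipow R ?Q n <+> ipow R B (Suc n))"
        using Suc by (intro ideal_prod_mono) simp_all
      also have "\<dots> = B \<cdot> (P \<cdot> ipow R ?Q n) <+> B \<cdot> ipow R B (Suc n)"
        using assms by (intro ideal_prod_distr ids)
      also have "\<dots> = P \<cdot> (B \<cdot> ipow R ?Q n) <+> ipow R B (Suc (Suc n))"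
        using assms ideal_prod_left_comm[of B P "ipow R ?Q n"] ipow_Suc2[of B "Suc n"]
        by (simp add: ideal_ops)
      also have "\<dots> \<subseteq> ?C"
      proof (intro set_add_mono ideal_prod_mono subset_refl)
        have "B \<cdot> ipow R ?Q n \<subseteq> ?Q \<cdot> ipow R ?Q n"
          using assms by (intro ideal_prod_mono subset_refl set_add_upper2)
        then show "B \<cdot> ipow R ?Q n \<subseteq> ipow R ?Q (Suc n)"
          using assms ipow_Suc2[of ?Q n] by (simp add: ideal_ops)
      qed
      finally show "B \<cdot> ipow R ?Q (Suc n) \<subseteq> ?C" .
    qed
    finally show ?case .
  qed
  have "P \<cdot> ipow R ?Q n \<subseteq> ?Q \<cdot> ipow R ?Q n"
    using assms by (intro ideal_prod_mono subset_refl set_add_upper1)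
  then have "P \<cdot> ipow R ?Q n \<subseteq> ipow R ?Q (Suc n)"
    using assms ipow_Suc2[of ?Q n] by (simp add: ideal_ops)
  moreover have "ipow R B (Suc n) \<subseteq> ipow R ?Q (Suc n)"
    using assms by (intro ipow_mono set_add_upper2)
  ultimately show "P \<cdot> ipow R ?Q n <+> ipow R B (Suc n) \<subseteq> ipow R ?Q (Suc n)"
    using assms by (intro set_add_least ids)
qed

lemma cgenideal_prodI: "ideal A R \<Longrightarrow> x \<in> carrier R \<Longrightarrow> a \<in> A \<Longrightarrow> x \<otimes> a \<in> (PIdl x) \<cdot> A"
  by (intro ideal_prod.prod cgenideal_self)

lemma mem_add_prod_add:
  assumes "ideal K R" "ideal C R" "ideal D R" "b \<in> carrier R"
  shows "z \<in> K <+> ((PIdl b) \<cdot> C <+> D) \<longleftrightarrow> (\<exists>s\<in>C. z \<ominus> b \<otimes> s \<in> K <+> D) \<and> z \<in> carrier R"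
proof
  assume "z \<in> K <+> ((PIdl b) \<cdot> C <+> D)"
  then obtain k s e where *: "k \<in> K" "s \<in> C" "e \<in> D" "z = k \<oplus> (b \<otimes> s \<oplus> e)"
    using assms by (auto simp: mem_set_add mem_cgenideal_prod)
  have c: "k \<in> carrier R" "s \<in> carrier R" "e \<in> carrier R"
    using * ideal_mem_carrier assms(1-3) by simp_all
  have "z \<ominus> b \<otimes> s = k \<oplus> e" unfolding *(4) using c assms(4) by algebra
  then have "z \<ominus> b \<otimes> s \<in> K <+> D" using *(1,3) by (simp add: set_addI)
  then show "(\<exists>s\<in>C. z \<ominus> b \<otimes> s \<in> K <+> D) \<and> z \<in> carrier R"
    using *(2,4) c assms(4) by auto
next
  assume "(\<exists>s\<in>C. z \<ominus> b \<otimes> s \<in> K <+> D) \<and> z \<in> carrier R"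
  then obtain s k e where *: "s \<in> C" "k \<in> K" "e \<in> D" "z \<ominus> b \<otimes> s = k \<oplus> e" and z: "z \<in> carrier R"
    by (auto simp: mem_set_add)
  have c: "k \<in> carrier R" "s \<in> carrier R" "e \<in> carrier R"
    using * ideal_mem_carrier assms(1-3) by simp_all
  have "z = (z \<ominus> b \<otimes> s) \<oplus> b \<otimes> s" using c z assms(4) by algebra
  also have "\<dots> = k \<oplus> (b \<otimes> s \<oplus> e)" unfolding *(4) using c assms(4) by algebra
  finally show "z \<in> K <+> ((PIdl b) \<cdot> C <+> D)"
    using set_addI[OF *(2) set_addI[OF cgenideal_prodI[OF assms(2,4) *(1)] *(3)]] by simp
qed

text \<open>The quotients of successive powers of the ideal of a regular sequence are free over R
  modulo that ideal, so y remains regular modulo the powers. The proof is a double induction, on bs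
  and on n, through B^(n+1) = b B^n + B'^(n+1), where B' omits b.\<close>

lemma nzd_mod_ipow:
  assumes "ideal K R" "set (y # bs) \<subseteq> carrier R" "permutable_mod R K (y # bs)"
  shows "nzd_mod R (K <+> ipow R (ideal_of R bs) n) y"
  using assms
proof (induction bs arbitrary: K y n)
  case Nil
  show ?case
  proof (cases n)
    case 0
    have "carrier R \<subseteq> K <+> carrier R" using Nil by (intro set_add_upper2 oneideal)
    then show ?thesis unfolding nzd_mod_def 0 by auto
  next
    case (Suc m)
    then show ?thesis
      using Nil by (simp add: ipow_zero_Suc ideal_add_zero permutable_mod_nzd)
  qed
next
  case (Cons b bs)
  note K = Cons.prems(1)
  have c: "y \<in> carrier R" "b \<in> carrier R" "set bs \<subseteq> carrier R" using Cons.prems(2) by auto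
  define B where "B = ideal_of R (b # bs)"
  define B' where "B' = ideal_of R bs"
  have idB: "ideal B R" "ideal B' R" unfolding B_def B'_def using c by (auto intro!: ideal_of_ideal simp del: adjoin.simps)
  have B: "B = PIdl b <+> B'" unfolding B_def B'_def using c by (intro ideal_of_Cons)
  note ids = K idB c ideal_ops
  have nzd1: "nzd_mod R ((K <+> PIdl b) <+> ipow R B' m) y" for m
    unfolding B'_def
  proof (rule Cons.IH)
    show "permutable_mod R (K <+> PIdl b) (y # bs)"
      using permutable_mod_right[OF Cons.prems(3), of "[b]" "y # bs"] by simp
  qed (use K c in \<open>auto intro: ideal_ops\<close>)
  have nzd2: "nzd_mod R (K <+> ipow R B' m) b" for m
    unfolding B'_def
  proof (rule Cons.IH)
    show "permutable_mod R K (b # bs)"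
      using permutable_mod_left[OF Cons.prems(3), of "b # bs" "[y]"] by simp
  qed (use K c in auto)
  have "nzd_mod R (K <+> ipow R B n) y"
  proof (induction n)
    case 0
    have "carrier R \<subseteq> K <+> carrier R" using K by (intro set_add_upper2 oneideal)
    then show ?case unfolding nzd_mod_def by auto
  next
    case (Suc n)
    let ?D = "ipow R B' (Suc n)"
    have Bn: "ipow R B (Suc n) = (PIdl b) \<cdot> ipow R B n <+> ?D"
      unfolding B using idB(2) c by (intro ipow_add_Suc cgenideal_ideal)
    have idD: "ideal ?D R" "ideal (K <+> ?D) R" by (intro ids)+
    note mem = mem_add_prod_add[OF K ipow_ideal[OF idB(1), of n] idD(1) c(2), folded Bn]
    have DB: "?D \<subseteq> ipow R B n"
      using ipow_antimono[OF idB(2), of n "Suc n"] ipow_mono[of B' B n]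
        set_add_upper2[OF cgenideal_ideal[OF c(2)] idB(2)] B by auto
    show ?case
      unfolding nzd_mod_def
    proof (intro ballI impI)
      fix z assume z: "z \<in> carrier R" "y \<otimes> z \<in> K <+> ipow R B (Suc n)"
      obtain s where s: "s \<in> ipow R B n" "y \<otimes> z \<ominus> b \<otimes> s \<in> K <+> ?D"
        using z(2) mem by auto
      have sc: "s \<in> carrier R" using s(1) ideal_mem_carrier[OF ipow_ideal[OF idB(1)]] by simp
      have eqK: "(K <+> PIdl b) <+> ?D = (K <+> ?D) <+> PIdl b"
        using K idD(1) cgenideal_ideal[OF c(2)] by (simp add: ideal_add_ac)
      have "y \<otimes> z \<in> (K <+> ?D) <+> PIdl b"
        using s(2) sc z(1) c idD(2) by (auto simp: mem_add_cgenideal')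
      then have "z \<in> (K <+> ?D) <+> PIdl b"
        using nzd_modD[OF nzd1[of "Suc n"]] z(1) eqK by simp
      then obtain t where t: "t \<in> carrier R" "z \<ominus> b \<otimes> t \<in> K <+> ?D"
        using z(1) c idD(2) by (auto simp: mem_add_cgenideal')
      \<comment> \<open>Modulo K + B'^(n+1) one has y z = b s and z = b t. Cancelling b gives y t =
        s, and since s lies in B^n the inner induction puts t into K + B^n.\<close>
      have "b \<otimes> (y \<otimes> t \<ominus> s) = (y \<otimes> z \<ominus> b \<otimes> s) \<ominus> y \<otimes> (z \<ominus> b \<otimes> t)"
        using z(1) t(1) sc c(1,2) by algebra
      also have "\<dots> \<in> K <+> ?D"
        using ideal_diff_mem[OF idD(2) s(2) ideal_mult_mem[OF idD(2) t(2) c(1)]] .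
      finally have "y \<otimes> t \<ominus> s \<in> K <+> ?D"
        using nzd_modD[OF nzd2[of "Suc n"]] c t(1) sc by simp
      then have "y \<otimes> t \<ominus> s \<in> K <+> ipow R B n"
        using set_add_mono[OF subset_refl[of K] DB] by auto
      moreover have "s \<in> K <+> ipow R B n"
        using set_add_right[OF K ipow_ideal[OF idB(1)] s(1)] .
      ultimately have "(y \<otimes> t \<ominus> s) \<oplus> s \<in> K <+> ipow R B n"
        using K idB(1) by (intro ideal_add_mem ideal_ops)
      moreover have "(y \<otimes> t \<ominus> s) \<oplus> s = y \<otimes> t" using c t(1) sc by algebra
      ultimately have "t \<in> K <+> ipow R B n"
        using nzd_modD[OF Suc t(1)] by simp
      then obtain k s' where ks: "k \<in> K" "s' \<in> ipow R B n" "t = k \<oplus> s'" by (auto simp: mem_set_add)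
      have ksc: "k \<in> carrier R" "s' \<in> carrier R"
        using ks ideal_mem_carrier[OF K] ideal_mem_carrier[OF ipow_ideal[OF idB(1)]] by auto
      have "z \<ominus> b \<otimes> s' = (z \<ominus> b \<otimes> t) \<oplus> b \<otimes> k"
        unfolding ks(3) using z(1) ksc c by algebra
      also have "\<dots> \<in> K <+> ?D"
        using ideal_add_mem[OF idD(2) t(2) ideal_mult_mem[OF idD(2) set_add_left[OF K idD(1) ks(1)] c(2)]] .
      finally show "z \<in> K <+> ipow R B (Suc n)" using mem ks(2) z(1) by auto
    qed
  qed
  then show ?case unfolding B_def .
qed

end

section \<open>Length through chains of ideals\<close>

definition chain_length :: "('a, 'b) ring_scheme \<Rightarrow> 'a set \<Rightarrow> 'a set \<Rightarrow> nat \<Rightarrow> bool"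
  where "chain_length R A B n \<longleftrightarrow> (\<exists>N :: nat \<Rightarrow> 'a set.
    (\<forall>i\<le>n. ideal (N i) R \<and> B \<subseteq> N i \<and> N i \<subseteq> A) \<and> (\<forall>i<n. N i \<subset> N (Suc i)))"

text \<open>The length of the module \<open>A/B\<close> for ideals \<open>B \<subseteq> A\<close>, with submodules replaced by
  intermediate ideals.\<close>

definition colength :: "('a, 'b) ring_scheme \<Rightarrow> 'a set \<Rightarrow> 'a set \<Rightarrow> enat"
  where "colength R A B = Sup {enat n | n. chain_length R A B n}"

lemma chain_lengthD: "chain_length R A B n \<Longrightarrow> m \<le> n \<Longrightarrow> chain_length R A B m"
  unfolding chain_length_def by (meson le_trans less_le_trans)

lemma chain_length_0: "ideal B R \<Longrightarrow> B \<subseteq> A \<Longrightarrow> chain_length R A B 0"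
  unfolding chain_length_def by auto

text \<open>Chains can be truncated, so the possible lengths form an initial segment and a finite
  supremum is attained.\<close>

lemma enat_le_colength_iff:
  assumes "ideal B R" "B \<subseteq> A"
  shows "enat n \<le> colength R A B \<longleftrightarrow> chain_length R A B n"
proof
  assume "chain_length R A B n"
  then show "enat n \<le> colength R A B" unfolding colength_def by (intro Sup_upper) auto
next
  assume *: "enat n \<le> colength R A B"
  show "chain_length R A B n"
  proof (rule ccontr)
    assume no: "\<not> chain_length R A B n"
    then have "n \<noteq> 0" using chain_length_0 assms by metis
    have "m \<le> n - 1" if "chain_length R A B m" for m
      using that no chain_lengthD[OF that, of n] \<open>n \<noteq> 0\<close> by linarith
    then have "colength R A B \<le> enat (n - 1)" unfolding colength_def by (intro Sup_least) auto
    then have "enat n \<le> enat (n - 1)" using * by (rule order_trans[rotated])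
    then show False using \<open>n \<noteq> 0\<close> by simp
  qed
qed

lemma enat_le_by_nat:
  fixes a b :: enat
  assumes "\<And>n. enat n \<le> a \<Longrightarrow> enat n \<le> b"
  shows "a \<le> b"
proof (cases a)
  case infinity
  then have "enat n \<le> b" for n using assms by simp
  then show ?thesis by (metis enat_ord_simps(1) infinity not_less_eq_eq order_refl enat.exhaust enat_ord_simps(3))
qed (use assms in auto)

lemma enat_add_le_by_nat:
  fixes a b c :: enat
  assumes "\<And>m n. enat m \<le> a \<Longrightarrow> enat n \<le> b \<Longrightarrow> enat (m + n) \<le> c"
  shows "a + b \<le> c"
proof (rule enat_le_by_nat)
  fix k assume k: "enat k \<le> a + b"
  have "\<exists>m n. k \<le> m + n \<and> enat m \<le> a \<and> enat n \<le> b"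
  proof (cases a)
    case (enat a')
    show ?thesis
    proof (cases b)
      case (enat b')
      then show ?thesis using k \<open>a = enat a'\<close> by (intro exI[of _ a'] exI[of _ b']) auto
    next
      case infinity
      then show ?thesis by (intro exI[of _ 0] exI[of _ k]) (auto simp flip: zero_enat_def)
    qed
  next
    case infinity
    then show ?thesis by (intro exI[of _ k] exI[of _ 0]) (auto simp flip: zero_enat_def)
  qed
  then obtain m n where "k \<le> m + n" "enat m \<le> a" "enat n \<le> b" by auto
  then show "enat k \<le> c" using assms[of m n] by (meson enat_ord_simps(1) order_trans)
qed

text \<open>The left inverse g is what keeps a strict chain strict under f.\<close>

lemma colength_le_by_map:
  assumes B: "ideal B R" "B \<subseteq> A" and B': "ideal B' R" "B' \<subseteq> A'"
    and f: "\<And>N. ideal N R \<Longrightarrow> B \<subseteq> N \<Longrightarrow> N \<subseteq> A \<Longrightarrow> ideal (f N) R \<and> B' \<subseteq> f N \<and> f N \<subseteq> A' \<and> g (f N) = N"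
    and mono: "\<And>N N'. N \<subseteq> N' \<Longrightarrow> f N \<subseteq> f N'"
  shows "colength R A B \<le> colength R A' B'"
proof (rule enat_le_by_nat)
  fix n assume "enat n \<le> colength R A B"
  then have "chain_length R A B n" using enat_le_colength_iff[OF B] by simp
  then obtain N where N: "\<And>i. i \<le> n \<Longrightarrow> ideal (N i) R \<and> B \<subseteq> N i \<and> N i \<subseteq> A"
    "\<And>i. i < n \<Longrightarrow> N i \<subset> N (Suc i)"
    unfolding chain_length_def by auto
  have "f (N i) \<subset> f (N (Suc i))" if "i < n" for i
    using mono[of "N i" "N (Suc i)"] N(2)[OF that] f[of "N i"] f[of "N (Suc i)"] N(1)[of i] N(1)[of "Suc i"] that
    by (metis Suc_leI less_imp_le psubset_eq)
  then have "chain_length R A' B' n"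
    unfolding chain_length_def using f N(1) by (intro exI[of _ "\<lambda>i. f (N i)"]) auto
  then show "enat n \<le> colength R A' B'" using enat_le_colength_iff[OF B'] by simp
qed

text \<open>Repetitions are deleted. The last conjunct, which fixes the end point, lets the
  induction append the next member.\<close>

lemma chain_of_weak_chain:
  assumes "\<forall>i\<le>k. ideal (N i) R \<and> B \<subseteq> N i \<and> N i \<subseteq> A" "\<forall>i<k. N i \<subseteq> N (Suc i)"
  shows "\<exists>P. (\<forall>i\<le>card {i. i < k \<and> N i \<noteq> N (Suc i)}. ideal (P i) R \<and> B \<subseteq> P i \<and> P i \<subseteq> A) \<and>
    (\<forall>i<card {i. i < k \<and> N i \<noteq> N (Suc i)}. P i \<subset> P (Suc i)) \<and> P (card {i. i < k \<and> N i \<noteq> N (Suc i)}) = N k"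
  using assms
proof (induction k)
  case 0
  then show ?case by (intro exI[of _ N]) auto
next
  case (Suc k)
  let ?c = "\<lambda>k. card {i. i < k \<and> N i \<noteq> N (Suc i)}"
  obtain P where P: "\<forall>i\<le>?c k. ideal (P i) R \<and> B \<subseteq> P i \<and> P i \<subseteq> A" "\<forall>i<?c k. P i \<subset> P (Suc i)" "P (?c k) = N k"
  proof -
    have "\<forall>i\<le>k. ideal (N i) R \<and> B \<subseteq> N i \<and> N i \<subseteq> A" "\<forall>i<k. N i \<subseteq> N (Suc i)"
      using Suc.prems by simp_all
    from Suc.IH[OF this] that show ?thesis by (elim exE conjE)
  qed
  show ?case
  proof (cases "N k = N (Suc k)")
    case True
    have "{i. i < Suc k \<and> N i \<noteq> N (Suc i)} = {i. i < k \<and> N i \<noteq> N (Suc i)}"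
      using True by (auto simp: less_Suc_eq)
    then show ?thesis using P True by (intro exI[of _ P]) simp
  next
    case False
    have "{i. i < Suc k \<and> N i \<noteq> N (Suc i)} = insert k {i. i < k \<and> N i \<noteq> N (Suc i)}"
      using False by (auto simp: less_Suc_eq)
    then have c: "?c (Suc k) = Suc (?c k)" by simp
    let ?P = "\<lambda>i. if i \<le> ?c k then P i else N (Suc k)"
    have "N k \<subset> N (Suc k)" using False Suc.prems(2) by auto
    moreover have "ideal (N (Suc k)) R \<and> B \<subseteq> N (Suc k) \<and> N (Suc k) \<subseteq> A" using Suc.prems(1) by simp
    ultimately show ?thesis unfolding c using P
      by (intro exI[of _ ?P]) (simp add: le_Suc_eq less_Suc_eq)
  qed
qed

lemma chain_length_of_weak_chain:
  assumes "\<forall>i\<le>k. ideal (N i) R \<and> B \<subseteq> N i \<and> N i \<subseteq> A" "\<forall>i<k. N i \<subseteq> N (Suc i)"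
  shows "chain_length R A B (card {i. i < k \<and> N i \<noteq> N (Suc i)})"
  using chain_of_weak_chain[OF assms] unfolding chain_length_def by (elim exE conjE) (rule exI, rule conjI)

context cring
begin

text \<open>Chains are concatenated for one inequality. For the other, a chain between C and A is
  sent to its sums with B and its intersections with B; if neither changes at a step, the modular
  law says that the step was not strict.\<close>

lemma colength_add:
  assumes "ideal A R" "ideal B R" "ideal C R" "C \<subseteq> B" "B \<subseteq> A"
  shows "colength R A C = colength R A B + colength R B C"
proof (rule antisym)
  have CA: "C \<subseteq> A" using assms by auto
  show "colength R A B + colength R B C \<le> colength R A C"
  proof (rule enat_add_le_by_nat)
    fix m n assume "enat m \<le> colength R A B" "enat n \<le> colength R B C"
    then have ch: "chain_length R A B m" "chain_length R B C n"
      using enat_le_colength_iff assms by blast+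
    from ch(1) obtain N where N: "\<And>i. i \<le> m \<Longrightarrow> ideal (N i) R \<and> B \<subseteq> N i \<and> N i \<subseteq> A"
      "\<And>i. i < m \<Longrightarrow> N i \<subset> N (Suc i)" unfolding chain_length_def by auto
    from ch(2) obtain P where P: "\<And>i. i \<le> n \<Longrightarrow> ideal (P i) R \<and> C \<subseteq> P i \<and> P i \<subseteq> B"
      "\<And>i. i < n \<Longrightarrow> P i \<subset> P (Suc i)" unfolding chain_length_def by auto
    let ?Q = "\<lambda>i. if i \<le> n then P i else N (i - n)"
    have "ideal (?Q i) R \<and> C \<subseteq> ?Q i \<and> ?Q i \<subseteq> A" if "i \<le> m + n" for i
    proof (cases "i \<le> n")
      case True
      then show ?thesis using P(1)[of i] assms(5) by auto
    next
      case False
      then have "i - n \<le> m" using that by auto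
      then show ?thesis using False N(1)[of "i - n"] assms(4) by auto
    qed
    moreover have "?Q i \<subset> ?Q (Suc i)" if "i < m + n" for i
    proof -
      have "i < n \<or> (i = n \<and> 0 < m) \<or> (i > n \<and> i - n < m)" using that by arith
      then consider "i < n" | "i = n" "0 < m" | "i > n" "i - n < m" by blast
      then show ?thesis
      proof cases
        case 1
        then show ?thesis using P(2)[of i] by simp
      next
        case 2
        then show ?thesis using P(1)[of n] N(1)[of 0] N(2)[of 0] by auto
      next
        case 3
        then show ?thesis using N(2)[of "i - n"] by (simp add: Suc_diff_le)
      qed
    qed
    ultimately have "chain_length R A C (m + n)"
      unfolding chain_length_def by (intro exI[of _ ?Q]) blast
    then show "enat (m + n) \<le> colength R A C" using enat_le_colength_iff[OF assms(3) CA] by simp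
  qed
  show "colength R A C \<le> colength R A B + colength R B C"
  proof (rule enat_le_by_nat)
    fix k assume "enat k \<le> colength R A C"
    then have "chain_length R A C k" using enat_le_colength_iff[OF assms(3) CA] by simp
    then obtain N where N: "\<And>i. i \<le> k \<Longrightarrow> ideal (N i) R \<and> C \<subseteq> N i \<and> N i \<subseteq> A"
      "\<And>i. i < k \<Longrightarrow> N i \<subset> N (Suc i)" unfolding chain_length_def by auto
    let ?U = "\<lambda>i. N i <+> B"
    let ?V = "\<lambda>i. N i \<inter> B"
    let ?c = "\<lambda>P. {i. i < k \<and> P i \<noteq> P (Suc i)}"
    have U: "\<forall>i\<le>k. ideal (?U i) R \<and> B \<subseteq> ?U i \<and> ?U i \<subseteq> A"
    proof (intro allI impI)
      fix i assume i: "i \<le> k"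
      show "ideal (?U i) R \<and> B \<subseteq> ?U i \<and> ?U i \<subseteq> A"
        using N(1)[OF i] assms add_ideals[of "N i" B] set_add_upper2[of "N i" B] set_add_least[of A "N i" B] by simp
    qed
    have V: "\<forall>i\<le>k. ideal (?V i) R \<and> C \<subseteq> ?V i \<and> ?V i \<subseteq> B"
      using N(1) assms i_intersect by auto
    have "\<forall>i<k. ?U i \<subseteq> ?U (Suc i)" using N(2) by (simp add: set_add_mono less_imp_le)
    then have cU: "enat (card (?c ?U)) \<le> colength R A B"
      using chain_length_of_weak_chain[OF U] enat_le_colength_iff[OF assms(2,5)] by simp
    have "\<forall>i<k. ?V i \<subseteq> ?V (Suc i)" using N(2) by auto
    then have cV: "enat (card (?c ?V)) \<le> colength R B C"
      using chain_length_of_weak_chain[OF V] enat_le_colength_iff[OF assms(3,4)] by simp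
    have "i \<in> ?c ?U \<union> ?c ?V" if "i < k" for i
    proof (rule ccontr)
      assume "i \<notin> ?c ?U \<union> ?c ?V"
      then have eq: "?U i = ?U (Suc i)" "?V i = ?V (Suc i)" using that by auto
      have idN: "ideal (N i) R" "ideal (N (Suc i)) R" using N(1)[of i] N(1)[of "Suc i"] that by auto
      have "N (Suc i) \<subseteq> N i"
      proof
        fix x assume x: "x \<in> N (Suc i)"
        then have "x \<in> ?U i" unfolding eq(1) by (rule set_add_left[OF idN(2) assms(2)])
        then obtain n b where nb: "n \<in> N i" "b \<in> B" "x = n \<oplus> b" by (auto simp: mem_set_add)
        have c: "n \<in> carrier R" "b \<in> carrier R"
          using nb ideal_mem_carrier[OF idN(1)] ideal_mem_carrier[OF assms(2)] by auto
        have "x \<ominus> n \<in> N (Suc i)" using x nb(1) N(2)[OF that] by (intro ideal_diff_mem[OF idN(2)]) auto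
        moreover have "x \<ominus> n = b" unfolding nb(3) using c by algebra
        ultimately have "b \<in> N i" using nb(2) eq(2) by auto
        then show "x \<in> N i" unfolding nb(3) using nb(1) by (intro ideal_add_mem[OF idN(1)])
      qed
      then show False using N(2)[OF that] by auto
    qed
    then have "{..<k} \<subseteq> ?c ?U \<union> ?c ?V" by auto
    then have "k \<le> card (?c ?U \<union> ?c ?V)" using card_mono[of "?c ?U \<union> ?c ?V" "{..<k}"] by simp
    also have "\<dots> \<le> card (?c ?U) + card (?c ?V)" by (rule card_Un_le)
    finally have "enat k \<le> enat (card (?c ?U)) + enat (card (?c ?V))" by simp
    also have "\<dots> \<le> colength R A B + colength R B C" using cU cV by (rule add_mono)
    finally show "enat k \<le> colength R A B + colength R B C" .
  qed
qed

lemma colength_self: "ideal A R \<Longrightarrow> colength R A A = 0"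
proof -
  assume A: "ideal A R"
  have "\<not> enat (Suc 0) \<le> colength R A A"
    unfolding enat_le_colength_iff[OF A subset_refl] chain_length_def by auto
  then show ?thesis by (metis enat_0_iff(1) enat_iless enat_ord_simps(2) less_Suc0 not_le)
qed

lemma colength_eq_0:
  assumes "ideal A R" "ideal B R" "B \<subseteq> A" "colength R A B = 0"
  shows "A = B"
proof (rule ccontr)
  assume "A \<noteq> B"
  then have "chain_length R A B (Suc 0)"
    unfolding chain_length_def using assms by (intro exI[of _ "\<lambda>i. if i = 0 then B else A"]) auto
  then have "enat (Suc 0) \<le> colength R A B" using enat_le_colength_iff assms by blast
  then show False using assms(4) by (simp add: enat_0_iff)
qed

text \<open>Multiplication by a induces an isomorphism from A modulo A \<inter> (B : a) onto (aA +
  B)/B. On intermediate ideals it is N to aN + B, with inverse given by preimages in A.\<close>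

lemma colength_smult:
  assumes A: "ideal A R" and B: "ideal B R" and a: "a \<in> carrier R"
  shows "colength R ((PIdl a) \<cdot> A <+> B) B = colength R A (A \<inter> {z \<in> carrier R. a \<otimes> z \<in> B})"
proof -
  let ?C = "A \<inter> {z \<in> carrier R. a \<otimes> z \<in> B}"
  let ?S = "(PIdl a) \<cdot> A <+> B"
  let ?f = "\<lambda>N. (PIdl a) \<cdot> N <+> B"
  let ?g = "\<lambda>N. A \<inter> {z \<in> carrier R. a \<otimes> z \<in> N}"
  have idC: "ideal ?C R" using A B a by (intro i_intersect ideal_colon)
  have idP: "ideal ((PIdl a) \<cdot> N) R" if "ideal N R" for N using that a by (intro ideal_ops)
  have BS: "B \<subseteq> ?S" using set_add_upper2[OF idP[OF A] B] .
  have memf: "x \<in> ?f N \<longleftrightarrow> (\<exists>n\<in>N. \<exists>b\<in>B. x = a \<otimes> n \<oplus> b)" if N: "ideal N R" for N x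
  proof
    assume "x \<in> ?f N"
    then obtain u b where "u \<in> (PIdl a) \<cdot> N" "b \<in> B" "x = u \<oplus> b" by (auto simp: mem_set_add)
    then show "\<exists>n\<in>N. \<exists>b\<in>B. x = a \<otimes> n \<oplus> b" using mem_cgenideal_prod[OF N a] by metis
  next
    assume "\<exists>n\<in>N. \<exists>b\<in>B. x = a \<otimes> n \<oplus> b"
    then show "x \<in> ?f N" using cgenideal_prodI[OF N a] by (auto intro: set_addI)
  qed
  have gf: "?g (?f N) = N" if N: "ideal N R" "?C \<subseteq> N" "N \<subseteq> A" for N
  proof
    show "?g (?f N) \<subseteq> N"
    proof
      fix z assume "z \<in> ?g (?f N)"
      then have z: "z \<in> A" "z \<in> carrier R" and "a \<otimes> z \<in> ?f N" by auto
      then obtain n b where nb: "n \<in> N" "b \<in> B" "a \<otimes> z = a \<otimes> n \<oplus> b" using memf[OF N(1)] by auto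
      have c: "n \<in> carrier R" "b \<in> carrier R"
        using nb ideal_mem_carrier[OF N(1)] ideal_mem_carrier[OF B] by auto
      have "a \<otimes> (z \<ominus> n) = (a \<otimes> z) \<ominus> a \<otimes> n" using z(2) c a by algebra
      also have "\<dots> = b" unfolding nb(3) using c a by algebra
      finally have "a \<otimes> (z \<ominus> n) \<in> B" using nb(2) by simp
      moreover have "z \<ominus> n \<in> A" using z(1) nb(1) N(3) by (intro ideal_diff_mem[OF A]) auto
      ultimately have "z \<ominus> n \<in> N" using N(2) z(2) c by auto
      then have "(z \<ominus> n) \<oplus> n \<in> N" using nb(1) by (intro ideal_add_mem[OF N(1)])
      moreover have "(z \<ominus> n) \<oplus> n = z" using z(2) c by algebra
      ultimately show "z \<in> N" by simp
    qed
    show "N \<subseteq> ?g (?f N)"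
    proof
      fix z assume z: "z \<in> N"
      have zc: "z \<in> carrier R" using z ideal_mem_carrier[OF N(1)] by simp
      have "a \<otimes> z = a \<otimes> z \<oplus> \<zero>" using zc a by simp
      then have "a \<otimes> z \<in> ?f N" unfolding memf[OF N(1)] using z ideal_zero_mem[OF B] by (intro bexI[of _ z] bexI[of _ \<zero>])
      then show "z \<in> ?g (?f N)" using z zc N(3) by auto
    qed
  qed
  have fg: "?f (?g N) = N" if N: "ideal N R" "B \<subseteq> N" "N \<subseteq> ?S" for N
  proof
    have idg: "ideal (?g N) R" using N(1) A a by (intro i_intersect ideal_colon)
    show "?f (?g N) \<subseteq> N"
    proof
      fix x assume "x \<in> ?f (?g N)"
      then obtain n b where "n \<in> ?g N" "b \<in> B" "x = a \<otimes> n \<oplus> b" using memf[OF idg] by auto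
      then show "x \<in> N" using N(2) by (auto intro: ideal_add_mem[OF N(1)])
    qed
    show "N \<subseteq> ?f (?g N)"
    proof
      fix x assume x: "x \<in> N"
      then obtain n b where nb: "n \<in> A" "b \<in> B" "x = a \<otimes> n \<oplus> b" using memf[OF A, of x] N(3) by auto
      have c: "n \<in> carrier R" "b \<in> carrier R"
        using nb ideal_mem_carrier[OF A] ideal_mem_carrier[OF B] by auto
      have "x \<ominus> b \<in> N" using x nb(2) N(2) by (intro ideal_diff_mem[OF N(1)]) auto
      moreover have "x \<ominus> b = a \<otimes> n" unfolding nb(3) using c a by algebra
      ultimately have "n \<in> ?g N" using nb(1) c by simp
      then show "x \<in> ?f (?g N)" unfolding memf[OF idg] using nb(2,3) by auto
    qed
  qed
  show ?thesis
  proof (rule antisym)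
    show "colength R ?S B \<le> colength R A ?C"
    proof (rule colength_le_by_map[where f = ?g and g = ?f])
      show "ideal B R" "B \<subseteq> ?S" "ideal ?C R" "?C \<subseteq> A" using B BS idC by auto
      fix N assume N: "ideal N R" "B \<subseteq> N" "N \<subseteq> ?S"
      have "ideal (?g N) R" using N(1) A a by (intro i_intersect ideal_colon)
      then show "ideal (?g N) R \<and> ?C \<subseteq> ?g N \<and> ?g N \<subseteq> A \<and> ?f (?g N) = N" using fg[OF N] N(2) by auto
    next
      fix N N' :: "'a set" assume "N \<subseteq> N'" then show "?g N \<subseteq> ?g N'" by auto
    qed
    show "colength R A ?C \<le> colength R ?S B"
    proof (rule colength_le_by_map[where f = ?f and g = ?g])
      show "ideal B R" "B \<subseteq> ?S" "ideal ?C R" "?C \<subseteq> A" using B BS idC by auto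
      fix N assume N: "ideal N R" "?C \<subseteq> N" "N \<subseteq> A"
      have "ideal (?f N) R" using idP[OF N(1)] B by (rule add_ideals)
      moreover have "B \<subseteq> ?f N" using set_add_upper2[OF idP[OF N(1)] B] .
      moreover have "?f N \<subseteq> ?S" using N(3) by (intro set_add_mono ideal_prod_mono subset_refl)
      ultimately show "ideal (?f N) R \<and> B \<subseteq> ?f N \<and> ?f N \<subseteq> ?S \<and> ?g (?f N) = N" using gf[OF N] by simp
    next
      fix N N' :: "'a set" assume "N \<subseteq> N'" then show "?f N \<subseteq> ?f N'"
        by (intro set_add_mono ideal_prod_mono subset_refl)
    qed
  qed
qed

lemma colength_add_cgenideal:
  assumes "ideal B R" "a \<in> carrier R"
  shows "colength R (B <+> PIdl a) B = colength R (carrier R) {z \<in> carrier R. a \<otimes> z \<in> B}"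
proof -
  have "(PIdl a) \<cdot> carrier R <+> B = B <+> PIdl a"
    using assms ideal_prod_one[of "PIdl a"] ideal_set_add_comm[of "PIdl a" B] by (simp add: cgenideal_ideal)
  moreover have "carrier R \<inter> {z \<in> carrier R. a \<otimes> z \<in> B} = {z \<in> carrier R. a \<otimes> z \<in> B}" by auto
  ultimately show ?thesis using colength_smult[OF oneideal assms] by simp
qed

lemma colength_second_iso:
  assumes "ideal A R" "ideal B R"
  shows "colength R (A <+> B) B = colength R A (A \<inter> B)"
proof -
  have "(PIdl \<one>) \<cdot> A = A"
    using assms(1) cgenideal_eq_genideal[of \<one>] by (simp add: genideal_one ideal_prod_one')
  moreover have "A \<inter> {z \<in> carrier R. \<one> \<otimes> z \<in> B} = A \<inter> B" using ideal_subset_carrier[OF assms(1)] by auto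
  ultimately show ?thesis using colength_smult[OF assms, of \<one>] by simp
qed

lemma colength_mono:
  assumes "ideal A R" "ideal B R" "ideal C R" "C \<subseteq> B" "B \<subseteq> A"
  shows "colength R A B \<le> colength R A C" "colength R B C \<le> colength R A C"
  using colength_add[OF assms] by (simp_all add: le_iff_add add.commute)

text \<open>Multiplication by b embeds R/(K + B^(s+1)) into R/(K + B^(s+2)) with cokernel R/(K + (b)
  + B'^(s+2)), where B' omits b. The two inductions, on s and on the list, then meet in Pascal's
  rule.\<close>

lemma colength_ipow:
  assumes "ideal K R" "set bs \<subseteq> carrier R" "permutable_mod R K bs"
  shows "colength R (carrier R) (K <+> ipow R (ideal_of R bs) (Suc s)) =
    of_nat ((length bs + s) choose length bs) * colength R (carrier R) (adjoin R K bs)"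
  using assms
proof (induction bs arbitrary: K s)
  case Nil
  then show ?case by (simp add: ipow_zero_Suc ideal_add_zero)
next
  case (Cons b bs)
  note K = Cons.prems(1)
  have c: "b \<in> carrier R" "set bs \<subseteq> carrier R" using Cons.prems(2) by auto
  define B where "B = ideal_of R (b # bs)"
  define B' where "B' = ideal_of R bs"
  define l where "l = colength R (carrier R) (adjoin R K (b # bs))"
  have idB: "ideal B R" "ideal B' R" unfolding B_def B'_def using c by (auto intro!: ideal_of_ideal simp del: adjoin.simps)
  have B: "B = PIdl b <+> B'" unfolding B_def B'_def using c by (intro ideal_of_Cons)
  have idb: "ideal (PIdl b) R" using c by (intro cgenideal_ideal)
  have perm: "permutable_mod R (K <+> PIdl b) bs"
    using permutable_mod_right[OF Cons.prems(3), of "[b]" bs] by simp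
  have "colength R (carrier R) (K <+> ipow R B (Suc s)) =
      of_nat ((Suc (length bs) + s) choose Suc (length bs)) * l"
  proof (induction s)
    case 0
    have "adjoin R K (b # bs) = K <+> B"
      unfolding B_def using K Cons.prems(2) by (intro adjoin_eq_add_ideal_of)
    then show ?case using idB by (simp add: l_def)
  next
    case (Suc s)
    let ?D = "K <+> ipow R B (Suc (Suc s))"
    let ?E = "(K <+> PIdl b) <+> ipow R B' (Suc (Suc s))"
    have ids: "ideal ?D R" "ideal ?E R" "ideal (K <+> ipow R B (Suc s)) R" "ideal (ipow R B' (Suc (Suc s))) R"
      by (intro ideal_ops K idB c)+
    have Bn: "ipow R B (Suc (Suc s)) = (PIdl b) \<cdot> ipow R B (Suc s) <+> ipow R B' (Suc (Suc s))"
      unfolding B using idB(2) idb by (intro ipow_add_Suc)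
    note mem = mem_add_prod_add[OF K ipow_ideal[OF idB(1), of "Suc s"] ids(4) c(1), folded Bn]
    have BB': "B' \<subseteq> B" unfolding B using idb idB(2) by (rule set_add_upper2)
    have "?E = (K <+> ipow R B' (Suc (Suc s))) <+> PIdl b"
      using K ids(4) idb by (simp add: ideal_add_ac)
    also have "\<dots> = ?D <+> PIdl b"
    proof
      show "(K <+> ipow R B' (Suc (Suc s))) <+> PIdl b \<subseteq> ?D <+> PIdl b"
        using BB' by (intro set_add_mono ipow_mono subset_refl)
      show "?D <+> PIdl b \<subseteq> (K <+> ipow R B' (Suc (Suc s))) <+> PIdl b"
      proof -
        let ?T = "(K <+> ipow R B' (Suc (Suc s))) <+> PIdl b"
        have idT: "ideal ?T R" by (intro ideal_ops K idB c)
        have i1: "ideal (K <+> ipow R B' (Suc (Suc s))) R" by (intro ideal_ops K idB)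
        have "PIdl b \<subseteq> ?T" "K <+> ipow R B' (Suc (Suc s)) \<subseteq> ?T"
          using set_add_upper1[OF i1 idb] set_add_upper2[OF i1 idb] by simp_all
        moreover have "K \<subseteq> K <+> ipow R B' (Suc (Suc s))" "ipow R B' (Suc (Suc s)) \<subseteq> K <+> ipow R B' (Suc (Suc s))"
          using set_add_upper1[OF K ids(4)] set_add_upper2[OF K ids(4)] by simp_all
        moreover have "(PIdl b) \<cdot> ipow R B (Suc s) \<subseteq> PIdl b"
          using idb idB by (intro ideal_prod_subset_left ipow_ideal)
        ultimately show ?thesis unfolding Bn
          using idT by (intro set_add_least) auto
      qed
    qed
    finally have E: "?E = ?D <+> PIdl b" .
    \<comment> \<open>This is the injectivity of multiplication by b; \<open>nzd_mod_ipow\<close>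
      cancels b modulo K + B'^(s+2).\<close>
    have "{z \<in> carrier R. b \<otimes> z \<in> ?D} = K <+> ipow R B (Suc s)"
    proof
      show "K <+> ipow R B (Suc s) \<subseteq> {z \<in> carrier R. b \<otimes> z \<in> ?D}"
      proof
        fix z assume "z \<in> K <+> ipow R B (Suc s)"
        then obtain k t where kt: "k \<in> K" "t \<in> ipow R B (Suc s)" "z = k \<oplus> t" by (auto simp: mem_set_add)
        have cc: "k \<in> carrier R" "t \<in> carrier R"
          using kt ideal_mem_carrier[OF K] ideal_mem_carrier[OF ipow_ideal[OF idB(1)]] by auto
        have "b \<otimes> z \<ominus> b \<otimes> t = b \<otimes> k" unfolding kt(3) using cc c by algebra
        moreover have "b \<otimes> k \<in> K <+> ipow R B' (Suc (Suc s))"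
          using set_add_left[OF K ids(4) ideal_mult_mem[OF K kt(1) c(1)]] .
        ultimately have "\<exists>r\<in>ipow R B (Suc s). b \<otimes> z \<ominus> b \<otimes> r \<in> K <+> ipow R B' (Suc (Suc s))"
          using kt(2) by (intro bexI[of _ t]) simp_all
        moreover have "z \<in> carrier R" using kt(3) cc by simp
        ultimately show "z \<in> {z \<in> carrier R. b \<otimes> z \<in> ?D}"
          using mem[of "b \<otimes> z"] c by simp
      qed
      show "{z \<in> carrier R. b \<otimes> z \<in> ?D} \<subseteq> K <+> ipow R B (Suc s)"
      proof
        fix z assume "z \<in> {z \<in> carrier R. b \<otimes> z \<in> ?D}"
        then have z: "z \<in> carrier R" "b \<otimes> z \<in> ?D" by auto
        then obtain t where t: "t \<in> ipow R B (Suc s)" "b \<otimes> z \<ominus> b \<otimes> t \<in> K <+> ipow R B' (Suc (Suc s))"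
          using mem by auto
        have tc: "t \<in> carrier R" using t(1) ideal_mem_carrier[OF ipow_ideal[OF idB(1)]] by simp
        have "b \<otimes> (z \<ominus> t) = b \<otimes> z \<ominus> b \<otimes> t" using z(1) tc c by algebra
        then have "b \<otimes> (z \<ominus> t) \<in> K <+> ipow R B' (Suc (Suc s))" using t(2) by simp
        moreover have nzd: "nzd_mod R (K <+> ipow R B' (Suc (Suc s))) b"
          unfolding B'_def by (rule nzd_mod_ipow[OF K Cons.prems(2,3)])
        ultimately have "z \<ominus> t \<in> K <+> ipow R B' (Suc (Suc s))"
          using nzd_modD[OF nzd, of "z \<ominus> t"] z(1) tc by simp
        moreover have "ipow R B' (Suc (Suc s)) \<subseteq> ipow R B (Suc s)"
          using ipow_antimono[OF idB(2), of "Suc s" "Suc (Suc s)"] ipow_mono[OF BB', of "Suc s"] by auto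
        ultimately have "z \<ominus> t \<in> K <+> ipow R B (Suc s)"
          using set_add_mono[OF subset_refl[of K]] by auto
        moreover have "t \<in> K <+> ipow R B (Suc s)"
          using set_add_right[OF K ipow_ideal[OF idB(1)] t(1)] .
        ultimately have "(z \<ominus> t) \<oplus> t \<in> K <+> ipow R B (Suc s)" by (rule ideal_add_mem[OF ids(3)])
        moreover have "(z \<ominus> t) \<oplus> t = z" using z(1) tc by algebra
        ultimately show "z \<in> K <+> ipow R B (Suc s)" by simp
      qed
    qed
    then have 1: "colength R ?E ?D = of_nat ((Suc (length bs) + s) choose Suc (length bs)) * l"
      using colength_add_cgenideal[OF ids(1) c(1)] Suc E by simp
    have 2: "colength R (carrier R) ?E = of_nat ((length bs + Suc s) choose length bs) * l"
      using Cons.IH[OF add_ideals[OF K idb] c(2) perm, of "Suc s"] by (simp add: l_def B'_def)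
    have "colength R (carrier R) ?D = colength R (carrier R) ?E + colength R ?E ?D"
      using ids(1,2) set_add_upper1[OF ids(1) idb] E ideal_subset_carrier[OF ids(2)]
      by (intro colength_add oneideal) simp_all
    then show ?case unfolding 1 2 by (simp add: distrib_right add_ac)
  qed
  then show ?case by (simp add: B_def l_def)
qed

text \<open>Multiplication by \<open>x\<close> is injective on \<open>R/D\<close>, so every submodule of finite colength has
  the same colength modulo \<open>x\<close> as \<open>R/D\<close> itself.\<close>

lemma colength_mod_nzd:
  assumes A: "ideal A R" and D: "ideal D R" and x: "x \<in> carrier R" and nzd: "nzd_mod R D x"
    and fin: "colength R (carrier R) (A <+> D) \<noteq> \<infinity>"
  shows "colength R (A <+> D) ((PIdl x) \<cdot> A <+> D) = colength R (carrier R) (D <+> PIdl x)"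
proof -
  let ?C = "(PIdl x) \<cdot> A <+> D"
  have idx: "ideal (PIdl x) R" using x by (rule cgenideal_ideal)
  have ids: "ideal (A <+> D) R" "ideal ?C R" "ideal (D <+> PIdl x) R" by (intro ideal_ops A D x)+
  have xA: "(PIdl x) \<cdot> A \<subseteq> A" "(PIdl x) \<cdot> A \<subseteq> PIdl x"
    using ideal_prod_subset_right[OF idx A] ideal_prod_subset_left[OF idx A] by simp_all
  have CA: "?C \<subseteq> A <+> D" using xA by (intro set_add_mono subset_refl)
  have Cx: "?C \<subseteq> D <+> PIdl x"
    using set_add_mono[OF xA(2) subset_refl[of D]] ideal_set_add_comm[OF idx D] by simp
  have "?C <+> PIdl x = D <+> PIdl x"
  proof
    show "?C <+> PIdl x \<subseteq> D <+> PIdl x"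
      by (rule set_add_least[OF ids(3) Cx set_add_upper2[OF D idx]])
    show "D <+> PIdl x \<subseteq> ?C <+> PIdl x"
      using set_add_upper2[OF ideal_prod_is_ideal[OF idx A] D] by (intro set_add_mono subset_refl)
  qed
  moreover have "{z \<in> carrier R. x \<otimes> z \<in> ?C} = A <+> D"
  proof
    show "{z \<in> carrier R. x \<otimes> z \<in> ?C} \<subseteq> A <+> D"
    proof
      fix z assume "z \<in> {z \<in> carrier R. x \<otimes> z \<in> ?C}"
      then obtain a e where *: "z \<in> carrier R" "a \<in> A" "e \<in> D" "x \<otimes> z = x \<otimes> a \<oplus> e"
        using A x by (auto simp: mem_set_add mem_cgenideal_prod)
      have c: "a \<in> carrier R" "e \<in> carrier R"
        using * ideal_mem_carrier[OF A] ideal_mem_carrier[OF D] by auto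
      have "x \<otimes> (z \<ominus> a) = (x \<otimes> z) \<ominus> x \<otimes> a" using *(1) c x by algebra
      also have "\<dots> = e" unfolding *(4) using c x by algebra
      finally have "z \<ominus> a \<in> D" using nzd_modD[OF nzd] *(1,3) c by simp
      moreover have "z = a \<oplus> (z \<ominus> a)" using *(1) c by algebra
      ultimately show "z \<in> A <+> D" using set_addI[OF *(2)] by metis
    qed
    show "A <+> D \<subseteq> {z \<in> carrier R. x \<otimes> z \<in> ?C}"
    proof
      fix z assume "z \<in> A <+> D"
      then obtain a e where *: "a \<in> A" "e \<in> D" "z = a \<oplus> e" by (auto simp: mem_set_add)
      have c: "a \<in> carrier R" "e \<in> carrier R"
        using * ideal_mem_carrier[OF A] ideal_mem_carrier[OF D] by auto
      have "x \<otimes> z = x \<otimes> a \<oplus> x \<otimes> e" unfolding *(3) using c x by algebra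
      then have "x \<otimes> z \<in> ?C"
        using set_addI[OF cgenideal_prodI[OF A x *(1)] ideal_mult_mem[OF D *(2) x]] by simp
      then show "z \<in> {z \<in> carrier R. x \<otimes> z \<in> ?C}"
        using * c by simp
    qed
  qed
  ultimately have 1: "colength R (D <+> PIdl x) ?C = colength R (carrier R) (A <+> D)"
    using colength_add_cgenideal[OF ids(2) x] by simp
  \<comment> \<open>The length of R/C is computed through A + D and through D + (x); the common
    summand is finite and cancels.\<close>
  have "colength R (carrier R) ?C = colength R (carrier R) (A <+> D) + colength R (A <+> D) ?C"
    using ids CA ideal_subset_carrier[OF ids(1)] by (intro colength_add oneideal)
  moreover have "colength R (carrier R) ?C =
      colength R (carrier R) (D <+> PIdl x) + colength R (D <+> PIdl x) ?C"
    using ids Cx ideal_subset_carrier[OF ids(3)] by (intro colength_add oneideal)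
  ultimately have "colength R (carrier R) (A <+> D) + colength R (A <+> D) ?C =
      colength R (carrier R) (A <+> D) + colength R (carrier R) (D <+> PIdl x)"
    using 1 by (metis add.commute)
  with fin show ?thesis by (metis enat_add_left_cancel)
qed

end

section \<open>Submodules of quotient modules as ideals\<close>

context cring
begin

lemma mem_coset_iff:
  assumes "ideal B R" "u \<in> carrier R" "x \<in> carrier R"
  shows "x \<in> B +> u \<longleftrightarrow> B +> x = B +> u"
proof -
  interpret ideal B R by (rule assms(1))
  show ?thesis using a_rcos_self[OF assms(3)] a_repr_independence'[of x u] assms by auto
qed

lemma coset_subset_carrier: "ideal B R \<Longrightarrow> u \<in> carrier R \<Longrightarrow> B +> u \<subseteq> carrier R"
  by (simp add: a_r_coset_subset_G ideal_subset_carrier)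

lemma coset_eq_iff:
  assumes "ideal B R" "u \<in> carrier R" "v \<in> carrier R"
  shows "B +> u = B +> v \<longleftrightarrow> u \<ominus> v \<in> B"
  using quotient_eq_iff_same_a_r_cos[OF assms] by simp

lemma coset_eq_self_iff: "ideal B R \<Longrightarrow> u \<in> carrier R \<Longrightarrow> B +> u = B \<longleftrightarrow> u \<in> B"
  using coset_eq_iff[of B u \<zero>] ideal_subset_carrier[of B] by (simp add: a_minus_def)

lemma coset_add: "ideal B R \<Longrightarrow> u \<in> carrier R \<Longrightarrow> v \<in> carrier R \<Longrightarrow> (B +> u) <+> (B +> v) = B +> (u \<oplus> v)"
  by (rule ideal.a_rcos_sum)

lemma coset_mult: "ideal B R \<Longrightarrow> u \<in> carrier R \<Longrightarrow> v \<in> carrier R \<Longrightarrow>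
    rcoset_mult R B (B +> u) (B +> v) = B +> (u \<otimes> v)"
  by (rule ideal.rcoset_mult_add)

text \<open>A submodule of A/B is a set of cosets, so its union is its full preimage in A; this is
  one half of the correspondence theorem.\<close>

lemma submodule_quot_module_Union:
  assumes A: "ideal A R" and B: "ideal B R" "B \<subseteq> A" and H: "submodule H R (quot_module R A B)"
  shows "ideal (\<Union>H) R" "B \<subseteq> \<Union>H" "\<Union>H \<subseteq> A" "(\<lambda>a. B +> a) ` (\<Union>H) = H"
proof -
  let ?Q = "quot_module R A B"
  have sub: "subgroup H (add_monoid ?Q)" using H by (rule submodule.axioms(1))
  have HA: "H \<subseteq> (\<lambda>a. B +> a) ` A"
    using subgroup.subset[OF sub] by (simp add: quot_module_def)
  have Ac: "A \<subseteq> carrier R" using A by (rule ideal_subset_carrier)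
  have U: "\<Union>H = {x \<in> A. B +> x \<in> H}"
  proof
    show "\<Union>H \<subseteq> {x \<in> A. B +> x \<in> H}"
    proof
      fix x assume "x \<in> \<Union>H"
      then obtain h where h: "h \<in> H" "x \<in> h" by auto
      then obtain a where a: "a \<in> A" "h = B +> a" using HA by auto
      have ac: "a \<in> carrier R" using a Ac by auto
      have xc: "x \<in> carrier R" using h a coset_subset_carrier[OF B(1) ac] by auto
      have eq: "B +> x = B +> a" using mem_coset_iff[OF B(1) ac xc] h a by simp
      then have "x \<ominus> a \<in> A" using coset_eq_iff[OF B(1) xc ac] B(2) by auto
      then have "(x \<ominus> a) \<oplus> a \<in> A" using a(1) by (rule ideal_add_mem[OF A])
      moreover have "(x \<ominus> a) \<oplus> a = x" using xc ac by algebra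
      ultimately show "x \<in> {x \<in> A. B +> x \<in> H}" using eq h a by simp
    qed
    show "{x \<in> A. B +> x \<in> H} \<subseteq> \<Union>H"
      using mem_coset_iff[OF B(1)] Ac by blast
  qed
  have B0: "B +> u \<in> H" if "u \<in> B" for u
  proof -
    have "B \<in> H" using subgroup.one_closed[OF sub] by (simp add: quot_module_def)
    moreover have "B +> u = B" using coset_eq_self_iff[OF B(1)] that ideal_mem_carrier[OF B(1)] by simp
    ultimately show ?thesis by simp
  qed
  show "\<Union>H \<subseteq> A" "B \<subseteq> \<Union>H" using U B0 B(2) by auto
  show "(\<lambda>a. B +> a) ` (\<Union>H) = H"
    unfolding U using HA by auto
  show "ideal (\<Union>H) R"
    unfolding U
  proof (rule ideal_ofI)
    show "{x \<in> A. B +> x \<in> H} \<subseteq> carrier R" using Ac by auto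
    show "\<zero> \<in> {x \<in> A. B +> x \<in> H}" using ideal_zero_mem[OF A] ideal_zero_mem[OF B(1)] B0 by simp
    fix x assume x: "x \<in> {x \<in> A. B +> x \<in> H}"
    then have xc: "x \<in> carrier R" using Ac by auto
    show "x \<oplus> y \<in> {x \<in> A. B +> x \<in> H}" if y: "y \<in> {x \<in> A. B +> x \<in> H}" for y
    proof -
      have yc: "y \<in> carrier R" using y Ac by auto
      have "(B +> x) <+> (B +> y) \<in> H"
        using subgroup.m_closed[OF sub, of "B +> x" "B +> y"] x y by (simp add: quot_module_def)
      then show ?thesis using x y coset_add[OF B(1) xc yc] ideal_add_mem[OF A] by simp
    qed
    show "r \<otimes> x \<in> {x \<in> A. B +> x \<in> H}" if r: "r \<in> carrier R" for r
    proof -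
      have "rcoset_mult R B (B +> r) (B +> x) \<in> H"
        using submodule.smult_closed[OF H r, of "B +> x"] x by (simp add: quot_module_def)
      then show ?thesis using x coset_mult[OF B(1) r xc] ideal_mult_mem[OF A _ r] by simp
    qed
  qed
qed

lemma submodule_quot_module_image:
  assumes A: "ideal A R" and B: "ideal B R" and N: "ideal N R" "B \<subseteq> N" "N \<subseteq> A"
  shows "submodule ((\<lambda>a. B +> a) ` N) R (quot_module R A B)" "\<Union>((\<lambda>a. B +> a) ` N) = N"
proof -
  let ?Q = "quot_module R A B" and ?H = "(\<lambda>a. B +> a) ` N"
  have Ac: "A \<subseteq> carrier R" using A by (rule ideal_subset_carrier)
  have Nc: "u \<in> carrier R" if "u \<in> N" for u using that N Ac by auto
  show "submodule ?H R ?Q"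
  proof (intro submodule.intro submodule_axioms.intro subgroup.intro)
    show "?H \<subseteq> carrier (add_monoid ?Q)" using N(3) by (auto simp: quot_module_def)
    show "\<one>\<^bsub>add_monoid ?Q\<^esub> \<in> ?H"
    proof -
      have "B +> \<zero> = B" using B by (simp add: ideal_subset_carrier)
      then show ?thesis using ideal_zero_mem[OF N(1)] by (auto simp: quot_module_def image_iff intro!: bexI[of _ \<zero>])
    qed
    fix h assume "h \<in> ?H"
    then obtain a where a: "a \<in> N" "h = B +> a" by auto
    have ac: "a \<in> carrier R" using Nc a by simp
    show "h \<otimes>\<^bsub>add_monoid ?Q\<^esub> k \<in> ?H" if "k \<in> ?H" for k
    proof -
      obtain b where b: "b \<in> N" "k = B +> b" using \<open>k \<in> ?H\<close> by auto
      then show ?thesis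
        using a coset_add[OF B ac, of b] Nc[of b] ideal_add_mem[OF N(1) a(1) b(1)] by (simp add: quot_module_def)
    qed
    \<comment> \<open>The inverse in the record is a definite description, so existence and
      uniqueness are checked directly among the cosets of elements of A.\<close>
    have inv: "inv\<^bsub>add_monoid ?Q\<^esub> h = B +> (\<ominus> a)"
      unfolding m_inv_def
    proof (rule the_equality)
      have e: "(B +> a) <+> (B +> \<ominus> a) = B" "(B +> \<ominus> a) <+> (B +> a) = B"
        using coset_add[OF B] ac by (simp_all add: r_neg l_neg ideal_subset_carrier B)
      have "\<ominus> a \<in> A" using ideal_inv_mem[OF N(1) a(1)] N(3) by auto
      then show "B +> \<ominus> a \<in> carrier (add_monoid ?Q) \<and> h \<otimes>\<^bsub>add_monoid ?Q\<^esub> (B +> \<ominus> a) = \<one>\<^bsub>add_monoid ?Q\<^esub> \<and>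
          (B +> \<ominus> a) \<otimes>\<^bsub>add_monoid ?Q\<^esub> h = \<one>\<^bsub>add_monoid ?Q\<^esub>"
        using e a by (simp add: quot_module_def)
      fix y assume y: "y \<in> carrier (add_monoid ?Q) \<and> h \<otimes>\<^bsub>add_monoid ?Q\<^esub> y = \<one>\<^bsub>add_monoid ?Q\<^esub> \<and>
          y \<otimes>\<^bsub>add_monoid ?Q\<^esub> h = \<one>\<^bsub>add_monoid ?Q\<^esub>"
      then obtain b where b: "b \<in> A" "y = B +> b" by (auto simp: quot_module_def)
      have bc: "b \<in> carrier R" using b Ac by auto
      have "(B +> b) <+> (B +> a) = B" using y a b by (simp add: quot_module_def)
      then have "b \<oplus> a \<in> B" using coset_add[OF B bc ac] coset_eq_self_iff[OF B, of "b \<oplus> a"] bc ac by simp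
      moreover have "b \<ominus> (\<ominus> a) = b \<oplus> a" using bc ac by algebra
      ultimately show "y = B +> \<ominus> a" using coset_eq_iff[OF B bc, of "\<ominus> a"] ac b by simp
    qed
    show "inv\<^bsub>add_monoid ?Q\<^esub> h \<in> ?H"
      unfolding inv using ideal_inv_mem[OF N(1) a(1)] by simp
  next
    fix r h assume r: "r \<in> carrier R" and "h \<in> ?H"
    then obtain a where a: "a \<in> N" "h = B +> a" by auto
    then show "r \<odot>\<^bsub>?Q\<^esub> h \<in> ?H"
      using coset_mult[OF B r Nc[OF a(1)]] ideal_mult_mem[OF N(1) a(1) r] by (simp add: quot_module_def)
  qed
  show "\<Union>?H = N"
  proof
    show "\<Union>?H \<subseteq> N"
    proof
      fix x assume "x \<in> \<Union>?H"
      then obtain a where a: "a \<in> N" "x \<in> B +> a" by auto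
      have xc: "x \<in> carrier R" using a coset_subset_carrier[OF B Nc[OF a(1)]] by auto
      have "x \<ominus> a \<in> N"
        using mem_coset_iff[OF B Nc[OF a(1)] xc] coset_eq_iff[OF B xc Nc[OF a(1)]] a N(2) by auto
      then have "(x \<ominus> a) \<oplus> a \<in> N" using a(1) by (rule ideal_add_mem[OF N(1)])
      moreover have "(x \<ominus> a) \<oplus> a = x" using xc Nc[OF a(1)] by algebra
      ultimately show "x \<in> N" by simp
    qed
    show "N \<subseteq> \<Union>?H" using mem_coset_iff[OF B] Nc by blast
  qed
qed

lemma module_length_quot_module:
  assumes A: "ideal A R" and B: "ideal B R" "B \<subseteq> A"
  shows "module_length R (quot_module R A B) = colength R A B"
proof -
  let ?Q = "quot_module R A B" and ?f = "\<lambda>N. (\<lambda>a. B +> a) ` N"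
  have "(\<exists>N. (\<forall>i\<le>n. submodule (N i) R ?Q) \<and> (\<forall>i<n. N i \<subset> N (Suc i))) \<longleftrightarrow> chain_length R A B n" for n :: nat
  proof
    assume "\<exists>N. (\<forall>i\<le>n. submodule (N i) R ?Q) \<and> (\<forall>i<n. N i \<subset> N (Suc i))"
    then obtain N where N: "\<And>i. i \<le> n \<Longrightarrow> submodule (N i) R ?Q" "\<And>i. i < n \<Longrightarrow> N i \<subset> N (Suc i)" by auto
    have "\<Union>(N i) \<subset> \<Union>(N (Suc i))" if i: "i < n" for i
    proof -
      have "?f (\<Union>(N i)) = N i" "?f (\<Union>(N (Suc i))) = N (Suc i)"
        using submodule_quot_module_Union(4)[OF A B N(1)] i by simp_all
      then have "\<Union>(N i) \<noteq> \<Union>(N (Suc i))" using N(2)[OF i] by (metis psubsetE)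
      moreover have "\<Union>(N i) \<subseteq> \<Union>(N (Suc i))" using N(2)[OF i] by (intro Union_mono) auto
      ultimately show ?thesis by auto
    qed
    then show "chain_length R A B n"
      unfolding chain_length_def using submodule_quot_module_Union(1-3)[OF A B N(1)]
      by (intro exI[of _ "\<lambda>i. \<Union>(N i)"]) simp
  next
    assume "chain_length R A B n"
    then obtain N where N: "\<And>i. i \<le> n \<Longrightarrow> ideal (N i) R" "\<And>i. i \<le> n \<Longrightarrow> B \<subseteq> N i" "\<And>i. i \<le> n \<Longrightarrow> N i \<subseteq> A"
      "\<And>i. i < n \<Longrightarrow> N i \<subset> N (Suc i)" unfolding chain_length_def by auto
    have "?f (N i) \<subset> ?f (N (Suc i))" if i: "i < n" for i
    proof -
      have "\<Union>(?f (N i)) = N i" "\<Union>(?f (N (Suc i))) = N (Suc i)"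
        using submodule_quot_module_image(2)[OF A B(1) N(1-3)] i by simp_all
      then have "?f (N i) \<noteq> ?f (N (Suc i))" using N(4)[OF i] by (metis psubsetE)
      moreover have "?f (N i) \<subseteq> ?f (N (Suc i))" using N(4)[OF i] by (intro image_mono) auto
      ultimately show ?thesis by auto
    qed
    then show "\<exists>N. (\<forall>i\<le>n. submodule (N i) R ?Q) \<and> (\<forall>i<n. N i \<subset> N (Suc i))"
      using submodule_quot_module_image(1)[OF A B(1) N(1-3)]
      by (intro exI[of _ "\<lambda>i. ?f (N i)"]) simp
  qed
  then show ?thesis unfolding module_length_def colength_def by simp
qed

end

section \<open>Leading terms of binomial polynomials\<close>

lemma tendsto_choose_over_power:
  assumes "j \<le> k"
  shows "(\<lambda>s. real ((c + s + j) choose j) / real s ^ k) \<longlonglongrightarrow> (if j = k then 1 / fact j else 0)"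
proof -
  have 1: "(\<lambda>s. real ((c + s + j) choose j) / real s ^ j) \<longlonglongrightarrow> 1 / fact j"
  proof -
    have *: "(\<lambda>s. (real (c + s + j) - real i) / real s) \<longlonglongrightarrow> 1" for i
    proof -
      have lim: "(\<lambda>s. (real c + real j - real i) / real s + 1) \<longlonglongrightarrow> 0 + 1"
        by (intro tendsto_add lim_const_over_n tendsto_const)
      have "\<forall>\<^sub>F s in sequentially.
          (real c + real j - real i) / real s + 1 = (real (c + s + j) - real i) / real s"
        using eventually_gt_at_top[of 0] by eventually_elim (simp add: field_simps)
      from Lim_transform_eventually[OF lim this] show ?thesis by simp
    qed
    have "(\<lambda>s. (\<Prod>i<j. (real (c + s + j) - real i) / real s) / fact j) \<longlonglongrightarrow> (\<Prod>i<j. 1) / fact j"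
      by (intro tendsto_divide tendsto_prod * tendsto_const) simp
    moreover have "(\<Prod>i<j. (real (c + s + j) - real i) / real s) / fact j = real ((c + s + j) choose j) / real s ^ j" for s
    proof -
      have "real ((c + s + j) choose j) = (\<Prod>i<j. real (c + s + j) - real i) / fact j"
        by (simp add: binomial_gbinomial gbinomial_prod_rev lessThan_atLeast0)
      then show ?thesis by (simp add: prod_dividef)
    qed
    ultimately show ?thesis by simp
  qed
  have 2: "(\<lambda>s. 1 / real s ^ (k - j)) \<longlonglongrightarrow> (if j = k then 1 else 0)"
  proof (cases "j = k")
    case False
    then have "(\<lambda>s. (1 / real s) ^ (k - j)) \<longlonglongrightarrow> 0 ^ (k - j)"
      by (intro tendsto_power lim_const_over_n)
    then show ?thesis using False assms by (simp add: power_divide power_0_left)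
  qed simp
  have "real ((c + s + j) choose j) / real s ^ k = real ((c + s + j) choose j) / real s ^ j * (1 / real s ^ (k - j))" for s
    using assms by (simp flip: power_add)
  then show ?thesis using tendsto_mult[OF 1 2] by (cases "j = k") simp_all
qed

text \<open>Divide by s^(d-1) and let s tend to infinity. The difference in r vanishes for i = 0 and
  is 1 for i = 1, and j = d - 1 forces i \<le> 1, so only e 1 (d - 1) / (d - 1)! survives on the
  right.\<close>

lemma leading_coefficient_le:
  fixes e :: "nat \<Rightarrow> nat \<Rightarrow> int" and q :: nat
  assumes d: "d \<ge> 1" and le: "\<And>s. int ((d - 1 + s) choose (d - 1)) * int q \<le>
    (\<Sum>i\<le>d. \<Sum>j\<le>d - i. e i j * (int ((Suc r + i) choose i) - int ((r + i) choose i)) * int ((c + s + j) choose j))"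
  shows "int q \<le> e 1 (d - 1)"
proof -
  define D where "D = (\<lambda>i. real ((Suc r + i) choose i) - real ((r + i) choose i))"
  have D0: "D 0 = 0" "D 1 = 1" by (simp_all add: D_def)
  let ?k = "d - 1"
  let ?F = "\<lambda>s. \<Sum>i\<le>d. \<Sum>j\<le>d - i. of_int (e i j) * D i * (real ((c + s + j) choose j) / real s ^ ?k)"
  have "(\<lambda>s. of_int (e i j) * D i * (real ((c + s + j) choose j) / real s ^ ?k))
      \<longlonglongrightarrow> (if i = 1 \<and> j = ?k then of_int (e i j) / fact ?k else 0)" if ij: "i \<le> d" "j \<le> d - i" for i j
  proof (cases "i = 0")
    case True
    then show ?thesis using D0 by simp
  next
    case False
    then have jk: "j \<le> ?k" using ij by auto
    have "(\<lambda>s. of_int (e i j) * D i * (real ((c + s + j) choose j) / real s ^ ?k))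
      \<longlonglongrightarrow> of_int (e i j) * D i * (if j = ?k then 1 / fact j else 0)"
      by (intro tendsto_mult tendsto_const tendsto_choose_over_power jk)
    moreover have "i = 1" if "j = ?k" using that ij False d by auto
    ultimately show ?thesis using D0 by (auto split: if_splits)
  qed
  then have "?F \<longlonglongrightarrow> (\<Sum>i\<le>d. \<Sum>j\<le>d - i. if i = 1 \<and> j = ?k then of_int (e i j) / fact ?k else 0)"
    by (intro tendsto_sum) simp
  also have "(\<Sum>i\<le>d. \<Sum>j\<le>d - i. if i = 1 \<and> j = ?k then of_int (e i j) / fact ?k else (0::real)) =
      (\<Sum>i\<le>d. if i = 1 then of_int (e 1 ?k) / fact ?k else 0)"
  proof (intro sum.cong refl)
    fix i
    show "(\<Sum>j\<le>d - i. if i = 1 \<and> j = ?k then of_int (e i j) / fact ?k else (0::real)) =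
        (if i = 1 then of_int (e 1 ?k) / fact ?k else 0)"
      by (cases "i = 1") simp_all
  qed
  also have "\<dots> = of_int (e 1 ?k) / fact ?k" using d by simp
  finally have F: "?F \<longlonglongrightarrow> of_int (e 1 ?k) / fact ?k" .
  have G: "(\<lambda>s. real ((0 + s + ?k) choose ?k) / real s ^ ?k * real q) \<longlonglongrightarrow> (if ?k = ?k then 1 / fact ?k else 0) * real q"
    by (intro tendsto_mult tendsto_const tendsto_choose_over_power) simp
  have "real ((0 + s + ?k) choose ?k) / real s ^ ?k * real q \<le> ?F s" for s
  proof -
    have "real_of_int (int ((?k + s) choose ?k) * int q) \<le> real_of_int (\<Sum>i\<le>d. \<Sum>j\<le>d - i.
        e i j * (int ((Suc r + i) choose i) - int ((r + i) choose i)) * int ((c + s + j) choose j))"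
      using le by (simp only: of_int_le_iff)
    then have "real ((0 + s + ?k) choose ?k) * real q \<le> (\<Sum>i\<le>d. \<Sum>j\<le>d - i. of_int (e i j) * D i * real ((c + s + j) choose j))"
      by (simp add: D_def add.commute)
    then have "real ((0 + s + ?k) choose ?k) * real q / real s ^ ?k \<le>
        (\<Sum>i\<le>d. \<Sum>j\<le>d - i. of_int (e i j) * D i * real ((c + s + j) choose j)) / real s ^ ?k"
      by (rule divide_right_mono) simp
    then show ?thesis by (simp add: sum_divide_distrib)
  qed
  then have "(if ?k = ?k then 1 / fact ?k else 0) * real q \<le> of_int (e 1 ?k) / fact ?k"
    using F G by (intro LIMSEQ_le[OF G F]) auto
  then have "real q \<le> of_int (e 1 ?k)" by (simp add: field_simps)
  then show ?thesis by linarith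
qed

section \<open>Joint reductions and mixed multiplicities\<close>

definition bipow :: "('a, 'b) ring_scheme \<Rightarrow> 'a set \<Rightarrow> 'a set \<Rightarrow> nat \<Rightarrow> nat \<Rightarrow> 'a set"
  where "bipow R A B r s = ipow R A r \<cdot>\<^bsub>R\<^esub> ipow R B s"

context cring
begin

lemma bipow_ideal: "ideal A R \<Longrightarrow> ideal B R \<Longrightarrow> ideal (bipow R A B r s) R"
  unfolding bipow_def by (simp add: ideal_ops)

lemma bipow_mult: "ideal A R \<Longrightarrow> ideal B R \<Longrightarrow>
    bipow R A B r s \<cdot> bipow R A B r' s' = bipow R A B (r + r') (s + s')"
  unfolding bipow_def by (simp add: ipow_add ideal_prod_ac ideal_ops)

lemma bipow_Suc_left: "ideal A R \<Longrightarrow> ideal B R \<Longrightarrow> A \<cdot> bipow R A B r s = bipow R A B (Suc r) s"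
  using bipow_mult[of A B 1 0 r s] by (simp add: bipow_def ideal_prod_one)

lemma bipow_Suc_right: "ideal A R \<Longrightarrow> ideal B R \<Longrightarrow> B \<cdot> bipow R A B r s = bipow R A B r (Suc s)"
  using bipow_mult[of A B 0 1 r s] by (simp add: bipow_def ideal_prod_one')

lemma bipow_antimono:
  assumes "ideal A R" "ideal B R" "r \<le> r'" "s \<le> s'"
  shows "bipow R A B r' s' \<subseteq> bipow R A B r s"
  unfolding bipow_def using assms by (intro ideal_prod_mono ipow_antimono)

end

text \<open>The asymptotic form of the joint reduction condition, which does not mention the exponents
  of the defining equation.\<close>

definition reduction_for_large :: "('a, 'b) ring_scheme \<Rightarrow> 'a set \<Rightarrow> 'a set \<Rightarrow> 'a \<Rightarrow> 'a list \<Rightarrow> bool"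
  where "reduction_for_large R A I x as \<longleftrightarrow> (\<exists>n. \<forall>r\<ge>n. \<forall>s\<ge>n.
    bipow R A I (Suc r) (Suc s) \<subseteq>
      (PIdl\<^bsub>R\<^esub> x) \<cdot>\<^bsub>R\<^esub> bipow R A I r (Suc s) <+>\<^bsub>R\<^esub> ideal_of R as \<cdot>\<^bsub>R\<^esub> bipow R A I (Suc r) s)"

text \<open>\<open>bhattacharya_coeffs\<close> with an explicit threshold and with lengths counted
  by ideals.\<close>

definition bhattacharya_polynomial ::
    "('a, 'b) ring_scheme \<Rightarrow> 'a set \<Rightarrow> 'a set \<Rightarrow> nat \<Rightarrow> (nat \<Rightarrow> nat \<Rightarrow> int) \<Rightarrow> nat \<Rightarrow> bool"
  where "bhattacharya_polynomial R A I d e n \<longleftrightarrow> (\<forall>r\<ge>n. \<forall>s\<ge>n. \<exists>l.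
    colength R (carrier R) (bipow R A I r s) = enat l \<and>
    int l = (\<Sum>i\<le>d. \<Sum>j\<le>d - i. e i j * int ((r + i) choose i) * int ((s + j) choose j)))"

context noetherian_local
begin

text \<open>Put A = M^k I^(k+s+1) and D = J^(s+1). The length of R/(D + (x)) is a binomial multiple
  of that of R/(x, J), and it equals the length of (A + D)/(xA + D), a quotient of A/MA because the
  reduction inclusion puts MA into xA + D. The length of A/MA is a first difference of the
  polynomial, so its leading term in s gives the bound.\<close>

lemma colength_le_mixed_multiplicity:
  assumes I: "ideal I R" and x: "x \<in> M" and as: "set as \<subseteq> I" "length as = d - 1" and d: "d \<ge> 1"
    and perm: "permutable_mod R {\<zero>} (x # as)"
    and red: "reduction_for_large R M I x as" and poly: "bhattacharya_polynomial R M I d e n"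
  obtains q where "colength R (carrier R) (ideal_of R (x # as)) = enat q" "int q \<le> e 1 (d - 1)"
proof -
  let ?E = "bipow R M I" and ?J = "ideal_of R as"
  note MI = M_ideal I
  have c: "x \<in> carrier R" "set as \<subseteq> carrier R"
    using x as ideal_mem_carrier[OF M_ideal] ideal_subset_carrier[OF I] by auto
  have idJ: "ideal ?J R" using c by (intro ideal_of_ideal)
  have idE: "ideal (?E r s) R" for r s using MI by (rule bipow_ideal)
  have idx: "ideal (PIdl x) R" using c by (intro cgenideal_ideal)
  have JI: "?J \<subseteq> I" using as ideal_zero_mem[OF I] by (intro adjoin_least zeroideal I) auto
  obtain m where m: "\<And>r s. r \<ge> m \<Longrightarrow> s \<ge> m \<Longrightarrow>
      ?E (Suc r) (Suc s) \<subseteq> (PIdl x) \<cdot> ?E r (Suc s) <+> ?J \<cdot> ?E (Suc r) s"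
    using red unfolding reduction_for_large_def by auto
  \<comment> \<open>The exponent of M stays at k and k + 1; only that of I grows.\<close>
  define k where "k = max m n"
  have km: "k \<ge> m" "k \<ge> n" by (simp_all add: k_def)
  \<comment> \<open>Iterating the reduction inclusion s times trades s factors I for J, up to
    multiples of x.\<close>
  have step: "?E (Suc k) (k + s) \<subseteq> (PIdl x) \<cdot> ?E k (k + s) <+> ipow R ?J s" for s
  proof (induction s)
    case 0
    have "carrier R \<subseteq> (PIdl x) \<cdot> ?E k k <+> carrier R"
      using set_add_upper2[OF ideal_prod_is_ideal[OF idx idE] oneideal] .
    then show ?case using ideal_subset_carrier[OF idE, of "Suc k" k] by simp
  next
    case (Suc s)
    let ?C = "(PIdl x) \<cdot> ?E k (Suc (k + s)) <+> ipow R ?J (Suc s)"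
    have idxE: "ideal ((PIdl x) \<cdot> ?E k t) R" for t using idx idE by (rule ideal_prod_is_ideal)
    have idC: "ideal ?C R" using idxE idJ by (simp add: ideal_ops)
    have up: "(PIdl x) \<cdot> ?E k (Suc (k + s)) \<subseteq> ?C" "ipow R ?J (Suc s) \<subseteq> ?C"
      using set_add_upper1[OF idxE ipow_ideal[OF idJ]] set_add_upper2[OF idxE ipow_ideal[OF idJ]] by simp_all
    have "?J \<cdot> ?E (Suc k) (k + s) \<subseteq> ?J \<cdot> ((PIdl x) \<cdot> ?E k (k + s) <+> ipow R ?J s)"
      using Suc by (intro ideal_prod_mono subset_refl)
    also have "\<dots> = (PIdl x) \<cdot> (?J \<cdot> ?E k (k + s)) <+> ipow R ?J (Suc s)"
      using idJ idx idE idxE by (simp add: ideal_prod_distr ipow_ideal ipow_Suc2 ideal_prod_left_comm[of ?J])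
    also have "\<dots> \<subseteq> ?C"
    proof (intro set_add_mono ideal_prod_mono subset_refl)
      have "?J \<cdot> ?E k (k + s) \<subseteq> I \<cdot> ?E k (k + s)" using JI by (intro ideal_prod_mono subset_refl)
      then show "?J \<cdot> ?E k (k + s) \<subseteq> ?E k (Suc (k + s))" using bipow_Suc_right[OF MI] by simp
    qed
    finally have "?J \<cdot> ?E (Suc k) (k + s) \<subseteq> ?C" .
    then have "(PIdl x) \<cdot> ?E k (Suc (k + s)) <+> ?J \<cdot> ?E (Suc k) (k + s) \<subseteq> ?C"
      using up by (intro set_add_least idC)
    then show ?case using m[of k "k + s"] km by simp
  qed
  have fin: "colength R (carrier R) (?E r s) \<noteq> \<infinity>" if "r \<ge> n" "s \<ge> n" for r s
    using poly that unfolding bhattacharya_polynomial_def by fastforce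
  let ?q = "colength R (carrier R) (ideal_of R (x # as))"
  have bound: "of_nat ((d - 1 + s) choose (d - 1)) * ?q + colength R (carrier R) (?E k (k + Suc s))
      \<le> colength R (carrier R) (?E (Suc k) (k + Suc s))" for s
  proof -
    let ?A = "?E k (k + Suc s)" and ?D = "ipow R ?J (Suc s)"
    let ?B = "(PIdl x) \<cdot> ?A <+> ?D"
    have idD: "ideal ?D R" using idJ by (rule ipow_ideal)
    have idB: "ideal ?B R" using idx idE idD by (simp add: ideal_ops)
    have MA: "M \<cdot> ?A = ?E (Suc k) (k + Suc s)" using bipow_Suc_left[OF MI] .
    have sub: "M \<cdot> ?A \<subseteq> ?A \<inter> ?B"
      using ideal_prod_subset_right[OF M_ideal idE[of k "k + Suc s"]] step[of "Suc s"] unfolding MA by (rule Int_greatest)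
    have AB: "?A <+> ?B = ?A <+> ?D"
    proof
      have idAD: "ideal (?A <+> ?D) R" using idE idD by (rule add_ideals)
      have "?A \<subseteq> ?A <+> ?D" "?D \<subseteq> ?A <+> ?D" using set_add_upper1[OF idE idD] set_add_upper2[OF idE idD] by simp_all
      moreover have "(PIdl x) \<cdot> ?A \<subseteq> ?A" using ideal_prod_subset_right[OF idx idE] .
      ultimately show "?A <+> ?B \<subseteq> ?A <+> ?D" by (intro set_add_least idAD) auto
      show "?A <+> ?D \<subseteq> ?A <+> ?B"
        using set_add_upper2[OF ideal_prod_is_ideal[OF idx idE] idD] by (intro set_add_mono subset_refl)
    qed
    have idAD: "ideal (?A <+> ?D) R" using idE idD by (rule add_ideals)
    have AD: "?A \<subseteq> ?A <+> ?D" using set_add_upper1[OF idE idD] .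
    have nzd: "nzd_mod R ?D x"
      using nzd_mod_ipow[OF zeroideal _ perm, of "Suc s"] c idD by (simp add: zero_add_ideal)
    have finAD: "colength R (carrier R) (?A <+> ?D) \<noteq> \<infinity>"
    proof
      assume "colength R (carrier R) (?A <+> ?D) = \<infinity>"
      moreover have "colength R (carrier R) (?A <+> ?D) \<le> colength R (carrier R) ?A"
        by (rule colength_mono(1)[OF oneideal idAD idE AD ideal_subset_carrier[OF idAD]])
      ultimately show False using fin[of k "k + Suc s"] km by simp
    qed
    have perm': "permutable_mod R ({\<zero>} <+> PIdl x) as"
      using permutable_mod_right[OF perm, of "[x]" as] by simp
    have "of_nat ((d - 1 + s) choose (d - 1)) * ?q = colength R (carrier R) (({\<zero>} <+> PIdl x) <+> ?D)"
      using colength_ipow[OF add_ideals[OF zeroideal idx] c(2) perm', of s] as(2) by simp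
    also have "({\<zero>} <+> PIdl x) <+> ?D = ?D <+> PIdl x"
      using zero_add_ideal[OF idx] ideal_set_add_comm[OF idx idD] by simp
    also have "colength R (carrier R) (?D <+> PIdl x) = colength R (?A <+> ?B) ?B"
      using colength_mod_nzd[OF idE idD c(1) nzd finAD] AB by simp
    also have "\<dots> = colength R ?A (?A \<inter> ?B)" using colength_second_iso[OF idE idB] .
    also have "\<dots> \<le> colength R ?A (M \<cdot> ?A)"
      using sub i_intersect[OF idE idB] ideal_prod_is_ideal[OF M_ideal idE] idE by (intro colength_mono(1)) auto
    finally have le: "of_nat ((d - 1 + s) choose (d - 1)) * ?q \<le> colength R ?A (M \<cdot> ?A)" .
    have "colength R (carrier R) (M \<cdot> ?A) = colength R (carrier R) ?A + colength R ?A (M \<cdot> ?A)"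
      using ideal_prod_is_ideal[OF M_ideal idE] ideal_prod_subset_right[OF M_ideal idE] ideal_subset_carrier[OF idE] idE
      by (intro colength_add oneideal)
    then show ?thesis using add_right_mono[OF le, of "colength R (carrier R) ?A"] MA by (simp add: add.commute)
  qed
  \<comment> \<open>One instance of the bound suffices for finiteness, since its binomial
    coefficient is not zero.\<close>
  obtain q where q: "?q = enat q"
  proof (cases ?q)
    case infinity
    have "colength R (carrier R) (?E (Suc k) (k + Suc 0)) = \<infinity>" using bound[of 0] infinity by simp
    then show ?thesis using fin[of "Suc k" "k + Suc 0"] km by simp
  qed auto
  \<comment> \<open>The exponent k + Suc s of I is rewritten as Suc k + s, so that the shift in
    \<open>leading_coefficient_le\<close> is Suc k.\<close>
  have "int ((d - 1 + s) choose (d - 1)) * int q \<le>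
    (\<Sum>i\<le>d. \<Sum>j\<le>d - i. e i j * (int ((Suc k + i) choose i) - int ((k + i) choose i)) * int ((Suc k + s + j) choose j))" for s
  proof -
    obtain l1 where l1: "colength R (carrier R) (?E k (k + Suc s)) = enat l1"
      "int l1 = (\<Sum>i\<le>d. \<Sum>j\<le>d - i. e i j * int ((k + i) choose i) * int ((k + Suc s + j) choose j))"
      using poly km unfolding bhattacharya_polynomial_def by (meson trans_le_add1)
    obtain l2 where l2: "colength R (carrier R) (?E (Suc k) (k + Suc s)) = enat l2"
      "int l2 = (\<Sum>i\<le>d. \<Sum>j\<le>d - i. e i j * int ((Suc k + i) choose i) * int ((k + Suc s + j) choose j))"
      using poly km unfolding bhattacharya_polynomial_def by (meson trans_le_add1 le_SucI)
    have "enat ((d - 1 + s choose (d - 1)) * q + l1) \<le> enat l2"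
      using bound[of s] unfolding q l1 l2 by (simp add: of_nat_eq_enat)
    then have "(d - 1 + s choose (d - 1)) * q + l1 \<le> l2" by simp
    then have "int ((d - 1 + s choose (d - 1)) * q + l1) \<le> int l2" by (simp only: of_nat_le_iff)
    then have "int ((d - 1 + s) choose (d - 1)) * int q \<le> int l2 - int l1" by simp
    also have "\<dots> = (\<Sum>i\<le>d. \<Sum>j\<le>d - i. e i j * (int ((Suc k + i) choose i) - int ((k + i) choose i)) * int ((Suc k + s + j) choose j))"
      unfolding l1(2) l2(2) by (simp add: sum_subtractf[symmetric] algebra_simps)
    finally show ?thesis .
  qed
  then have "int q \<le> e 1 (d - 1)" by (rule leading_coefficient_le[OF d])
  with q show ?thesis by (rule that)
qed

lemma colength_carrier_M_le: "ideal A R \<Longrightarrow> M \<subseteq> A \<Longrightarrow> colength R (carrier R) A \<le> 1"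
proof -
  assume A: "ideal A R" "M \<subseteq> A"
  have "\<not> enat 2 \<le> colength R (carrier R) A"
    unfolding enat_le_colength_iff[OF A(1) ideal_subset_carrier[OF A(1)]] chain_length_def
  proof
    assume "\<exists>N. (\<forall>i\<le>2. ideal (N i) R \<and> A \<subseteq> N i \<and> N i \<subseteq> carrier R) \<and> (\<forall>i<2. N i \<subset> N (Suc i))"
    then obtain N where N: "\<And>i. i \<le> 2 \<Longrightarrow> ideal (N i) R \<and> A \<subseteq> N i \<and> N i \<subseteq> carrier R"
      "\<And>i. i < (2::nat) \<Longrightarrow> N i \<subset> N (Suc i)" by auto
    have "N (Suc 1) \<subseteq> carrier R" using N(1)[of "Suc 1"] by simp
    then have "N 1 \<noteq> carrier R" using N(2)[of 1] by auto
    then have "N 1 \<subseteq> M" using proper_ideal_subset_M N(1)[of 1] by simp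
    moreover have "M \<subseteq> N 0" using A(2) N(1)[of 0] by auto
    ultimately show False using N(2)[of 0] by auto
  qed
  then show ?thesis by (cases "colength R (carrier R) A") (auto simp: one_enat_def)
qed

text \<open>Each generator adds a cyclic module killed by M, hence of length at most 1.\<close>

lemma colength_adjoin_le:
  assumes "ideal B R" "set ys \<subseteq> carrier R" "\<And>y m. y \<in> set ys \<Longrightarrow> m \<in> M \<Longrightarrow> y \<otimes> m \<in> B"
  shows "colength R (adjoin R B ys) B \<le> of_nat (length ys)"
  using assms
proof (induction ys arbitrary: B)
  case Nil
  then show ?case by (simp add: colength_self)
next
  case (Cons y ys)
  have c: "y \<in> carrier R" "set ys \<subseteq> carrier R" using Cons.prems(2) by auto
  let ?B = "B <+> PIdl y"
  have idB: "ideal ?B R" using Cons.prems(1) c by (simp add: ideal_ops)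
  have BB: "B \<subseteq> ?B" using set_add_upper1[OF Cons.prems(1) cgenideal_ideal[OF c(1)]] .
  have 1: "colength R (adjoin R ?B ys) ?B \<le> of_nat (length ys)"
    using Cons.prems(3) BB by (intro Cons.IH idB c(2)) auto
  have "colength R ?B B = colength R (carrier R) {z \<in> carrier R. y \<otimes> z \<in> B}"
    using Cons.prems(1) c(1) by (rule colength_add_cgenideal)
  also have "\<dots> \<le> 1"
    using Cons.prems(1,3) c(1) ideal_mem_carrier[OF M_ideal] by (intro colength_carrier_M_le ideal_colon) auto
  finally have 2: "colength R ?B B \<le> 1" .
  have "colength R (adjoin R ?B ys) B = colength R (adjoin R ?B ys) ?B + colength R ?B B"
    using idB Cons.prems(1) c BB by (intro colength_add adjoin_ideal adjoin_superset)
  also have "\<dots> \<le> of_nat (length ys) + 1" using 1 2 by (rule add_mono)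
  finally show ?case by (simp add: add.commute)
qed

text \<open>Let B = xI + MJ \<subseteq> MI and Q = (x) + J. The elements of as contribute at most
  \<open>length as\<close> to the length of Q/B, and B + (x) over B is a quotient of R/I. Computing
  the length of R/B through I and through Q and cancelling that of R/I, the length of I/B is at most
  q + \<open>length as\<close>, hence at most the length \<mu> of I/MI, which forces B = MI.\<close>

lemma minimal_multiplicity_product:
  assumes I: "ideal I R" and IM: "I \<subseteq> M" and x: "x \<in> M" and as: "set as \<subseteq> I"
    and fin: "colength R (carrier R) I \<noteq> \<infinity>"
    and mu: "colength R I (M \<cdot> I) = enat \<mu>"
    and q: "colength R (carrier R) (ideal_of R (x # as)) = enat q" "q + length as \<le> \<mu>"
  shows "M \<cdot> I = (PIdl x) \<cdot> I <+> M \<cdot> ideal_of R as"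
proof -
  let ?J = "ideal_of R as" and ?Q = "ideal_of R (x # as)"
  let ?B = "(PIdl x) \<cdot> I <+> M \<cdot> ?J"
  have c: "x \<in> carrier R" "set as \<subseteq> carrier R"
    using x as ideal_mem_carrier[OF M_ideal] ideal_subset_carrier[OF I] by auto
  have idJ: "ideal ?J R" using c by (intro ideal_of_ideal)
  have idQ: "ideal ?Q R" using c by (intro ideal_of_ideal) simp
  have idx: "ideal (PIdl x) R" using c by (intro cgenideal_ideal)
  have JI: "?J \<subseteq> I" using as ideal_zero_mem[OF I] by (intro adjoin_least zeroideal I) auto
  have Q: "?Q = PIdl x <+> ?J" using c by (intro ideal_of_Cons)
  have i1: "ideal ((PIdl x) \<cdot> I) R" "ideal (M \<cdot> ?J) R" using ideal_prod_is_ideal[OF idx I] ideal_prod_is_ideal[OF M_ideal idJ] by simp_all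
  have idB: "ideal ?B R" using i1 by (rule add_ideals)
  have xM: "PIdl x \<subseteq> M" using x M_ideal by (intro cgenideal_minimal)
  have BQ: "?B \<subseteq> ?Q"
    unfolding Q using ideal_prod_subset_left[OF idx I] ideal_prod_subset_right[OF M_ideal idJ] by (rule set_add_mono)
  have BMI: "?B \<subseteq> M \<cdot> I"
    using xM JI ideal_prod_is_ideal[OF M_ideal I] by (intro set_add_least ideal_prod_mono) simp_all
  have MII: "M \<cdot> I \<subseteq> I" using ideal_prod_subset_right[OF M_ideal I] .
  have BI: "?B \<subseteq> I" using BMI MII by auto
  let ?Bx = "?B <+> PIdl x"
  have idBx: "ideal ?Bx R" using idB idx by (rule add_ideals)
  have "adjoin R ?Bx as = ?Bx <+> ?J" using idBx c by (intro adjoin_eq_add_ideal_of)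
  also have "\<dots> = ?Q"
  proof
    have "PIdl x \<subseteq> ?Q" "?J \<subseteq> ?Q" unfolding Q using set_add_upper1[OF idx idJ] set_add_upper2[OF idx idJ] by simp_all
    then show "?Bx <+> ?J \<subseteq> ?Q" using set_add_least[OF idQ set_add_least[OF idQ BQ]] by simp
    show "?Q \<subseteq> ?Bx <+> ?J" unfolding Q using set_add_upper2[OF idB idx] by (intro set_add_mono subset_refl)
  qed
  finally have adj: "adjoin R ?Bx as = ?Q" .
  have 1: "colength R ?Q ?Bx \<le> of_nat (length as)"
    unfolding adj[symmetric]
  proof (rule colength_adjoin_le[OF idBx c(2)])
    fix y m assume ym: "y \<in> set as" "m \<in> M"
    have "m \<otimes> y \<in> M \<cdot> ?J" using ym c by (intro ideal_prod.prod adjoin_mem zeroideal)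
    moreover have "m \<otimes> y = y \<otimes> m" using ym c ideal_mem_carrier[OF M_ideal] by (intro m_comm) auto
    ultimately have "y \<otimes> m \<in> M \<cdot> ?J" by simp
    then show "y \<otimes> m \<in> ?Bx"
      using set_add_upper2[OF i1] set_add_upper1[OF idB idx] by auto
  qed
  have "colength R ?Bx ?B = colength R (carrier R) {z \<in> carrier R. x \<otimes> z \<in> ?B}"
    using idB c(1) by (rule colength_add_cgenideal)
  also have "\<dots> \<le> colength R (carrier R) I"
  proof (rule colength_mono(1)[OF oneideal ideal_colon[OF idB c(1)] I])
    show "I \<subseteq> {z \<in> carrier R. x \<otimes> z \<in> ?B}"
      using cgenideal_prodI[OF I c(1)] set_add_upper1[OF i1] ideal_mem_carrier[OF I] by auto
  qed auto
  finally have 2: "colength R ?Bx ?B \<le> colength R (carrier R) I" .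
  have BBx: "?B \<subseteq> ?Bx" using set_add_upper1[OF idB idx] .
  have BxQ: "?Bx \<subseteq> ?Q" using adj adjoin_superset[OF idBx c(2)] by simp
  have "colength R ?Q ?B = colength R ?Q ?Bx + colength R ?Bx ?B"
    by (rule colength_add[OF idQ idBx idB BBx BxQ])
  also have "\<dots> \<le> of_nat (length as) + colength R (carrier R) I" using 1 2 by (rule add_mono)
  finally have 3: "colength R ?Q ?B \<le> of_nat (length as) + colength R (carrier R) I" .
  have "colength R (carrier R) I + colength R I ?B = colength R (carrier R) ?Q + colength R ?Q ?B"
    using colength_add[OF oneideal I idB BI ideal_subset_carrier[OF I]]
      colength_add[OF oneideal idQ idB BQ ideal_subset_carrier[OF idQ]] by simp
  also have "\<dots> \<le> enat q + (of_nat (length as) + colength R (carrier R) I)"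
    unfolding q(1) using 3 by (intro add_mono order_refl)
  finally have 4: "colength R (carrier R) I + colength R I ?B \<le> enat q + (of_nat (length as) + colength R (carrier R) I)" .
  obtain i where i: "colength R (carrier R) I = enat i" using fin by auto
  have 5: "colength R I ?B = enat \<mu> + colength R (M \<cdot> I) ?B"
    using colength_add[OF I ideal_prod_is_ideal[OF M_ideal I] idB BMI MII] mu by simp
  have "colength R (M \<cdot> I) ?B = 0"
    using 4 q(2) unfolding 5 i
    by (cases "colength R (M \<cdot> I) ?B") (auto simp: of_nat_eq_enat zero_enat_def)
  then show ?thesis
    using colength_eq_0[OF ideal_prod_is_ideal[OF M_ideal I] idB BMI] by simp
qed

end

section \<open>Regular forms in the associated graded ring and the fiber cone\<close>

text \<open>L is placed in degree one, so it contributes L I^(n-1) in degree n and nothing in degree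
  0.\<close>

definition shifted :: "('a, 'b) ring_scheme \<Rightarrow> 'a set \<Rightarrow> 'a set \<Rightarrow> nat \<Rightarrow> 'a set"
  where "shifted R L I n = (case n of 0 \<Rightarrow> {\<zero>\<^bsub>R\<^esub>} | Suc m \<Rightarrow> L \<cdot>\<^bsub>R\<^esub> ipow R I m)"

text \<open>The degree-one forms of \<open>as\<close> are a regular sequence on \<open>\<Oplus>\<^sub>n I\<^sup>n/K\<^sub>n\<close>, expressed through
  homogeneous elements: the degree \<open>n\<close> part of the ideal generated by the forms of a list is
  the image of \<open>shifted R L I n\<close>, where \<open>L\<close> is the ideal generated by the list.\<close>

definition forms_regular ::
    "('a, 'b) ring_scheme \<Rightarrow> 'a set \<Rightarrow> (nat \<Rightarrow> 'a set) \<Rightarrow> 'a list \<Rightarrow> bool"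
  where "forms_regular R I K as \<longleftrightarrow> (\<forall>i<length as. \<forall>n. \<forall>b\<in>ipow R I n.
    as ! i \<otimes>\<^bsub>R\<^esub> b \<in> K (Suc n) <+>\<^bsub>R\<^esub> ideal_of R (take i as) \<cdot>\<^bsub>R\<^esub> ipow R I n \<longrightarrow>
    b \<in> K n <+>\<^bsub>R\<^esub> shifted R (ideal_of R (take i as)) I n)"

context cring
begin

lemma shifted_0 [simp]: "shifted R L I 0 = {\<zero>}"
  and shifted_Suc [simp]: "shifted R L I (Suc n) = L \<cdot> ipow R I n"
  by (simp_all add: shifted_def)

lemma shifted_ideal: "ideal L R \<Longrightarrow> ideal I R \<Longrightarrow> ideal (shifted R L I n) R"
  by (cases n) (simp_all add: zeroideal ideal_ops)

lemma shifted_subset: "ideal L R \<Longrightarrow> ideal I R \<Longrightarrow> shifted R L I n \<subseteq> L"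
  by (cases n) (simp_all add: ideal_zero_mem ideal_prod_subset_left ipow_ideal)

lemma mem_add_diff:
  assumes "ideal A R" "ideal B R" "z \<in> carrier R"
  shows "z \<in> A <+> B \<longleftrightarrow> (\<exists>a\<in>A. z \<ominus> a \<in> B)"
proof
  assume "z \<in> A <+> B"
  then obtain a b where *: "a \<in> A" "b \<in> B" "z = a \<oplus> b" by (auto simp: mem_set_add)
  have c: "a \<in> carrier R" "b \<in> carrier R" using * ideal_mem_carrier assms by simp_all
  have "z \<ominus> a = b" unfolding *(3) using c by algebra
  then show "\<exists>a\<in>A. z \<ominus> a \<in> B" using *(1,2) by auto
next
  assume "\<exists>a\<in>A. z \<ominus> a \<in> B"
  then obtain a where *: "a \<in> A" "z \<ominus> a \<in> B" by auto
  have "a \<in> carrier R" using * ideal_mem_carrier[OF assms(1)] by simp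
  then have "z = a \<oplus> (z \<ominus> a)" using assms(3) by algebra
  then show "z \<in> A <+> B" using set_addI[OF *] by simp
qed

lemma ideal_of_take_Suc:
  assumes "set as \<subseteq> carrier R" "i < length as"
  shows "ideal_of R (take (Suc i) as) = ideal_of R (take i as) <+> PIdl (as ! i)"
  using assms by (simp add: take_Suc_conv_app_nth adjoin_append)

context
  fixes I as
  assumes I: "ideal I R" and as: "set as \<subseteq> I"
    and reg: "forms_regular R I (\<lambda>n. ipow R I (Suc n)) as"
begin

private lemma as_carrier: "set as \<subseteq> carrier R"
  using as ideal_subset_carrier[OF I] by auto

private lemma take_ideal: "ideal (ideal_of R (take i as)) R"
  using as_carrier set_take_subset[of i as] by (intro ideal_of_ideal) auto

private lemma regD:
  assumes "i < length as" "b \<in> ipow R I n"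
    "as ! i \<otimes> b \<in> ipow R I (Suc (Suc n)) <+> ideal_of R (take i as) \<cdot> ipow R I n"
  obtains b' where "b' \<in> ipow R I (Suc n)" "b \<ominus> b' \<in> ideal_of R (take i as)"
proof -
  let ?L = "ideal_of R (take i as)"
  have "b \<in> ipow R I (Suc n) <+> shifted R ?L I n"
    using reg assms unfolding forms_regular_def by simp
  then obtain b' where "b' \<in> ipow R I (Suc n)" "b \<ominus> b' \<in> shifted R ?L I n"
    using mem_add_diff[OF ipow_ideal[OF I] shifted_ideal[OF take_ideal I]]
      ideal_mem_carrier[OF ipow_ideal[OF I] assms(2)] by auto
  then show ?thesis using that shifted_subset[OF take_ideal I] by auto
qed

text \<open>Let L be the ideal of the first i elements and a the next one. For z = a e modulo L with
  z in I^(n+1), the coefficient e is pushed into deeper powers: with e in I^k, the induction on i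
  gives z - a e in L I^k, so the form of a kills that of e modulo the earlier forms, and regularity
  replaces e by an element of I^(k+1).\<close>

lemma valabrega_valla:
  assumes "i \<le> length as"
  shows "ideal_of R (take i as) \<inter> ipow R I (Suc n) \<subseteq> ideal_of R (take i as) \<cdot> ipow R I n"
  using assms
proof (induction i arbitrary: n)
  case 0
  have "\<zero> \<in> {\<zero>} \<cdot> ipow R I n" using I by (intro ideal_zero_mem ideal_prod_is_ideal zeroideal ipow_ideal)
  then show ?case by auto
next
  case (Suc i)
  then have i: "i < length as" by simp
  let ?L = "ideal_of R (take i as)" and ?a = "as ! i"
  have idI: "ideal (ipow R I k) R" for k using I by (rule ipow_ideal)
  have aI: "?a \<in> I" "?a \<in> carrier R" using i as as_carrier by auto
  show ?case
  proof
    fix z assume "z \<in> ideal_of R (take (Suc i) as) \<inter> ipow R I (Suc n)"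
    then have z: "z \<in> ?L <+> PIdl ?a" "z \<in> ipow R I (Suc n)" "z \<in> carrier R"
      using ideal_of_take_Suc[OF as_carrier i] ideal_mem_carrier[OF idI] by auto
    have diff: "z \<ominus> ?a \<otimes> e \<in> ?L \<cdot> ipow R I k" if "e \<in> ipow R I k" "z \<ominus> ?a \<otimes> e \<in> ?L" "k \<le> n" for e k
    proof -
      have "z \<in> ipow R I (Suc k)" using ipow_antimono[OF I, of "Suc k" "Suc n"] that(3) z(2) by auto
      moreover have "?a \<otimes> e \<in> ipow R I (Suc k)" using ideal_prod.prod[OF aI(1) that(1), of R] ipow_Suc2[OF I] by simp
      ultimately have "z \<ominus> ?a \<otimes> e \<in> ipow R I (Suc k)" by (rule ideal_diff_mem[OF idI])
      then show ?thesis using Suc.IH[of k] i that(2) by auto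
    qed
    have "\<exists>e\<in>ipow R I k. z \<ominus> ?a \<otimes> e \<in> ?L" if "k \<le> n" for k
      using that
    proof (induction k)
      case 0
      then show ?case using z(1) mem_add_cgenideal'[OF take_ideal aI(2) z(3)] by simp
    next
      case (Suc k)
      then obtain e where e: "e \<in> ipow R I k" "z \<ominus> ?a \<otimes> e \<in> ?L" by auto
      have ec: "e \<in> carrier R" using e ideal_mem_carrier[OF idI] by auto
      have "z \<ominus> ?a \<otimes> e \<in> ?L \<cdot> ipow R I k" using diff[OF e] Suc.prems by simp
      then have "\<ominus> (z \<ominus> ?a \<otimes> e) \<in> ?L \<cdot> ipow R I k"
        by (rule ideal_inv_mem[OF ideal_prod_is_ideal[OF take_ideal idI]])
      moreover have "\<ominus> (z \<ominus> ?a \<otimes> e) = ?a \<otimes> e \<ominus> z" using z(3) ec aI by algebra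
      moreover have "z \<in> ipow R I (Suc (Suc k))"
        using ipow_antimono[OF I, of "Suc (Suc k)" "Suc n"] Suc.prems z(2) by auto
      ultimately have "?a \<otimes> e \<in> ipow R I (Suc (Suc k)) <+> ?L \<cdot> ipow R I k"
        using mem_add_diff[OF idI ideal_prod_is_ideal[OF take_ideal idI]] aI ec by auto
      then obtain e' where e': "e' \<in> ipow R I (Suc k)" "e \<ominus> e' \<in> ?L" using regD[OF i e(1)] by auto
      have e'c: "e' \<in> carrier R" using e' ideal_mem_carrier[OF idI] by auto
      have "z \<ominus> ?a \<otimes> e' = (z \<ominus> ?a \<otimes> e) \<oplus> ?a \<otimes> (e \<ominus> e')" using z(3) ec e'c aI(2) by algebra
      also have "\<dots> \<in> ?L"
        by (rule ideal_add_mem[OF take_ideal e(2) ideal_mult_mem[OF take_ideal e'(2) aI(2)]])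
      finally show ?case using e'(1) by auto
    qed
    then obtain e where e: "e \<in> ipow R I n" "z \<ominus> ?a \<otimes> e \<in> ?L" by auto
    have ec: "e \<in> carrier R" using e ideal_mem_carrier[OF idI] by auto
    have "(z \<ominus> ?a \<otimes> e) \<oplus> ?a \<otimes> e \<in> ?L \<cdot> ipow R I n <+> (PIdl ?a) \<cdot> ipow R I n"
      using diff[OF e] cgenideal_prodI[OF idI aI(2) e(1)] by (intro set_addI) simp_all
    moreover have "(z \<ominus> ?a \<otimes> e) \<oplus> ?a \<otimes> e = z" using z(3) ec aI(2) by algebra
    ultimately show "z \<in> ideal_of R (take (Suc i) as) \<cdot> ipow R I n"
      using ideal_of_take_Suc[OF as_carrier i] ideal_prod_distr(2)[OF idI take_ideal cgenideal_ideal[OF aI(2)]] by simp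
  qed
qed

text \<open>The same deepening of powers: \<open>valabrega_valla\<close> sharpens a relation modulo
  L to one modulo L I^k, to which the regularity of the form of a applies.\<close>

lemma form_nzd_mod:
  assumes i: "i < length as" and e: "e \<in> carrier R"
    and ae: "as ! i \<otimes> e \<in> ipow R I (Suc n) <+> ideal_of R (take i as)"
  obtains e' where "e' \<in> ipow R I n" "e \<ominus> e' \<in> ideal_of R (take i as)"
proof -
  let ?L = "ideal_of R (take i as)" and ?a = "as ! i"
  have idI: "ideal (ipow R I k) R" for k using I by (rule ipow_ideal)
  have aI: "?a \<in> I" "?a \<in> carrier R" using i as as_carrier by auto
  obtain z where z: "z \<in> ipow R I (Suc n)" "?a \<otimes> e \<ominus> z \<in> ?L"
    using ae mem_add_diff[OF idI take_ideal, of "?a \<otimes> e"] e aI by auto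
  have zc: "z \<in> carrier R" using z ideal_mem_carrier[OF idI] by auto
  have "\<exists>e'\<in>ipow R I k. e \<ominus> e' \<in> ?L" if "k \<le> n" for k
    using that
  proof (induction k)
    case 0
    have "e \<ominus> e = \<zero>" using e by algebra
    then have "e \<ominus> e \<in> ?L" using ideal_zero_mem[OF take_ideal] by simp
    then show ?case using e by (intro bexI[of _ e]) simp_all
  next
    case (Suc k)
    then obtain e' where e': "e' \<in> ipow R I k" "e \<ominus> e' \<in> ?L" by auto
    have e'c: "e' \<in> carrier R" using e' ideal_mem_carrier[OF idI] by auto
    have "?a \<otimes> e' \<ominus> z = (?a \<otimes> e \<ominus> z) \<ominus> ?a \<otimes> (e \<ominus> e')" using e e'c aI(2) zc by algebra
    also have "\<dots> \<in> ?L"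
      by (rule ideal_diff_mem[OF take_ideal z(2) ideal_mult_mem[OF take_ideal e'(2) aI(2)]])
    finally have 1: "?a \<otimes> e' \<ominus> z \<in> ?L" .
    have "?a \<otimes> e' \<in> ipow R I (Suc k)" using ideal_prod.prod[OF aI(1) e'(1), of R] ipow_Suc2[OF I] by simp
    moreover have "z \<in> ipow R I (Suc k)" using ipow_antimono[OF I, of "Suc k" "Suc n"] Suc.prems z(1) by auto
    ultimately have "?a \<otimes> e' \<ominus> z \<in> ipow R I (Suc k)" by (rule ideal_diff_mem[OF idI])
    then have "?a \<otimes> e' \<ominus> z \<in> ?L \<cdot> ipow R I k" using valabrega_valla[of i k] 1 i by auto
    moreover have "z \<in> ipow R I (Suc (Suc k))" using ipow_antimono[OF I, of "Suc (Suc k)" "Suc n"] Suc.prems z(1) by auto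
    ultimately have "?a \<otimes> e' \<in> ipow R I (Suc (Suc k)) <+> ?L \<cdot> ipow R I k"
      using mem_add_diff[OF idI ideal_prod_is_ideal[OF take_ideal idI], of "?a \<otimes> e'"] aI e'c by auto
    then obtain e'' where e'': "e'' \<in> ipow R I (Suc k)" "e' \<ominus> e'' \<in> ?L" using regD[OF i e'(1)] by auto
    have e''c: "e'' \<in> carrier R" using e'' ideal_mem_carrier[OF idI] by auto
    have "e \<ominus> e'' = (e \<ominus> e') \<oplus> (e' \<ominus> e'')" using e e'c e''c by algebra
    also have "\<dots> \<in> ?L" by (rule ideal_add_mem[OF take_ideal e'(2) e''(2)])
    finally show ?case using e''(1) by auto
  qed
  then show ?thesis using that by auto
qed

end

end

context noetherian_local
begin

text \<open>Multiply by I and substitute M I = x I + M J into the term I M J^(n+1).\<close>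

lemma fiber_product_power:
  assumes I: "ideal I R" and x: "x \<in> carrier R" and J: "ideal J R" "J \<subseteq> I"
    and MI: "M \<cdot> I = (PIdl x) \<cdot> I <+> M \<cdot> J"
  shows "M \<cdot> ipow R I (Suc n) \<subseteq> (PIdl x) \<cdot> ipow R I (Suc n) <+> M \<cdot> ipow R J (Suc n)"
proof (induction n)
  case 0
  then show ?case using MI I J by simp
next
  case (Suc n)
  have idx: "ideal (PIdl x) R" using x by (rule cgenideal_ideal)
  have id1: "ideal (ipow R I k) R" "ideal (ipow R J k) R" for k using I J by (auto intro: ipow_ideal)
  have id2: "ideal ((PIdl x) \<cdot> ipow R I k) R" "ideal (M \<cdot> ipow R J k) R" for k
    using idx id1 M_ideal by (auto intro: ideal_prod_is_ideal)
  let ?C = "(PIdl x) \<cdot> ipow R I (Suc (Suc n)) <+> M \<cdot> ipow R J (Suc (Suc n))"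
  have idC: "ideal ?C R" using id2 by (intro add_ideals)
  have up: "(PIdl x) \<cdot> ipow R I (Suc (Suc n)) \<subseteq> ?C" "M \<cdot> ipow R J (Suc (Suc n)) \<subseteq> ?C"
    using set_add_upper1[OF id2] set_add_upper2[OF id2] by simp_all
  have "M \<cdot> ipow R I (Suc (Suc n)) = I \<cdot> (M \<cdot> ipow R I (Suc n))"
    using ideal_prod_left_comm[OF I M_ideal id1(1)] ipow_Suc2[OF I, of "Suc n"] by simp
  also have "\<dots> \<subseteq> I \<cdot> ((PIdl x) \<cdot> ipow R I (Suc n) <+> M \<cdot> ipow R J (Suc n))"
    using Suc by (intro ideal_prod_mono subset_refl)
  also have "\<dots> = I \<cdot> ((PIdl x) \<cdot> ipow R I (Suc n)) <+> I \<cdot> (M \<cdot> ipow R J (Suc n))"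
    by (rule ideal_prod_distr(1)[OF I id2])
  also have "\<dots> = (PIdl x) \<cdot> ipow R I (Suc (Suc n)) <+> ipow R J (Suc n) \<cdot> (M \<cdot> I)"
  proof -
    have "I \<cdot> ((PIdl x) \<cdot> ipow R I (Suc n)) = (PIdl x) \<cdot> ipow R I (Suc (Suc n))"
      using ideal_prod_left_comm[OF I idx id1(1)] ipow_Suc2[OF I, of "Suc n"] by simp
    moreover have "I \<cdot> (M \<cdot> ipow R J (Suc n)) = ipow R J (Suc n) \<cdot> (M \<cdot> I)"
      by (simp add: ideal_prod_ac I M_ideal id1 ideal_prod_is_ideal)
    ultimately show ?thesis by simp
  qed
  also have "\<dots> \<subseteq> ?C"
  proof (rule set_add_least[OF idC up(1)])
    have "ipow R J (Suc n) \<cdot> (M \<cdot> I) =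
        ipow R J (Suc n) \<cdot> ((PIdl x) \<cdot> I) <+> ipow R J (Suc n) \<cdot> (M \<cdot> J)"
      unfolding MI by (rule ideal_prod_distr(1)[OF id1(2) ideal_prod_is_ideal[OF idx I] ideal_prod_is_ideal[OF M_ideal J(1)]])
    also have "ipow R J (Suc n) \<cdot> ((PIdl x) \<cdot> I) = (PIdl x) \<cdot> (ipow R J (Suc n) \<cdot> I)"
      by (rule ideal_prod_left_comm[OF id1(2) idx I])
    also have "ipow R J (Suc n) \<cdot> (M \<cdot> J) = M \<cdot> ipow R J (Suc (Suc n))"
      using ideal_prod_left_comm[OF id1(2)[of "Suc n"] M_ideal J(1)] ipow_Suc[of J "Suc n"] by simp
    also have "(PIdl x) \<cdot> (ipow R J (Suc n) \<cdot> I) <+> M \<cdot> ipow R J (Suc (Suc n)) \<subseteq> ?C"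
    proof (intro set_add_mono ideal_prod_mono subset_refl)
      show "ipow R J (Suc n) \<cdot> I \<subseteq> ipow R I (Suc (Suc n))"
        unfolding ipow_Suc[of I "Suc n"] using J(2) by (intro ideal_prod_mono ipow_mono subset_refl)
    qed
    finally show "ipow R J (Suc n) \<cdot> (M \<cdot> I) \<subseteq> ?C" .
  qed
  finally show ?case .
qed

text \<open>Let L and J2 be the ideals of the elements before and after a, and T = L + J2^(n+1).
  Then a b = x c + a m' modulo T with c in I^(n+1) and m' in M I^n. Regularity of x modulo T + (a)
  gives c = a e modulo T, \<open>form_nzd_mod\<close> replaces e by some e' in I^n modulo L, and
  cancelling a leaves b = m' + x e' modulo T with m' and x e' in M I^n.\<close>

lemma forms_regular_fiber:
  assumes I: "ideal I R" and IM: "I \<subseteq> M" and x: "x \<in> M" and as: "set as \<subseteq> I" "t \<le> length as"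
    and perm: "permutable_mod R {\<zero>} (x # as)" and MI: "M \<cdot> I = (PIdl x) \<cdot> I <+> M \<cdot> ideal_of R as"
    and reg: "forms_regular R I (\<lambda>n. ipow R I (Suc n)) (take t as)"
  shows "forms_regular R I (\<lambda>n. M \<cdot> ipow R I n) (take t as)"
  unfolding forms_regular_def
proof (intro allI ballI impI)
  fix i n b
  assume i: "i < length (take t as)" and b: "b \<in> ipow R I n"
    and ab: "take t as ! i \<otimes> b \<in> M \<cdot> ipow R I (Suc n) <+> ideal_of R (take i (take t as)) \<cdot> ipow R I n"
  let ?L = "ideal_of R (take i (take t as))"
  define a where "a = as ! i"
  define J2 where "J2 = ideal_of R (drop (Suc i) as)"
  define J where "J = ideal_of R as"
  have it: "i < t" "i < length as" using i by auto
  then have tk: "take i (take t as) = take i as" "take t as ! i = a" by (simp_all add: a_def min_def)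
  have split: "as = take i as @ a # drop (Suc i) as" unfolding a_def using it(2) by (rule id_take_nth_drop)
  have Ic: "I \<subseteq> carrier R" using I by (rule ideal_subset_carrier)
  have as_t: "set (take t as) \<subseteq> I" using as set_take_subset[of t as] by auto
  have aI: "a \<in> I" unfolding a_def using as it by auto
  have seti: "set (take i as) \<subseteq> I" "set (drop (Suc i) as) \<subseteq> I"
    using as set_take_subset[of i as] set_drop_subset[of "Suc i" as] by auto
  have sets: "set (take i as) \<subseteq> carrier R" "set (drop (Suc i) as) \<subseteq> carrier R" "a \<in> carrier R"
    "x \<in> carrier R" "set as \<subseteq> carrier R"
    using seti aI Ic ideal_mem_carrier[OF M_ideal x] as by auto
  define L where "L = ideal_of R (take i as)"
  have LL: "?L = L" unfolding L_def tk(1) ..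
  have idL: "ideal L R" unfolding L_def using sets by (intro ideal_of_ideal)
  have idJ2: "ideal J2 R" unfolding J2_def using sets by (intro ideal_of_ideal)
  have idJ: "ideal J R" unfolding J_def using sets by (intro ideal_of_ideal)
  have idI: "ideal (ipow R I k) R" for k using I by (rule ipow_ideal)
  have ida: "ideal (PIdl a) R" using sets by (intro cgenideal_ideal)
  have zI: "{\<zero>} \<subseteq> I" using ideal_zero_mem[OF I] by simp
  have sub: "L \<subseteq> I" "J2 \<subseteq> I" "J \<subseteq> I"
    unfolding L_def J2_def J_def
    using adjoin_least[OF zeroideal seti(1) zI I] adjoin_least[OF zeroideal seti(2) zI I]
      adjoin_least[OF zeroideal as(1) zI I] by simp_all
  have xJ: "M \<cdot> ipow R I (Suc n) \<subseteq> (PIdl x) \<cdot> ipow R I (Suc n) <+> M \<cdot> ipow R J (Suc n)"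
    using fiber_product_power[OF I sets(4) idJ sub(3)] MI unfolding J_def .
  define B where "B = PIdl a <+> J2"
  have idB: "ideal B R" unfolding B_def using ida idJ2 by (rule add_ideals)
  have JLB: "J = L <+> B"
  proof -
    have "J = ideal_of R (take i as @ (a # drop (Suc i) as))" unfolding J_def using split by simp
    also have "\<dots> = L <+> ideal_of R (a # drop (Suc i) as)"
      unfolding L_def using sets by (intro ideal_of_append) auto
    also have "ideal_of R (a # drop (Suc i) as) = B" unfolding B_def J2_def using sets by (intro ideal_of_Cons)
    finally show ?thesis .
  qed
  \<comment> \<open>T may be discarded at the end: L is the ideal being factored out, and J2^(n+1)
    lies in M I^n.\<close>
  define T where "T = L <+> ipow R J2 (Suc n)"
  have idT: "ideal T R" unfolding T_def using idL idJ2 by (intro add_ideals ipow_ideal)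
  have LT: "L \<subseteq> T" "ipow R J2 (Suc n) \<subseteq> T"
    unfolding T_def using set_add_upper1[OF idL ipow_ideal[OF idJ2]] set_add_upper2[OF idL ipow_ideal[OF idJ2]] by simp_all
  have BI: "B \<subseteq> I" unfolding B_def using aI sub I by (intro set_add_least cgenideal_minimal)
  have idMI: "ideal (M \<cdot> ipow R I n) R" using M_ideal idI by (rule ideal_prod_is_ideal)
  have idaM: "ideal ((PIdl a) \<cdot> (M \<cdot> ipow R I n)) R" using ida idMI by (rule ideal_prod_is_ideal)
  \<comment> \<open>A product in J^(n+1) has a factor from L, or a factor a, or all its factors in
    J2.\<close>
  have MJ: "M \<cdot> ipow R J (Suc n) \<subseteq> T <+> (PIdl a) \<cdot> (M \<cdot> ipow R I n)"
  proof -
    let ?S = "T <+> (PIdl a) \<cdot> (M \<cdot> ipow R I n)"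
    have idS: "ideal ?S R" using idT idaM by (rule add_ideals)
    have TS: "T \<subseteq> ?S" "(PIdl a) \<cdot> (M \<cdot> ipow R I n) \<subseteq> ?S"
      using set_add_upper1[OF idT idaM] set_add_upper2[OF idT idaM] by simp_all
    have i1: "ideal (L \<cdot> ipow R J n) R" using idL idJ by (intro ideal_prod_is_ideal ipow_ideal)
    have i2: "ideal ((PIdl a) \<cdot> ipow R B n) R" using ida idB by (intro ideal_prod_is_ideal ipow_ideal)
    have i3: "ideal (ipow R J2 (Suc n)) R" using idJ2 by (rule ipow_ideal)
    have "ipow R J (Suc n) = L \<cdot> ipow R J n <+> ipow R B (Suc n)"
      unfolding JLB by (rule ipow_add_Suc[OF idL idB])
    also have "ipow R B (Suc n) = (PIdl a) \<cdot> ipow R B n <+> ipow R J2 (Suc n)"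
      unfolding B_def by (rule ipow_add_Suc[OF ida idJ2])
    finally have "M \<cdot> ipow R J (Suc n) =
        M \<cdot> (L \<cdot> ipow R J n) <+> (M \<cdot> ((PIdl a) \<cdot> ipow R B n) <+> M \<cdot> ipow R J2 (Suc n))"
      using ideal_prod_distr(1)[OF M_ideal i1 add_ideals[OF i2 i3]] ideal_prod_distr(1)[OF M_ideal i2 i3] by simp
    also have "\<dots> \<subseteq> ?S"
    proof (intro set_add_least idS)
      have "M \<cdot> (L \<cdot> ipow R J n) \<subseteq> L \<cdot> ipow R J n" using ideal_prod_subset_right[OF M_ideal i1] .
      also have "\<dots> \<subseteq> L" using idL idJ by (intro ideal_prod_subset_left ipow_ideal)
      finally show "M \<cdot> (L \<cdot> ipow R J n) \<subseteq> ?S" using LT TS by auto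
      have "M \<cdot> ((PIdl a) \<cdot> ipow R B n) = (PIdl a) \<cdot> (M \<cdot> ipow R B n)"
        using ideal_prod_left_comm[OF M_ideal ida ipow_ideal[OF idB]] .
      also have "\<dots> \<subseteq> (PIdl a) \<cdot> (M \<cdot> ipow R I n)" using BI by (intro ideal_prod_mono ipow_mono subset_refl)
      finally show "M \<cdot> ((PIdl a) \<cdot> ipow R B n) \<subseteq> ?S" using TS by auto
      show "M \<cdot> ipow R J2 (Suc n) \<subseteq> ?S" using ideal_prod_subset_right[OF M_ideal i3] LT TS by auto
    qed
    finally show ?thesis .
  qed
  have bc: "b \<in> carrier R" using b ideal_mem_carrier[OF idI] by simp
  obtain u l where ul: "u \<in> M \<cdot> ipow R I (Suc n)" "l \<in> L \<cdot> ipow R I n" "a \<otimes> b = u \<oplus> l"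
    using ab unfolding tk L_def by (auto simp: mem_set_add)
  have lL: "l \<in> T" using ul(2) ideal_prod_subset_left[OF idL idI] LT by auto
  obtain u1 u2 where u12: "u1 \<in> (PIdl x) \<cdot> ipow R I (Suc n)" "u2 \<in> M \<cdot> ipow R J (Suc n)" "u = u1 \<oplus> u2"
    using subsetD[OF xJ ul(1)] by (auto simp: mem_set_add)
  obtain c where c: "c \<in> ipow R I (Suc n)" "u1 = x \<otimes> c"
    using u12(1) mem_cgenideal_prod[OF idI sets(4)] by auto
  obtain w v where wv: "w \<in> T" "v \<in> (PIdl a) \<cdot> (M \<cdot> ipow R I n)" "u2 = w \<oplus> v"
    using subsetD[OF MJ u12(2)] by (auto simp: mem_set_add)
  obtain m' where m': "m' \<in> M \<cdot> ipow R I n" "v = a \<otimes> m'"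
    using wv(2) mem_cgenideal_prod[OF idMI sets(3)] by auto
  have cc: "c \<in> carrier R" "m' \<in> carrier R" "w \<in> carrier R" "l \<in> carrier R"
    using c(1) m'(1) wv(1) lL ideal_mem_carrier[OF idI] ideal_mem_carrier[OF idMI] ideal_mem_carrier[OF idT] by auto
  have ab': "a \<otimes> b = (x \<otimes> c \<oplus> (w \<oplus> a \<otimes> m')) \<oplus> l" using ul(3) u12(3) c(2) wv(3) m'(2) by simp
  have abT: "a \<otimes> b \<ominus> x \<otimes> c \<ominus> a \<otimes> m' \<in> T"
  proof -
    have "a \<otimes> b \<ominus> x \<otimes> c \<ominus> a \<otimes> m' = w \<oplus> l" unfolding ab' using cc sets(3,4) by algebra
    then show ?thesis using ideal_add_mem[OF idT wv(1) lL] by simp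
  qed
  \<comment> \<open>Two orders are needed: x directly after a for its regularity modulo T + (a), and
    x at the very end for the regularity of a modulo T.\<close>
  have perm_i: "mset (x # as) = mset ((take i as @ [a]) @ (x # drop (Suc i) as))"
    by (subst split) simp
  have adj: "adjoin R {\<zero>} (take i as @ [a]) = L <+> PIdl a" by (simp add: adjoin_append L_def)
  have nzd_x: "nzd_mod R ((L <+> PIdl a) <+> ipow R J2 (Suc n)) x"
    unfolding J2_def
    using permutable_mod_right[OF perm perm_i] adj sets idL ida
    by (intro nzd_mod_ipow) (simp_all add: add_ideals)
  have perm_i': "mset (x # as) = mset (take i as @ (a # drop (Suc i) as @ [x]))"
    by (subst split) simp
  have "permutable_mod R L (a # drop (Suc i) as)"
    using permutable_mod_left[OF permutable_mod_right[OF perm perm_i'], of "a # drop (Suc i) as" "[x]"] by (simp add: L_def)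
  then have nzd_a: "nzd_mod R T a"
    unfolding T_def J2_def using sets idL by (intro nzd_mod_ipow) simp_all
  have eqT: "(L <+> PIdl a) <+> ipow R J2 (Suc n) = T <+> PIdl a"
    unfolding T_def using idL ida ipow_ideal[OF idJ2, of "Suc n"] by (simp add: ideal_add_ac)
  have "x \<otimes> c \<ominus> a \<otimes> (b \<ominus> m') = \<ominus> (a \<otimes> b \<ominus> x \<otimes> c \<ominus> a \<otimes> m')" using cc bc sets(3,4) by algebra
  then have "x \<otimes> c \<ominus> a \<otimes> (b \<ominus> m') \<in> T" using ideal_inv_mem[OF idT abT] by simp
  then have "x \<otimes> c \<in> T <+> PIdl a"
    using mem_add_cgenideal'[OF idT sets(3), of "x \<otimes> c"] cc bc sets(4) by auto
  then have "c \<in> T <+> PIdl a" using nzd_modD[OF nzd_x cc(1)] unfolding eqT by simp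
  then obtain e where e: "e \<in> carrier R" "c \<ominus> a \<otimes> e \<in> T"
    using mem_add_cgenideal'[OF idT sets(3) cc(1)] by auto
  \<comment> \<open>a e differs from c, which lies in I^(n+1), by an element of T, and T \<subseteq>
    I^(n+1) + L.\<close>
  have "a \<otimes> e \<in> ipow R I (Suc n) <+> L"
  proof -
    have idS: "ideal (ipow R I (Suc n) <+> L) R" using idI idL by (rule add_ideals)
    have "ipow R J2 (Suc n) \<subseteq> ipow R I (Suc n)" using sub by (intro ipow_mono)
    then have "T \<subseteq> ipow R I (Suc n) <+> L"
      unfolding T_def using idS set_add_upper1[OF idI idL, of "Suc n"] set_add_upper2[OF idI idL, of "Suc n"]
      by (intro set_add_least) auto
    then have "c \<ominus> (c \<ominus> a \<otimes> e) \<in> ipow R I (Suc n) <+> L"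
      using ideal_diff_mem[OF idS set_add_left[OF idI idL c(1)]] e(2) by (simp only: subset_iff)
    moreover have "c \<ominus> (c \<ominus> a \<otimes> e) = a \<otimes> e" using cc e(1) sets(3) by algebra
    ultimately show ?thesis by simp
  qed
  then obtain e' where e': "e' \<in> ipow R I n" "e \<ominus> e' \<in> L"
    using form_nzd_mod[OF I as_t reg i e(1), of n] unfolding tk L_def by auto
  have e'c: "e' \<in> carrier R" using e'(1) ideal_mem_carrier[OF idI] by simp
  have "a \<otimes> (b \<ominus> m' \<ominus> x \<otimes> e') =
      (a \<otimes> b \<ominus> x \<otimes> c \<ominus> a \<otimes> m') \<oplus> x \<otimes> ((c \<ominus> a \<otimes> e) \<oplus> a \<otimes> (e \<ominus> e'))"
    using cc bc e(1) e'c sets(3,4) by algebra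
  also have "\<dots> \<in> T"
    using abT e(2) e'(2) LT sets(3,4) by (intro ideal_add_mem[OF idT] ideal_mult_mem[OF idT]) auto
  finally have "b \<ominus> m' \<ominus> x \<otimes> e' \<in> T"
    using nzd_modD[OF nzd_a, of "b \<ominus> m' \<ominus> x \<otimes> e'"] bc cc e'c sets(4) by simp
  then obtain l2 g where lg: "l2 \<in> L" "g \<in> ipow R J2 (Suc n)" "b \<ominus> m' \<ominus> x \<otimes> e' = l2 \<oplus> g"
    unfolding T_def by (auto simp: mem_set_add)
  have lgc: "l2 \<in> carrier R" "g \<in> carrier R"
    using lg ideal_mem_carrier[OF idL] ideal_mem_carrier[OF ipow_ideal[OF idJ2]] by auto
  define y where "y = m' \<oplus> x \<otimes> e' \<oplus> g"
  have yc: "y \<in> carrier R" unfolding y_def using cc e'c lgc sets(4) by simp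
  have "b = (b \<ominus> m' \<ominus> x \<otimes> e') \<oplus> (m' \<oplus> x \<otimes> e')" using bc cc e'c sets(4) by algebra
  also have "\<dots> = y \<oplus> l2" unfolding lg(3) y_def using cc e'c lgc sets(4) by algebra
  finally have by2: "b = y \<oplus> l2" .
  have "g \<in> M \<cdot> ipow R I n"
  proof -
    have "ipow R J2 (Suc n) \<subseteq> J2 \<cdot> ipow R J2 n" using ipow_Suc2[OF idJ2] by simp
    also have "\<dots> \<subseteq> M \<cdot> ipow R I n" using sub IM by (intro ideal_prod_mono ipow_mono) auto
    finally show ?thesis using lg by auto
  qed
  then have yM: "y \<in> M \<cdot> ipow R I n"
    unfolding y_def using m'(1) ideal_prod.prod[OF x e'(1), of R] by (intro ideal_add_mem[OF idMI])
  have "b \<in> M \<cdot> ipow R I n <+> shifted R L I n"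
  \<comment> \<open>In degree 0 the shifted ideal is zero, but then M I^n is M and contains
    L.\<close>
  proof (cases n)
    case 0
    have LM: "L \<subseteq> M" using sub IM by auto
    have MM: "M \<cdot> ipow R I n = M" using 0 ideal_prod_one[OF M_ideal] by simp
    have "b \<in> M" unfolding by2 using yM LM lg(1) MM by (intro ideal_add_mem[OF M_ideal]) auto
    then show ?thesis unfolding MM unfolding 0 using ideal_add_zero[OF M_ideal] by simp
  next
    \<comment> \<open>The L-part of b lies in L \<inter> I^n, which \<open>valabrega_valla\<close>
      sharpens to L I^(n-1).\<close>
    case (Suc k)
    have "y \<in> ipow R I n" using yM ideal_prod_subset_right[OF M_ideal idI] by auto
    then have "b \<ominus> y \<in> ipow R I n" by (rule ideal_diff_mem[OF idI b])
    moreover have "b \<ominus> y = l2" unfolding by2 using yc lgc by algebra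
    ultimately have "l2 \<in> ideal_of R (take i (take t as)) \<inter> ipow R I (Suc k)" using lg(1) Suc LL by simp
    then have "l2 \<in> L \<cdot> ipow R I k" using valabrega_valla[OF I as_t reg, of i k] i LL by auto
    then show ?thesis unfolding by2 Suc using yM Suc by (intro set_addI) simp_all
  qed
  then show "b \<in> M \<cdot> ipow R I n <+> shifted R (ideal_of R (take i (take t as))) I n"
    unfolding LL .
qed

end

section \<open>The graded ring of a filtration\<close>

lemma (in cring) nonzerodivisor_Quot_iff:
  assumes J: "ideal J R" and y: "y \<in> carrier R"
  shows "nonzerodivisor (R Quot J) (J +> y) \<longleftrightarrow> nzd_mod R J y"
proof -
  have car: "carrier (R Quot J) = (\<lambda>z. J +> z) ` carrier R"
    by (auto simp: FactRing_def A_RCOSETS_def' a_r_coset_def')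
  have "(J +> y) \<otimes>\<^bsub>R Quot J\<^esub> (J +> z) = \<zero>\<^bsub>R Quot J\<^esub> \<longleftrightarrow> y \<otimes> z \<in> J" if "z \<in> carrier R" for z
    using coset_mult[OF J y that] coset_eq_self_iff[OF J, of "y \<otimes> z"] y that by (simp add: FactRing_def)
  moreover have "J +> z = \<zero>\<^bsub>R Quot J\<^esub> \<longleftrightarrow> z \<in> J" if "z \<in> carrier R" for z
    using coset_eq_self_iff[OF J that] by (simp add: FactRing_def)
  ultimately show ?thesis
    unfolding nonzerodivisor_def nzd_mod_def car using y by auto
qed

lemma (in cring) ideal_of_eq_Idl: "set ys \<subseteq> carrier R \<Longrightarrow> ideal_of R ys = Idl (set ys)"
  by (simp add: adjoin_eq_Idl zeroideal zero_add_ideal genideal_ideal)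

lemma (in cring) regular_sequence_iff:
  assumes "set ys \<subseteq> carrier R"
  shows "regular_sequence R ys \<longleftrightarrow> regular_mod R {\<zero>} ys \<and> ideal_of R ys \<noteq> carrier R"
proof -
  have "nonzerodivisor (R Quot Idl (set (take i ys))) (Idl (set (take i ys)) +> (ys ! i)) \<longleftrightarrow>
      nzd_mod R (ideal_of R (take i ys)) (ys ! i)" if "i < length ys" for i
  proof -
    have s: "set (take i ys) \<subseteq> carrier R" using assms set_take_subset[of i ys] by auto
    have "ys ! i \<in> carrier R" using assms that by auto
    then show ?thesis
      using nonzerodivisor_Quot_iff[OF genideal_ideal[OF s]] ideal_of_eq_Idl[OF s] by simp
  qed
  then show ?thesis
    unfolding regular_sequence_def regular_mod_iff_nth using assms ideal_of_eq_Idl[OF assms] by (simp add: Let_def)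
qed

text \<open>Covers I^(n+1) and M I^n together, so that G(I) and F(I) share all that follows.\<close>

locale rees_filtration = cring R for R (structure) +
  fixes I :: "'a set" and K :: "nat \<Rightarrow> 'a set"
  assumes I: "ideal I R" and K: "\<And>n. ideal (K n) R" and K_sub: "\<And>n. K n \<subseteq> ipow R I n"
    and K_mult: "\<And>i j. ipow R I i \<cdot> K j \<subseteq> K (i + j)"
begin

abbreviation G where "G \<equiv> graded_ring R I K"

text \<open>The Rees algebra as a set of polynomials over R. The graded ring is its image under
  \<open>form_seq\<close>, so the ring laws can be taken from \<open>UP R\<close>.\<close>

definition rees :: "(nat \<Rightarrow> 'a) set"
  where "rees = {u \<in> up R. \<forall>n. u n \<in> ipow R I n}"

definition form_seq :: "(nat \<Rightarrow> 'a) \<Rightarrow> nat \<Rightarrow> 'a set"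
  where "form_seq u = (\<lambda>n. K n +> u n)"

definition conv :: "(nat \<Rightarrow> 'a) \<Rightarrow> (nat \<Rightarrow> 'a) \<Rightarrow> nat \<Rightarrow> 'a"
  where "conv u v = (\<lambda>n. \<Oplus>i\<in>{..n}. u i \<otimes> v (n - i))"

definition homog :: "nat \<Rightarrow> 'a \<Rightarrow> nat \<Rightarrow> 'a"
  where "homog n a = (\<lambda>k. if k = n then a else \<zero>)"

lemma ipow_I_ideal: "ideal (ipow R I n) R"
  using I by (rule ipow_ideal)

lemma reesD: "u \<in> rees \<Longrightarrow> u n \<in> ipow R I n" "u \<in> rees \<Longrightarrow> u n \<in> carrier R" "u \<in> rees \<Longrightarrow> u \<in> up R"
  by (auto simp: rees_def dest: mem_upD)

lemma homog_rees: "a \<in> ipow R I n \<Longrightarrow> homog n a \<in> rees"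
proof -
  assume a: "a \<in> ipow R I n"
  have ac: "a \<in> carrier R" using a ideal_mem_carrier[OF ipow_I_ideal] by simp
  have "bound \<zero> n (homog n a)" by (rule bound.intro) (simp add: homog_def)
  then have "homog n a \<in> up R" using ac by (intro mem_upI) (auto simp: homog_def)
  then show ?thesis using a ideal_zero_mem[OF ipow_I_ideal] by (auto simp: rees_def homog_def)
qed

lemma UP_is_cring: "cring (UP R)"
  by (rule UP_cring.UP_cring) (simp add: UP_cring_def is_cring)

lemma conv_eq_UP_mult: "u \<in> up R \<Longrightarrow> v \<in> up R \<Longrightarrow> conv u v = u \<otimes>\<^bsub>UP R\<^esub> v"
  by (simp add: UP_def conv_def)

lemma add_eq_UP_add: "u \<in> up R \<Longrightarrow> v \<in> up R \<Longrightarrow> (\<lambda>n. u n \<oplus> v n) = u \<oplus>\<^bsub>UP R\<^esub> v"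
  by (simp add: UP_def)

lemma UP_carrier: "carrier (UP R) = up R"
  by (simp add: UP_def)

lemma rees_conv: "u \<in> rees \<Longrightarrow> v \<in> rees \<Longrightarrow> conv u v \<in> rees"
proof -
  assume u: "u \<in> rees" and v: "v \<in> rees"
  have "conv u v n \<in> ipow R I n" for n
    unfolding conv_def
  proof (rule ideal_finsum_mem[OF ipow_I_ideal])
    fix i assume "i \<in> {..n}"
    then show "u i \<otimes> v (n - i) \<in> ipow R I n"
      using ipow_mult[OF I reesD(1)[OF u] reesD(1)[OF v], of i "n - i"] by simp
  qed
  moreover have "conv u v \<in> up R"
    using cring.cring_simprules(5)[OF UP_is_cring] reesD(3)[OF u] reesD(3)[OF v]
    by (simp add: conv_eq_UP_mult UP_carrier)
  ultimately show ?thesis by (simp add: rees_def)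
qed

lemma rees_add: "u \<in> rees \<Longrightarrow> v \<in> rees \<Longrightarrow> (\<lambda>n. u n \<oplus> v n) \<in> rees"
proof -
  assume u: "u \<in> rees" and v: "v \<in> rees"
  have "(\<lambda>n. u n \<oplus> v n) \<in> up R" using reesD(3)[OF u] reesD(3)[OF v] by (rule up_add_closed)
  then show ?thesis using reesD(1)[OF u] reesD(1)[OF v] by (auto simp: rees_def intro: ideal_add_mem[OF ipow_I_ideal])
qed

lemma rees_minus: "u \<in> rees \<Longrightarrow> (\<lambda>n. \<ominus> u n) \<in> rees"
proof -
  assume u: "u \<in> rees"
  have "(\<lambda>n. \<ominus> u n) \<in> up R" using reesD(3)[OF u] by (rule up_a_inv_closed)
  then show ?thesis using reesD(1)[OF u] by (auto simp: rees_def intro: ideal_inv_mem[OF ipow_I_ideal])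
qed

lemma rees_zero: "(\<lambda>n. \<zero>) \<in> rees"
  using homog_rees[OF ideal_zero_mem[OF ipow_I_ideal], of 0] by (simp add: homog_def)

lemma rees_one: "homog 0 \<one> \<in> rees"
  by (rule homog_rees) simp

lemma form_seq_eq_iff:
  "u \<in> rees \<Longrightarrow> v \<in> rees \<Longrightarrow> form_seq u = form_seq v \<longleftrightarrow> (\<forall>n. u n \<ominus> v n \<in> K n)"
  using coset_eq_iff[OF K reesD(2) reesD(2)] by (simp add: form_seq_def fun_eq_iff)

lemma carrier_G: "carrier G = form_seq ` rees"
proof
  show "form_seq ` rees \<subseteq> carrier G"
  proof
    fix f assume "f \<in> form_seq ` rees"
    then obtain u where u: "u \<in> rees" "f = form_seq u" by auto
    obtain N where N: "bound \<zero> N u" using reesD(3)[OF u(1)] by auto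
    have "n \<le> N" if "f n \<noteq> K n" for n
    proof (rule ccontr)
      assume "\<not> n \<le> N"
      then have "u n = \<zero>" using N by (auto simp: bound_def)
      then have "f n = K n" using u K[of n] by (simp add: form_seq_def ideal_subset_carrier)
      then show False using that by simp
    qed
    then have "{n. f n \<noteq> K n} \<subseteq> {..N}" by auto
    then have "finite {n. f n \<noteq> K n}" using finite_subset by blast
    then show "f \<in> carrier G"
      using reesD(1)[OF u(1)] u(2) by (auto simp: graded_ring_def form_seq_def ipow_def)
  qed
  show "carrier G \<subseteq> form_seq ` rees"
  proof
    fix f assume f: "f \<in> carrier G"
    then have "\<forall>n. \<exists>a. a \<in> ipow R I n \<and> f n = K n +> a" and fin: "finite {n. f n \<noteq> K n}"
      by (auto simp: graded_ring_def ipow_def)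
    then obtain w where w: "\<And>n. w n \<in> ipow R I n \<and> f n = K n +> w n" by metis
    define u where "u = (\<lambda>n. if f n = K n then \<zero> else w n)"
    obtain N where N: "\<And>n. f n \<noteq> K n \<Longrightarrow> n \<le> N" using fin finite_nat_set_iff_bounded_le by auto
    have "bound \<zero> N u" by (rule bound.intro) (use N in \<open>force simp: u_def\<close>)
    moreover have uI: "u n \<in> ipow R I n" for n using w ideal_zero_mem[OF ipow_I_ideal] by (simp add: u_def)
    ultimately have "u \<in> rees" using ideal_mem_carrier[OF ipow_I_ideal uI] by (auto simp: rees_def)
    moreover have "f = form_seq u"
    proof
      fix n show "f n = form_seq u n" using w[of n] K[of n] by (simp add: form_seq_def u_def ideal_subset_carrier)
    qed
    ultimately show "f \<in> form_seq ` rees" by auto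
  qed
qed

lemma form_seq_carrier: "u \<in> rees \<Longrightarrow> form_seq u \<in> carrier G"
  by (simp add: carrier_G)

lemma G_add: "u \<in> rees \<Longrightarrow> v \<in> rees \<Longrightarrow> form_seq u \<oplus>\<^bsub>G\<^esub> form_seq v = form_seq (\<lambda>n. u n \<oplus> v n)"
  using coset_add[OF K reesD(2) reesD(2)] by (simp add: graded_ring_def form_seq_def FactRing_def)

text \<open>\<open>rcoset_mult\<close> unites the cosets of all products of representatives;
  \<open>K_mult\<close> makes these cosets of K (i + j) coincide although the factors are cosets of
  different ideals.\<close>

lemma rcoset_mult_mixed:
  assumes "u \<in> ipow R I i" "v \<in> ipow R I j"
  shows "rcoset_mult R (K (i + j)) (K i +> u) (K j +> v) = K (i + j) +> (u \<otimes> v)"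
proof -
  have uv: "u \<in> carrier R" "v \<in> carrier R" using assms ideal_mem_carrier[OF ipow_I_ideal] by auto
  have eq: "K (i + j) +> (a \<otimes> b) = K (i + j) +> (u \<otimes> v)" if ab: "a \<in> K i +> u" "b \<in> K j +> v" for a b
  proof -
    obtain k l where k: "k \<in> K i" "a = k \<oplus> u" and l: "l \<in> K j" "b = l \<oplus> v"
      using ab by (auto simp: a_r_coset_def')
    have c: "k \<in> carrier R" "l \<in> carrier R" using k l ideal_mem_carrier[OF K] by auto
    have bI: "b \<in> ipow R I j" unfolding l(2) using l(1) K_sub assms(2) by (auto intro: ideal_add_mem[OF ipow_I_ideal])
    have bc: "b \<in> carrier R" using bI ideal_mem_carrier[OF ipow_I_ideal] by simp
    have "b \<otimes> k \<in> K (j + i)" using ideal_prod.prod[OF bI k(1), of R] K_mult[of j i] by auto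
    moreover have "u \<otimes> l \<in> K (i + j)" using ideal_prod.prod[OF assms(1) l(1), of R] K_mult[of i j] by auto
    ultimately have "b \<otimes> k \<oplus> u \<otimes> l \<in> K (i + j)" by (intro ideal_add_mem[OF K]) (simp_all add: add.commute)
    moreover have "a \<otimes> b \<ominus> u \<otimes> v = b \<otimes> k \<oplus> u \<otimes> l" unfolding k(2) l(2) using c uv by algebra
    ultimately show ?thesis using coset_eq_iff[OF K, of "a \<otimes> b" "u \<otimes> v"] c uv bc k(2) by simp
  qed
  have uv': "u \<in> K i +> u" "v \<in> K j +> v"
    using mem_coset_iff[OF K uv(1) uv(1)] mem_coset_iff[OF K uv(2) uv(2)] by auto
  show ?thesis
    unfolding rcoset_mult_def
  proof
    show "(\<Union>a\<in>K i +> u. \<Union>b\<in>K j +> v. K (i + j) +> (a \<otimes> b)) \<subseteq> K (i + j) +> (u \<otimes> v)"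
      using eq by (intro UN_least) simp
    show "K (i + j) +> (u \<otimes> v) \<subseteq> (\<Union>a\<in>K i +> u. \<Union>b\<in>K j +> v. K (i + j) +> (a \<otimes> b))"
      by (rule subset_trans[OF UN_upper[OF uv'(2)] UN_upper[OF uv'(1)]])
  qed
qed

lemma G_mult: "u \<in> rees \<Longrightarrow> v \<in> rees \<Longrightarrow> form_seq u \<otimes>\<^bsub>G\<^esub> form_seq v = form_seq (conv u v)"
proof
  fix n assume u: "u \<in> rees" and v: "v \<in> rees"
  interpret h: ring_hom_ring R "R Quot K n" "(+>) (K n)"
    using ideal.rcos_ring_hom_ring[OF K] .
  have "(form_seq u \<otimes>\<^bsub>G\<^esub> form_seq v) n =
      (\<Oplus>\<^bsub>R Quot K n\<^esub>i\<in>{..n}. rcoset_mult R (K n) (K i +> u i) (K (n - i) +> v (n - i)))"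
    by (simp add: graded_ring_def form_seq_def)
  also have "\<dots> = (\<Oplus>\<^bsub>R Quot K n\<^esub>i\<in>{..n}. ((+>) (K n) \<circ> (\<lambda>i. u i \<otimes> v (n - i))) i)"
  proof (rule h.S.finsum_cong')
    show "(\<lambda>i. ((+>) (K n) \<circ> (\<lambda>i. u i \<otimes> v (n - i))) i) \<in> {..n} \<rightarrow> carrier (R Quot K n)"
      using reesD(2)[OF u] reesD(2)[OF v] by auto
    fix i assume "i \<in> {..n}"
    then show "rcoset_mult R (K n) (K i +> u i) (K (n - i) +> v (n - i)) = ((+>) (K n) \<circ> (\<lambda>i. u i \<otimes> v (n - i))) i"
      using rcoset_mult_mixed[OF reesD(1)[OF u, of i] reesD(1)[OF v, of "n - i"]] by simp
  qed simp
  also have "\<dots> = K n +> (\<Oplus>i\<in>{..n}. u i \<otimes> v (n - i))"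
    using h.hom_finsum[of "\<lambda>i. u i \<otimes> v (n - i)" "{..n}"] reesD(2)[OF u] reesD(2)[OF v] by (simp add: comp_def)
  finally show "(form_seq u \<otimes>\<^bsub>G\<^esub> form_seq v) n = form_seq (conv u v) n"
    by (simp add: form_seq_def conv_def)
qed

lemma G_one: "\<one>\<^bsub>G\<^esub> = form_seq (homog 0 \<one>)"
  using K by (auto simp: graded_ring_def form_seq_def homog_def fun_eq_iff ideal_subset_carrier)

lemma G_zero: "\<zero>\<^bsub>G\<^esub> = form_seq (\<lambda>n. \<zero>)"
  using K by (auto simp: graded_ring_def form_seq_def fun_eq_iff ideal_subset_carrier)

lemma UP_one: "\<one>\<^bsub>UP R\<^esub> = homog 0 \<one>"
  by (simp add: UP_def homog_def)

text \<open>Each law is checked on polynomial representatives, where it is a law of R or of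
  \<open>UP R\<close>.\<close>

lemma G_cring: "cring G"
proof -
  interpret P: cring "UP R" by (rule UP_is_cring)
  note car = P.m_assoc[unfolded UP_carrier] P.m_comm[unfolded UP_carrier] P.l_distr[unfolded UP_carrier]
    P.l_one[unfolded UP_carrier]
  have rep: "\<exists>u\<in>rees. f = form_seq u" if "f \<in> carrier G" for f using that by (auto simp: carrier_G)
  show ?thesis
  proof (rule cringI)
    show "abelian_group G"
    proof (rule abelian_groupI)
      fix f g h assume "f \<in> carrier G" "g \<in> carrier G"
      then obtain u v where u: "u \<in> rees" "f = form_seq u" and v: "v \<in> rees" "g = form_seq v" using rep by blast
      show "f \<oplus>\<^bsub>G\<^esub> g \<in> carrier G" using u v by (simp add: G_add form_seq_carrier rees_add)
      show "f \<oplus>\<^bsub>G\<^esub> g = g \<oplus>\<^bsub>G\<^esub> f"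
        using u v reesD(2)[OF u(1)] reesD(2)[OF v(1)] by (simp add: G_add a_comm)
      assume "h \<in> carrier G"
      then obtain w where w: "w \<in> rees" "h = form_seq w" using rep by blast
      show "f \<oplus>\<^bsub>G\<^esub> g \<oplus>\<^bsub>G\<^esub> h = f \<oplus>\<^bsub>G\<^esub> (g \<oplus>\<^bsub>G\<^esub> h)"
        using u v w reesD(2)[OF u(1)] reesD(2)[OF v(1)] reesD(2)[OF w(1)] by (simp add: G_add rees_add a_assoc)
    next
      show "\<zero>\<^bsub>G\<^esub> \<in> carrier G" unfolding G_zero by (rule form_seq_carrier[OF rees_zero])
      fix f assume "f \<in> carrier G"
      then obtain u where u: "u \<in> rees" "f = form_seq u" using rep by blast
      show "\<zero>\<^bsub>G\<^esub> \<oplus>\<^bsub>G\<^esub> f = f" unfolding G_zero using u reesD(2)[OF u(1)] by (simp add: G_add rees_zero)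
      have "form_seq (\<lambda>n. \<ominus> u n) \<oplus>\<^bsub>G\<^esub> f = \<zero>\<^bsub>G\<^esub>"
        unfolding G_zero using u reesD(2)[OF u(1)] by (simp add: G_add rees_minus l_neg)
      then show "\<exists>g\<in>carrier G. g \<oplus>\<^bsub>G\<^esub> f = \<zero>\<^bsub>G\<^esub>" using form_seq_carrier[OF rees_minus[OF u(1)]] by blast
    qed
    show "comm_monoid G"
    proof (rule comm_monoidI)
      show "\<one>\<^bsub>G\<^esub> \<in> carrier G" unfolding G_one by (rule form_seq_carrier[OF rees_one])
      fix f assume "f \<in> carrier G"
      then obtain u where u: "u \<in> rees" "f = form_seq u" using rep by blast
      show "\<one>\<^bsub>G\<^esub> \<otimes>\<^bsub>G\<^esub> f = f"
        unfolding G_one u(2) G_mult[OF rees_one u(1)]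
        using conv_eq_UP_mult[OF reesD(3)[OF rees_one] reesD(3)[OF u(1)]] car(4)[OF reesD(3)[OF u(1)]]
        by (simp add: UP_one)
    next
      fix f g h assume "f \<in> carrier G" "g \<in> carrier G"
      then obtain u v where u: "u \<in> rees" "f = form_seq u" and v: "v \<in> rees" "g = form_seq v" using rep by blast
      show "f \<otimes>\<^bsub>G\<^esub> g \<in> carrier G" using u v by (simp add: G_mult form_seq_carrier rees_conv)
      show "f \<otimes>\<^bsub>G\<^esub> g = g \<otimes>\<^bsub>G\<^esub> f"
        using u v car(2)[of u v] by (simp add: G_mult conv_eq_UP_mult reesD(3))
      assume "h \<in> carrier G"
      then obtain w where w: "w \<in> rees" "h = form_seq w" using rep by blast
      have "conv (conv u v) w = conv u (conv v w)"
        using u(1) v(1) w(1) car(1)[of u v w] rees_conv[of u v] rees_conv[of v w]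
        by (simp add: conv_eq_UP_mult reesD(3) del: car)
      then show "f \<otimes>\<^bsub>G\<^esub> g \<otimes>\<^bsub>G\<^esub> h = f \<otimes>\<^bsub>G\<^esub> (g \<otimes>\<^bsub>G\<^esub> h)"
        using u v w by (simp add: G_mult rees_conv)
    qed
    fix f g h assume "f \<in> carrier G" "g \<in> carrier G" "h \<in> carrier G"
    then obtain u v w where u: "u \<in> rees" "f = form_seq u" and v: "v \<in> rees" "g = form_seq v"
      and w: "w \<in> rees" "h = form_seq w" using rep by metis
    have "conv (\<lambda>n. u n \<oplus> v n) w = (\<lambda>n. conv u w n \<oplus> conv v w n)"
      using u(1) v(1) w(1) car(3)[of u v w] rees_conv[of u w] rees_conv[of v w] rees_add[of u v]
      by (simp add: conv_eq_UP_mult add_eq_UP_add reesD(3) del: car)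
    then show "(f \<oplus>\<^bsub>G\<^esub> g) \<otimes>\<^bsub>G\<^esub> h = f \<otimes>\<^bsub>G\<^esub> h \<oplus>\<^bsub>G\<^esub> g \<otimes>\<^bsub>G\<^esub> h"
      using u v w by (simp add: G_mult G_add rees_conv rees_add)
  qed
qed

text \<open>The homogeneous ideal with components S n / K n, described through
  representatives.\<close>

definition graded_ideal :: "(nat \<Rightarrow> 'a set) \<Rightarrow> (nat \<Rightarrow> 'a set) set"
  where "graded_ideal S = form_seq ` {u \<in> rees. \<forall>n. u n \<in> S n}"

lemma form_seq_mem_graded_ideal:
  assumes "\<And>n. ideal (S n) R" "\<And>n. K n \<subseteq> S n" "u \<in> rees"
  shows "form_seq u \<in> graded_ideal S \<longleftrightarrow> (\<forall>n. u n \<in> S n)"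
proof
  assume "form_seq u \<in> graded_ideal S"
  then obtain v where v: "v \<in> rees" "\<And>n. v n \<in> S n" "form_seq u = form_seq v" by (auto simp: graded_ideal_def)
  show "\<forall>n. u n \<in> S n"
  proof
    fix n
    have "u n \<ominus> v n \<in> S n" using v form_seq_eq_iff[OF assms(3) v(1)] assms(2) by auto
    then have "(u n \<ominus> v n) \<oplus> v n \<in> S n" using v(2) by (rule ideal_add_mem[OF assms(1)])
    moreover have "(u n \<ominus> v n) \<oplus> v n = u n"
      using reesD(2)[OF assms(3), of n] reesD(2)[OF v(1), of n] by algebra
    ultimately show "u n \<in> S n" by simp
  qed
qed (use assms in \<open>auto simp: graded_ideal_def\<close>)

lemma graded_ideal_ideal:
  assumes S: "\<And>n. ideal (S n) R" "\<And>n. K n \<subseteq> S n" "\<And>i j. ipow R I i \<cdot> S j \<subseteq> S (i + j)"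
  shows "ideal (graded_ideal S) G"
proof (rule cring.ideal_ofI[OF G_cring])
  show "graded_ideal S \<subseteq> carrier G" by (auto simp: graded_ideal_def carrier_G)
  show "\<zero>\<^bsub>G\<^esub> \<in> graded_ideal S"
    unfolding G_zero using form_seq_mem_graded_ideal[OF S(1,2) rees_zero] ideal_zero_mem[OF S(1)] by simp
  fix f assume "f \<in> graded_ideal S"
  then obtain u where u: "u \<in> rees" "\<And>n. u n \<in> S n" "f = form_seq u" by (auto simp: graded_ideal_def)
  show "f \<oplus>\<^bsub>G\<^esub> g \<in> graded_ideal S" if g: "g \<in> graded_ideal S" for g
  proof -
    obtain v where v: "v \<in> rees" "\<And>n. v n \<in> S n" "g = form_seq v" using g by (auto simp: graded_ideal_def)
    then show ?thesis
      using form_seq_mem_graded_ideal[OF S(1,2) rees_add[OF u(1) v(1)]] u ideal_add_mem[OF S(1)] by (simp add: G_add)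
  qed
  show "g \<otimes>\<^bsub>G\<^esub> f \<in> graded_ideal S" if g: "g \<in> carrier G" for g
  proof -
    obtain v where v: "v \<in> rees" "g = form_seq v" using g by (auto simp: carrier_G)
    have "conv v u n \<in> S n" for n
      unfolding conv_def
    proof (rule ideal_finsum_mem[OF S(1)])
      fix i assume "i \<in> {..n}"
      then show "v i \<otimes> u (n - i) \<in> S n"
        using ideal_prod.prod[OF reesD(1)[OF v(1), of i] u(2)[of "n - i"], of R] S(3)[of i "n - i"] by auto
    qed
    then show ?thesis
      using form_seq_mem_graded_ideal[OF S(1,2) rees_conv[OF v(1) u(1)]] u v by (simp add: G_mult)
  qed
qed

lemma conv_homog:
  assumes "a \<in> carrier R" "u \<in> rees"
  shows "conv (homog k a) u n = (if k \<le> n then a \<otimes> u (n - k) else \<zero>)"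
proof (cases "k \<le> n")
  case True
  have "conv (homog k a) u n = (\<Oplus>i\<in>{..n}. if k = i then a \<otimes> u (n - i) else \<zero>)"
    unfolding conv_def homog_def using assms reesD(2)[OF assms(2)] by (intro finsum_cong') auto
  also have "\<dots> = a \<otimes> u (n - k)"
    using finsum_singleton[of k "{..n}" "\<lambda>i. a \<otimes> u (n - i)"] True assms reesD(2)[OF assms(2)] by auto
  finally show ?thesis using True by simp
next
  case False
  have "conv (homog k a) u n = (\<Oplus>i\<in>{..n}. \<zero>)"
    unfolding conv_def homog_def using False assms reesD(2)[OF assms(2)] by (intro finsum_cong') auto
  then show ?thesis using False by simp
qed

lemma degree_one_form_eq: "degree_one_form R K a = form_seq (homog 1 a)"
  using K by (auto simp: degree_one_form_def form_seq_def homog_def fun_eq_iff ideal_subset_carrier)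

lemma degree_one_form_carrier: "a \<in> I \<Longrightarrow> degree_one_form R K a \<in> carrier G"
  unfolding degree_one_form_eq using I by (intro form_seq_carrier homog_rees) simp

definition forms_ideal :: "'a set \<Rightarrow> nat \<Rightarrow> 'a set"
  where "forms_ideal L n = K n <+> shifted R L I n"

lemma forms_ideal_props:
  assumes L: "ideal L R"
  shows "ideal (forms_ideal L n) R" "K n \<subseteq> forms_ideal L n" "ipow R I i \<cdot> forms_ideal L j \<subseteq> forms_ideal L (i + j)"
proof -
  have sh: "ideal (shifted R L I n) R" for n using L I by (rule shifted_ideal)
  show id: "ideal (forms_ideal L n) R" for n unfolding forms_ideal_def using K sh by (rule add_ideals)
  show up: "K n \<subseteq> forms_ideal L n" for n unfolding forms_ideal_def using K sh by (rule set_add_upper1)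
  have "ipow R I i \<cdot> shifted R L I j \<subseteq> shifted R L I (i + j)"
  proof (cases j)
    case 0
    then have "ipow R I i \<cdot> shifted R L I j = {\<zero>}" using ideal_prod_zero[OF ipow_I_ideal] by simp
    then show ?thesis using ideal_zero_mem[OF sh] by simp
  next
    case (Suc k)
    then show ?thesis
      using ideal_prod_left_comm[OF ipow_I_ideal L ipow_I_ideal] by (simp add: ipow_add[OF I])
  qed
  moreover have "ipow R I i \<cdot> forms_ideal L j = ipow R I i \<cdot> K j <+> ipow R I i \<cdot> shifted R L I j"
    unfolding forms_ideal_def by (rule ideal_prod_distr(1)[OF ipow_I_ideal K sh])
  ultimately show "ipow R I i \<cdot> forms_ideal L j \<subseteq> forms_ideal L (i + j)"
    using K_mult[of i j] by (simp add: forms_ideal_def set_add_mono)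
qed

text \<open>The generators lie in the right-hand side. Conversely a representative is taken apart
  from its top degree downwards, and a homogeneous element of L I^m in degree m + 1 is reached from
  the generators by linearity.\<close>

lemma ideal_of_forms:
  assumes as: "set as \<subseteq> I"
  shows "ideal_of G (map (degree_one_form R K) as) = graded_ideal (forms_ideal (ideal_of R as))"
proof
  interpret G: cring G by (rule G_cring)
  let ?L = "ideal_of R as" and ?ys = "map (degree_one_form R K) as"
  have asc: "set as \<subseteq> carrier R" using as ideal_subset_carrier[OF I] by auto
  have L: "ideal ?L R" using asc by (rule ideal_of_ideal)
  have ys: "set ?ys \<subseteq> carrier G" using as degree_one_form_carrier by auto
  note S = forms_ideal_props[OF L]
  have idS: "ideal (graded_ideal (forms_ideal ?L)) G" using S by (intro graded_ideal_ideal)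
  show "ideal_of G ?ys \<subseteq> graded_ideal (forms_ideal ?L)"
  proof (rule G.adjoin_least[OF G.zeroideal _ _ idS])
    show "{\<zero>\<^bsub>G\<^esub>} \<subseteq> graded_ideal (forms_ideal ?L)" using G.ideal_zero_mem[OF idS] by simp
    have "degree_one_form R K a \<in> graded_ideal (forms_ideal ?L)" if a: "a \<in> set as" for a
    proof -
      have aI: "a \<in> I" using a as by auto
      then have r: "homog 1 a \<in> rees" using I by (intro homog_rees) simp
      have "a \<in> ?L \<cdot> ipow R I 0" using adjoin_mem[OF zeroideal asc a] ideal_prod_one[OF L] by simp
      then have "a \<in> forms_ideal ?L 1"
        unfolding forms_ideal_def using set_add_right[OF K shifted_ideal[OF L I], of a 1 1] by simp
      then have "homog 1 a n \<in> forms_ideal ?L n" for n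
        using ideal_zero_mem[OF S(1)] by (simp add: homog_def)
      then show ?thesis unfolding degree_one_form_eq using form_seq_mem_graded_ideal[OF S(1,2) r] by simp
    qed
    then show "set ?ys \<subseteq> graded_ideal (forms_ideal ?L)" by auto
  qed
  let ?Y = "ideal_of G ?ys"
  have idY: "ideal ?Y G" using ys by (rule G.ideal_of_ideal)
  have hom_mult: "form_seq (homog (Suc m) (a \<otimes> b)) = degree_one_form R K a \<otimes>\<^bsub>G\<^esub> form_seq (homog m b)"
    if "a \<in> I" "b \<in> ipow R I m" for a b m
  proof -
    have ac: "a \<in> carrier R" using that ideal_mem_carrier[OF I] by simp
    have r: "homog m b \<in> rees" "homog 1 a \<in> rees" using that I by (auto intro: homog_rees)
    have "conv (homog 1 a) (homog m b) = homog (Suc m) (a \<otimes> b)"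
    proof
      fix n show "conv (homog 1 a) (homog m b) n = homog (Suc m) (a \<otimes> b) n"
        unfolding conv_homog[OF ac r(1)] using ac by (auto simp: homog_def)
    qed
    then show ?thesis unfolding degree_one_form_eq using G_mult[OF r(2,1)] by simp
  qed
  have hom_add: "form_seq (homog m (a \<oplus> b)) = form_seq (homog m a) \<oplus>\<^bsub>G\<^esub> form_seq (homog m b)"
    if "a \<in> ipow R I m" "b \<in> ipow R I m" for a b m
  proof -
    have "homog m (a \<oplus> b) = (\<lambda>n. homog m a n \<oplus> homog m b n)" by (auto simp: homog_def)
    then show ?thesis using G_add[OF homog_rees[OF that(1)] homog_rees[OF that(2)]] by simp
  qed
  have hom_smult: "form_seq (homog m (r \<otimes> a)) = form_seq (homog 0 r) \<otimes>\<^bsub>G\<^esub> form_seq (homog m a)"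
    if "r \<in> carrier R" "a \<in> ipow R I m" for r a m
  proof -
    have r: "homog m a \<in> rees" "homog 0 r \<in> rees" using that by (auto intro: homog_rees)
    have "conv (homog 0 r) (homog m a) = homog m (r \<otimes> a)"
    proof
      fix n show "conv (homog 0 r) (homog m a) n = homog m (r \<otimes> a) n"
        unfolding conv_homog[OF that(1) r(1)] using that by (auto simp: homog_def)
    qed
    then show ?thesis using G_mult[OF r(2,1)] by simp
  qed
  have hom_zero: "form_seq (homog m \<zero>) \<in> ?Y" for m
  proof -
    have "form_seq (homog m \<zero>) = \<zero>\<^bsub>G\<^esub>" unfolding G_zero by (simp add: homog_def)
    then show ?thesis using G.ideal_zero_mem[OF idY] by simp
  qed
  have smult_Y: "form_seq (homog m (r \<otimes> a)) \<in> ?Y"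
    if "r \<in> carrier R" "a \<in> ipow R I m" "form_seq (homog m a) \<in> ?Y" for r a m
    unfolding hom_smult[OF that(1,2)] using that
    by (intro G.ideal_mult_mem[OF idY] form_seq_carrier homog_rees) simp_all
  have homY: "form_seq (homog (Suc m) w) \<in> ?Y" if w: "w \<in> ?L \<cdot> ipow R I m" for m w
  proof -
    \<comment> \<open>Those u in I whose products with I^m all have their forms in Y: an ideal
      containing as, hence L.\<close>
    let ?T = "{u \<in> I. \<forall>b\<in>ipow R I m. form_seq (homog (Suc m) (u \<otimes> b)) \<in> ?Y}"
    have IS: "u \<otimes> b \<in> ipow R I (Suc m)" if "u \<in> I" "b \<in> ipow R I m" for u b
      using ideal_prod.prod[OF that, of R] ipow_Suc2[OF I] by simp
    have Ic: "\<And>u. u \<in> I \<Longrightarrow> u \<in> carrier R" "\<And>b k. b \<in> ipow R I k \<Longrightarrow> b \<in> carrier R"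
      using ideal_mem_carrier[OF I] ideal_mem_carrier[OF ipow_I_ideal] by auto
    have idT: "ideal ?T R"
    proof (rule ideal_ofI)
      show "?T \<subseteq> carrier R" using Ic by auto
      show "\<zero> \<in> ?T" using ideal_zero_mem[OF I] hom_zero Ic by simp
      fix x assume x: "x \<in> ?T"
      show "x \<oplus> y \<in> ?T" if y: "y \<in> ?T" for y
      proof -
        have "form_seq (homog (Suc m) ((x \<oplus> y) \<otimes> b)) \<in> ?Y" if b: "b \<in> ipow R I m" for b
        proof -
          have "(x \<oplus> y) \<otimes> b = x \<otimes> b \<oplus> y \<otimes> b" using x y b Ic by (intro l_distr) auto
          then show ?thesis using hom_add[OF IS IS, of x b y b] x y b G.ideal_add_mem[OF idY] by simp
        qed
        then show ?thesis using x y ideal_add_mem[OF I] by simp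
      qed
      show "r \<otimes> x \<in> ?T" if r: "r \<in> carrier R" for r
      proof -
        have "form_seq (homog (Suc m) ((r \<otimes> x) \<otimes> b)) \<in> ?Y" if b: "b \<in> ipow R I m" for b
        proof -
          have "(r \<otimes> x) \<otimes> b = r \<otimes> (x \<otimes> b)" using r x b Ic by (intro m_assoc) auto
          then show ?thesis using smult_Y[OF r IS[of x b]] x b by simp
        qed
        then show ?thesis using x r ideal_mult_mem[OF I] by simp
      qed
    qed
    have asT: "set as \<subseteq> ?T"
    proof
      fix a assume a: "a \<in> set as"
      then have aI: "a \<in> I" using as by auto
      have "degree_one_form R K a \<in> ?Y" using G.adjoin_mem[OF G.zeroideal ys] a by auto
      then have "form_seq (homog (Suc m) (a \<otimes> b)) \<in> ?Y" if "b \<in> ipow R I m" for b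
        unfolding hom_mult[OF aI that] using that
        by (intro G.ideal_mult_mem'[OF idY] form_seq_carrier homog_rees)
      then show "a \<in> ?T" using aI by simp
    qed
    have LT: "?L \<subseteq> ?T" using ideal_zero_mem[OF idT] by (intro adjoin_least[OF zeroideal asT _ idT]) simp
    let ?W = "{w \<in> ipow R I (Suc m). form_seq (homog (Suc m) w) \<in> ?Y}"
    have idW: "ideal ?W R"
    proof (rule ideal_ofI)
      show "?W \<subseteq> carrier R" using Ic by auto
      show "\<zero> \<in> ?W" using ideal_zero_mem[OF ipow_I_ideal] hom_zero by simp
      show "x \<oplus> y \<in> ?W" if "x \<in> ?W" "y \<in> ?W" for x y
        using that hom_add[of x "Suc m" y] G.ideal_add_mem[OF idY] ideal_add_mem[OF ipow_I_ideal] by simp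
      show "r \<otimes> x \<in> ?W" if "x \<in> ?W" "r \<in> carrier R" for x r
        using that smult_Y[of r x "Suc m"] ideal_mult_mem[OF ipow_I_ideal] by simp
    qed
    have "?L \<cdot> ipow R I m \<subseteq> ?W"
    proof (rule ideal_prod_least[OF idW])
      fix u b assume "u \<in> ?L" "b \<in> ipow R I m"
      then show "u \<otimes> b \<in> ?W" using LT IS by auto
    qed
    then show ?thesis using w by auto
  qed
  have homY': "form_seq (homog n w) \<in> ?Y" if "w \<in> shifted R ?L I n" for n w
    using that homY hom_zero by (cases n) auto
  have "form_seq u \<in> ?Y" if "u \<in> rees" "\<And>n. u n \<in> forms_ideal ?L n" "\<And>n. n \<ge> N \<Longrightarrow> u n = \<zero>" for u N
    using that
  proof (induction N arbitrary: u)
    case 0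
    then have "u = (\<lambda>n. \<zero>)" by auto
    then have "form_seq u = \<zero>\<^bsub>G\<^esub>" by (simp add: G_zero)
    then show ?case using G.ideal_zero_mem[OF idY] by simp
  next
    case (Suc N)
    \<comment> \<open>u' drops the top coefficient u N = k + w; the part k in K N has zero form, and
      w is homogeneous of the kind already treated.\<close>
    define u' where "u' = (\<lambda>n. if n = N then \<zero> else u n)"
    have u'0: "u' n = \<zero>" if "n \<ge> N" for n using Suc.prems(3)[of n] that by (auto simp: u'_def)
    have "bound \<zero> N u'" by (rule bound.intro) (use u'0 in auto)
    moreover have u'I: "u' n \<in> ipow R I n" for n
      using reesD(1)[OF Suc.prems(1)] ideal_zero_mem[OF ipow_I_ideal] by (simp add: u'_def)
    ultimately have u'r: "u' \<in> rees" using ideal_mem_carrier[OF ipow_I_ideal u'I] by (auto simp: rees_def)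
    have 1: "form_seq u' \<in> ?Y"
      using Suc.prems(2) ideal_zero_mem[OF S(1)] u'0 by (intro Suc.IH u'r) (simp_all add: u'_def)
    obtain k w where kw: "k \<in> K N" "w \<in> shifted R ?L I N" "u N = k \<oplus> w"
      using Suc.prems(2)[of N] by (auto simp: forms_ideal_def mem_set_add)
    have c: "k \<in> carrier R" "w \<in> carrier R"
      using kw ideal_mem_carrier[OF K] ideal_mem_carrier[OF shifted_ideal[OF L I]] by auto
    have wI: "w \<in> ipow R I N"
    proof -
      have "u N \<ominus> k \<in> ipow R I N" using reesD(1)[OF Suc.prems(1)] kw(1) K_sub by (intro ideal_diff_mem[OF ipow_I_ideal]) auto
      moreover have "u N \<ominus> k = w" unfolding kw(3) using c by algebra
      ultimately show ?thesis by simp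
    qed
    have "form_seq u = form_seq (\<lambda>n. homog N w n \<oplus> u' n)"
    proof (subst form_seq_eq_iff[OF Suc.prems(1) rees_add[OF homog_rees[OF wI] u'r]], rule allI)
      fix n
      show "u n \<ominus> (homog N w n \<oplus> u' n) \<in> K n"
      proof (cases "n = N")
        case True
        have "u N \<ominus> (w \<oplus> \<zero>) = k" unfolding kw(3) using c by algebra
        then show ?thesis using True kw(1) by (simp add: homog_def u'_def)
      next
        case False
        have "u n \<in> carrier R" using reesD(2)[OF Suc.prems(1)] .
        then have "u n \<ominus> (\<zero> \<oplus> u n) = \<zero>" by algebra
        then show ?thesis using False ideal_zero_mem[OF K] by (simp add: homog_def u'_def)
      qed
    qed
    also have "\<dots> = form_seq (homog N w) \<oplus>\<^bsub>G\<^esub> form_seq u'" using G_add[OF homog_rees[OF wI] u'r] by simp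
    finally show ?case using G.ideal_add_mem[OF idY homY'[OF kw(2)] 1] by simp
  qed
  note all = this
  show "graded_ideal (forms_ideal ?L) \<subseteq> ?Y"
  proof
    fix f assume "f \<in> graded_ideal (forms_ideal ?L)"
    then obtain u where u: "u \<in> rees" "\<And>n. u n \<in> forms_ideal ?L n" "f = form_seq u" by (auto simp: graded_ideal_def)
    obtain N where N: "bound \<zero> N u" using reesD(3)[OF u(1)] by auto
    have "u n = \<zero>" if "n \<ge> Suc N" for n using N that by (auto simp: bound_def)
    then show "f \<in> ?Y" using all[OF u(1,2)] u(3) by auto
  qed
qed

text \<open>Multiplication by a form of degree one only shifts degrees, so regularity can be tested
  on homogeneous elements.\<close>

lemma nzd_form_iff:
  assumes L: "ideal L R" and a: "a \<in> I"
  shows "nzd_mod G (graded_ideal (forms_ideal L)) (degree_one_form R K a) \<longleftrightarrow>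
    (\<forall>n. \<forall>b\<in>ipow R I n. a \<otimes> b \<in> forms_ideal L (Suc n) \<longrightarrow> b \<in> forms_ideal L n)"
proof -
  note S = forms_ideal_props[OF L]
  have ac: "a \<in> carrier R" using a ideal_mem_carrier[OF I] by simp
  have r: "homog 1 a \<in> rees" using a I by (intro homog_rees) simp
  have mult: "degree_one_form R K a \<otimes>\<^bsub>G\<^esub> form_seq u \<in> graded_ideal (forms_ideal L) \<longleftrightarrow>
      (\<forall>n. a \<otimes> u n \<in> forms_ideal L (Suc n))" if u: "u \<in> rees" for u
  proof -
    have "degree_one_form R K a \<otimes>\<^bsub>G\<^esub> form_seq u \<in> graded_ideal (forms_ideal L) \<longleftrightarrow>
        (\<forall>n. conv (homog 1 a) u n \<in> forms_ideal L n)"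
      unfolding degree_one_form_eq G_mult[OF r u]
      using form_seq_mem_graded_ideal[OF S(1,2) rees_conv[OF r u]] .
    also have "\<dots> \<longleftrightarrow> (\<forall>n. a \<otimes> u n \<in> forms_ideal L (Suc n))"
    proof
      assume *: "\<forall>n. conv (homog 1 a) u n \<in> forms_ideal L n"
      show "\<forall>n. a \<otimes> u n \<in> forms_ideal L (Suc n)"
      proof
        fix n show "a \<otimes> u n \<in> forms_ideal L (Suc n)"
          using *[rule_format, of "Suc n"] unfolding conv_homog[OF ac u] by simp
      qed
    next
      assume *: "\<forall>n. a \<otimes> u n \<in> forms_ideal L (Suc n)"
      show "\<forall>n. conv (homog 1 a) u n \<in> forms_ideal L n"
      proof
        fix n show "conv (homog 1 a) u n \<in> forms_ideal L n"
          unfolding conv_homog[OF ac u] using * ideal_zero_mem[OF S(1)] by (cases n) auto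
      qed
    qed
    finally show ?thesis .
  qed
  show ?thesis
  proof
    assume nzd: "nzd_mod G (graded_ideal (forms_ideal L)) (degree_one_form R K a)"
    show "\<forall>n. \<forall>b\<in>ipow R I n. a \<otimes> b \<in> forms_ideal L (Suc n) \<longrightarrow> b \<in> forms_ideal L n"
    proof (intro allI ballI impI)
      fix n b assume b: "b \<in> ipow R I n" "a \<otimes> b \<in> forms_ideal L (Suc n)"
      have u: "homog n b \<in> rees" using b(1) by (rule homog_rees)
      have "a \<otimes> homog n b k \<in> forms_ideal L (Suc k)" for k
        using b(2) ideal_zero_mem[OF S(1)] ac by (simp add: homog_def)
      then have "form_seq (homog n b) \<in> graded_ideal (forms_ideal L)"
        using nzd_modD[OF nzd form_seq_carrier[OF u]] mult[OF u] by simp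
      then have "homog n b n \<in> forms_ideal L n" using form_seq_mem_graded_ideal[OF S(1,2) u] by blast
      then show "b \<in> forms_ideal L n" by (simp add: homog_def)
    qed
  next
    assume *: "\<forall>n. \<forall>b\<in>ipow R I n. a \<otimes> b \<in> forms_ideal L (Suc n) \<longrightarrow> b \<in> forms_ideal L n"
    show "nzd_mod G (graded_ideal (forms_ideal L)) (degree_one_form R K a)"
      unfolding nzd_mod_def
    proof (intro ballI impI)
      fix z assume z: "z \<in> carrier G" "degree_one_form R K a \<otimes>\<^bsub>G\<^esub> z \<in> graded_ideal (forms_ideal L)"
      then obtain u where u: "u \<in> rees" "z = form_seq u" by (auto simp: carrier_G)
      have "u n \<in> forms_ideal L n" for n
        using z(2) mult[OF u(1)] * reesD(1)[OF u(1)] unfolding u(2) by simp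
      then show "z \<in> graded_ideal (forms_ideal L)"
        unfolding u(2) using form_seq_mem_graded_ideal[OF S(1,2) u(1)] by simp
    qed
  qed
qed

lemma regular_mod_forms_iff:
  assumes as: "set as \<subseteq> I"
  shows "regular_mod G {\<zero>\<^bsub>G\<^esub>} (map (degree_one_form R K) as) \<longleftrightarrow> forms_regular R I K as"
proof -
  interpret G: cring G by (rule G_cring)
  have "nzd_mod G (ideal_of G (take i (map (degree_one_form R K) as))) (map (degree_one_form R K) as ! i) \<longleftrightarrow>
      (\<forall>n. \<forall>b\<in>ipow R I n. as ! i \<otimes> b \<in> K (Suc n) <+> ideal_of R (take i as) \<cdot> ipow R I n \<longrightarrow>
        b \<in> K n <+> shifted R (ideal_of R (take i as)) I n)" if i: "i < length as" for i
  proof -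
    have t: "set (take i as) \<subseteq> I" using as set_take_subset[of i as] by auto
    then have "set (take i as) \<subseteq> carrier R" using ideal_subset_carrier[OF I] by auto
    then have L: "ideal (ideal_of R (take i as)) R" by (rule ideal_of_ideal)
    have "as ! i \<in> I" using as i by auto
    then show ?thesis
      using nzd_form_iff[OF L, of "as ! i"] ideal_of_forms[OF t] i by (simp add: take_map forms_ideal_def)
  qed
  then show ?thesis unfolding G.regular_mod_iff_nth forms_regular_def by simp
qed

text \<open>Properness of the generated ideal is seen in degree 0, where forms of degree one
  contribute nothing and only K 0 remains.\<close>

lemma regular_sequence_forms_iff:
  assumes as: "set as \<subseteq> I" and K0: "K 0 \<noteq> carrier R"
  shows "regular_sequence G (map (degree_one_form R K) as) \<longleftrightarrow> forms_regular R I K as"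
proof -
  interpret G: cring G by (rule G_cring)
  have ys: "set (map (degree_one_form R K) as) \<subseteq> carrier G" using as degree_one_form_carrier by auto
  have "set as \<subseteq> carrier R" using as ideal_subset_carrier[OF I] by auto
  then have L: "ideal (ideal_of R as) R" by (rule ideal_of_ideal)
  note S = forms_ideal_props[OF L]
  have "\<one>\<^bsub>G\<^esub> \<notin> graded_ideal (forms_ideal (ideal_of R as))"
  proof
    assume "\<one>\<^bsub>G\<^esub> \<in> graded_ideal (forms_ideal (ideal_of R as))"
    then have "homog 0 \<one> 0 \<in> forms_ideal (ideal_of R as) 0"
      unfolding G_one using form_seq_mem_graded_ideal[OF S(1,2) rees_one] by blast
    then have "\<one> \<in> K 0" by (simp add: homog_def forms_ideal_def ideal_add_zero[OF K])
    then show False using K0 ideal.one_imp_carrier[OF K] by auto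
  qed
  then have "ideal_of G (map (degree_one_form R K) as) \<noteq> carrier G" unfolding ideal_of_forms[OF as] by auto
  then show ?thesis
    unfolding G.regular_sequence_iff[OF ys] using regular_mod_forms_iff[OF as] by simp
qed

end

section \<open>Noetherian families of ideals\<close>

text \<open>Each component is recorded by its coefficient ideal in R. The degrees form a
  cancellative commutative monoid, which covers both \<open>nat\<close> and
  \<open>nat \<times> nat\<close>.\<close>

definition graded_algebra :: "('a, 'b) ring_scheme \<Rightarrow> ('d::cancel_comm_monoid_add \<Rightarrow> 'a set) \<Rightarrow> bool"
  where "graded_algebra R A \<longleftrightarrow> (\<forall>p. ideal (A p) R) \<and> A 0 = carrier R \<and> (\<forall>p q. A p \<cdot>\<^bsub>R\<^esub> A q \<subseteq> A (p + q))"

definition graded_submodule ::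
    "('a, 'b) ring_scheme \<Rightarrow> ('d::cancel_comm_monoid_add \<Rightarrow> 'a set) \<Rightarrow> ('d \<Rightarrow> 'a set) \<Rightarrow> bool"
  where "graded_submodule R A N \<longleftrightarrow>
    (\<forall>p. ideal (N p) R) \<and> N \<le> A \<and> (\<forall>p q. A p \<cdot>\<^bsub>R\<^esub> N q \<subseteq> N (p + q))"

definition graded_noetherian :: "('a, 'b) ring_scheme \<Rightarrow> ('d::cancel_comm_monoid_add \<Rightarrow> 'a set) \<Rightarrow> bool"
  where "graded_noetherian R A \<longleftrightarrow> (\<forall>N :: nat \<Rightarrow> 'd \<Rightarrow> 'a set.
    (\<forall>i. graded_submodule R A (N i)) \<and> incseq N \<longrightarrow> (\<exists>m. \<forall>i\<ge>m. N i = N m))"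

lemma graded_submoduleD:
  assumes "graded_submodule R A N"
  shows "ideal (N p) R" "N p \<subseteq> A p" "a \<in> A p \<Longrightarrow> b \<in> N q \<Longrightarrow> a \<otimes>\<^bsub>R\<^esub> b \<in> N (p + q)"
  using assms ideal_prod.prod[of a "A p" b "N q" R] unfolding graded_submodule_def le_fun_def by (simp_all, blast)

lemma graded_noetherian_maximal:
  assumes "graded_noetherian R A" "Ns \<noteq> {}" "\<And>N. N \<in> Ns \<Longrightarrow> graded_submodule R A N"
  shows "\<exists>N\<in>Ns. \<forall>N'\<in>Ns. N \<le> N' \<longrightarrow> N' = N"
proof (rule ccontr)
  assume "\<not> ?thesis"
  then have "\<forall>N\<in>Ns. \<exists>N'. N' \<in> Ns \<and> N \<le> N' \<and> N' \<noteq> N" by blast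
  from bchoice[OF this] obtain g where g: "\<And>N. N \<in> Ns \<Longrightarrow> g N \<in> Ns \<and> N \<le> g N \<and> g N \<noteq> N" by blast
  obtain N0 where N0: "N0 \<in> Ns" using assms(2) by blast
  define s where "s = rec_nat N0 (\<lambda>_. g)"
  have s: "s 0 = N0" "s (Suc i) = g (s i)" for i by (simp_all add: s_def)
  have sN: "s i \<in> Ns" for i by (induction i) (use N0 g in \<open>simp_all add: s\<close>)
  have "incseq s" by (rule incseq_SucI) (use g sN in \<open>simp add: s\<close>)
  then obtain m where m: "\<And>i. i \<ge> m \<Longrightarrow> s i = s m"
    using assms(1,3) sN unfolding graded_noetherian_def by blast
  have "g (s m) = s m" using m[of "Suc m"] by (simp add: s)
  then show False using g[OF sN] by blast
qed

lemma (in noetherian_cring) ideal_sequence_stabilizes: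
  assumes "\<And>i. ideal (B i) R" "incseq B"
  shows "\<exists>m::nat. \<forall>i\<ge>m. B i = B m"
proof -
  have "\<exists>A\<in>range B. \<forall>Z\<in>range B. A \<subseteq> Z \<longrightarrow> Z = A"
    using assms(1) by (intro exists_maximal_ideal_in) auto
  then obtain m where m: "\<And>i. B m \<subseteq> B i \<Longrightarrow> B i = B m" by auto
  have "B i = B m" if "i \<ge> m" for i using m[of i] incseqD[OF assms(2) that] .
  then show ?thesis by blast
qed

section \<open>Hilbert's basis theorem for graded algebras of ideals\<close>

context cring
begin

lemma graded_algebraD:
  assumes "graded_algebra R A"
  shows "ideal (A p) R" "A 0 = carrier R" "a \<in> A p \<Longrightarrow> b \<in> A q \<Longrightarrow> a \<otimes> b \<in> A (p + q)"
  using assms ideal_prod.prod[of a "A p" b "A q" R] unfolding graded_algebra_def by (simp_all, blast)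

lemma graded_algebra_carrier: "graded_algebra R A \<Longrightarrow> a \<in> A p \<Longrightarrow> a \<in> carrier R"
  using graded_algebraD(1) ideal_mem_carrier by metis

text \<open>The elements of degree p that are polynomials in z of degree less than k. The condition
  on q stands for q = p - j \<delta>, as degrees cannot be subtracted.\<close>

definition ext_below :: "('d::cancel_comm_monoid_add \<Rightarrow> 'a set) \<Rightarrow> 'a \<Rightarrow> 'd \<Rightarrow> nat \<Rightarrow> 'd \<Rightarrow> 'a set"
  where "ext_below A z \<delta> k p = Idl {z [^] j \<otimes> c |j q c. j < k \<and> c \<in> A q \<and> ((+) \<delta> ^^ j) q = p}"

text \<open>The graded algebra \<open>A[z]\<close> with \<open>z\<close> in degree \<open>\<delta>\<close>.\<close>

definition ext :: "('d::cancel_comm_monoid_add \<Rightarrow> 'a set) \<Rightarrow> 'a \<Rightarrow> 'd \<Rightarrow> 'd \<Rightarrow> 'a set"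
  where "ext A z \<delta> p = Idl {z [^] j \<otimes> c |j q c. c \<in> A q \<and> ((+) \<delta> ^^ j) q = p}"

lemma shift_add: "((+) \<delta> ^^ j) (r + q) = r + ((+) (\<delta>::'d::cancel_comm_monoid_add) ^^ j) q"
  by (induction j) (simp_all add: add.left_commute)

lemma shift_inj: "((+) \<delta> ^^ j) q = ((+) (\<delta>::'d::cancel_comm_monoid_add) ^^ j) q' \<Longrightarrow> q = q'"
  by (induction j) simp_all

context
  fixes A :: "'d::cancel_comm_monoid_add \<Rightarrow> 'a set" and z :: 'a and \<delta> :: 'd
  assumes A: "graded_algebra R A" and z: "z \<in> carrier R"
begin

private lemma Ac: "c \<in> A q \<Longrightarrow> c \<in> carrier R"
  using graded_algebra_carrier[OF A] .

lemma ext_gens_carrier: "{z [^] j \<otimes> c |j q c. c \<in> A q \<and> ((+) \<delta> ^^ j) q = p} \<subseteq> carrier R"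
  "{z [^] j \<otimes> c |j q c. j < k \<and> c \<in> A q \<and> ((+) \<delta> ^^ j) q = p} \<subseteq> carrier R"
  using Ac z by auto

lemma ext_ideal: "ideal (ext A z \<delta> p) R" "ideal (ext_below A z \<delta> k p) R"
  unfolding ext_def ext_below_def using genideal_ideal[OF ext_gens_carrier(1)] genideal_ideal[OF ext_gens_carrier(2)]
  by simp_all

lemma ext_memI: "c \<in> A q \<Longrightarrow> ((+) \<delta> ^^ j) q = p \<Longrightarrow> z [^] j \<otimes> c \<in> ext A z \<delta> p"
  unfolding ext_def using genideal_self[OF ext_gens_carrier(1)] by blast

lemma ext_below_memI: "c \<in> A q \<Longrightarrow> ((+) \<delta> ^^ j) q = p \<Longrightarrow> j < k \<Longrightarrow> z [^] j \<otimes> c \<in> ext_below A z \<delta> k p"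
  unfolding ext_below_def using genideal_self[OF ext_gens_carrier(2)] by blast

lemma ext_least:
  assumes "ideal B R" "\<And>j q c. c \<in> A q \<Longrightarrow> ((+) \<delta> ^^ j) q = p \<Longrightarrow> z [^] j \<otimes> c \<in> B"
  shows "ext A z \<delta> p \<subseteq> B"
  unfolding ext_def using assms by (intro genideal_minimal) auto

lemma ext_below_least:
  assumes "ideal B R" "\<And>j q c. j < k \<Longrightarrow> c \<in> A q \<Longrightarrow> ((+) \<delta> ^^ j) q = p \<Longrightarrow> z [^] j \<otimes> c \<in> B"
  shows "ext_below A z \<delta> k p \<subseteq> B"
  unfolding ext_below_def using assms by (intro genideal_minimal) auto

lemma ext_superset: "A p \<subseteq> ext A z \<delta> p"
proof
  fix c assume c: "c \<in> A p"
  then show "c \<in> ext A z \<delta> p" using ext_memI[of c p 0 p] Ac[OF c] by simp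
qed

lemma ext_below_mult:
  assumes "a \<in> A r" "u \<in> ext_below A z \<delta> k p"
  shows "a \<otimes> u \<in> ext_below A z \<delta> k (r + p)"
proof -
  have ac: "a \<in> carrier R" using Ac[OF assms(1)] .
  have "ext_below A z \<delta> k p \<subseteq> {u \<in> carrier R. a \<otimes> u \<in> ext_below A z \<delta> k (r + p)}"
  proof (rule ext_below_least[OF ideal_colon[OF ext_ideal(2) ac]])
    fix j q c assume *: "j < k" "c \<in> A q" "((+) \<delta> ^^ j) q = p"
    have "z [^] j \<otimes> (a \<otimes> c) \<in> ext_below A z \<delta> k (r + p)"
      using * graded_algebraD(3)[OF A assms(1) *(2)] by (intro ext_below_memI[of _ "r + q"]) (simp_all add: shift_add)
    moreover have "z [^] j \<otimes> (a \<otimes> c) = a \<otimes> (z [^] j \<otimes> c)" using ac Ac[OF *(2)] z by (simp add: m_lcomm)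
    ultimately show "z [^] j \<otimes> c \<in> {u \<in> carrier R. a \<otimes> u \<in> ext_below A z \<delta> k (r + p)}"
      using Ac[OF *(2)] z by simp
  qed
  then show ?thesis using assms(2) by auto
qed

lemma ext_below_shift:
  assumes "u \<in> ext_below A z \<delta> k p"
  shows "z \<otimes> u \<in> ext_below A z \<delta> (Suc k) (\<delta> + p)"
proof -
  have "ext_below A z \<delta> k p \<subseteq> {u \<in> carrier R. z \<otimes> u \<in> ext_below A z \<delta> (Suc k) (\<delta> + p)}"
  proof (rule ext_below_least[OF ideal_colon[OF ext_ideal(2) z]])
    fix j q c assume *: "j < k" "c \<in> A q" "((+) \<delta> ^^ j) q = p"
    have "z [^] Suc j \<otimes> c \<in> ext_below A z \<delta> (Suc k) (\<delta> + p)"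
      using * by (intro ext_below_memI[of _ q]) simp_all
    moreover have "z [^] Suc j \<otimes> c = z \<otimes> (z [^] j \<otimes> c)"
      using Ac[OF *(2)] z by (simp add: m_assoc m_lcomm m_comm)
    ultimately show "z [^] j \<otimes> c \<in> {u \<in> carrier R. z \<otimes> u \<in> ext_below A z \<delta> (Suc k) (\<delta> + p)}"
      using Ac[OF *(2)] z by simp
  qed
  then show ?thesis using assms by auto
qed

lemma ext_below_mono: "k \<le> k' \<Longrightarrow> ext_below A z \<delta> k p \<subseteq> ext_below A z \<delta> k' p"
  by (intro ext_below_least ext_ideal ext_below_memI) auto

lemma ext_below_0: "ext_below A z \<delta> 0 p \<subseteq> {\<zero>}"
  by (rule ext_below_least[OF zeroideal]) simp

text \<open>By cancellation at most one degree q is possible for the coefficient of z^k; if there is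
  none, the new power of z contributes nothing.\<close>

lemma ext_below_Suc:
  assumes "e \<in> ext_below A z \<delta> (Suc k) p"
  shows "e \<in> ext_below A z \<delta> k p \<or>
    (\<exists>q c u. ((+) \<delta> ^^ k) q = p \<and> c \<in> A q \<and> u \<in> ext_below A z \<delta> k p \<and> e = u \<oplus> z [^] k \<otimes> c)"
proof (cases "\<exists>q. ((+) \<delta> ^^ k) q = p")
  case False
  have "ext_below A z \<delta> (Suc k) p \<subseteq> ext_below A z \<delta> k p"
  proof (rule ext_below_least[OF ext_ideal(2)])
    fix j q c assume *: "j < Suc k" "c \<in> A q" "((+) \<delta> ^^ j) q = p"
    then have "j < k" using False less_Suc_eq by auto
    then show "z [^] j \<otimes> c \<in> ext_below A z \<delta> k p" using * by (intro ext_below_memI)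
  qed
  then show ?thesis using assms by auto
next
  case True
  then obtain q where q: "((+) \<delta> ^^ k) q = p" by blast
  have zk: "z [^] k \<in> carrier R" using z by simp
  have idS: "ideal (ext_below A z \<delta> k p <+> (PIdl (z [^] k)) \<cdot> A q) R"
    using ext_ideal(2) graded_algebraD(1)[OF A] zk by (intro ideal_ops)
  have idp: "ideal ((PIdl (z [^] k)) \<cdot> A q) R"
    using graded_algebraD(1)[OF A] zk by (intro ideal_ops)
  have "ext_below A z \<delta> (Suc k) p \<subseteq> ext_below A z \<delta> k p <+> (PIdl (z [^] k)) \<cdot> A q"
  proof (rule ext_below_least[OF idS])
    fix j q' c assume *: "j < Suc k" "c \<in> A q'" "((+) \<delta> ^^ j) q' = p"
    show "z [^] j \<otimes> c \<in> ext_below A z \<delta> k p <+> (PIdl (z [^] k)) \<cdot> A q"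
    proof (cases "j = k")
      case True
      then have "q' = q" using * q shift_inj by metis
      then have "z [^] j \<otimes> c \<in> (PIdl (z [^] k)) \<cdot> A q"
        using cgenideal_prodI[OF graded_algebraD(1)[OF A] zk] * True by simp
      then show ?thesis using set_add_right[OF ext_ideal(2) idp] by simp
    next
      case False
      then have "z [^] j \<otimes> c \<in> ext_below A z \<delta> k p" using * by (intro ext_below_memI) auto
      then show ?thesis using set_add_left[OF ext_ideal(2) idp] by simp
    qed
  qed
  then have "e \<in> ext_below A z \<delta> k p <+> (PIdl (z [^] k)) \<cdot> A q" using assms by auto
  then obtain u v where uv: "u \<in> ext_below A z \<delta> k p" "v \<in> (PIdl (z [^] k)) \<cdot> A q" "e = u \<oplus> v"
    by (auto simp: mem_set_add)
  then obtain c where "c \<in> A q" "v = z [^] k \<otimes> c"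
    using mem_cgenideal_prod[OF graded_algebraD(1)[OF A] zk] by auto
  then show ?thesis using uv q by blast
qed

lemma ext_Union:
  assumes "e \<in> ext A z \<delta> p" shows "\<exists>k. e \<in> ext_below A z \<delta> k p"
proof -
  have "ideal (\<Union>k. ext_below A z \<delta> k p) R"
  proof (rule ideal_ofI)
    show "(\<Union>k. ext_below A z \<delta> k p) \<subseteq> carrier R" using ideal_subset_carrier[OF ext_ideal(2)] by auto
    show "\<zero> \<in> (\<Union>k. ext_below A z \<delta> k p)" using ideal_zero_mem[OF ext_ideal(2)] by auto
    show "x \<oplus> y \<in> (\<Union>k. ext_below A z \<delta> k p)"
      if xy: "x \<in> (\<Union>k. ext_below A z \<delta> k p)" "y \<in> (\<Union>k. ext_below A z \<delta> k p)" for x y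
    proof -
      obtain i j where "x \<in> ext_below A z \<delta> i p" "y \<in> ext_below A z \<delta> j p" using xy by auto
      then have "x \<in> ext_below A z \<delta> (max i j) p" "y \<in> ext_below A z \<delta> (max i j) p"
        using ext_below_mono[of i "max i j" p] ext_below_mono[of j "max i j" p] by auto
      then show ?thesis using ideal_add_mem[OF ext_ideal(2)] by blast
    qed
    show "r \<otimes> x \<in> (\<Union>k. ext_below A z \<delta> k p)"
      if xr: "x \<in> (\<Union>k. ext_below A z \<delta> k p)" "r \<in> carrier R" for x r
    proof -
      obtain k where "x \<in> ext_below A z \<delta> k p" using xr(1) by blast
      then have "r \<otimes> x \<in> ext_below A z \<delta> k p" using xr(2) by (rule ideal_mult_mem[OF ext_ideal(2)])
      then show ?thesis by blast
    qed
  qed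
  then have "ext A z \<delta> p \<subseteq> (\<Union>k. ext_below A z \<delta> k p)"
    by (rule ext_least) (auto intro!: ext_below_memI exI[of _ "Suc _"])
  then show ?thesis using assms by auto
qed

lemma ext_algebra: "graded_algebra R (ext A z \<delta>)"
  unfolding graded_algebra_def
proof (intro conjI allI)
  show "ideal (ext A z \<delta> p) R" for p by (rule ext_ideal)
  show "ext A z \<delta> 0 = carrier R"
    using ext_superset[of 0] graded_algebraD(2)[OF A] ideal_subset_carrier[OF ext_ideal(1), of 0] by auto
  fix p p'
  have 1: "(z [^] j \<otimes> c) \<otimes> w \<in> ext A z \<delta> (p + p')"
    if jc: "c \<in> A q" "((+) \<delta> ^^ j) q = p" and w: "w \<in> ext A z \<delta> p'" for j q c w
  proof -
    have zc: "z [^] j \<otimes> c \<in> carrier R" using Ac[OF jc(1)] z by simp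
    have "ext A z \<delta> p' \<subseteq> {u \<in> carrier R. (z [^] j \<otimes> c) \<otimes> u \<in> ext A z \<delta> (p + p')}"
    proof (rule ext_least[OF ideal_colon[OF ext_ideal(1) zc]])
      fix j' q' c' assume *: "c' \<in> A q'" "((+) \<delta> ^^ j') q' = p'"
      have "((+) \<delta> ^^ (j + j')) (q + q') = ((+) \<delta> ^^ j) (((+) \<delta> ^^ j') (q + q'))" by (simp add: funpow_add)
      also have "((+) \<delta> ^^ j') (q + q') = q + p'" using shift_add[of j' \<delta> q q'] *(2) by simp
      also have "((+) \<delta> ^^ j) (q + p') = p' + p"
        using shift_add[of j \<delta> p' q] jc(2) add.commute[of q p'] by simp
      finally have "((+) \<delta> ^^ (j + j')) (q + q') = p + p'" by (simp only: add.commute[of p' p])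
      then have "z [^] (j + j') \<otimes> (c \<otimes> c') \<in> ext A z \<delta> (p + p')"
        using graded_algebraD(3)[OF A jc(1) *(1)] by (rule ext_memI[rotated])
      moreover have "z [^] (j + j') \<otimes> (c \<otimes> c') = (z [^] j \<otimes> c) \<otimes> (z [^] j' \<otimes> c')"
        using Ac[OF jc(1)] Ac[OF *(1)] z by (simp add: nat_pow_mult[symmetric] m_ac)
      ultimately show "z [^] j' \<otimes> c' \<in> {u \<in> carrier R. (z [^] j \<otimes> c) \<otimes> u \<in> ext A z \<delta> (p + p')}"
        using Ac[OF *(1)] z by simp
    qed
    then show ?thesis using w by auto
  qed
  show "ext A z \<delta> p \<cdot> ext A z \<delta> p' \<subseteq> ext A z \<delta> (p + p')"
  proof (rule ideal_prod_least[OF ext_ideal(1)])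
    fix v w assume v: "v \<in> ext A z \<delta> p" and w: "w \<in> ext A z \<delta> p'"
    have wc: "w \<in> carrier R" using w ideal_mem_carrier[OF ext_ideal(1)] by simp
    have "ext A z \<delta> p \<subseteq> {u \<in> carrier R. w \<otimes> u \<in> ext A z \<delta> (p + p')}"
    proof (rule ext_least[OF ideal_colon[OF ext_ideal(1) wc]])
      fix j q c assume *: "c \<in> A q" "((+) \<delta> ^^ j) q = p"
      have "z [^] j \<otimes> c \<in> carrier R" using Ac[OF *(1)] z by simp
      then show "z [^] j \<otimes> c \<in> {u \<in> carrier R. w \<otimes> u \<in> ext A z \<delta> (p + p')}"
        using 1[OF * w] wc m_comm[of w "z [^] j \<otimes> c"] by simp
    qed
    then have "w \<otimes> v \<in> ext A z \<delta> (p + p')" using v by auto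
    moreover have "v \<in> carrier R" using v ideal_mem_carrier[OF ext_ideal(1)] by simp
    ultimately show "v \<otimes> w \<in> ext A z \<delta> (p + p')" using wc m_comm[of v w] by simp
  qed
qed

text \<open>Leading coefficients in the sense of Hilbert's basis theorem, taken over all ways of
  writing elements of N with z-degree at most k.\<close>

definition leading :: "('d \<Rightarrow> 'a set) \<Rightarrow> nat \<Rightarrow> 'd \<Rightarrow> 'a set"
  where "leading N k q = {c \<in> A q. \<exists>u\<in>ext_below A z \<delta> k (((+) \<delta> ^^ k) q). z [^] k \<otimes> c \<oplus> u \<in> N (((+) \<delta> ^^ k) q)}"

lemma leading_submodule:
  assumes N: "graded_submodule R (ext A z \<delta>) N"
  shows "graded_submodule R A (leading N k)"
proof -
  have zk: "z [^] k \<in> carrier R" using z by simp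
  have Uc: "u \<in> carrier R" if "u \<in> ext_below A z \<delta> k p" for u p
    using that ideal_mem_carrier[OF ext_ideal(2)] by simp
  have mult: "a \<otimes> c \<in> leading N k (r + q)" if a: "a \<in> A r" and c: "c \<in> leading N k q" for a c r q
  proof -
    let ?p = "((+) \<delta> ^^ k) q"
    obtain u where u: "c \<in> A q" "u \<in> ext_below A z \<delta> k ?p" "z [^] k \<otimes> c \<oplus> u \<in> N ?p"
      using c by (auto simp: leading_def)
    have "a \<otimes> (z [^] k \<otimes> c \<oplus> u) \<in> N (r + ?p)"
      using graded_submoduleD(3)[OF N subsetD[OF ext_superset a] u(3)] .
    moreover have "a \<otimes> (z [^] k \<otimes> c \<oplus> u) = z [^] k \<otimes> (a \<otimes> c) \<oplus> a \<otimes> u"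
      using Ac[OF a] Ac[OF u(1)] Uc[OF u(2)] zk by (simp add: r_distr m_lcomm)
    moreover have "a \<otimes> u \<in> ext_below A z \<delta> k (r + ?p)" using ext_below_mult[OF a u(2)] .
    ultimately show ?thesis
      using graded_algebraD(3)[OF A a u(1)] by (auto simp: leading_def shift_add)
  qed
  have id: "ideal (leading N k q) R" for q
  proof (rule ideal_ofI)
    let ?p = "((+) \<delta> ^^ k) q"
    show "leading N k q \<subseteq> carrier R" using Ac by (auto simp: leading_def)
    have "z [^] k \<otimes> \<zero> \<oplus> \<zero> \<in> N ?p" using zk ideal_zero_mem[OF graded_submoduleD(1)[OF N]] by simp
    then show "\<zero> \<in> leading N k q"
      using ideal_zero_mem[OF ext_ideal(2)] ideal_zero_mem[OF graded_algebraD(1)[OF A]] unfolding leading_def by blast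
    fix x assume x: "x \<in> leading N k q"
    then obtain u where u: "x \<in> A q" "u \<in> ext_below A z \<delta> k ?p" "z [^] k \<otimes> x \<oplus> u \<in> N ?p" by (auto simp: leading_def)
    show "x \<oplus> y \<in> leading N k q" if y: "y \<in> leading N k q" for y
    proof -
      obtain v where v: "y \<in> A q" "v \<in> ext_below A z \<delta> k ?p" "z [^] k \<otimes> y \<oplus> v \<in> N ?p"
        using y by (auto simp: leading_def)
      have "(z [^] k \<otimes> x \<oplus> u) \<oplus> (z [^] k \<otimes> y \<oplus> v) \<in> N ?p"
        using u(3) v(3) by (rule ideal_add_mem[OF graded_submoduleD(1)[OF N]])
      moreover have "(z [^] k \<otimes> x \<oplus> u) \<oplus> (z [^] k \<otimes> y \<oplus> v) = z [^] k \<otimes> (x \<oplus> y) \<oplus> (u \<oplus> v)"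
        using Ac[OF u(1)] Ac[OF v(1)] Uc[OF u(2)] Uc[OF v(2)] zk by algebra
      moreover have "u \<oplus> v \<in> ext_below A z \<delta> k ?p" using u(2) v(2) by (rule ideal_add_mem[OF ext_ideal(2)])
      moreover have "x \<oplus> y \<in> A q" using u(1) v(1) by (rule ideal_add_mem[OF graded_algebraD(1)[OF A]])
      ultimately show ?thesis unfolding leading_def by auto
    qed
    show "r \<otimes> x \<in> leading N k q" if "r \<in> carrier R" for r
      using mult[of r 0 x q] that x graded_algebraD(2)[OF A] by simp
  qed
  show ?thesis
    unfolding graded_submodule_def
  proof (intro conjI allI id)
    show "leading N k \<le> A" by (auto simp: le_fun_def leading_def)
    show "A p \<cdot> leading N k q \<subseteq> leading N k (p + q)" for p q using mult by (rule ideal_prod_least[OF id])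
  qed
qed

lemma leading_mono: "N \<le> N' \<Longrightarrow> leading N k \<le> leading N' k"
  unfolding le_fun_def leading_def by blast

lemma leading_Suc:
  assumes N: "graded_submodule R (ext A z \<delta>) N"
  shows "leading N k \<le> leading N (Suc k)"
proof (rule le_funI, rule subsetI)
  fix q c assume "c \<in> leading N k q"
  then obtain u where u: "c \<in> A q" "u \<in> ext_below A z \<delta> k (((+) \<delta> ^^ k) q)" "z [^] k \<otimes> c \<oplus> u \<in> N (((+) \<delta> ^^ k) q)"
    by (auto simp: leading_def)
  have uc: "u \<in> carrier R" using u(2) ideal_mem_carrier[OF ext_ideal(2)] by simp
  have "\<one> \<in> A 0" using graded_algebraD(2)[OF A] by simp
  then have "z [^] (1::nat) \<otimes> \<one> \<in> ext A z \<delta> \<delta>" by (rule ext_memI) simp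
  then have "z \<in> ext A z \<delta> \<delta>" using z by simp
  then have "z \<otimes> (z [^] k \<otimes> c \<oplus> u) \<in> N (\<delta> + ((+) \<delta> ^^ k) q)" using graded_submoduleD(3)[OF N] u(3) by blast
  moreover have "z \<otimes> (z [^] k \<otimes> c \<oplus> u) = z [^] Suc k \<otimes> c \<oplus> z \<otimes> u"
    using Ac[OF u(1)] uc z by (simp add: r_distr m_ac)
  ultimately show "c \<in> leading N (Suc k) q"
    using u(1) ext_below_shift[OF u(2)] by (auto simp: leading_def)
qed

text \<open>Subtract from an element of N' an element of N with the same leading coefficient; the
  difference is in N' and has smaller z-degree.\<close>

lemma leading_determines:
  assumes N: "graded_submodule R (ext A z \<delta>) N" and N': "graded_submodule R (ext A z \<delta>) N'"
    and le: "N \<le> N'" and lead: "\<And>k. leading N' k = leading N k"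
  shows "N' = N"
proof (rule antisym[OF _ le], rule le_funI, rule subsetI)
  fix p e assume e: "e \<in> N' p"
  have "e \<in> N p" if "e \<in> N' p" "e \<in> ext_below A z \<delta> k p" for k e
    using that
  proof (induction k arbitrary: e)
    case 0
    then show ?case using ext_below_0[of p] ideal_zero_mem[OF graded_submoduleD(1)[OF N]] by auto
  next
    case (Suc k)
    from ext_below_Suc[OF Suc.prems(2)] show ?case
    proof
      assume "e \<in> ext_below A z \<delta> k p"
      then show ?thesis using Suc by simp
    next
      assume "\<exists>q c u. ((+) \<delta> ^^ k) q = p \<and> c \<in> A q \<and> u \<in> ext_below A z \<delta> k p \<and> e = u \<oplus> z [^] k \<otimes> c"
      then obtain q c u where *: "((+) \<delta> ^^ k) q = p" "c \<in> A q" "u \<in> ext_below A z \<delta> k p" "e = u \<oplus> z [^] k \<otimes> c"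
        by blast
      have c: "c \<in> carrier R" "u \<in> carrier R" "z [^] k \<in> carrier R"
        using Ac[OF *(2)] *(3) ideal_mem_carrier[OF ext_ideal(2)] z by auto
      have "z [^] k \<otimes> c \<oplus> u \<in> N' p" using Suc.prems(1) *(4) c by (simp add: a_comm)
      then have "c \<in> leading N' k q" using * by (auto simp: leading_def)
      then have "c \<in> leading N k q" using lead by simp
      then obtain u' where u': "u' \<in> ext_below A z \<delta> k p" "z [^] k \<otimes> c \<oplus> u' \<in> N p"
        using *(1) by (auto simp: leading_def)
      have u'c: "u' \<in> carrier R" using u'(1) ideal_mem_carrier[OF ext_ideal(2)] by simp
      have eq: "e \<ominus> (z [^] k \<otimes> c \<oplus> u') = u \<ominus> u'" unfolding *(4) using c u'c by algebra
      have "e \<ominus> (z [^] k \<otimes> c \<oplus> u') \<in> N' p"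
        using Suc.prems(1) u'(2) le by (intro ideal_diff_mem[OF graded_submoduleD(1)[OF N']]) (auto simp: le_fun_def)
      moreover have "u \<ominus> u' \<in> ext_below A z \<delta> k p" using *(3) u'(1) by (rule ideal_diff_mem[OF ext_ideal(2)])
      ultimately have "e \<ominus> (z [^] k \<otimes> c \<oplus> u') \<in> N p" using Suc.IH unfolding eq by simp
      then have "(e \<ominus> (z [^] k \<otimes> c \<oplus> u')) \<oplus> (z [^] k \<otimes> c \<oplus> u') \<in> N p"
        using u'(2) by (rule ideal_add_mem[OF graded_submoduleD(1)[OF N]])
      moreover have "(e \<ominus> (z [^] k \<otimes> c \<oplus> u')) \<oplus> (z [^] k \<otimes> c \<oplus> u') = e"
        unfolding *(4) using c u'c by algebra
      ultimately show ?thesis by simp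
    qed
  qed
  then show "e \<in> N p" using e ext_Union[of e p] graded_submoduleD(2)[OF N'] by blast
qed

text \<open>Leading submodules increase both with i and with the z-degree k, so stabilization has to
  be made uniform in k before \<open>leading_determines\<close> can be applied.\<close>

lemma ext_noetherian:
  assumes "graded_noetherian R A"
  shows "graded_noetherian R (ext A z \<delta>)"
  unfolding graded_noetherian_def
proof (intro allI impI)
  fix N :: "nat \<Rightarrow> 'd \<Rightarrow> 'a set"
  assume "(\<forall>i. graded_submodule R (ext A z \<delta>) (N i)) \<and> incseq N"
  then have N: "\<And>i. graded_submodule R (ext A z \<delta>) (N i)" and inc: "incseq N" by auto
  have stab: "\<exists>m. \<forall>i\<ge>m. L i = L m" if "\<And>i. graded_submodule R A (L i)" "incseq L" for L :: "nat \<Rightarrow> 'd \<Rightarrow> 'a set"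
    using assms that unfolding graded_noetherian_def by blast
  have mono: "leading (N i) k \<le> leading (N j) l" if "i \<le> j" "k \<le> l" for i j k l
  proof -
    have "incseq (leading (N j))" by (rule incseq_SucI) (rule leading_Suc[OF N])
    then have "leading (N j) k \<le> leading (N j) l" using that(2) by (rule incseqD)
    moreover have "leading (N i) k \<le> leading (N j) k" by (rule leading_mono) (rule incseqD[OF inc that(1)])
    ultimately show ?thesis by (rule order_trans[rotated])
  qed
  \<comment> \<open>Once the diagonal is constant from m on, all k \<ge> m are settled together;
    only the finitely many k < m need bounds of their own.\<close>
  have "incseq (\<lambda>i. leading (N i) i)" by (rule incseq_SucI) (rule mono, simp_all)
  then obtain m where m: "\<And>i. i \<ge> m \<Longrightarrow> leading (N i) i = leading (N m) m"
    using stab[of "\<lambda>i. leading (N i) i"] leading_submodule[OF N] by blast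
  have "\<exists>n. \<forall>i\<ge>n. leading (N i) k = leading (N n) k" for k
    using stab[of "\<lambda>i. leading (N i) k"] leading_submodule[OF N] mono by (auto simp: incseq_def)
  then obtain n where n: "\<And>k i. i \<ge> n k \<Longrightarrow> leading (N i) k = leading (N (n k)) k" by metis
  define s where "s = Max (insert m (n ` {..<m}))"
  have sm: "m \<le> s" and sn: "\<And>k. k < m \<Longrightarrow> n k \<le> s" by (auto simp: s_def)
  have "N i = N s" if i: "i \<ge> s" for i
  proof (rule leading_determines[OF N N incseqD[OF inc i]])
    fix k show "leading (N i) k = leading (N s) k"
    proof (cases "k < m")
      case True
      then show ?thesis using n[of k i] n[of k s] sn[OF True] i by simp
    next
      case False
      have "leading (N j) k = leading (N m) m" if "j \<ge> m" for j
      proof (rule antisym)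
        show "leading (N m) m \<le> leading (N j) k" using that False by (intro mono) auto
        have "leading (N j) k \<le> leading (N (max j k)) (max j k)" by (intro mono) auto
        then show "leading (N j) k \<le> leading (N m) m" using m[of "max j k"] that by simp
      qed
      then show ?thesis using i sm by simp
    qed
  qed
  then show "\<exists>m. \<forall>i\<ge>m. N i = N m" by blast
qed

end

fun gens_algebra :: "('a \<times> 'd::cancel_comm_monoid_add) list \<Rightarrow> 'd \<Rightarrow> 'a set"
  where "gens_algebra [] = (\<lambda>p. if p = 0 then carrier R else {\<zero>})"
  | "gens_algebra (g # gs) = ext (gens_algebra gs) (fst g) (snd g)"

lemma gens_algebra_algebra: "fst ` set gs \<subseteq> carrier R \<Longrightarrow> graded_algebra R (gens_algebra gs)"
proof (induction gs)
  case Nil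
  have "{\<zero>} \<cdot> B \<subseteq> {\<zero>}" "B \<cdot> {\<zero>} \<subseteq> {\<zero>}" if "ideal B R" for B
    using that ideal_prod_zero[OF that] ideal_prod_commute[OF that zeroideal] by simp_all
  then show ?case
    unfolding graded_algebra_def using oneideal zeroideal ideal_prod_one[OF oneideal] by auto
qed (auto intro: ext_algebra)

lemma gens_algebra_gen:
  "fst ` set gs \<subseteq> carrier R \<Longrightarrow> (z, \<delta>) \<in> set gs \<Longrightarrow> z \<in> gens_algebra gs \<delta>"
proof (induction gs)
  case (Cons g gs)
  have alg: "graded_algebra R (gens_algebra gs)" using Cons.prems by (intro gens_algebra_algebra) auto
  have gc: "fst g \<in> carrier R" using Cons.prems by auto
  show ?case
  proof (cases "(z, \<delta>) = g")
    case True
    have "\<one> \<in> gens_algebra gs 0" using graded_algebraD(2)[OF alg] by simp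
    then have "fst g [^] (1::nat) \<otimes> \<one> \<in> ext (gens_algebra gs) (fst g) (snd g) (snd g)"
      by (rule ext_memI[OF alg gc]) simp
    moreover have "fst g = z" "snd g = \<delta>" using True by auto
    ultimately show ?thesis using gc by simp
  next
    case False
    then have "z \<in> gens_algebra gs \<delta>" using Cons by auto
    then show ?thesis using ext_superset[OF alg gc] by auto
  qed
qed simp

lemma gens_algebra_least:
  assumes "fst ` set gs \<subseteq> carrier R" and E: "graded_algebra R E" and "\<And>z \<delta>. (z, \<delta>) \<in> set gs \<Longrightarrow> z \<in> E \<delta>"
  shows "gens_algebra gs p \<subseteq> E p"
  using assms(1,3)
proof (induction gs arbitrary: p)
  case Nil
  then show ?case using graded_algebraD(2)[OF E] ideal_zero_mem[OF graded_algebraD(1)[OF E]] by auto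
next
  case (Cons g gs)
  have alg: "graded_algebra R (gens_algebra gs)" using Cons.prems by (intro gens_algebra_algebra) auto
  have gc: "fst g \<in> carrier R" using Cons.prems by auto
  have gE: "fst g \<in> E (snd g)" using Cons.prems(2)[of "fst g" "snd g"] by simp
  have gE': "fst g [^] j \<otimes> c \<in> E (((+) (snd g) ^^ j) q)" if "c \<in> gens_algebra gs q" for j q c
  proof (induction j)
    case 0
    have "c \<in> E q" using that Cons.IH[of q] Cons.prems by auto
    then show ?case using graded_algebra_carrier[OF E] by simp
  next
    case (Suc j)
    have "fst g \<otimes> (fst g [^] j \<otimes> c) \<in> E (snd g + ((+) (snd g) ^^ j) q)"
      using graded_algebraD(3)[OF E gE Suc] .
    moreover have "c \<in> carrier R" using that graded_algebra_carrier[OF alg] by auto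
    ultimately show ?case using gc by (simp add: m_ac)
  qed
  have "ext (gens_algebra gs) (fst g) (snd g) p \<subseteq> E p"
  proof (rule ext_least[OF alg gc graded_algebraD(1)[OF E]])
    fix j q c assume "c \<in> gens_algebra gs q" "((+) (snd g) ^^ j) q = p"
    then show "fst g [^] j \<otimes> c \<in> E p" using gE'[of c q j] by simp
  qed
  then show ?case by simp
qed

end

context noetherian_cring
begin

lemma gens_algebra_noetherian:
  "fst ` set gs \<subseteq> carrier R \<Longrightarrow> graded_noetherian R (gens_algebra (gs :: ('a \<times> 'd::cancel_comm_monoid_add) list))"
proof (induction gs)
  case Nil
  show ?case
    unfolding graded_noetherian_def
  proof (intro allI impI)
    fix N :: "nat \<Rightarrow> 'd \<Rightarrow> 'a set"
    assume "(\<forall>i. graded_submodule R (gens_algebra []) (N i)) \<and> incseq N"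
    then have N: "\<And>i. graded_submodule R (gens_algebra []) (N i)" and inc: "incseq N" by auto
    have "incseq (\<lambda>i. N i 0)" using inc by (simp add: incseq_def le_fun_def)
    then obtain m where m: "\<And>i. i \<ge> m \<Longrightarrow> N i 0 = N m 0"
      using ideal_sequence_stabilizes[of "\<lambda>i. N i 0"] graded_submoduleD(1)[OF N] by blast
    have "N i p = {\<zero>}" if "p \<noteq> 0" for i p
      using that graded_submoduleD(2)[OF N, of i p] ideal_zero_mem[OF graded_submoduleD(1)[OF N], of i p] by auto
    then have "N i = N m" if "i \<ge> m" for i using m[OF that] by (metis ext)
    then show "\<exists>m. \<forall>i\<ge>m. N i = N m" by blast
  qed
next
  case (Cons g gs)
  then show ?case using gens_algebra_algebra[of gs] by (auto intro: ext_noetherian)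
qed

definition bipow_pair :: "'a set \<Rightarrow> 'a set \<Rightarrow> nat \<times> nat \<Rightarrow> 'a set"
  where "bipow_pair A B p = bipow R A B (fst p) (snd p)"

lemma bipow_pair_algebra: "ideal A R \<Longrightarrow> ideal B R \<Longrightarrow> graded_algebra R (bipow_pair A B)"
  unfolding graded_algebra_def bipow_pair_def
  by (simp add: bipow_ideal bipow_mult) (simp add: bipow_def ideal_prod_one oneideal)

text \<open>The family is generated over R by finitely many generators of A in degree (1, 0) and of
  B in degree (0, 1), so it is a \<open>gens_algebra\<close>.\<close>

lemma bipow_pair_noetherian:
  assumes A: "ideal A R" and B: "ideal B R"
  shows "graded_noetherian R (bipow_pair A B)"
proof -
  obtain SA SB where SA: "SA \<subseteq> carrier R" "finite SA" "A = Idl SA" and SB: "SB \<subseteq> carrier R" "finite SB" "B = Idl SB"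
    using finetely_gen[OF A] finetely_gen[OF B] by blast
  obtain as bs where as: "set as = SA" and bs: "set bs = SB" using finite_list SA(2) SB(2) by metis
  define gs where "gs = map (\<lambda>a. (a, (1::nat, 0::nat))) as @ map (\<lambda>b. (b, (0, 1))) bs"
  have gc: "fst ` set gs \<subseteq> carrier R" using SA(1) SB(1) by (auto simp: gs_def as bs)
  note alg = gens_algebra_algebra[OF gc]
  note E = bipow_pair_algebra[OF A B]
  have "A \<subseteq> gens_algebra gs (1, 0)"
    unfolding SA(3) using gens_algebra_gen[OF gc]
    by (intro genideal_minimal graded_algebraD(1)[OF alg]) (auto simp: gs_def as)
  then have Ap: "ipow R A r \<subseteq> gens_algebra gs (r, 0)" for r
  proof (induction r)
    case 0
    then show ?case using graded_algebraD(2)[OF alg] by (simp flip: zero_prod_def)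
  next
    case (Suc r)
    show ?case
      unfolding ipow_Suc
    proof (rule ideal_prod_least[OF graded_algebraD(1)[OF alg]])
      fix a b assume "a \<in> ipow R A r" "b \<in> A"
      then show "a \<otimes> b \<in> gens_algebra gs (Suc r, 0)"
        using graded_algebraD(3)[OF alg, of a "(r, 0)" b "(1, 0)"] Suc by auto
    qed
  qed
  have "B \<subseteq> gens_algebra gs (0, 1)"
    unfolding SB(3) using gens_algebra_gen[OF gc]
    by (intro genideal_minimal graded_algebraD(1)[OF alg]) (auto simp: gs_def bs)
  then have Bp: "ipow R B s \<subseteq> gens_algebra gs (0, s)" for s
  proof (induction s)
    case 0
    then show ?case using graded_algebraD(2)[OF alg] by (simp flip: zero_prod_def)
  next
    case (Suc s)
    show ?case
      unfolding ipow_Suc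
    proof (rule ideal_prod_least[OF graded_algebraD(1)[OF alg]])
      fix a b assume "a \<in> ipow R B s" "b \<in> B"
      then show "a \<otimes> b \<in> gens_algebra gs (0, Suc s)"
        using graded_algebraD(3)[OF alg, of a "(0, s)" b "(0, 1)"] Suc by auto
    qed
  qed
  have "bipow_pair A B p = gens_algebra gs p" for p
  proof
    show "bipow_pair A B p \<subseteq> gens_algebra gs p"
      unfolding bipow_pair_def bipow_def
    proof (rule ideal_prod_least[OF graded_algebraD(1)[OF alg]])
      fix a b assume "a \<in> ipow R A (fst p)" "b \<in> ipow R B (snd p)"
      then show "a \<otimes> b \<in> gens_algebra gs p"
        using graded_algebraD(3)[OF alg, of a "(fst p, 0)" b "(0, snd p)"] Ap Bp by auto
    qed
    show "gens_algebra gs p \<subseteq> bipow_pair A B p"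
    proof (rule gens_algebra_least[OF gc E])
      fix z \<delta> assume "(z, \<delta>) \<in> set gs"
      then have "(z \<in> SA \<and> \<delta> = (1, 0)) \<or> (z \<in> SB \<and> \<delta> = (0, 1))" by (auto simp: gs_def as bs)
      moreover have "SA \<subseteq> A" "SB \<subseteq> B" using genideal_self SA SB by auto
      ultimately show "z \<in> bipow_pair A B \<delta>"
        using A B by (auto simp: bipow_pair_def bipow_def ideal_prod_one ideal_prod_one')
    qed
  qed
  then have "bipow_pair A B = gens_algebra gs" by (rule ext)
  then show ?thesis using gens_algebra_noetherian[OF gc] by simp
qed

text \<open>\<open>finitely_many_maximal_annihilators\<close> applied to pairs of a degree and an
  element. Annihilators of sets of such pairs are graded submodules, which provides the maximality
  condition.\<close>

lemma finitely_many_homogeneous_zero_divisor_ideals: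
  assumes alg: "graded_algebra R A" and noeth: "graded_noetherian R A" and N: "graded_submodule R A N"
  shows "\<exists>T. finite T \<and> (\<forall>(q, u)\<in>T. u \<in> A q \<and> u \<notin> N q) \<and>
    (\<forall>p q c b. c \<in> A p \<longrightarrow> b \<in> A q \<longrightarrow> b \<notin> N q \<longrightarrow> c \<otimes> b \<in> N (p + q) \<longrightarrow>
      (\<exists>(q', u)\<in>T. c \<otimes> u \<in> N (p + q')))"
proof -
  let ?S = "{(p, a). a \<in> A p}" and ?N = "{(p, a). a \<in> N p}"
  let ?f = "\<lambda>(p, a) (q, b). (p + q, a \<otimes> b)"
  note car = graded_algebra_carrier[OF alg]
  let ?fam = "\<lambda>B p. {c \<in> A p. \<forall>(q, u)\<in>B. c \<otimes> u \<in> N (p + q)}"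
  have fam: "graded_submodule R A (?fam B)" if B: "B \<subseteq> ?S" for B
  proof -
    have Bc: "(q, u) \<in> B \<Longrightarrow> u \<in> carrier R" for q u using B car by auto
    have id: "ideal (?fam B p) R" for p
    proof (rule ideal_ofI)
      show "?fam B p \<subseteq> carrier R" using car by auto
      show "\<zero> \<in> ?fam B p"
        using ideal_zero_mem[OF graded_algebraD(1)[OF alg]] ideal_zero_mem[OF graded_submoduleD(1)[OF N]] Bc by auto
      show "x \<oplus> y \<in> ?fam B p" if "x \<in> ?fam B p" "y \<in> ?fam B p" for x y
        using that ideal_add_mem[OF graded_algebraD(1)[OF alg]] ideal_add_mem[OF graded_submoduleD(1)[OF N]] Bc car
        by (auto simp: l_distr split: prod.splits)
      show "r \<otimes> x \<in> ?fam B p" if "x \<in> ?fam B p" "r \<in> carrier R" for x r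
        using that ideal_mult_mem[OF graded_algebraD(1)[OF alg]] ideal_mult_mem[OF graded_submoduleD(1)[OF N]] Bc car
        by (auto simp: m_assoc split: prod.splits)
    qed
    have "A p \<cdot> ?fam B q \<subseteq> ?fam B (p + q)" for p q
    proof (rule ideal_prod_least[OF id])
      fix a c assume a: "a \<in> A p" and c: "c \<in> ?fam B q"
      have "(a \<otimes> c) \<otimes> u \<in> N (p + q + q')" if "(q', u) \<in> B" for q' u
      proof -
        have "c \<otimes> u \<in> N (q + q')" using c that by auto
        then have "a \<otimes> (c \<otimes> u) \<in> N (p + (q + q'))" using graded_submoduleD(3)[OF N a] by blast
        then show ?thesis using a c Bc[OF that] car by (auto simp: m_assoc add.assoc)
      qed
      then show "a \<otimes> c \<in> ?fam B (p + q)" using graded_algebraD(3)[OF alg a] c by auto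
    qed
    then show ?thesis unfolding graded_submodule_def using id by (auto simp: le_fun_def)
  qed
  have "\<exists>T. finite T \<and> T \<subseteq> ?S - ?N \<and> (\<forall>b c. b \<in> ?S - ?N \<longrightarrow> c \<in> ?S \<longrightarrow> ?f c b \<in> ?N \<longrightarrow> (\<exists>u\<in>T. ?f c u \<in> ?N))"
  proof (rule finitely_many_maximal_annihilators[of ?S ?f "(0, \<one>)" ?N])
    show "?f a b \<in> ?S" if "a \<in> ?S" "b \<in> ?S" for a b using that graded_algebraD(3)[OF alg] by auto
    show "?f (?f a b) c = ?f a (?f b c)" if "a \<in> ?S" "b \<in> ?S" "c \<in> ?S" for a b c
      using that car by (auto simp: m_assoc add.assoc)
    show "?f a b = ?f b a" if "a \<in> ?S" "b \<in> ?S" for a b using that car by (auto simp: m_comm add.commute)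
    show "(0, \<one>) \<in> ?S" using graded_algebraD(2)[OF alg] by simp
    show "?f (0, \<one>) a = a" if "a \<in> ?S" for a using that car by auto
    show "?N \<subseteq> ?S" using graded_submoduleD(2)[OF N] by auto
    show "?f a b \<in> ?N" if "a \<in> ?S" "b \<in> ?N" for a b using that graded_submoduleD(3)[OF N] by auto
    show "\<exists>B\<in>As. \<forall>B'\<in>As. {c \<in> ?S. \<forall>u\<in>B. ?f c u \<in> ?N} \<subseteq> {c \<in> ?S. \<forall>u\<in>B'. ?f c u \<in> ?N} \<longrightarrow>
        {c \<in> ?S. \<forall>u\<in>B'. ?f c u \<in> ?N} = {c \<in> ?S. \<forall>u\<in>B. ?f c u \<in> ?N}"
      if As: "As \<noteq> {}" "As \<subseteq> Pow ?S" for As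
    proof -
      have ann: "{c \<in> ?S. \<forall>u\<in>B. ?f c u \<in> ?N} = {(p, c). c \<in> ?fam B p}" for B by auto
      have le: "{(p, c). c \<in> F p} \<subseteq> {(p, c). c \<in> F' p} \<longleftrightarrow> F \<le> F'" for F F'
        by (auto simp: le_fun_def)
      have "\<exists>F\<in>?fam ` As. \<forall>F'\<in>?fam ` As. F \<le> F' \<longrightarrow> F' = F"
      proof (rule graded_noetherian_maximal[OF noeth])
        show "?fam ` As \<noteq> {}" using As(1) by simp
        fix F assume "F \<in> ?fam ` As"
        then obtain B where "B \<in> As" "F = ?fam B" by (rule imageE)
        then show "graded_submodule R A F" using fam[of B] As(2) by auto
      qed
      then obtain B where B: "B \<in> As" "\<And>B'. B' \<in> As \<Longrightarrow> ?fam B \<le> ?fam B' \<Longrightarrow> ?fam B' = ?fam B"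
        by (simp add: image_iff Bex_def) blast
      show ?thesis
        unfolding ann le
      proof (rule bexI[OF _ B(1)], intro ballI impI)
        fix B' assume "B' \<in> As" "?fam B \<le> ?fam B'"
        from B(2)[OF this] show "{(p, c). c \<in> ?fam B' p} = {(p, c). c \<in> ?fam B p}"
          unfolding fun_eq_iff set_eq_iff by simp
      qed
    qed
    fix T assume "finite T" "T \<subseteq> ?S - ?N"
      "\<And>b c. b \<in> ?S - ?N \<Longrightarrow> c \<in> ?S \<Longrightarrow> ?f c b \<in> ?N \<Longrightarrow> \<exists>u\<in>T. ?f c u \<in> ?N"
    then show ?thesis by (intro exI[of _ T] conjI) blast+
  qed
  then obtain T where T: "finite T \<and> T \<subseteq> ?S - ?N \<and>
    (\<forall>b c. b \<in> ?S - ?N \<longrightarrow> c \<in> ?S \<longrightarrow> ?f c b \<in> ?N \<longrightarrow> (\<exists>u\<in>T. ?f c u \<in> ?N))" by (elim exE)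
  note T3 = conjunct2[OF conjunct2[OF T], rule_format]
  show ?thesis
  proof (intro exI[of _ T] conjI allI impI)
    show "finite T" using T by simp
    show "\<forall>(q, u)\<in>T. u \<in> A q \<and> u \<notin> N q" using T by auto
    fix p q c b assume *: "c \<in> A p" "b \<in> A q" "b \<notin> N q" "c \<otimes> b \<in> N (p + q)"
    then have "\<exists>u\<in>T. ?f (p, c) u \<in> ?N" by (intro T3[of "(q, b)"]) auto
    then show "\<exists>(q', u)\<in>T. c \<otimes> u \<in> N (p + q')" by auto
  qed
qed

text \<open>The search takes place in the ideal A \<delta> of R: it must leave the finitely many
  ideals of those c with u c in N (\<delta> + q), and lying inside one of them would make u a socle
  element.\<close>

lemma exists_homogeneous_nzd:
  assumes U: "unit_differences R U" "infinite U"
    and alg: "graded_algebra R A" and noeth: "graded_noetherian R A"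
    and Ns: "finite Ns" "\<And>N. N \<in> Ns \<Longrightarrow> graded_submodule R A N"
    and no_socle: "\<And>N q b. N \<in> Ns \<Longrightarrow> b \<in> A q \<Longrightarrow> \<forall>c\<in>A \<delta>. c \<otimes> b \<in> N (\<delta> + q) \<Longrightarrow> b \<in> N q"
  shows "\<exists>a\<in>A \<delta>. \<forall>N\<in>Ns. \<forall>q. \<forall>b\<in>A q. a \<otimes> b \<in> N (\<delta> + q) \<longrightarrow> b \<in> N q"
proof -
  have "\<forall>N\<in>Ns. \<exists>T. finite T \<and> (\<forall>(q, u)\<in>T. u \<in> A q \<and> u \<notin> N q) \<and>
    (\<forall>p q c b. c \<in> A p \<longrightarrow> b \<in> A q \<longrightarrow> b \<notin> N q \<longrightarrow> c \<otimes> b \<in> N (p + q) \<longrightarrow>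
      (\<exists>(q', u)\<in>T. c \<otimes> u \<in> N (p + q')))"
    using finitely_many_homogeneous_zero_divisor_ideals[OF alg noeth Ns(2)] by blast
  from bchoice[OF this] obtain T where T: "\<forall>N\<in>Ns. finite (T N) \<and> (\<forall>(q, u)\<in>T N. u \<in> A q \<and> u \<notin> N q) \<and>
    (\<forall>p q c b. c \<in> A p \<longrightarrow> b \<in> A q \<longrightarrow> b \<notin> N q \<longrightarrow> c \<otimes> b \<in> N (p + q) \<longrightarrow>
      (\<exists>(q', u)\<in>T N. c \<otimes> u \<in> N (p + q')))" by (elim exE)
  let ?C = "\<lambda>N (q, u). {c \<in> carrier R. u \<otimes> c \<in> N (\<delta> + q)}"
  let ?As = "\<Union>N\<in>Ns. ?C N ` T N"
  note car = graded_algebra_carrier[OF alg]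
  have As: "\<exists>N q u. N \<in> Ns \<and> (q, u) \<in> T N \<and> u \<in> A q \<and> u \<notin> N q \<and> B = {c \<in> carrier R. u \<otimes> c \<in> N (\<delta> + q)}"
    if B: "B \<in> ?As" for B
  proof -
    obtain N t where Nt: "N \<in> Ns" "t \<in> T N" "B = ?C N t" using B by blast
    obtain q u where t: "t = (q, u)" by (cases t)
    have "u \<in> A q \<and> u \<notin> N q" using bspec[OF T Nt(1)] Nt(2) t by auto
    then show ?thesis using Nt t by auto
  qed
  obtain a where a: "a \<in> A \<delta>" "a \<notin> \<Union>?As"
  proof (rule ideal_avoidance[OF U _ _ graded_algebraD(1)[OF alg]])
    show "finite ?As" using Ns(1) T by blast
    show "ideal B R" if Bm: "B \<in> ?As" for B
    proof -
      obtain N q u where "N \<in> Ns" "u \<in> A q" "B = {c \<in> carrier R. u \<otimes> c \<in> N (\<delta> + q)}" using As[OF Bm] by blast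
      then show ?thesis using ideal_colon[OF graded_submoduleD(1)[OF Ns(2)] car] by simp
    qed
    show "\<not> A \<delta> \<subseteq> B" if Bm: "B \<in> ?As" for B
    proof
      assume sub: "A \<delta> \<subseteq> B"
      obtain N q u where *: "N \<in> Ns" "u \<in> A q" "u \<notin> N q" "B = {c \<in> carrier R. u \<otimes> c \<in> N (\<delta> + q)}"
        using As[OF Bm] by blast
      have "c \<otimes> u \<in> N (\<delta> + q)" if "c \<in> A \<delta>" for c
        using subsetD[OF sub that] *(4) m_comm[of c u] car[OF that] car[OF *(2)] by simp
      then show False using no_socle[OF *(1,2)] *(3) by simp
    qed
  qed
  show ?thesis
  proof (rule bexI[OF _ a(1)], intro ballI allI impI, rule ccontr)
    fix N q b assume *: "N \<in> Ns" "b \<in> A q" "a \<otimes> b \<in> N (\<delta> + q)" "b \<notin> N q"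
    then have "\<exists>(q', u)\<in>T N. a \<otimes> u \<in> N (\<delta> + q')" using bspec[OF T *(1)] a(1) by blast
    then obtain q' u where t: "(q', u) \<in> T N" "a \<otimes> u \<in> N (\<delta> + q')" by auto
    have "u \<in> A q'" using bspec[OF T *(1)] t(1) by auto
    then have "a \<in> ?C N (q', u)" using t(2) m_comm[of a u] car[OF a(1)] car[of u q'] by simp
    then have "a \<in> \<Union>?As" using *(1) t(1) by blast
    then show False using a(2) by simp
  qed
qed

end

section \<open>Joint reductions with regular forms\<close>

context noetherian_cring
begin

lemma bipow_pair_mult: "ideal A R \<Longrightarrow> ideal B R \<Longrightarrow> bipow_pair A B p \<cdot> bipow_pair A B q = bipow_pair A B (p + q)"
  by (simp add: bipow_pair_def bipow_mult)

text \<open>Saturation with respect to the ideal of elements of degree \<open>(1, 1)\<close>: it removes the socle and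
  changes \<open>N\<close> only in small degrees.\<close>

definition saturation :: "(nat \<times> nat \<Rightarrow> 'a set) \<Rightarrow> (nat \<times> nat \<Rightarrow> 'a set) \<Rightarrow> nat \<times> nat \<Rightarrow> 'a set"
  where "saturation E N p = {b \<in> E p. \<exists>n. \<forall>e\<in>E (n, n). e \<otimes> b \<in> N ((n, n) + p)}"

context
  fixes A B :: "'a set" and N :: "nat \<times> nat \<Rightarrow> 'a set"
  assumes A: "ideal A R" and B: "ideal B R" and N: "graded_submodule R (bipow_pair A B) N"
begin

private abbreviation E where "E \<equiv> bipow_pair A B"

private lemma E_ideal: "ideal (E p) R"
  using graded_algebraD(1)[OF bipow_pair_algebra[OF A B]] .

private lemma Ec: "b \<in> E p \<Longrightarrow> b \<in> carrier R"
  using ideal_mem_carrier[OF E_ideal] .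

private lemma saturation_step_mono:
  assumes b: "b \<in> carrier R" and n: "\<forall>e\<in>E (n, n). e \<otimes> b \<in> N ((n, n) + p)" and le: "n \<le> m"
  shows "\<forall>e\<in>E (m, m). e \<otimes> b \<in> N ((m, m) + p)"
proof -
  have "E (m - n, m - n) \<cdot> E (n, n) \<subseteq> {e \<in> carrier R. b \<otimes> e \<in> N ((m, m) + p)}"
  proof (rule ideal_prod_least[OF ideal_colon[OF graded_submoduleD(1)[OF N] b]])
    fix f e assume f: "f \<in> E (m - n, m - n)" and e: "e \<in> E (n, n)"
    have "f \<otimes> (e \<otimes> b) \<in> N ((m - n, m - n) + ((n, n) + p))"
      using graded_submoduleD(3)[OF N f] n e by blast
    moreover have "(m - n, m - n) + ((n, n) + p) = (m, m) + p" using le by (cases p) simp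
    moreover have "f \<otimes> (e \<otimes> b) = b \<otimes> (f \<otimes> e)" using Ec[OF f] Ec[OF e] b by (simp add: m_ac)
    ultimately show "f \<otimes> e \<in> {e \<in> carrier R. b \<otimes> e \<in> N ((m, m) + p)}" using Ec[OF f] Ec[OF e] by simp
  qed
  moreover have "E (m - n, m - n) \<cdot> E (n, n) = E (m, m)" using bipow_pair_mult[OF A B] le by simp
  ultimately show ?thesis using m_comm[of _ b] b Ec[of _ "(m, m)"] by force
qed

private lemma saturation_step_ideal:
  shows "ideal {b \<in> E p. \<forall>e\<in>E (n, n). e \<otimes> b \<in> N ((n, n) + p)} R"
proof (rule ideal_ofI)
  let ?S = "{b \<in> E p. \<forall>e\<in>E (n, n). e \<otimes> b \<in> N ((n, n) + p)}"
  note NI = graded_submoduleD(1)[OF N]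
  show "?S \<subseteq> carrier R" using ideal_subset_carrier[OF E_ideal[of p]] by blast
  show "\<zero> \<in> ?S" using ideal_zero_mem[OF E_ideal] ideal_zero_mem[OF NI] Ec[of _ "(n, n)"] by simp
  fix x assume x: "x \<in> ?S"
  show "x \<oplus> y \<in> ?S" if y: "y \<in> ?S" for y
  proof -
    have "e \<otimes> (x \<oplus> y) \<in> N ((n, n) + p)" if e: "e \<in> E (n, n)" for e
    proof -
      have "e \<otimes> (x \<oplus> y) = e \<otimes> x \<oplus> e \<otimes> y" using x y Ec[OF e] Ec[of x p] Ec[of y p] by (intro r_distr) simp_all
      then show ?thesis using x y e ideal_add_mem[OF NI] by simp
    qed
    then show ?thesis using x y ideal_add_mem[OF E_ideal] by simp
  qed
  show "r \<otimes> x \<in> ?S" if r: "r \<in> carrier R" for r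
  proof -
    have "e \<otimes> (r \<otimes> x) \<in> N ((n, n) + p)" if e: "e \<in> E (n, n)" for e
    proof -
      have "e \<otimes> (r \<otimes> x) = r \<otimes> (e \<otimes> x)" using x r Ec[OF e] Ec[of x p] by (intro m_lcomm) simp_all
      then show ?thesis using x r e ideal_mult_mem[OF NI] by simp
    qed
    then show ?thesis using x r ideal_mult_mem[OF E_ideal] by simp
  qed
qed

private lemma saturation_Union: "saturation E N p = (\<Union>n. {b \<in> E p. \<forall>e\<in>E (n, n). e \<otimes> b \<in> N ((n, n) + p)})"
  by (auto simp: saturation_def)

text \<open>In a fixed degree the colon ideals by E (n, n) increase with n, so one exponent
  suffices; the exponent still depends on the degree.\<close>

private lemma saturation_stabilizes:
  "\<exists>m. saturation E N p = {b \<in> E p. \<forall>e\<in>E (m, m). e \<otimes> b \<in> N ((m, m) + p)}"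
proof -
  let ?S = "\<lambda>n. {b \<in> E p. \<forall>e\<in>E (n, n). e \<otimes> b \<in> N ((n, n) + p)}"
  have inc: "incseq ?S"
  proof (rule incseq_SucI, rule subsetI)
    fix n b assume b: "b \<in> ?S n"
    then have "\<forall>e\<in>E (Suc n, Suc n). e \<otimes> b \<in> N ((Suc n, Suc n) + p)"
      using Ec[of b p] by (intro saturation_step_mono[of b n p "Suc n"]) simp_all
    then show "b \<in> ?S (Suc n)" using b by blast
  qed
  obtain m where m: "\<forall>i\<ge>m. ?S i = ?S m"
    using ideal_sequence_stabilizes[of ?S, OF saturation_step_ideal inc] by (rule exE)
  have "?S i \<subseteq> ?S m" for i
  proof -
    have "?S (max i m) = ?S m" by (rule m[rule_format]) (rule max.cobounded2)
    then show ?thesis using incseqD[OF inc max.cobounded1[of i m]] by (simp only:)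
  qed
  then have "(\<Union>i. ?S i) = ?S m" by (intro equalityI UN_least UN_upper) simp_all
  then have "saturation E N p = ?S m" by (simp only: saturation_Union)
  then show ?thesis by (rule exI)
qed

lemma saturation_submodule: "graded_submodule R E (saturation E N)"
  unfolding graded_submodule_def
proof (intro conjI allI)
  show id: "ideal (saturation E N p) R" for p
  proof -
    obtain m where "saturation E N p = {b \<in> E p. \<forall>e\<in>E (m, m). e \<otimes> b \<in> N ((m, m) + p)}"
      using saturation_stabilizes[of p] by (rule exE)
    then show ?thesis by (simp only: saturation_step_ideal)
  qed
  show "saturation E N \<le> E" by (auto simp: le_fun_def saturation_def)
  fix p q
  show "E p \<cdot> saturation E N q \<subseteq> saturation E N (p + q)"
  proof (rule ideal_prod_least[OF id])
    fix a b assume a: "a \<in> E p" and b: "b \<in> saturation E N q"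
    then obtain n where n: "b \<in> E q" "\<forall>e\<in>E (n, n). e \<otimes> b \<in> N ((n, n) + q)" by (auto simp: saturation_def)
    have "e \<otimes> (a \<otimes> b) \<in> N ((n, n) + (p + q))" if e: "e \<in> E (n, n)" for e
    proof -
      have "a \<otimes> (e \<otimes> b) \<in> N (p + ((n, n) + q))" using graded_submoduleD(3)[OF N a] n e by blast
      moreover have "e \<otimes> (a \<otimes> b) = a \<otimes> (e \<otimes> b)" using Ec[OF a] Ec[OF n(1)] Ec[OF e] by (intro m_lcomm)
      ultimately show ?thesis by (simp add: add.left_commute)
    qed
    then show "a \<otimes> b \<in> saturation E N (p + q)"
      using graded_algebraD(3)[OF bipow_pair_algebra[OF A B] a n(1)] by (auto simp: saturation_def)
  qed
qed

text \<open>If E \<delta> multiplies b into the saturation, multiplying further by E \<delta>' does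
  so with E (1, 1) = E \<delta>' E \<delta>. One more power of E (1, 1) then takes b into N.\<close>

lemma saturation_no_socle:
  assumes \<delta>: "\<delta> + \<delta>' = (1, 1)" and b: "b \<in> E q" and soc: "\<forall>c\<in>E \<delta>. c \<otimes> b \<in> saturation E N (\<delta> + q)"
  shows "b \<in> saturation E N q"
proof -
  obtain m where m: "saturation E N (\<delta> + q) = {b \<in> E (\<delta> + q). \<forall>e\<in>E (m, m). e \<otimes> b \<in> N ((m, m) + (\<delta> + q))}"
    using saturation_stabilizes by blast
  have bc: "b \<in> carrier R" using Ec[OF b] .
  let ?T = "{x \<in> carrier R. b \<otimes> x \<in> N ((Suc m, Suc m) + q)}"
  have eq: "\<delta>' + ((m, m) + (\<delta> + q)) = (Suc m, Suc m) + q"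
    using \<delta> by (cases \<delta>; cases \<delta>'; cases q) auto
  have "E \<delta>' \<cdot> (E (m, m) \<cdot> E \<delta>) \<subseteq> ?T"
  proof (rule ideal_prod_least[OF ideal_colon[OF graded_submoduleD(1)[OF N] bc]])
    fix f x assume f: "f \<in> E \<delta>'" and x: "x \<in> E (m, m) \<cdot> E \<delta>"
    have fc: "f \<in> carrier R" using Ec[OF f] .
    have fb: "f \<otimes> b \<in> carrier R" using fc bc by simp
    have "E (m, m) \<cdot> E \<delta> \<subseteq> {x \<in> carrier R. (f \<otimes> b) \<otimes> x \<in> N ((Suc m, Suc m) + q)}"
    proof (rule ideal_prod_least[OF ideal_colon[OF graded_submoduleD(1)[OF N] fb]])
      fix e c assume e: "e \<in> E (m, m)" and c: "c \<in> E \<delta>"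
      have "e \<otimes> (c \<otimes> b) \<in> N ((m, m) + (\<delta> + q))" using soc c e unfolding m by blast
      then have "f \<otimes> (e \<otimes> (c \<otimes> b)) \<in> N (\<delta>' + ((m, m) + (\<delta> + q)))" by (rule graded_submoduleD(3)[OF N f])
      moreover have "f \<otimes> (e \<otimes> (c \<otimes> b)) = (f \<otimes> b) \<otimes> (e \<otimes> c)" using fc bc Ec[OF e] Ec[OF c] by (simp add: m_ac)
      ultimately show "e \<otimes> c \<in> {x \<in> carrier R. (f \<otimes> b) \<otimes> x \<in> N ((Suc m, Suc m) + q)}"
        using Ec[OF e] Ec[OF c] eq by simp
    qed
    then have *: "x \<in> carrier R" "(f \<otimes> b) \<otimes> x \<in> N ((Suc m, Suc m) + q)" using x by auto
    moreover have "(f \<otimes> b) \<otimes> x = b \<otimes> (f \<otimes> x)" using fc bc *(1) by (simp add: m_ac)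
    ultimately show "f \<otimes> x \<in> ?T" using fc by simp
  qed
  moreover have "E \<delta>' \<cdot> (E (m, m) \<cdot> E \<delta>) = E (\<delta>' + ((m, m) + \<delta>))" by (simp add: bipow_pair_mult[OF A B])
  moreover have "\<delta>' + ((m, m) + \<delta>) = (Suc m, Suc m)" using \<delta> by (cases \<delta>; cases \<delta>') auto
  ultimately have sub: "E (Suc m, Suc m) \<subseteq> ?T" by simp
  have "e \<otimes> b \<in> N ((Suc m, Suc m) + q)" if e: "e \<in> E (Suc m, Suc m)" for e
    using subsetD[OF sub e] m_comm[of e b] Ec[OF e] bc by simp
  then show ?thesis using b by (auto simp: saturation_def)
qed

text \<open>The saturation is generated in degrees at most (k, k). A single m multiplies these
  finitely many components into N by E (m, m), and beyond k + m every cofactor of a generator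
  contains the factor E (m, m).\<close>

lemma saturation_eq_large: "\<exists>n. \<forall>r\<ge>n. \<forall>s\<ge>n. saturation E N (r, s) \<subseteq> N (r, s)"
proof -
  let ?S = "saturation E N"
  note S = saturation_submodule
  \<comment> \<open>The submodule generated by the components of the saturation in degrees at most
    (k, k); it increases with k and therefore stabilizes.\<close>
  let ?gen = "\<lambda>k p. \<Union>{E t \<cdot> ?S q |t q. t + q = p \<and> fst q \<le> k \<and> snd q \<le> k}"
  define gen where "gen = (\<lambda>k p. Idl (?gen k p))"
  have prod_id: "ideal (E t \<cdot> ?S q) R" for t q
    using E_ideal graded_submoduleD(1)[OF S] by (rule ideal_prod_is_ideal)
  have gc: "?gen k p \<subseteq> carrier R" for k p using ideal_subset_carrier[OF prod_id] by blast
  have gid: "ideal (gen k p) R" for k p unfolding gen_def using gc by (rule genideal_ideal)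
  have gself: "?gen k p \<subseteq> gen k p" for k p unfolding gen_def using gc by (rule genideal_self)
  have gleast: "gen k p \<subseteq> C" if "ideal C R" "\<And>t q. t + q = p \<Longrightarrow> fst q \<le> k \<Longrightarrow> snd q \<le> k \<Longrightarrow> E t \<cdot> ?S q \<subseteq> C" for k p C
    unfolding gen_def using that by (intro genideal_minimal Sup_least) blast+
  have gup: "E t \<cdot> ?S q \<subseteq> gen k (t + q)" if "fst q \<le> k" "snd q \<le> k" for t q k
  proof -
    have "E t \<cdot> ?S q \<subseteq> ?gen k (t + q)" using that by blast
    then show ?thesis using gself by (rule subset_trans)
  qed
  have gsub: "graded_submodule R E (gen k)" for k
    unfolding graded_submodule_def
  proof (intro conjI allI gid)
    show "gen k \<le> E"
    proof (rule le_funI, rule gleast[OF E_ideal])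
      fix p t q :: "nat \<times> nat" assume "t + q = p"
      have "E t \<cdot> ?S q \<subseteq> E t \<cdot> E q" using graded_submoduleD(2)[OF S] by (intro ideal_prod_mono subset_refl)
      then show "E t \<cdot> ?S q \<subseteq> E p" using bipow_pair_mult[OF A B, of t q] \<open>t + q = p\<close> by simp
    qed
    fix p q
    show "E p \<cdot> gen k q \<subseteq> gen k (p + q)"
    proof (rule ideal_prod_least[OF gid])
      fix a b assume a: "a \<in> E p" and b: "b \<in> gen k q"
      have "gen k q \<subseteq> {b \<in> carrier R. a \<otimes> b \<in> gen k (p + q)}"
      proof (rule gleast[OF ideal_colon[OF gid Ec[OF a]]])
        fix t q' :: "nat \<times> nat" assume *: "t + q' = q" "fst q' \<le> k" "snd q' \<le> k"
        show "E t \<cdot> ?S q' \<subseteq> {b \<in> carrier R. a \<otimes> b \<in> gen k (p + q)}"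
        proof (rule ideal_prod_least[OF ideal_colon[OF gid Ec[OF a]]])
          fix c d assume c: "c \<in> E t" and d: "d \<in> ?S q'"
          have dc: "d \<in> carrier R" using d ideal_mem_carrier[OF graded_submoduleD(1)[OF S]] by simp
          have "a \<otimes> c \<in> E (p + t)" using graded_algebraD(3)[OF bipow_pair_algebra[OF A B] a c] .
          then have "(a \<otimes> c) \<otimes> d \<in> E (p + t) \<cdot> ?S q'" using d by (rule ideal_prod.prod)
          then have "(a \<otimes> c) \<otimes> d \<in> gen k ((p + t) + q')" by (rule subsetD[OF gup[OF *(2,3)]])
          then have "a \<otimes> (c \<otimes> d) \<in> gen k (p + q)"
            using Ec[OF a] Ec[OF c] dc *(1) by (simp add: m_assoc add.assoc)
          then show "c \<otimes> d \<in> {b \<in> carrier R. a \<otimes> b \<in> gen k (p + q)}" using Ec[OF c] dc by simp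
        qed
      qed
      then show "a \<otimes> b \<in> gen k (p + q)" using b by auto
    qed
  qed
  have ginc: "incseq gen"
  proof (rule incseq_SucI, rule le_funI, rule gleast[OF gid])
    fix k and p t q :: "nat \<times> nat" assume "t + q = p" "fst q \<le> k" "snd q \<le> k"
    then show "E t \<cdot> ?S q \<subseteq> gen (Suc k) p" using gup[of q "Suc k" t] le_SucI by simp
  qed
  obtain k where k: "\<And>i. i \<ge> k \<Longrightarrow> gen i = gen k"
    using bipow_pair_noetherian[OF A B] gsub ginc unfolding graded_noetherian_def by blast
  have Sgen: "?S p \<subseteq> gen k p" for p
  proof -
    let ?i = "max k (max (fst p) (snd p))"
    have E0: "E 0 = carrier R" using graded_algebraD(2)[OF bipow_pair_algebra[OF A B]] .
    have "carrier R \<cdot> ?S p \<subseteq> gen ?i p" using gup[of p ?i 0] by (simp add: E0)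
    then show ?thesis using ideal_prod_one'[OF graded_submoduleD(1)[OF S]] k[of ?i] by simp
  qed
  have "\<forall>q. \<exists>m. ?S q = {b \<in> E q. \<forall>e\<in>E (m, m). e \<otimes> b \<in> N ((m, m) + q)}" using saturation_stabilizes by blast
  from choice[OF this] obtain f where f: "\<And>q. ?S q = {b \<in> E q. \<forall>e\<in>E (f q, f q). e \<otimes> b \<in> N ((f q, f q) + q)}" by blast
  \<comment> \<open>The exponents f q from the separate degrees are made uniform over the finite
    square of generating degrees.\<close>
  define m where "m = Max (f ` ({..k} \<times> {..k}))"
  have m: "\<forall>e\<in>E (m, m). e \<otimes> b \<in> N ((m, m) + q)" if "b \<in> ?S q" "fst q \<le> k" "snd q \<le> k" for b q
  proof -
    have b: "b \<in> E q" "\<forall>e\<in>E (f q, f q). e \<otimes> b \<in> N ((f q, f q) + q)" using that(1) f[of q] by auto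
    have "q \<in> {..k} \<times> {..k}" using that by (cases q) auto
    then have "f q \<le> m" unfolding m_def by (intro Max_ge) auto
    then show ?thesis using saturation_step_mono[OF Ec[OF b(1)] b(2)] by blast
  qed
  have "?S (r, s) \<subseteq> N (r, s)" if rs: "r \<ge> k + m" "s \<ge> k + m" for r s
  proof -
    have "gen k (r, s) \<subseteq> N (r, s)"
    proof (rule gleast[OF graded_submoduleD(1)[OF N]])
      fix t q :: "nat \<times> nat" assume *: "t + q = (r, s)" "fst q \<le> k" "snd q \<le> k"
      \<comment> \<open>t is at least (m, m), since t + q = (r, s) is at least k + m in both entries
        and q at most k.\<close>
      define t' where "t' = (fst t - m, snd t - m)"
      have t: "t = t' + (m, m)" using *(1,2,3) rs by (cases t; cases q) (auto simp: t'_def)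
      have tE: "E t = E t' \<cdot> E (m, m)" unfolding t using bipow_pair_mult[OF A B] by simp
      show "E t \<cdot> ?S q \<subseteq> N (r, s)"
      proof (rule ideal_prod_least[OF graded_submoduleD(1)[OF N]])
        fix c d assume c: "c \<in> E t" and d: "d \<in> ?S q"
        have dc: "d \<in> carrier R" using d ideal_mem_carrier[OF graded_submoduleD(1)[OF S]] by simp
        have "E t' \<cdot> E (m, m) \<subseteq> {c \<in> carrier R. d \<otimes> c \<in> N (r, s)}"
        proof (rule ideal_prod_least[OF ideal_colon[OF graded_submoduleD(1)[OF N] dc]])
          fix a e assume a: "a \<in> E t'" and e: "e \<in> E (m, m)"
          have "a \<otimes> (e \<otimes> d) \<in> N (t' + ((m, m) + q))"
            using graded_submoduleD(3)[OF N a] m[OF d *(2,3)] e by blast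
          moreover have "t' + ((m, m) + q) = (r, s)" using *(1) t by (simp add: add.assoc)
          moreover have "a \<otimes> (e \<otimes> d) = d \<otimes> (a \<otimes> e)" using Ec[OF a] Ec[OF e] dc by (simp add: m_ac)
          ultimately show "a \<otimes> e \<in> {c \<in> carrier R. d \<otimes> c \<in> N (r, s)}" using Ec[OF a] Ec[OF e] by simp
        qed
        then show "c \<otimes> d \<in> N (r, s)" using c m_comm[of c d] Ec[OF c] dc unfolding tE by auto
      qed
    qed
    then show ?thesis using Sgen by blast
  qed
  then show ?thesis by blast
qed

end

end

text \<open>\<open>reduction_filtration R \<mm> I L\<close> and \<open>assoc_forms_family R \<mm> I L\<close> are chosen so that an element
  of \<open>I\<close> is filter-regular modulo the first iff it is superficial for \<open>\<Oplus> \<mm>\<^sup>r I\<^sup>s/\<mm>\<^bsup>r+1\<^esup> I\<^sup>s\<close> modulo \<open>L\<close>, and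
  regular modulo the second iff its form is regular on \<open>G(I)\<close> modulo the forms of \<open>L\<close>; only the
  part with \<open>r = 0\<close> of the latter is a proper submodule.\<close>

definition reduction_filtration :: "('a, 'b) ring_scheme \<Rightarrow> 'a set \<Rightarrow> 'a set \<Rightarrow> 'a set \<Rightarrow> nat \<times> nat \<Rightarrow> 'a set"
  where "reduction_filtration R A I L p = bipow R A I (Suc (fst p)) (snd p) <+>\<^bsub>R\<^esub>
    (case snd p of 0 \<Rightarrow> {\<zero>\<^bsub>R\<^esub>} | Suc s \<Rightarrow> L \<cdot>\<^bsub>R\<^esub> bipow R A I (fst p) s)"

definition assoc_forms_family :: "('a, 'b) ring_scheme \<Rightarrow> 'a set \<Rightarrow> 'a set \<Rightarrow> 'a set \<Rightarrow> nat \<times> nat \<Rightarrow> 'a set"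
  where "assoc_forms_family R A I L p = (if fst p = 0
    then ipow R I (Suc (snd p)) <+>\<^bsub>R\<^esub> shifted R L I (snd p) else bipow R A I (fst p) (snd p))"

lemma (in cring) rees_filtration_assoc:
  assumes I: "ideal I R"
  shows "rees_filtration R I (\<lambda>n. ipow R I (Suc n))"
proof (intro rees_filtration.intro rees_filtration_axioms.intro is_cring)
  show "ideal I R" by fact
  show "ideal (ipow R I (Suc n)) R" for n using I by (rule ipow_ideal)
  show "ipow R I (Suc n) \<subseteq> ipow R I n" for n using I by (rule ipow_antimono) simp
  show "ipow R I i \<cdot> ipow R I (Suc j) \<subseteq> ipow R I (Suc (i + j))" for i j
    using ipow_add[OF I, of i "Suc j"] by simp
qed

section \<open>Superficial elements\<close>

context noetherian_local
begin

lemma reduction_filtration_submodule: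
  assumes I: "ideal I R" and L: "ideal L R" "L \<subseteq> I"
  shows "graded_submodule R (bipow_pair M I) (reduction_filtration R M I L)"
proof -
  let ?E = "bipow R M I"
  note MI = M_ideal I
  have idE: "ideal (?E r s) R" for r s using MI by (rule bipow_ideal)
  let ?S = "\<lambda>r s. case s of 0 \<Rightarrow> {\<zero>} | Suc s \<Rightarrow> L \<cdot> ?E r s"
  have idS: "ideal (?S r s) R" for r s using zeroideal ideal_prod_is_ideal[OF L(1) idE] by (cases s) auto
  have T: "reduction_filtration R M I L (r, s) = ?E (Suc r) s <+> ?S r s" for r s
    by (cases s) (simp_all add: reduction_filtration_def)
  have id: "ideal (reduction_filtration R M I L p) R" for p
    using add_ideals[OF idE idS] by (cases p) (simp only: T)
  have SE: "?S r s \<subseteq> ?E r s" for r s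
  proof (cases s)
    case 0
    then show ?thesis using ideal_zero_mem[OF idE] by simp
  next
    case (Suc s')
    have "L \<cdot> ?E r s' \<subseteq> I \<cdot> ?E r s'" using L(2) by (intro ideal_prod_mono subset_refl)
    then show ?thesis using bipow_Suc_right[OF MI] Suc by simp
  qed
  have sub: "reduction_filtration R M I L (r, s) \<subseteq> ?E r s" for r s
    unfolding T using bipow_antimono[OF MI, of r "Suc r" s s] SE by (intro set_add_least idE) auto
  have "?E r s \<cdot> ?S r' s' \<subseteq> ?S (r + r') (s + s')" for r s r' s'
  proof (cases s')
    case 0
    then have "?E r s \<cdot> ?S r' s' = {\<zero>}" using ideal_prod_zero[OF idE] by simp
    then show ?thesis using ideal_zero_mem[OF idS] by simp
  next
    case (Suc n)
    have "?E r s \<cdot> (L \<cdot> ?E r' n) = L \<cdot> ?E (r + r') (s + n)"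
      using ideal_prod_left_comm[OF idE L(1) idE] bipow_mult[OF MI] by simp
    then show ?thesis using Suc by simp
  qed
  then have "?E r s \<cdot> reduction_filtration R M I L (r', s') \<subseteq> reduction_filtration R M I L (r + r', s + s')" for r s r' s'
    unfolding T ideal_prod_distr(1)[OF idE idE idS] bipow_mult[OF MI] by (intro set_add_mono) simp_all
  then show ?thesis
    unfolding graded_submodule_def le_fun_def bipow_pair_def using id sub by auto
qed

lemma assoc_forms_family_submodule:
  assumes I: "ideal I R" and L: "ideal L R" "L \<subseteq> I"
  shows "graded_submodule R (bipow_pair M I) (assoc_forms_family R M I L)"
proof -
  interpret rf: rees_filtration R I "\<lambda>n. ipow R I (Suc n)" using I by (rule rees_filtration_assoc)
  let ?E = "bipow R M I" and ?N = "assoc_forms_family R M I L"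
  note MI = M_ideal I
  have idE: "ideal (?E r s) R" for r s using MI by (rule bipow_ideal)
  have E0: "?E 0 s = ipow R I s" for s using ideal_prod_one'[OF ipow_ideal[OF I]] by (simp add: bipow_def)
  have N0: "?N (0, s) = rf.forms_ideal L s" for s by (simp add: assoc_forms_family_def rf.forms_ideal_def)
  have N1: "?N (Suc r, s) = ?E (Suc r) s" for r s by (simp add: assoc_forms_family_def)
  have id: "ideal (?N (r, s)) R" for r s using rf.forms_ideal_props(1)[OF L(1)] idE by (cases r) (simp_all add: N0 N1)
  have sub: "?N (r, s) \<subseteq> ?E r s" for r s
  proof (cases r)
    case 0
    have "shifted R L I s \<subseteq> ipow R I s"
    proof (cases s)
      case (Suc n)
      have "L \<cdot> ipow R I n \<subseteq> I \<cdot> ipow R I n" using L(2) by (intro ideal_prod_mono subset_refl)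
      then show ?thesis using Suc ipow_Suc2[OF I] by simp
    qed (use zeroideal ideal_subset_carrier in auto)
    then have "rf.forms_ideal L s \<subseteq> ipow R I s"
      unfolding rf.forms_ideal_def using rf.K_sub by (intro set_add_least rf.ipow_I_ideal)
    then show ?thesis using 0 by (simp add: N0 E0)
  qed (simp add: N1)
  have "?E r s \<cdot> ?N (r', s') \<subseteq> ?N (r + r', s + s')" for r s r' s'
  proof (cases "r + r'")
    case 0
    then show ?thesis using rf.forms_ideal_props(3)[OF L(1), of s s'] by (simp add: N0 E0)
  next
    case (Suc n)
    have "?E r s \<cdot> ?N (r', s') \<subseteq> ?E r s \<cdot> ?E r' s'" using sub by (intro ideal_prod_mono subset_refl)
    then show ?thesis using bipow_mult[OF MI, of r s r' s'] unfolding Suc by (simp add: N1)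
  qed
  then show ?thesis
    unfolding graded_submodule_def le_fun_def bipow_pair_def using id sub by auto
qed

text \<open>One a is made regular modulo two submodules: the saturation of
  \<open>reduction_filtration\<close>, which agrees with it in large degrees and so yields
  superficiality, and \<open>assoc_forms_family\<close>, which yields regularity of the form. The
  former never has a socle; for the latter \<open>no_socle\<close> is assumed.\<close>

lemma exists_superficial_form:
  assumes U: "unit_differences R U" "infinite U"
    and I: "ideal I R" and L: "ideal L R" "L \<subseteq> I"
    and no_socle: "\<And>s b. b \<in> ipow R I s \<Longrightarrow>
      \<forall>c\<in>I. c \<otimes> b \<in> ipow R I (Suc (Suc s)) <+> shifted R L I (Suc s) \<Longrightarrow> b \<in> ipow R I (Suc s) <+> shifted R L I s"
  obtains a where "a \<in> I"
    "\<And>n b. b \<in> ipow R I n \<Longrightarrow> a \<otimes> b \<in> ipow R I (Suc (Suc n)) <+> shifted R L I (Suc n) \<Longrightarrow>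
      b \<in> ipow R I (Suc n) <+> shifted R L I n"
    "\<exists>n. \<forall>r\<ge>n. \<forall>s\<ge>n. \<forall>b\<in>bipow R M I r s. a \<otimes> b \<in> reduction_filtration R M I L (r, Suc s) \<longrightarrow>
      b \<in> reduction_filtration R M I L (r, s)"
proof -
  let ?E = "bipow_pair M I"
  let ?T = "reduction_filtration R M I L" and ?F = "assoc_forms_family R M I L"
  note T = reduction_filtration_submodule[OF I L] and F = assoc_forms_family_submodule[OF I L]
  note sat = saturation_submodule[OF M_ideal I T]
  have E0: "?E (0, s) = ipow R I s" for s using ideal_prod_one'[OF ipow_ideal[OF I]] by (simp add: bipow_pair_def bipow_def)
  have E01: "?E (0, 1) = I" unfolding E0 using I by simp
  have F0: "?F (0, s) = ipow R I (Suc s) <+> shifted R L I s" for s by (simp add: assoc_forms_family_def)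
  have "\<exists>a\<in>?E (0, 1). \<forall>N\<in>{saturation ?E ?T, ?F}. \<forall>q. \<forall>b\<in>?E q. a \<otimes> b \<in> N ((0, 1) + q) \<longrightarrow> b \<in> N q"
  proof (rule exists_homogeneous_nzd[OF U bipow_pair_algebra[OF M_ideal I] bipow_pair_noetherian[OF M_ideal I]])
    show "finite {saturation ?E ?T, ?F}" by simp
    show "graded_submodule R ?E N" if "N \<in> {saturation ?E ?T, ?F}" for N using that sat F by auto
    fix N q b assume N: "N \<in> {saturation ?E ?T, ?F}" and b: "b \<in> ?E q" and soc: "\<forall>c\<in>?E (0, 1). c \<otimes> b \<in> N ((0, 1) + q)"
    show "b \<in> N q"
    proof (cases "N = saturation ?E ?T")
      case True
      then show ?thesis using saturation_no_socle[OF M_ideal I T, of "(0, 1)" "(1, 0)" b q] b soc by simp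
    next
      case False
      then have NF: "N = ?F" using N by simp
      obtain r s where q: "q = (r, s)" by (cases q)
      show ?thesis
      proof (cases "r = 0")
        case True
        have bI: "b \<in> ipow R I s" using b unfolding q True E0 .
        have "\<forall>c\<in>I. c \<otimes> b \<in> ipow R I (Suc (Suc s)) <+> shifted R L I (Suc s)"
          using soc unfolding NF q True E01 F0[symmetric] by simp
        then show ?thesis unfolding NF q True F0 using no_socle[OF bI] by simp
      next
        case False
        \<comment> \<open>For r > 0 the family consists of the whole components M^r I^s.\<close>
        then show ?thesis using b unfolding NF q by (simp add: assoc_forms_family_def bipow_pair_def)
      qed
    qed
  qed
  then obtain a where a: "a \<in> I" "\<And>q b. b \<in> ?E q \<Longrightarrow> a \<otimes> b \<in> saturation ?E ?T ((0, 1) + q) \<Longrightarrow> b \<in> saturation ?E ?T q"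
    "\<And>q b. b \<in> ?E q \<Longrightarrow> a \<otimes> b \<in> ?F ((0, 1) + q) \<Longrightarrow> b \<in> ?F q"
    unfolding E01 by blast
  show ?thesis
  proof (rule that[OF a(1)])
    fix n b assume "b \<in> ipow R I n" "a \<otimes> b \<in> ipow R I (Suc (Suc n)) <+> shifted R L I (Suc n)"
    then show "b \<in> ipow R I (Suc n) <+> shifted R L I n"
      using a(3)[of b "(0, n)"] unfolding E0 F0[symmetric] by simp
  next
    obtain n where n: "\<And>r s. r \<ge> n \<Longrightarrow> s \<ge> n \<Longrightarrow> saturation ?E ?T (r, s) \<subseteq> ?T (r, s)"
      using saturation_eq_large[OF M_ideal I T] by blast
    have "b \<in> ?T (r, s)" if "r \<ge> n" "s \<ge> n" "b \<in> bipow R M I r s" "a \<otimes> b \<in> ?T (r, Suc s)" for r s b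
    proof -
      have bE: "b \<in> ?E (r, s)" using that(3) by (simp add: bipow_pair_def)
      \<comment> \<open>Exponent 0 in the definition of the saturation is enough.\<close>
      have idT: "?T p \<subseteq> saturation ?E ?T p" for p
      proof
        fix x assume x: "x \<in> ?T p"
        have "e \<otimes> x \<in> ?T ((0, 0) + p)" if "e \<in> ?E (0, 0)" for e
          using graded_submoduleD(3)[OF T that x] .
        then show "x \<in> saturation ?E ?T p"
          using x graded_submoduleD(2)[OF T, of p] unfolding saturation_def by blast
      qed
      have "a \<otimes> b \<in> saturation ?E ?T ((0, 1) + (r, s))" using idT that(4) by auto
      then have "b \<in> saturation ?E ?T (r, s)" using a(2)[OF bE] by simp
      then show ?thesis using n[OF that(1,2)] by blast
    qed
    then show "\<exists>n. \<forall>r\<ge>n. \<forall>s\<ge>n. \<forall>b\<in>bipow R M I r s. a \<otimes> b \<in> ?T (r, Suc s) \<longrightarrow> b \<in> ?T (r, s)" by blast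
  qed
qed

text \<open>The analogue in the direction of r: only the saturation is avoided, now with an element
  of degree (1, 0).\<close>

lemma exists_superficial_element:
  assumes U: "unit_differences R U" "infinite U"
    and I: "ideal I R" and L: "ideal L R" "L \<subseteq> I"
  obtains x where "x \<in> M"
    "\<exists>n. \<forall>r\<ge>n. \<forall>s\<ge>n. \<forall>b\<in>bipow R M I r s. x \<otimes> b \<in> reduction_filtration R M I L (Suc r, s) \<longrightarrow>
      b \<in> reduction_filtration R M I L (r, s)"
proof -
  let ?E = "bipow_pair M I"
  let ?T = "reduction_filtration R M I L"
  note T = reduction_filtration_submodule[OF I L]
  note sat = saturation_submodule[OF M_ideal I T]
  have E10: "?E (1, 0) = M" using ideal_prod_one[OF M_ideal] M_ideal by (simp add: bipow_pair_def bipow_def)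
  have "\<exists>a\<in>?E (1, 0). \<forall>N\<in>{saturation ?E ?T}. \<forall>q. \<forall>b\<in>?E q. a \<otimes> b \<in> N ((1, 0) + q) \<longrightarrow> b \<in> N q"
  proof (rule exists_homogeneous_nzd[OF U bipow_pair_algebra[OF M_ideal I] bipow_pair_noetherian[OF M_ideal I]])
    show "finite {saturation ?E ?T}" by simp
    show "graded_submodule R ?E N" if "N \<in> {saturation ?E ?T}" for N using that sat by auto
    fix N q b assume N: "N \<in> {saturation ?E ?T}" and b: "b \<in> ?E q" and soc: "\<forall>c\<in>?E (1, 0). c \<otimes> b \<in> N ((1, 0) + q)"
    then show "b \<in> N q" using saturation_no_socle[OF M_ideal I T, of "(1, 0)" "(0, 1)" b q] by simp
  qed
  then obtain a where a: "a \<in> M" "\<And>q b. b \<in> ?E q \<Longrightarrow> a \<otimes> b \<in> saturation ?E ?T ((1, 0) + q) \<Longrightarrow> b \<in> saturation ?E ?T q"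
    unfolding E10 by blast
  show ?thesis
  proof (rule that[OF a(1)])
    obtain n where n: "\<And>r s. r \<ge> n \<Longrightarrow> s \<ge> n \<Longrightarrow> saturation ?E ?T (r, s) \<subseteq> ?T (r, s)"
      using saturation_eq_large[OF M_ideal I T] by blast
    have "b \<in> ?T (r, s)" if "r \<ge> n" "s \<ge> n" "b \<in> bipow R M I r s" "a \<otimes> b \<in> ?T (Suc r, s)" for r s b
    proof -
      have bE: "b \<in> ?E (r, s)" using that(3) by (simp add: bipow_pair_def)
      have idT: "?T p \<subseteq> saturation ?E ?T p" for p
      proof
        fix x assume x: "x \<in> ?T p"
        have "e \<otimes> x \<in> ?T ((0, 0) + p)" if "e \<in> ?E (0, 0)" for e
          using graded_submoduleD(3)[OF T that x] .
        then show "x \<in> saturation ?E ?T p"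
          using x graded_submoduleD(2)[OF T, of p] unfolding saturation_def by blast
      qed
      have "a \<otimes> b \<in> saturation ?E ?T ((1, 0) + (r, s))" using idT that(4) by auto
      then have "b \<in> saturation ?E ?T (r, s)" using a(2)[OF bE] by simp
      then show ?thesis using n[OF that(1,2)] by blast
    qed
    then show "\<exists>n. \<forall>r\<ge>n. \<forall>s\<ge>n. \<forall>b\<in>bipow R M I r s. a \<otimes> b \<in> ?T (Suc r, s) \<longrightarrow> b \<in> ?T (r, s)" by blast
  qed
qed

end

text \<open>The first difference in \<open>r\<close> and \<open>k\<close>-th difference in \<open>s\<close> of the Bhattacharya polynomial.\<close>

definition difference_polynomial :: "nat \<Rightarrow> (nat \<Rightarrow> nat \<Rightarrow> int) \<Rightarrow> nat \<Rightarrow> nat \<Rightarrow> nat \<Rightarrow> int"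
  where "difference_polynomial d e k r s = (\<Sum>i\<le>d. \<Sum>j\<le>d - i. if k \<le> j
    then e i j * (int ((Suc r + i) choose i) - int ((r + i) choose i)) * int ((s + (j - k)) choose (j - k)) else 0)"

text \<open>Pascal's rule lowers the degree in s by one; the summands with j = k are constant in s
  and drop out.\<close>

lemma difference_polynomial_Suc:
  "difference_polynomial d e (Suc k) r (Suc s) =
    difference_polynomial d e k r (Suc s) - difference_polynomial d e k r s"
  unfolding difference_polynomial_def sum_subtractf[symmetric]
proof (intro sum.cong refl)
  fix i j
  let ?c = "e i j * (int ((Suc r + i) choose i) - int ((r + i) choose i))"
  consider "j < k" | "j = k" | n where "j = Suc (k + n)"
    by (metis add_Suc_right less_imp_Suc_add linorder_neqE_nat)
  then show "(if Suc k \<le> j then ?c * int ((Suc s + (j - Suc k)) choose (j - Suc k)) else 0) =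
      (if k \<le> j then ?c * int ((Suc s + (j - k)) choose (j - k)) else 0) -
      (if k \<le> j then ?c * int ((s + (j - k)) choose (j - k)) else 0)"
  proof cases
    case 3
    then have "j - k = Suc n" "j - Suc k = n" by auto
    moreover have "int ((Suc s + Suc n) choose Suc n) = int ((Suc s + n) choose n) + int ((s + Suc n) choose Suc n)"
      by simp
    ultimately show ?thesis using 3 by (simp add: algebra_simps del: binomial_Suc_Suc)
  qed simp_all
qed

text \<open>After d - 1 differences in s only j \<ge> d - 1 is left, hence i \<le> 1, and for such i
  the first difference in r is the constant 0 or 1.\<close>

lemma difference_polynomial_const:
  assumes "d \<ge> 1"
  shows "difference_polynomial d e (d - 1) (Suc r) s = difference_polynomial d e (d - 1) r s"
  unfolding difference_polynomial_def
proof (intro sum.cong refl)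
  fix i j assume "i \<in> {..d}" "j \<in> {..d - i}"
  then have "i = 0 \<or> i = 1 \<or> j < d - 1" using assms by auto
  then show "(if d - 1 \<le> j then e i j * (int ((Suc (Suc r) + i) choose i) - int ((Suc r + i) choose i)) *
        int ((s + (j - (d - 1))) choose (j - (d - 1))) else 0) =
      (if d - 1 \<le> j then e i j * (int ((Suc r + i) choose i) - int ((r + i) choose i)) *
        int ((s + (j - (d - 1))) choose (j - (d - 1))) else 0)"
    by auto
qed

section \<open>Lengths along superficial sequences\<close>

context noetherian_local
begin

text \<open>In large degrees multiplication by the next element is injective from degree (r, s - 1)
  to (r, s) of the current quotient, by superficiality. Factoring out its image subtracts the length
  in degree (r, s - 1), which is a difference in s.\<close>

lemma colength_reduction_filtration:
  assumes I: "ideal I R" and as: "set as \<subseteq> I" and poly: "bhattacharya_polynomial R M I d e n0"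
    and sup: "\<And>i. i < length as \<Longrightarrow> \<exists>n. \<forall>r\<ge>n. \<forall>s\<ge>n. \<forall>b\<in>bipow R M I r s.
      as ! i \<otimes> b \<in> reduction_filtration R M I (ideal_of R (take i as)) (r, Suc s) \<longrightarrow>
      b \<in> reduction_filtration R M I (ideal_of R (take i as)) (r, s)"
    and k: "k \<le> length as"
  shows "\<exists>n. \<forall>r\<ge>n. \<forall>s\<ge>n. \<exists>l.
    colength R (bipow R M I r s) (reduction_filtration R M I (ideal_of R (take k as)) (r, s)) = enat l \<and>
    int l = difference_polynomial d e k r s"
  using k
proof (induction k)
  let ?E = "bipow R M I"
  note MI = M_ideal I
  have idE: "ideal (?E r s) R" for r s using MI by (rule bipow_ideal)
  case 0
  have "\<exists>l. colength R (?E r s) (reduction_filtration R M I (ideal_of R (take 0 as)) (r, s)) = enat l \<and>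
      int l = difference_polynomial d e 0 r s" if rs: "r \<ge> n0" "s \<ge> n0" for r s
  proof -
    have sh: "(case s of 0 \<Rightarrow> {\<zero>} | Suc t \<Rightarrow> {\<zero>} \<cdot> ?E r t) = {\<zero>}"
      using ideal_prod_zero[OF idE] ideal_prod_commute[OF idE zeroideal] by (cases s) simp_all
    have red: "reduction_filtration R M I (ideal_of R (take 0 as)) (r, s) = ?E (Suc r) s"
      using sh ideal_add_zero[OF idE] by (cases s) (simp_all add: reduction_filtration_def)
    obtain l1 where l1: "colength R (carrier R) (?E r s) = enat l1"
      "int l1 = (\<Sum>i\<le>d. \<Sum>j\<le>d - i. e i j * int ((r + i) choose i) * int ((s + j) choose j))"
      using poly rs unfolding bhattacharya_polynomial_def by blast
    obtain l2 where l2: "colength R (carrier R) (?E (Suc r) s) = enat l2"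
      "int l2 = (\<Sum>i\<le>d. \<Sum>j\<le>d - i. e i j * int ((Suc r + i) choose i) * int ((s + j) choose j))"
      using poly rs unfolding bhattacharya_polynomial_def by (meson le_SucI)
    have "colength R (carrier R) (?E (Suc r) s) = colength R (carrier R) (?E r s) + colength R (?E r s) (?E (Suc r) s)"
      using bipow_antimono[OF MI, of r "Suc r" s s] ideal_subset_carrier[OF idE]
      by (intro colength_add oneideal idE) auto
    then obtain l where l: "colength R (?E r s) (?E (Suc r) s) = enat l" "l2 = l1 + l"
      unfolding l1 l2 by (cases "colength R (?E r s) (?E (Suc r) s)") auto
    have "int l = int l2 - int l1" using l(2) by simp
    also have "\<dots> = difference_polynomial d e 0 r s"
      unfolding l1(2) l2(2) difference_polynomial_def by (simp add: sum_subtractf[symmetric] algebra_simps)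
    finally show ?thesis unfolding red using l(1) by blast
  qed
  then show ?case by blast
next
  case (Suc k)
  let ?E = "bipow R M I"
  note MI = M_ideal I
  have idE: "ideal (?E r s) R" for r s using MI by (rule bipow_ideal)
  let ?L = "ideal_of R (take k as)" and ?a = "as ! k"
  let ?T = "reduction_filtration R M I"
  have kl: "k < length as" using Suc.prems by simp
  have asc: "set as \<subseteq> carrier R" using as ideal_subset_carrier[OF I] by auto
  have tk: "set (take i as) \<subseteq> I" "set (take i as) \<subseteq> carrier R" for i
    using set_take_subset[of i as] as asc by auto
  have Lid: "ideal (ideal_of R (take i as)) R" for i using tk(2) by (rule ideal_of_ideal)
  have LI: "ideal_of R (take i as) \<subseteq> I" for i
    using tk(1) ideal_zero_mem[OF I] by (intro adjoin_least zeroideal I) auto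
  have ac: "?a \<in> carrier R" using asc kl by auto
  have ida: "ideal (PIdl ?a) R" using ac by (rule cgenideal_ideal)
  note T = reduction_filtration_submodule[OF I Lid LI]
  note Tid = graded_submoduleD(1)[OF T]
  obtain n1 where n1: "\<And>r s. r \<ge> n1 \<Longrightarrow> s \<ge> n1 \<Longrightarrow>
    \<exists>l. colength R (?E r s) (?T ?L (r, s)) = enat l \<and> int l = difference_polynomial d e k r s"
    using Suc by auto
  obtain n2 where n2: "\<And>r s b. r \<ge> n2 \<Longrightarrow> s \<ge> n2 \<Longrightarrow> b \<in> ?E r s \<Longrightarrow> ?a \<otimes> b \<in> ?T ?L (r, Suc s) \<Longrightarrow> b \<in> ?T ?L (r, s)"
    using sup[OF kl] by auto
  have "\<exists>l. colength R (?E r s) (?T (ideal_of R (take (Suc k) as)) (r, s)) = enat l \<and>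
      int l = difference_polynomial d e (Suc k) r s" if rs: "r \<ge> Suc (max n1 n2)" "s \<ge> Suc (max n1 n2)" for r s
  proof -
    \<comment> \<open>The threshold was raised by one so that t = s - 1 still exceeds both
      bounds.\<close>
    obtain t where t: "s = Suc t" "t \<ge> n1" "t \<ge> n2" using rs(2) by (cases s) auto
    have r: "r \<ge> n1" "r \<ge> n2" using rs(1) by auto
    let ?V = "?T ?L (r, s)" and ?W = "?T (ideal_of R (take (Suc k) as)) (r, s)"
    have T1: "?W = (PIdl ?a) \<cdot> ?E r t <+> ?V"
    proof -
      have "ideal_of R (take (Suc k) as) \<cdot> ?E r t = ?L \<cdot> ?E r t <+> (PIdl ?a) \<cdot> ?E r t"
        unfolding ideal_of_take_Suc[OF asc kl] by (rule ideal_prod_distr(2)[OF idE Lid ida])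
      then show ?thesis
        using idE ideal_prod_is_ideal[OF Lid idE] ideal_prod_is_ideal[OF ida idE]
        by (simp add: reduction_filtration_def t(1) ideal_add_ac)
    qed
    have TE: "?V \<subseteq> ?W" "?W \<subseteq> ?E r s"
      using T1 set_add_upper2[OF ideal_prod_is_ideal[OF ida idE] Tid] graded_submoduleD(2)[OF T, of "Suc k" "(r, s)"]
      by (simp_all add: bipow_pair_def)
    have "?E r t \<inter> {z \<in> carrier R. ?a \<otimes> z \<in> ?V} = ?T ?L (r, t)"
    proof
      show "?E r t \<inter> {z \<in> carrier R. ?a \<otimes> z \<in> ?V} \<subseteq> ?T ?L (r, t)" using n2[OF r(2) t(3)] t(1) by auto
      show "?T ?L (r, t) \<subseteq> ?E r t \<inter> {z \<in> carrier R. ?a \<otimes> z \<in> ?V}"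
      proof
        fix z assume z: "z \<in> ?T ?L (r, t)"
        have "?a \<in> bipow_pair M I (0, 1)"
          using as kl I ideal_prod_one'[OF I] by (auto simp: bipow_pair_def bipow_def)
        then have "?a \<otimes> z \<in> ?T ?L ((0, 1) + (r, t))" using graded_submoduleD(3)[OF T _ z] by blast
        then show "z \<in> ?E r t \<inter> {z \<in> carrier R. ?a \<otimes> z \<in> ?V}"
          using z graded_submoduleD(2)[OF T, of k "(r, t)"] ideal_mem_carrier[OF Tid] t(1) by (auto simp: bipow_pair_def)
      qed
    qed
    then have c1: "colength R ?W ?V = colength R (?E r t) (?T ?L (r, t))"
      unfolding T1 using colength_smult[OF idE Tid ac] by simp
    have c2: "colength R (?E r s) ?V = colength R (?E r s) ?W + colength R ?W ?V"
      using TE by (intro colength_add idE Tid)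
    obtain l0 where l0: "colength R (?E r s) ?V = enat l0" "int l0 = difference_polynomial d e k r s"
      using n1[OF r(1), of s] t by auto
    obtain l1 where l1: "colength R (?E r t) (?T ?L (r, t)) = enat l1" "int l1 = difference_polynomial d e k r t"
      using n1[OF r(1) t(2)] by auto
    obtain l where l: "colength R (?E r s) ?W = enat l" "l0 = l + l1"
      using c2 unfolding c1 l0 l1 by (cases "colength R (?E r s) ?W") auto
    have "int l = difference_polynomial d e (Suc k) r s"
      unfolding t(1) difference_polynomial_Suc using l(2) l0(2) l1(2) t(1) by simp
    then show ?thesis using l(1) by blast
  qed
  then show ?case by blast
qed

text \<open>After d - 1 differences in s the length no longer depends on r. Multiplication by x,
  injective in large degrees, is thus also surjective from degree (r, s + 1) onto (r + 1, s + 1),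
  which is the reduction inclusion up to M^(r+2) I^(s+1).\<close>

lemma reduction_for_large_of_superficial:
  assumes I: "ideal I R" and as: "set as \<subseteq> I" "length as = d - 1" and d: "d \<ge> 1"
    and poly: "bhattacharya_polynomial R M I d e n0"
    and sup: "\<And>i. i < length as \<Longrightarrow> \<exists>n. \<forall>r\<ge>n. \<forall>s\<ge>n. \<forall>b\<in>bipow R M I r s.
      as ! i \<otimes> b \<in> reduction_filtration R M I (ideal_of R (take i as)) (r, Suc s) \<longrightarrow>
      b \<in> reduction_filtration R M I (ideal_of R (take i as)) (r, s)"
    and x: "x \<in> M" and supx: "\<exists>n. \<forall>r\<ge>n. \<forall>s\<ge>n. \<forall>b\<in>bipow R M I r s.
      x \<otimes> b \<in> reduction_filtration R M I (ideal_of R as) (Suc r, s) \<longrightarrow>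
      b \<in> reduction_filtration R M I (ideal_of R as) (r, s)"
  shows "reduction_for_large R M I x as"
proof -
  let ?E = "bipow R M I" and ?J = "ideal_of R as"
  let ?T = "reduction_filtration R M I ?J"
  note MI = M_ideal I
  have idE: "ideal (?E r s) R" for r s using MI by (rule bipow_ideal)
  have asc: "set as \<subseteq> carrier R" using as ideal_subset_carrier[OF I] by auto
  have J: "ideal ?J R" using asc by (rule ideal_of_ideal)
  have JI: "?J \<subseteq> I" using as(1) ideal_zero_mem[OF I] by (intro adjoin_least zeroideal I) auto
  have xc: "x \<in> carrier R" using x ideal_mem_carrier[OF M_ideal] by simp
  have idx: "ideal (PIdl x) R" using xc by (rule cgenideal_ideal)
  note T = reduction_filtration_submodule[OF I J JI]
  note Tid = graded_submoduleD(1)[OF T]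
  obtain n1 where n1: "\<And>r s. r \<ge> n1 \<Longrightarrow> s \<ge> n1 \<Longrightarrow>
    \<exists>l. colength R (?E r s) (?T (r, s)) = enat l \<and> int l = difference_polynomial d e (d - 1) r s"
    using colength_reduction_filtration[OF I as(1) poly sup, of "d - 1"] as(2) by auto
  obtain n2 where n2: "\<And>r s b. r \<ge> n2 \<Longrightarrow> s \<ge> n2 \<Longrightarrow> b \<in> ?E r s \<Longrightarrow> x \<otimes> b \<in> ?T (Suc r, s) \<Longrightarrow> b \<in> ?T (r, s)"
    using supx by auto
  have "?E (Suc r) (Suc s) \<subseteq> (PIdl x) \<cdot> ?E r (Suc s) <+> ?J \<cdot> ?E (Suc r) s"
    if rs: "r \<ge> max n1 n2" "s \<ge> max n1 n2" for r s
  proof -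
    let ?V = "?T (Suc r, Suc s)"
    let ?W = "(PIdl x) \<cdot> ?E r (Suc s) <+> ?V"
    have idxE: "ideal ((PIdl x) \<cdot> ?E r (Suc s)) R" using idx idE by (rule ideal_prod_is_ideal)
    have idJE: "ideal (?J \<cdot> ?E (Suc r) s) R" using J idE by (rule ideal_prod_is_ideal)
    have T1id: "ideal ?W R" using idxE Tid by (rule add_ideals)
    have xE: "(PIdl x) \<cdot> ?E r (Suc s) \<subseteq> ?E (Suc r) (Suc s)"
    proof -
      have "PIdl x \<subseteq> M" using x M_ideal by (intro cgenideal_minimal)
      then have "(PIdl x) \<cdot> ?E r (Suc s) \<subseteq> M \<cdot> ?E r (Suc s)" by (intro ideal_prod_mono subset_refl)
      then show ?thesis using bipow_Suc_left[OF MI] by simp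
    qed
    have TE: "?V \<subseteq> ?W" "?W \<subseteq> ?E (Suc r) (Suc s)"
      using set_add_upper2[OF idxE Tid] set_add_least[OF idE xE] graded_submoduleD(2)[OF T, of "(Suc r, Suc s)"]
      by (simp_all add: bipow_pair_def)
    have "?E r (Suc s) \<inter> {z \<in> carrier R. x \<otimes> z \<in> ?V} = ?T (r, Suc s)"
    proof
      show "?E r (Suc s) \<inter> {z \<in> carrier R. x \<otimes> z \<in> ?V} \<subseteq> ?T (r, Suc s)" using n2[of r "Suc s"] rs by auto
      show "?T (r, Suc s) \<subseteq> ?E r (Suc s) \<inter> {z \<in> carrier R. x \<otimes> z \<in> ?V}"
      proof
        fix z assume z: "z \<in> ?T (r, Suc s)"
        have "x \<in> bipow_pair M I (1, 0)"
          using x M_ideal ideal_prod_one[OF M_ideal] by (auto simp: bipow_pair_def bipow_def)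
        then have "x \<otimes> z \<in> ?T ((1, 0) + (r, Suc s))" using graded_submoduleD(3)[OF T _ z] by blast
        then show "z \<in> ?E r (Suc s) \<inter> {z \<in> carrier R. x \<otimes> z \<in> ?V}"
          using z graded_submoduleD(2)[OF T, of "(r, Suc s)"] ideal_mem_carrier[OF Tid] by (auto simp: bipow_pair_def)
      qed
    qed
    then have c1: "colength R ?W ?V = colength R (?E r (Suc s)) (?T (r, Suc s))"
      using colength_smult[OF idE Tid xc] by simp
    have c2: "colength R (?E (Suc r) (Suc s)) ?V = colength R (?E (Suc r) (Suc s)) ?W + colength R ?W ?V"
      using TE by (intro colength_add idE Tid T1id)
    obtain l0 where l0: "colength R (?E (Suc r) (Suc s)) ?V = enat l0"
      "int l0 = difference_polynomial d e (d - 1) (Suc r) (Suc s)"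
      using n1[of "Suc r" "Suc s"] rs by auto
    obtain l1 where l1: "colength R (?E r (Suc s)) (?T (r, Suc s)) = enat l1"
      "int l1 = difference_polynomial d e (d - 1) r (Suc s)"
      using n1[of r "Suc s"] rs by auto
    have "l0 = l1" using l0(2) l1(2) difference_polynomial_const[OF d] by simp
    then have "colength R (?E (Suc r) (Suc s)) ?W = 0"
      using c2 unfolding c1 l0 l1 by (cases "colength R (?E (Suc r) (Suc s)) ?W") (auto simp: zero_enat_def)
    then have eq: "?E (Suc r) (Suc s) = ?W" using colength_eq_0[OF idE T1id TE(2)] by simp
    \<comment> \<open>The remaining term is M times the left-hand side, so Nakayama removes
      it.\<close>
    let ?K = "(PIdl x) \<cdot> ?E r (Suc s) <+> ?J \<cdot> ?E (Suc r) s"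
    have "?W = ?K <+> M \<cdot> ?E (Suc r) (Suc s)"
      using idxE idJE idE bipow_Suc_left[OF MI, of "Suc r" "Suc s"]
      by (simp add: reduction_filtration_def ideal_add_ac)
    then show ?thesis
      using nakayama[OF idE add_ideals[OF idxE idJE], of "Suc r" "Suc s"] eq by simp
  qed
  then show ?thesis unfolding reduction_for_large_def by blast
qed

end

text \<open>The Rees algebra of I is the bigraded family of the ideals 0 and I: the zeroth power of
  the zero ideal is R and the higher ones vanish, so only r = 0 remains.\<close>

lemma (in noetherian_cring) ipow_noetherian:
  assumes I: "ideal I R"
  shows "graded_noetherian R (ipow R I)"
  unfolding graded_noetherian_def
proof (intro allI impI)
  fix N :: "nat \<Rightarrow> nat \<Rightarrow> 'a set"
  assume N: "(\<forall>i. graded_submodule R (ipow R I) (N i)) \<and> incseq N"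
  let ?E = "bipow_pair {\<zero>} I"
  define P where "P = (\<lambda>i (p :: nat \<times> nat). if fst p = 0 then N i (snd p) else {\<zero>})"
  note idI = ipow_ideal[OF I]
  have Nid: "ideal (N i s) R" and Nsub: "N i s \<subseteq> ipow R I s"
    and Nmult: "a \<in> ipow R I r \<Longrightarrow> b \<in> N i s \<Longrightarrow> a \<otimes> b \<in> N i (r + s)" for i r s a b
    using N graded_submoduleD[of R "ipow R I" "N i"] by blast+
  have E0: "?E (0, s) = ipow R I s" for s using ideal_prod_one'[OF idI] by (simp add: bipow_pair_def bipow_def)
  have E1: "?E (Suc r, s) = {\<zero>}" for r s
    using ideal_prod_zero[OF idI] ideal_prod_commute[OF zeroideal idI]
    by (simp add: bipow_pair_def bipow_def ipow_zero_Suc)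
  have Pid: "ideal (P i p) R" for i p using Nid zeroideal by (simp add: P_def)
  have sub: "P i p \<subseteq> ?E p" for i p
  proof (cases p)
    case (Pair r s)
    then show ?thesis using Nsub by (cases r) (simp_all add: P_def E0 E1)
  qed
  have "?E p \<cdot> P i q \<subseteq> P i (p + q)" for i p q
  proof (rule ideal_prod_least[OF Pid])
    fix a b assume a: "a \<in> ?E p" and b: "b \<in> P i q"
    obtain r s r' s' where pq: "p = (r, s)" "q = (r', s')" by (cases p; cases q)
    show "a \<otimes> b \<in> P i (p + q)"
    proof (cases "r = 0 \<and> r' = 0")
      case True
      then show ?thesis using a b Nmult by (simp add: pq E0 P_def)
    next
      case False
      have c: "a \<in> carrier R" "b \<in> carrier R"
        using a b ideal_mem_carrier[OF Pid] ideal_mem_carrier[OF bipow_ideal[OF zeroideal I]]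
        by (auto simp: bipow_pair_def)
      have "a = \<zero> \<or> b = \<zero>" using False a b by (cases r; cases r') (simp_all add: pq E1 P_def)
      then have "a \<otimes> b = \<zero>" using c by auto
      then show ?thesis using ideal_zero_mem[OF Pid] by simp
    qed
  qed
  then have "graded_submodule R ?E (P i)" for i unfolding graded_submodule_def le_fun_def using Pid sub by blast
  moreover have "incseq P"
  proof (rule incseq_SucI, rule le_funI)
    fix i p show "P i p \<subseteq> P (Suc i) p"
      using incseqD[of N i "Suc i"] N by (simp add: P_def le_fun_def)
  qed
  ultimately obtain m where m: "\<forall>i\<ge>m. P i = P m"
    using bipow_pair_noetherian[OF zeroideal I] unfolding graded_noetherian_def by blast
  have "N i = N m" if "i \<ge> m" for i
  proof
    fix s show "N i s = N m s" using fun_cong[OF m[rule_format, OF that], of "(0, s)"] by (simp add: P_def)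
  qed
  then show "\<exists>m. \<forall>i\<ge>m. N i = N m" by blast
qed

section \<open>The graded ring of a filtration is Noetherian\<close>

context rees_filtration
begin

text \<open>Top coefficients of representatives of elements of A. Since A need not be homogeneous,
  these replace its graded components.\<close>

definition leading_forms :: "(nat \<Rightarrow> 'a set) set \<Rightarrow> nat \<Rightarrow> 'a set"
  where "leading_forms A s = {c. \<exists>u\<in>rees. form_seq u \<in> A \<and> u s = c \<and> (\<forall>k>s. u k = \<zero>)}"

lemma leading_forms_submodule:
  assumes A: "ideal A G"
  shows "graded_submodule R (ipow R I) (leading_forms A)"
proof -
  interpret G: cring G by (rule G_cring)
  have sub: "leading_forms A s \<subseteq> ipow R I s" for s by (auto simp: leading_forms_def intro: reesD(1))
  have mult: "a \<otimes> c \<in> leading_forms A (i + j)" if a: "a \<in> ipow R I i" and c: "c \<in> leading_forms A j" for a c i j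
  proof -
    obtain u where u: "u \<in> rees" "form_seq u \<in> A" "u j = c" "\<forall>k>j. u k = \<zero>"
      using c by (auto simp: leading_forms_def)
    have ac: "a \<in> carrier R" using a ideal_mem_carrier[OF ipow_I_ideal] by simp
    let ?w = "conv (homog i a) u"
    have "form_seq ?w \<in> A"
      unfolding G_mult[OF homog_rees[OF a] u(1), symmetric]
      by (rule G.ideal_mult_mem[OF A u(2) form_seq_carrier[OF homog_rees[OF a]]])
    moreover have "?w (i + j) = a \<otimes> c" "\<forall>k>i + j. ?w k = \<zero>"
      unfolding conv_homog[OF ac u(1)] using u(3,4) ac by auto
    ultimately show ?thesis using rees_conv[OF homog_rees[OF a] u(1)] unfolding leading_forms_def by blast
  qed
  have id: "ideal (leading_forms A s) R" for s
  proof (rule ideal_ofI)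
    show "leading_forms A s \<subseteq> carrier R" using sub ideal_subset_carrier[OF ipow_I_ideal] by blast
    have "form_seq (\<lambda>n. \<zero>) \<in> A" using G.ideal_zero_mem[OF A] by (simp add: G_zero)
    then show "\<zero> \<in> leading_forms A s" using rees_zero unfolding leading_forms_def by blast
    fix x assume x: "x \<in> leading_forms A s"
    show "r \<otimes> x \<in> leading_forms A s" if "r \<in> carrier R" for r using mult[of r 0 x s] x that by simp
    show "x \<oplus> y \<in> leading_forms A s" if y: "y \<in> leading_forms A s" for y
    proof -
      obtain u where u: "u \<in> rees" "form_seq u \<in> A" "u s = x" "\<forall>k>s. u k = \<zero>"
        using x by (auto simp: leading_forms_def)
      obtain v where v: "v \<in> rees" "form_seq v \<in> A" "v s = y" "\<forall>k>s. v k = \<zero>"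
        using y by (auto simp: leading_forms_def)
      have "form_seq (\<lambda>n. u n \<oplus> v n) \<in> A"
        unfolding G_add[OF u(1) v(1), symmetric] by (rule G.ideal_add_mem[OF A u(2) v(2)])
      then show ?thesis
        unfolding leading_forms_def using rees_add[OF u(1) v(1)] u(3,4) v(3,4)
        by (intro CollectI bexI[of _ "\<lambda>n. u n \<oplus> v n"]) auto
    qed
  qed
  have "ipow R I i \<cdot> leading_forms A j \<subseteq> leading_forms A (i + j)" for i j
    using mult by (intro ideal_prod_least[OF id])
  then show ?thesis unfolding graded_submodule_def le_fun_def using id sub by blast
qed

text \<open>Subtract an element of A with the same top coefficient and induct on the top
  degree.\<close>

lemma leading_forms_determine:
  assumes A: "ideal A G" and B: "ideal B G" and AB: "A \<subseteq> B" and le: "leading_forms B \<le> leading_forms A"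
  shows "B \<subseteq> A"
proof -
  interpret G: cring G by (rule G_cring)
  have *: "form_seq u \<in> A" if "u \<in> rees" "form_seq u \<in> B" "\<forall>n\<ge>N. u n = \<zero>" for N u
    using that
  proof (induction N arbitrary: u)
    case 0
    then have "u = (\<lambda>n. \<zero>)" by auto
    then show ?case using G.ideal_zero_mem[OF A] by (simp add: G_zero)
  next
    case (Suc N)
    have "u N \<in> leading_forms B N" using Suc.prems unfolding leading_forms_def by auto
    then have "u N \<in> leading_forms A N" using le by (auto simp: le_fun_def)
    then obtain v where v: "v \<in> rees" "form_seq v \<in> A" "v N = u N" "\<forall>k>N. v k = \<zero>"
      by (auto simp: leading_forms_def)
    define w where "w = (\<lambda>n. u n \<oplus> \<ominus> v n)"
    note c = reesD(2)[OF Suc.prems(1)] reesD(2)[OF v(1)]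
    have w: "w \<in> rees" unfolding w_def by (rule rees_add[OF Suc.prems(1) rees_minus[OF v(1)]])
    have sum: "form_seq w \<oplus>\<^bsub>G\<^esub> form_seq v = form_seq u"
      unfolding G_add[OF w v(1)] by (rule arg_cong[of _ _ form_seq]) (use c in \<open>auto simp: w_def a_assoc l_neg\<close>)
    have "form_seq w = form_seq u \<ominus>\<^bsub>G\<^esub> form_seq v"
      unfolding sum[symmetric] using form_seq_carrier[OF w] form_seq_carrier[OF v(1)]
      by (simp add: a_minus_def G.a_assoc G.r_neg)
    then have "form_seq w \<in> B" using G.ideal_diff_mem[OF B Suc.prems(2)] v(2) AB by auto
    moreover have "w n = \<zero>" if "n \<ge> N" for n
      using Suc.prems(3) v(3,4) that c by (cases "n = N") (auto simp: w_def r_neg)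
    ultimately have "form_seq w \<in> A" using Suc.IH[OF w] by blast
    then show ?case unfolding sum[symmetric] using v(2) by (rule G.ideal_add_mem[OF A])
  qed
  show ?thesis
  proof
    fix f assume f: "f \<in> B"
    then have "f \<in> carrier G" using G.ideal_mem_carrier[OF B] by simp
    then obtain u where u: "u \<in> rees" "f = form_seq u" by (auto simp: carrier_G)
    obtain N where N: "bound \<zero> N u" using reesD(3)[OF u(1)] by auto
    have "\<forall>n\<ge>Suc N. u n = \<zero>" using N by (auto simp: bound_def)
    then show "f \<in> A" using *[of u] u f by blast
  qed
qed

text \<open>Leading forms turn a chain of arbitrary ideals of G into a chain of graded submodules of
  the Rees algebra; where these are maximal, \<open>leading_forms_determine\<close> makes the chain
  itself stop.\<close>

lemma G_noetherian:
  assumes "noetherian_ring R"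
  shows "noetherian_cring G"
proof -
  interpret G: cring G by (rule G_cring)
  interpret N: noetherian_cring R using assms is_cring by (rule noetherian_cring.intro)
  have "noetherian_ring G"
  proof (rule G.trivial_ideal_chain_imp_noetherian)
    fix C assume C: "C \<noteq> {}" "subset.chain {A. ideal A G} C"
    have idC: "ideal A G" if "A \<in> C" for A using C(2) that by (auto simp: subset.chain_def)
    have "\<exists>P\<in>leading_forms ` C. \<forall>P'\<in>leading_forms ` C. P \<le> P' \<longrightarrow> P' = P"
      using C(1) leading_forms_submodule idC
      by (intro graded_noetherian_maximal[OF N.ipow_noetherian[OF I]]) auto
    then obtain A where A: "A \<in> C" "\<And>B. B \<in> C \<Longrightarrow> leading_forms A \<le> leading_forms B \<Longrightarrow> leading_forms B = leading_forms A"
      by blast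
    have "B \<subseteq> A" if B: "B \<in> C" for B
    proof (cases "B \<subseteq> A")
      case False
      then have AB: "A \<subseteq> B" using C(2) A(1) B by (auto simp: subset.chain_def)
      then have "leading_forms A \<le> leading_forms B" by (auto simp: le_fun_def leading_forms_def)
      then show ?thesis using leading_forms_determine[OF idC[OF A(1)] idC[OF B] AB] A(2)[OF B] by simp
    qed
    then have "\<Union>C = A" using A(1) by blast
    then show "\<Union>C \<in> C" using A(1) by simp
  qed
  then show ?thesis using G_cring by (rule noetherian_cring.intro)
qed

lemma degree_zero_hom: "ring_hom_cring R G (\<lambda>r. form_seq (homog 0 r))"
proof (intro ring_hom_cringI[OF is_cring G_cring] ring_hom_memI)
  fix r assume r: "r \<in> carrier R"
  then have rr: "homog 0 r \<in> rees" by (intro homog_rees) simp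
  show "form_seq (homog 0 r) \<in> carrier G" using form_seq_carrier[OF rr] .
  fix r' assume r': "r' \<in> carrier R"
  then have rr': "homog 0 r' \<in> rees" by (intro homog_rees) simp
  have "conv (homog 0 r) (homog 0 r') = homog 0 (r \<otimes> r')"
  proof
    fix n show "conv (homog 0 r) (homog 0 r') n = homog 0 (r \<otimes> r') n"
      unfolding conv_homog[OF r rr'] using r by (simp add: homog_def)
  qed
  then show "form_seq (homog 0 (r \<otimes> r')) = form_seq (homog 0 r) \<otimes>\<^bsub>G\<^esub> form_seq (homog 0 r')"
    unfolding G_mult[OF rr rr'] by simp
  have "homog 0 (r \<oplus> r') = (\<lambda>n. homog 0 r n \<oplus> homog 0 r' n)" by (auto simp: homog_def)
  then show "form_seq (homog 0 (r \<oplus> r')) = form_seq (homog 0 r) \<oplus>\<^bsub>G\<^esub> form_seq (homog 0 r')"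
    unfolding G_add[OF rr rr'] by simp
qed (simp add: G_one)

text \<open>Unit differences pass through the ring homomorphism from R to degree 0. It is injective
  on U, since a difference that is both a unit and zero would make G trivial, whereas its degree 0
  part is R/K 0.\<close>

lemma G_unit_differences:
  assumes U: "unit_differences R U" "infinite U" and K0: "K 0 \<noteq> carrier R"
  shows "unit_differences G ((\<lambda>r. form_seq (homog 0 r)) ` U)" "infinite ((\<lambda>r. form_seq (homog 0 r)) ` U)"
proof -
  let ?h = "\<lambda>r. form_seq (homog 0 r)"
  interpret h: ring_hom_cring R G ?h by (rule degree_zero_hom)
  have Uc: "U \<subseteq> carrier R" using U(1) by (simp add: unit_differences_def)
  have ex: "\<exists>v\<in>carrier G. v \<otimes>\<^bsub>G\<^esub> (?h r \<ominus>\<^bsub>G\<^esub> ?h r') = \<one>\<^bsub>G\<^esub>" if "r \<in> U" "r' \<in> U" "r \<noteq> r'" for r r'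
  proof -
    have "\<exists>v\<in>carrier R. v \<otimes> (r \<ominus> r') = \<one>" using U(1) that by (simp add: unit_differences_def)
    then obtain v where v: "v \<in> carrier R" "v \<otimes> (r \<ominus> r') = \<one>" by (rule bexE)
    have c: "r \<in> carrier R" "r' \<in> carrier R" using that Uc by auto
    have "?h (v \<otimes> (r \<ominus> r')) = ?h v \<otimes>\<^bsub>G\<^esub> (?h r \<ominus>\<^bsub>G\<^esub> ?h r')"
      unfolding a_minus_def h.hom_mult[OF v(1) a_closed[OF c(1) a_inv_closed[OF c(2)]]]
        h.hom_add[OF c(1) a_inv_closed[OF c(2)]] h.hom_a_inv[OF c(2)] by (rule refl)
    then show ?thesis unfolding v(2) h.hom_one by (intro bexI[of _ "?h v"] h.hom_closed v(1)) (rule sym)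
  qed
  then show "unit_differences G (?h ` U)"
    unfolding unit_differences_def using h.hom_closed Uc by (intro conjI ballI impI) (auto simp only:)
  have "inj_on ?h U"
  proof (rule inj_onI, rule ccontr)
    fix r r' assume r: "r \<in> U" "r' \<in> U" "?h r = ?h r'" "r \<noteq> r'"
    obtain v where v: "v \<in> carrier G" "v \<otimes>\<^bsub>G\<^esub> (?h r \<ominus>\<^bsub>G\<^esub> ?h r') = \<one>\<^bsub>G\<^esub>"
      using ex[OF r(1,2,4)] by (rule bexE)
    have "?h r' \<in> carrier G" using subsetD[OF Uc r(2)] by (rule h.hom_closed)
    then have "?h r \<ominus>\<^bsub>G\<^esub> ?h r' = \<zero>\<^bsub>G\<^esub>" unfolding r(3) a_minus_def by (rule h.S.r_neg)
    then have "\<one>\<^bsub>G\<^esub> = \<zero>\<^bsub>G\<^esub>" using v h.S.r_null[OF v(1)] by (simp only:)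
    then have "homog 0 \<one> 0 \<ominus> \<zero> \<in> K 0" unfolding G_one G_zero form_seq_eq_iff[OF rees_one rees_zero] by blast
    then have "\<one> \<in> K 0" by (simp add: homog_def a_minus_def)
    then show False using K0 ideal.one_imp_carrier[OF K] by auto
  qed
  then show "infinite (?h ` U)" using U(2) finite_imageD by blast
qed

end

context noetherian_local
begin

text \<open>If b violates the claim, some multiple b' = c b is still outside but is taken inside by
  M, because M^k lies in I, which is zero in degree 0 of G(I). Then the whole maximal homogeneous
  ideal kills the form of b', a socle modulo the forms of as; the longer regular sequence fs
  excludes this.\<close>

lemma assoc_graded_no_socle:
  fixes I defines "K \<equiv> \<lambda>n. ipow R I (Suc n)"
  assumes U: "unit_differences R U" "infinite U" and I: "ideal I R" and IM: "I \<subseteq> M" and k: "ipow R M k \<subseteq> I"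
    and fs: "set fs \<subseteq> max_homogeneous_ideal R M I K" "regular_mod (graded_ring R I K) {\<zero>\<^bsub>graded_ring R I K\<^esub>} fs"
    and as: "set as \<subseteq> I" "forms_regular R I K as" "length as < length fs"
    and b: "b \<in> ipow R I s" "\<forall>c\<in>I. c \<otimes> b \<in> K (Suc s) <+> shifted R (ideal_of R as) I (Suc s)"
  shows "b \<in> K s <+> shifted R (ideal_of R as) I s"
proof (rule ccontr)
  interpret rf: rees_filtration R I K unfolding K_def using I by (rule rees_filtration_assoc)
  interpret G: noetherian_cring rf.G by (rule rf.G_noetherian) (rule noetherian_ring_axioms)
  let ?L = "ideal_of R as" and ?MH = "max_homogeneous_ideal R M I K"
  let ?F = "rf.forms_ideal ?L"
  have asc: "set as \<subseteq> carrier R" using as(1) ideal_subset_carrier[OF I] by auto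
  have L: "ideal ?L R" using asc by (rule ideal_of_ideal)
  note F = rf.forms_ideal_props[OF L]
  assume "\<not> ?thesis"
  then have nF: "b \<notin> ?F s" by (simp add: rf.forms_ideal_def)
  have bF: "c \<otimes> b \<in> ?F (Suc s)" if "c \<in> I" for c using b(2) that by (simp add: rf.forms_ideal_def)
  have bc: "b \<in> carrier R" using b(1) ideal_mem_carrier[OF ipow_ideal[OF I]] by simp
  let ?P = "\<lambda>j. \<forall>c\<in>ipow R M j. c \<otimes> b \<in> ?F s"
  have "?P k"
  proof
    fix c assume "c \<in> ipow R M k"
    then have "c \<otimes> b \<in> I \<cdot> ipow R I s" using k b(1) by (intro ideal_prod.prod) auto
    then show "c \<otimes> b \<in> ?F s" using F(2)[of s] ipow_Suc2[OF I] by (auto simp: K_def)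
  qed
  moreover have "\<not> ?P 0" using nF bc by (auto intro!: bexI[of _ \<one>])
  \<comment> \<open>At j the condition switches: some element of M^j keeps b outside
    \<open>?F s\<close>, while all of M^(j+1) takes it inside.\<close>
  ultimately obtain j where j: "\<not> ?P j" "?P (Suc j)" using inc_induct[of 0 k ?P] by blast
  then obtain c where c: "c \<in> ipow R M j" "c \<otimes> b \<notin> ?F s" by blast
  have cc: "c \<in> carrier R" using c(1) ideal_mem_carrier[OF ipow_ideal[OF M_ideal]] by simp
  define b' where "b' = c \<otimes> b"
  have b': "b' \<in> ipow R I s" unfolding b'_def using b(1) cc by (rule ideal_mult_mem[OF ipow_ideal[OF I]])
  have b'c: "b' \<in> carrier R" using cc bc by (simp add: b'_def)
  have b'M: "b' \<otimes> m \<in> ?F s" if m: "m \<in> M" for m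
  proof -
    have mc: "m \<in> carrier R" using m ideal_mem_carrier[OF M_ideal] by simp
    have "c \<otimes> m \<in> ipow R M (Suc j)" unfolding ipow_Suc using c(1) m by (rule ideal_prod.prod)
    then have "(c \<otimes> m) \<otimes> b \<in> ?F s" using j(2) by blast
    moreover have "(c \<otimes> m) \<otimes> b = b' \<otimes> m" unfolding b'_def using cc mc bc by (simp add: m_ac)
    ultimately show ?thesis by simp
  qed
  have b'I: "b' \<otimes> w \<in> ?F (s + Suc n)" if w: "w \<in> ipow R I (Suc n)" for w n
  proof -
    have "ipow R I n \<cdot> I \<subseteq> {w \<in> carrier R. b' \<otimes> w \<in> ?F (s + Suc n)}"
    proof (rule ideal_prod_least[OF ideal_colon[OF F(1) b'c]])
      fix a i assume a: "a \<in> ipow R I n" and i: "i \<in> I"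
      have ai: "a \<in> carrier R" "i \<in> carrier R"
        using a i ideal_mem_carrier[OF ipow_ideal[OF I]] ideal_mem_carrier[OF I] by auto
      have "c \<otimes> (i \<otimes> b) \<in> ?F (Suc s)" using bF[OF i] cc by (rule ideal_mult_mem[OF F(1)])
      then have "a \<otimes> (c \<otimes> (i \<otimes> b)) \<in> ?F (n + Suc s)"
        using ideal_prod.prod[OF a, of _ "?F (Suc s)" R] F(3)[of n "Suc s"] by blast
      moreover have "a \<otimes> (c \<otimes> (i \<otimes> b)) = b' \<otimes> (a \<otimes> i)" unfolding b'_def using ai cc bc by (simp add: m_ac)
      ultimately show "a \<otimes> i \<in> {w \<in> carrier R. b' \<otimes> w \<in> ?F (s + Suc n)}" using ai by (simp add: add.commute)
    qed
    then show ?thesis using w unfolding ipow_Suc by blast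
  qed
  let ?gs = "map (degree_one_form R K) as" and ?u = "rf.form_seq (rf.homog s b')"
  have gs: "ideal_of rf.G ?gs = rf.graded_ideal ?F" using as(1) by (rule rf.ideal_of_forms)
  have idg: "ideal (rf.graded_ideal ?F) rf.G" using F by (rule rf.graded_ideal_ideal)
  have ur: "rf.homog s b' \<in> rf.rees" using b' by (rule rf.homog_rees)
  have uc: "?u \<in> carrier rf.G" using ur by (rule rf.form_seq_carrier)
  have "rf.homog s b' s \<notin> ?F s" using c(2) by (simp add: rf.homog_def b'_def)
  then have un: "?u \<notin> rf.graded_ideal ?F" using rf.form_seq_mem_graded_ideal[OF F(1,2) ur] by blast
  have MHc: "?MH \<subseteq> carrier rf.G" by (auto simp: max_homogeneous_ideal_def)
  have "?MH \<subseteq> {g \<in> carrier rf.G. ?u \<otimes>\<^bsub>rf.G\<^esub> g \<in> rf.graded_ideal ?F}"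
  proof
    fix g assume g: "g \<in> ?MH"
    then obtain w where w: "w \<in> rf.rees" "g = rf.form_seq w"
      using MHc rf.carrier_G by blast
    have "K 0 +> w 0 \<subseteq> M" using g w(2) by (simp add: max_homogeneous_ideal_def rf.form_seq_def)
    then have w0: "w 0 \<in> M"
      using mem_coset_iff[OF rf.K, of "w 0" "w 0" 0] rf.reesD(2)[OF w(1), of 0] by blast
    have "rf.conv (rf.homog s b') w n \<in> ?F n" for n
    proof -
      consider "n < s" | "n = s" | m where "n = s + Suc m"
        by (metis less_imp_Suc_add linorder_neqE_nat add_Suc_right)
      then show ?thesis
        unfolding rf.conv_homog[OF b'c w(1)]
        by cases (use w0 b'M b'I[OF rf.reesD(1)[OF w(1)]] ideal_zero_mem[OF F(1)] in simp_all)
    qed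
    then have "?u \<otimes>\<^bsub>rf.G\<^esub> g \<in> rf.graded_ideal ?F"
      unfolding w(2) rf.G_mult[OF ur w(1)]
      using rf.form_seq_mem_graded_ideal[OF F(1,2) rf.rees_conv[OF ur w(1)]] by blast
    then show "g \<in> {g \<in> carrier rf.G. ?u \<otimes>\<^bsub>rf.G\<^esub> g \<in> rf.graded_ideal ?F}" using g MHc by blast
  qed
  \<comment> \<open>Annihilation is a colon condition, so it extends from the set to the ideal
    generated by it, to which the socle criterion applies.\<close>
  then have J: "Idl\<^bsub>rf.G\<^esub> ?MH \<subseteq> {g \<in> carrier rf.G. ?u \<otimes>\<^bsub>rf.G\<^esub> g \<in> rf.graded_ideal ?F}"
    by (intro G.genideal_minimal G.ideal_colon idg uc)
  have "socle_nonzero rf.G (Idl\<^bsub>rf.G\<^esub> ?MH) (ideal_of rf.G ?gs)"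
    unfolding socle_nonzero_def gs
  proof (rule bexI[of _ ?u])
    show "\<forall>c\<in>Idl\<^bsub>rf.G\<^esub> ?MH. c \<otimes>\<^bsub>rf.G\<^esub> ?u \<in> rf.graded_ideal ?F"
    proof
      fix g assume "g \<in> Idl\<^bsub>rf.G\<^esub> ?MH"
      then have "g \<in> carrier rf.G" "?u \<otimes>\<^bsub>rf.G\<^esub> g \<in> rf.graded_ideal ?F" using J by auto
      then show "g \<otimes>\<^bsub>rf.G\<^esub> ?u \<in> rf.graded_ideal ?F" using G.m_comm[OF _ uc] by simp
    qed
  qed (use uc un in blast)
  moreover have "K 0 = I" using I by (simp add: K_def)
  then have "K 0 \<noteq> carrier R" using IM one_notin_M by auto
  note UG = rf.G_unit_differences[OF U this]
  have "set ?gs \<subseteq> ?MH"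
    using rf.degree_one_form_carrier as(1) IM \<open>K 0 = I\<close>
    by (auto simp: max_homogeneous_ideal_def degree_one_form_def)
  moreover have "regular_mod rf.G {\<zero>\<^bsub>rf.G\<^esub>} ?gs" using rf.regular_mod_forms_iff[OF as(1)] as(2) by blast
  ultimately show False
    using G.shorter_regular_no_socle[OF UG G.genideal_ideal[OF MHc] G.zeroideal _ fs(2), of ?gs]
      G.genideal_self[OF MHc] fs(1) as(3) by auto
qed

end

text \<open>Take B maximal among the ideals inside M with a power in I. If B^k \<subseteq> I and a^n
  lies in I, then (B + (a))^(k+n) \<subseteq> B^k + (a)^n \<subseteq> I, so every a in M already
  belongs to B.\<close>

lemma (in noetherian_cring) ipow_subset_of_radical:
  assumes M: "ideal M R" and I: "ideal I R" and rad: "\<And>a. a \<in> M \<Longrightarrow> \<exists>n::nat. a [^] n \<in> I"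
  shows "\<exists>k. ipow R M k \<subseteq> I"
proof -
  let ?C = "{B. ideal B R \<and> B \<subseteq> M \<and> (\<exists>k. ipow R B k \<subseteq> I)}"
  have "ipow R {\<zero>} (Suc 0) \<subseteq> I" using ideal_zero_mem[OF I] zeroideal by simp
  then have "{\<zero>} \<in> ?C" using ideal_zero_mem[OF M] zeroideal by blast
  then obtain B where B: "B \<in> ?C" "\<And>B'. B' \<in> ?C \<Longrightarrow> B \<subseteq> B' \<Longrightarrow> B' = B"
    using exists_maximal_ideal_in[of ?C] by (metis (mono_tags, lifting) empty_iff mem_Collect_eq)
  obtain k where k: "ideal B R" "B \<subseteq> M" "ipow R B k \<subseteq> I" using B(1) by blast
  have "a \<in> B" if a: "a \<in> M" for a
  proof -
    have ac: "a \<in> carrier R" using a ideal_mem_carrier[OF M] by simp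
    have ida: "ideal (PIdl a) R" using ac by (rule cgenideal_ideal)
    obtain n :: nat where n: "a [^] n \<in> I" using rad[OF a] by blast
    have "ipow R (PIdl a) n \<subseteq> PIdl (a [^] n)" for n :: nat
    proof (induction n)
      case 0
      then show ?case using ac by (auto simp: mem_cgenideal)
    next
      case (Suc n)
      have "ipow R (PIdl a) n \<cdot> (PIdl a) \<subseteq> PIdl (a [^] Suc n)"
      proof (rule ideal_prod_least)
        show "ideal (PIdl (a [^] Suc n)) R" using ac by (intro cgenideal_ideal nat_pow_closed)
        fix b c assume b: "b \<in> ipow R (PIdl a) n" and c: "c \<in> PIdl a"
        obtain r where r: "r \<in> carrier R" "b = r \<otimes> a [^] n"
          using subsetD[OF Suc.IH b] unfolding mem_cgenideal by (rule bexE)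
        obtain r' where r': "r' \<in> carrier R" "c = r' \<otimes> a" using c unfolding mem_cgenideal by (rule bexE)
        have "b \<otimes> c = (r \<otimes> r') \<otimes> a [^] Suc n" using r r' ac by (simp add: m_ac)
        then show "b \<otimes> c \<in> PIdl (a [^] Suc n)" unfolding mem_cgenideal by (intro bexI[of _ "r \<otimes> r'"] m_closed r(1) r'(1))
      qed
      then show ?case by (simp only: ipow_Suc)
    qed
    then have "ipow R (PIdl a) n \<subseteq> I" using cgenideal_minimal[OF I n] by blast
    then have "ipow R (B <+> PIdl a) (k + n) \<subseteq> I"
      using ipow_set_add[OF k(1) ida, of k n] set_add_least[OF I k(3)] by blast
    moreover have "B <+> PIdl a \<subseteq> M" using k(2) cgenideal_minimal[OF M a] by (rule set_add_least[OF M])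
    ultimately have "B <+> PIdl a = B"
      using B(2)[of "B <+> PIdl a"] add_ideals[OF k(1) ida] set_add_upper1[OF k(1) ida] by blast
    then show ?thesis using add_cgenideal_mem[OF k(1) ac] by simp
  qed
  then have "B = M" using k(2) by blast
  then show ?thesis using k(3) by blast
qed

context cring
begin

lemma finprod_two_ideals:
  assumes M: "ideal M R" and I: "ideal I R" and A: "A \<subseteq> {..<Suc m}"
  shows "finprod (ideals_set R) (\<lambda>i. (M # replicate m I) ! i) A =
    bipow R M I (if 0 \<in> A then 1 else 0) (card (A - {0}))"
proof -
  interpret S: comm_monoid "ideals_set R" by (rule ideals_set_is_comm_monoid)
  let ?f = "\<lambda>i. (M # replicate m I) ! i"
  have IM: "I \<in> carrier (ideals_set R)" "M \<in> carrier (ideals_set R)" using I M by (simp_all add: ideals_set_def)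
  have fI: "?f i = I" if "i \<in> A - {0}" for i using that A by (cases i) auto
  have fin: "finite A" using A finite_subset by blast
  have "finprod (ideals_set R) ?f (A - {0}) = finprod (ideals_set R) (\<lambda>i. I) (A - {0})"
    using IM fI by (intro S.finprod_cong') auto
  then have P: "finprod (ideals_set R) ?f (A - {0}) = ipow R I (card (A - {0}))"
    by (simp add: S.finprod_const[OF IM(1)] ipow_def)
  show ?thesis
  proof (cases "0 \<in> A")
    case True
    have "finprod (ideals_set R) ?f (insert 0 (A - {0})) = M \<cdot> finprod (ideals_set R) ?f (A - {0})"
      using fin IM fI by (subst S.finprod_insert) (auto simp: ideals_set_def)
    then show ?thesis using True P M by (simp add: insert_absorb bipow_def)
  next
    case False
    then show ?thesis using P ideal_prod_one'[OF ipow_ideal[OF I]] by (simp add: bipow_def)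
  qed
qed

text \<open>The product of all d ideals is M I^(d-1), so the defining equation lives in bidegree (n,
  (d-1) n). Multiplying it by M^a I^b spreads the inclusion to all large degrees.\<close>

lemma joint_reduction_reduction_for_large:
  assumes M: "ideal M R" and I: "ideal I R" and d: "d \<ge> 2"
    and jr: "joint_reduction R (M # replicate (d - 1) I) (x # as)"
  shows "x \<in> M" "set as \<subseteq> I" "length as = d - 1" "reduction_for_large R M I x as"
proof -
  let ?Is = "M # replicate (d - 1) I" and ?E = "bipow R M I"
  obtain m where m: "d = Suc (Suc m)" using d by (metis Suc_le_D numeral_2_eq_2 Suc_le_mono)
  have len: "length (x # as) = length ?Is" and mem: "\<And>i. i < length ?Is \<Longrightarrow> (x # as) ! i \<in> ?Is ! i"
    using jr unfolding joint_reduction_def by blast+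
  show "x \<in> M" using mem[of 0] by simp
  show la: "length as = d - 1" using len by simp
  show asI: "set as \<subseteq> I"
  proof
    fix a assume "a \<in> set as"
    then obtain i where "i < length as" "a = as ! i" by (metis in_set_conv_nth)
    then show "a \<in> I" using mem[of "Suc i"] la by simp
  qed
  note MI = M I
  have idE: "ideal (?E r s) R" for r s using MI by (rule bipow_ideal)
  have xc: "x \<in> carrier R" using \<open>x \<in> M\<close> ideal_mem_carrier[OF M] by simp
  have asc: "set as \<subseteq> carrier R" using asI ideal_subset_carrier[OF I] by auto
  let ?L = "ideal_of R as"
  have L: "ideal ?L R" using asc by (rule ideal_of_ideal)
  have X: "ideal (PIdl x) R" using xc by (rule cgenideal_ideal)
  let ?P = "\<lambda>A. finprod (ideals_set R) (\<lambda>i. ?Is ! i) A" and ?D = "{..<length ?Is}"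
  obtain n where n: "n \<ge> 1" and eq: "(Idl (\<Union>j\<in>?D. (\<lambda>b. (x # as) ! j \<otimes> b) ` ?P (?D - {j}))) \<cdot> ideal_power R (?P ?D) (n - 1) =
      ideal_power R (?P ?D) n"
    using jr unfolding joint_reduction_def Let_def by blast
  obtain p where p: "n = Suc p" using n by (cases n) auto
  have D: "?D = {..<Suc (Suc m)}" using m by simp
  have P: "?P A = ?E (if 0 \<in> A then 1 else 0) (card (A - {0}))" if "A \<subseteq> ?D" for A
    using finprod_two_ideals[OF MI, of A "d - 1"] that by simp
  have PD: "?P ?D = ?E 1 (Suc m)"
    using P[of ?D] unfolding D by (simp add: card_Diff_singleton)
  have P0: "?P (?D - {0}) = ?E 0 (Suc m)"
    using P[of "?D - {0}"] unfolding D by (simp add: card_Diff_singleton)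
  have Pj: "?P (?D - {j}) = ?E 1 m" if "j \<in> ?D" "j \<noteq> 0" for j
  proof -
    have "card (?D - {j} - {0}) = m" using that unfolding D by (simp add: card_Diff_singleton)
    then show ?thesis using P[of "?D - {j}"] that unfolding D by auto
  qed
  \<comment> \<open>With d = m + 2, the element x is paired with I^(d-1) and each entry of as with M
    I^(d-2).\<close>
  define Q where "Q = (PIdl x) \<cdot> ?E 0 (Suc m) <+> ?L \<cdot> ?E 1 m"
  have idQ: "ideal Q R" unfolding Q_def using X L idE by (intro add_ideals ideal_prod_is_ideal)
  have "(x # as) ! j \<otimes> b \<in> Q" if j: "j \<in> ?D" and b: "b \<in> ?P (?D - {j})" for j b
  proof (cases j)
    case 0
    then have "x \<otimes> b \<in> (PIdl x) \<cdot> ?E 0 (Suc m)" using b P0 by (intro cgenideal_prodI idE xc) simp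
    then show ?thesis
      unfolding Q_def using 0 set_add_left[OF ideal_prod_is_ideal[OF X idE] ideal_prod_is_ideal[OF L idE]] by simp
  next
    case (Suc i)
    then have "as ! i \<in> set as" using j la by simp
    then have "as ! i \<in> ?L" by (rule adjoin_mem[OF zeroideal asc])
    moreover have "b \<in> ?E 1 m" using b Pj[OF j] Suc by simp
    ultimately have "as ! i \<otimes> b \<in> ?L \<cdot> ?E 1 m" by (rule ideal_prod.prod)
    then show ?thesis
      unfolding Q_def using Suc set_add_right[OF ideal_prod_is_ideal[OF X idE] ideal_prod_is_ideal[OF L idE]] by simp
  qed
  then have "Idl (\<Union>j\<in>?D. (\<lambda>b. (x # as) ! j \<otimes> b) ` ?P (?D - {j})) \<subseteq> Q"
    by (intro genideal_minimal idQ UN_least image_subsetI)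
  then have "ideal_power R (?P ?D) n \<subseteq> Q \<cdot> ideal_power R (?P ?D) (n - 1)"
    unfolding eq[symmetric] by (intro ideal_prod_mono subset_refl)
  moreover have pow: "ideal_power R (?P ?D) l = ?E l (Suc m * l)" for l
    unfolding PD ipow_def[symmetric] bipow_def using M I
    by (simp only: ipow_prod[OF ipow_ideal[OF M] ipow_ideal[OF I]] ipow_ipow mult_1 mult_1_left)
  ultimately have sub: "?E (Suc p) (Suc m * Suc p) \<subseteq> Q \<cdot> ?E p (Suc m * p)"
    unfolding pow p by simp
  have "?E (Suc r) (Suc s) \<subseteq> (PIdl x) \<cdot> ?E r (Suc s) <+> ?L \<cdot> ?E (Suc r) s"
    if rs: "r \<ge> Suc m * Suc p + p" "s \<ge> Suc m * Suc p + p" for r s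
  proof -
    \<comment> \<open>a and b are the surplus exponents beyond the degree of the equation; the
      threshold makes them exist.\<close>
    obtain a where a: "r = p + a" using rs(1) le_iff_add[of p r] by auto
    obtain b where b: "s = Suc m * p + m + b" using rs(2) le_iff_add[of "Suc m * p + m" s] by auto
    have "?E (Suc p) (Suc m * Suc p) \<cdot> ?E a b \<subseteq> (Q \<cdot> ?E p (Suc m * p)) \<cdot> ?E a b"
      using sub by (intro ideal_prod_mono subset_refl)
    also have "(Q \<cdot> ?E p (Suc m * p)) \<cdot> ?E a b = Q \<cdot> ?E (p + a) (Suc m * p + b)"
      by (simp only: ideal_prod_assoc[OF idQ idE idE] bipow_mult[OF MI])
    also have "\<dots> = (PIdl x) \<cdot> ?E r (Suc s) <+> ?L \<cdot> ?E (Suc r) s"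
    proof -
      have "Q \<cdot> ?E (p + a) (Suc m * p + b) =
          ((PIdl x) \<cdot> ?E 0 (Suc m)) \<cdot> ?E (p + a) (Suc m * p + b) <+> (?L \<cdot> ?E 1 m) \<cdot> ?E (p + a) (Suc m * p + b)"
        unfolding Q_def by (rule ideal_prod_distr(2)[OF idE ideal_prod_is_ideal[OF X idE] ideal_prod_is_ideal[OF L idE]])
      also have "\<dots> = (PIdl x) \<cdot> ?E (0 + (p + a)) (Suc m + (Suc m * p + b)) <+> ?L \<cdot> ?E (1 + (p + a)) (m + (Suc m * p + b))"
        by (simp only: ideal_prod_assoc[OF X idE idE] ideal_prod_assoc[OF L idE idE] bipow_mult[OF MI])
      also have "0 + (p + a) = r" using a by simp
      also have "1 + (p + a) = Suc r" using a by simp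
      also have "Suc m + (Suc m * p + b) = Suc s" using b by simp
      also have "m + (Suc m * p + b) = s" using b by simp
      finally show ?thesis .
    qed
    finally show ?thesis using a b by (simp add: bipow_mult[OF MI] ac_simps)
  qed
  then show "reduction_for_large R M I x as" unfolding reduction_for_large_def by blast
qed

lemma regular_sequence_of_depth:
  assumes n: "enat n \<le> depth R J" "n > 0"
  obtains ys where "set ys \<subseteq> J" "regular_sequence R ys" "n \<le> length ys"
proof -
  have "\<not> depth R J \<le> enat (n - 1)" using n by (metis diff_less enat_ord_simps(1) not_le order_trans zero_less_one)
  then obtain ys where "set ys \<subseteq> J" "regular_sequence R ys" "\<not> enat (length ys) \<le> enat (n - 1)"
    unfolding depth_def by (auto simp: Sup_le_iff)
  then show ?thesis by (intro that) auto
qed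

end

section \<open>Existence of reductions with regular forms, and the fiber cone\<close>

lemma forms_regular_snoc:
  "forms_regular R I K (as @ [a]) \<longleftrightarrow> forms_regular R I K as \<and> (\<forall>n. \<forall>b\<in>ipow R I n.
    a \<otimes>\<^bsub>R\<^esub> b \<in> K (Suc n) <+>\<^bsub>R\<^esub> ideal_of R as \<cdot>\<^bsub>R\<^esub> ipow R I n \<longrightarrow> b \<in> K n <+>\<^bsub>R\<^esub> shifted R (ideal_of R as) I n)"
  unfolding forms_regular_def by (auto simp: nth_append less_Suc_eq all_conj_distrib)

context noetherian_local
begin

lemma exists_infinite_unit_differences:
  assumes "infinite (carrier (R Quot M))"
  obtains U where "unit_differences R U" "infinite U"
proof -
  have car: "carrier (R Quot M) = (\<lambda>z. M +> z) ` carrier R"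
    by (auto simp: FactRing_def A_RCOSETS_def' a_r_coset_def')
  obtain U where U: "U \<subseteq> carrier R" "inj_on (\<lambda>z. M +> z) U" "(\<lambda>z. M +> z) ` U = carrier (R Quot M)"
    unfolding car using subset_image_inj[of "(\<lambda>z. M +> z) ` carrier R" "\<lambda>z. M +> z" "carrier R"] by auto
  have "\<exists>v\<in>carrier R. v \<otimes> (r \<ominus> r') = \<one>" if r: "r \<in> U" "r' \<in> U" "r \<noteq> r'" for r r'
  proof -
    have c: "r \<in> carrier R" "r' \<in> carrier R" using r U(1) by auto
    have "M +> r \<noteq> M +> r'" using r U(2) by (auto dest: inj_onD)
    then have "r \<ominus> r' \<notin> M" using coset_eq_iff[OF M_ideal c] by simp
    then obtain v where "v \<in> carrier R" "v \<otimes> (r \<ominus> r') = \<one>" using unit_outside_M[of "r \<ominus> r'"] c by auto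
    then show ?thesis by blast
  qed
  then have "unit_differences R U" using U(1) by (simp add: unit_differences_def)
  moreover have "infinite U" using assms U(3) finite_imageI by metis
  ultimately show ?thesis by (rule that)
qed

text \<open>At every stage fewer than d - 1 \<le> \<open>length fs\<close> elements have been
  chosen, so \<open>assoc_graded_no_socle\<close> permits another one. Each is superficial modulo
  its predecessors, and x modulo all of them, which gives the reduction property by counting
  lengths.\<close>

lemma exists_reduction_with_regular_forms:
  fixes I defines "K \<equiv> \<lambda>n. ipow R I (Suc n)"
  assumes U: "unit_differences R U" "infinite U" and I: "ideal I R" and IM: "I \<subseteq> M" and k: "ipow R M k \<subseteq> I"
    and fs: "set fs \<subseteq> max_homogeneous_ideal R M I K" "regular_mod (graded_ring R I K) {\<zero>\<^bsub>graded_ring R I K\<^esub>} fs"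
    and len: "d - 1 \<le> length fs" and d: "d \<ge> 1" and poly: "bhattacharya_polynomial R M I d e n"
  obtains x as where "x \<in> M" "set as \<subseteq> I" "length as = d - 1" "reduction_for_large R M I x as" "forms_regular R I K as"
proof -
  define sup where "sup = (\<lambda>a us. \<exists>n. \<forall>r\<ge>n. \<forall>s\<ge>n. \<forall>b\<in>bipow R M I r s.
      a \<otimes> b \<in> reduction_filtration R M I (ideal_of R us) (r, Suc s) \<longrightarrow>
      b \<in> reduction_filtration R M I (ideal_of R us) (r, s))"
  have Lprops: "ideal (ideal_of R us) R" "ideal_of R us \<subseteq> I" if us: "set us \<subseteq> I" for us
  proof -
    show "ideal (ideal_of R us) R" using us ideal_subset_carrier[OF I] by (intro ideal_of_ideal) auto
    show "ideal_of R us \<subseteq> I" using us ideal_zero_mem[OF I] by (intro adjoin_least zeroideal I) auto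
  qed
  have "\<exists>as. set as \<subseteq> I \<and> length as = i \<and> forms_regular R I K as \<and> (\<forall>j<i. sup (as ! j) (take j as))"
    if "i \<le> d - 1" for i
    using that
  proof (induction i)
    case 0
    show ?case by (intro exI[of _ "[]"]) (simp add: forms_regular_def)
  next
    case (Suc i)
    then obtain as where as: "set as \<subseteq> I" "length as = i" "forms_regular R I K as" "\<forall>j<i. sup (as ! j) (take j as)"
      by auto
    have l: "length as < length fs" using as(2) Suc.prems len by simp
    have soc: "b \<in> ipow R I (Suc s) <+> shifted R (ideal_of R as) I s" if "b \<in> ipow R I s"
      "\<forall>c\<in>I. c \<otimes> b \<in> ipow R I (Suc (Suc s)) <+> shifted R (ideal_of R as) I (Suc s)" for s b
      using assoc_graded_no_socle[OF U I IM k fs[unfolded K_def] as(1) as(3)[unfolded K_def] l] that by simp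
    obtain a where a: "a \<in> I"
      "\<forall>n. \<forall>b\<in>ipow R I n. a \<otimes> b \<in> ipow R I (Suc (Suc n)) <+> shifted R (ideal_of R as) I (Suc n) \<longrightarrow>
        b \<in> ipow R I (Suc n) <+> shifted R (ideal_of R as) I n"
      "sup a as"
    proof (rule exists_superficial_form[OF U I Lprops[OF as(1)] soc])
      fix a assume 1: "a \<in> I"
        and 2: "\<And>n b. b \<in> ipow R I n \<Longrightarrow> a \<otimes> b \<in> ipow R I (Suc (Suc n)) <+> shifted R (ideal_of R as) I (Suc n) \<Longrightarrow>
          b \<in> ipow R I (Suc n) <+> shifted R (ideal_of R as) I n"
        and 3: "\<exists>n. \<forall>r\<ge>n. \<forall>s\<ge>n. \<forall>b\<in>bipow R M I r s.
          a \<otimes> b \<in> reduction_filtration R M I (ideal_of R as) (r, Suc s) \<longrightarrow>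
          b \<in> reduction_filtration R M I (ideal_of R as) (r, s)"
      show thesis
      proof (rule that[OF 1])
        show "\<forall>n. \<forall>b\<in>ipow R I n. a \<otimes> b \<in> ipow R I (Suc (Suc n)) <+> shifted R (ideal_of R as) I (Suc n) \<longrightarrow>
          b \<in> ipow R I (Suc n) <+> shifted R (ideal_of R as) I n"
          by (intro allI ballI impI) (rule 2)
        show "sup a as" unfolding sup_def by (rule 3)
      qed
    qed
    have "forms_regular R I K (as @ [a])"
      unfolding forms_regular_snoc using as(3) a(2) by (simp add: K_def)
    moreover have "sup ((as @ [a]) ! j) (take j (as @ [a]))" if "j < Suc i" for j
      using that as(2,4) a(3) by (cases "j = i") (auto simp: nth_append)
    ultimately show ?case using as(1,2) a(1) by (intro exI[of _ "as @ [a]"]) simp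
  qed
  then obtain as where as: "set as \<subseteq> I" "length as = d - 1" "forms_regular R I K as" "\<forall>j<d - 1. sup (as ! j) (take j as)"
    by blast
  obtain x where x: "x \<in> M" "\<exists>n. \<forall>r\<ge>n. \<forall>s\<ge>n. \<forall>b\<in>bipow R M I r s.
      x \<otimes> b \<in> reduction_filtration R M I (ideal_of R as) (Suc r, s) \<longrightarrow>
      b \<in> reduction_filtration R M I (ideal_of R as) (r, s)"
    by (rule exists_superficial_element[OF U I Lprops[OF as(1)]])
  have "reduction_for_large R M I x as"
    using as(2,4) unfolding sup_def
    by (intro reduction_for_large_of_superficial[OF I as(1,2) d poly _ x]) simp
  then show ?thesis using that[OF x(1) as(1,2) _ as(3)] by blast
qed

text \<open>The reduction inclusion in a single degree, together with M^k \<subseteq> I, puts a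
  power of M into the ideal of x and as. This ideal ignores the order of its generators, so
  \<open>parameters_regular\<close> applies to every ordering.\<close>

lemma reduction_permutable:
  assumes U: "unit_differences R U" "infinite U" and I: "ideal I R" and IM: "I \<subseteq> M" and k: "ipow R M k \<subseteq> I"
    and ys: "set ys \<subseteq> M" "regular_mod R {\<zero>} ys" "length ys = Suc (length as)"
    and x: "x \<in> M" and as: "set as \<subseteq> I" and red: "reduction_for_large R M I x as"
  shows "permutable_mod R {\<zero>} (x # as)"
proof -
  note MI = M_ideal I
  have idE: "ideal (bipow R M I r s) R" for r s using MI by (rule bipow_ideal)
  have xc: "x \<in> carrier R" using x ideal_mem_carrier[OF M_ideal] by simp
  have asc: "set as \<subseteq> carrier R" using as ideal_subset_carrier[OF I] by auto
  have X: "ideal (PIdl x) R" using xc by (rule cgenideal_ideal)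
  have L: "ideal (ideal_of R as) R" using asc by (rule ideal_of_ideal)
  have xas: "set (x # as) \<subseteq> M" "set (x # as) \<subseteq> carrier R" using x as IM xc asc by auto
  obtain n where n: "bipow R M I (Suc n) (Suc n) \<subseteq>
      (PIdl x) \<cdot> bipow R M I n (Suc n) <+> ideal_of R as \<cdot> bipow R M I (Suc n) n"
    using red unfolding reduction_for_large_def by blast
  have "ipow R M (k * Suc n) \<subseteq> ipow R I (Suc n)"
    unfolding ipow_ipow[OF M_ideal, symmetric] using k by (rule ipow_mono)
  then have "ipow R M (Suc n + k * Suc n) \<subseteq> bipow R M I (Suc n) (Suc n)"
    unfolding ipow_add[OF M_ideal] bipow_def by (intro ideal_prod_mono subset_refl)
  also note n
  also have "(PIdl x) \<cdot> bipow R M I n (Suc n) <+> ideal_of R as \<cdot> bipow R M I (Suc n) n \<subseteq> PIdl x <+> ideal_of R as"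
    by (intro set_add_mono ideal_prod_subset_left X L idE)
  also have "PIdl x <+> ideal_of R as = ideal_of R (x # as)" using ideal_of_Cons[OF xc asc] by simp
  finally have N: "ipow R M (Suc n + k * Suc n) \<subseteq> ideal_of R (x # as)" .
  show ?thesis
    unfolding permutable_mod_def
  proof (intro allI impI)
    fix zs assume zs: "mset zs = mset (x # as)"
    have s: "set zs = set (x # as)" using zs by (metis set_mset_mset)
    have "length zs = length ys" using mset_eq_length[OF zs] ys(3) by simp
    moreover have "ipow R M (Suc n + k * Suc n) \<subseteq> ideal_of R zs"
      using N adjoin_cong_set[OF zeroideal xas(2) s[symmetric]] by simp
    ultimately show "regular_mod R {\<zero>} zs" using s xas(1) by (intro parameters_regular[OF U ys(1,2)]) simp_all
  qed
qed

text \<open>The bound q \<le> e 1 (d - 1) and the value of \<mu> give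
  \<open>q + length as \<le> \<mu>\<close>, the inequality that forces the product formula for M
  I.\<close>

lemma minimal_multiplicity_forms_regular_fiber:
  assumes U: "unit_differences R U" "infinite U" and I: "ideal I R" and IM: "I \<subseteq> M" and k: "ipow R M k \<subseteq> I"
    and ys: "set ys \<subseteq> M" "regular_mod R {\<zero>} ys" "length ys = d" and d: "d \<ge> 1"
    and poly: "bhattacharya_polynomial R M I d e n"
    and mu: "colength R I (M \<cdot> I) = enat \<mu>" "int \<mu> = e 1 (d - 1) + int d - 1"
    and x: "x \<in> M" and as: "set as \<subseteq> I" "length as = d - 1" and red: "reduction_for_large R M I x as"
    and t: "t \<le> length as" and reg: "forms_regular R I (\<lambda>n. ipow R I (Suc n)) (take t as)"
  shows "forms_regular R I (\<lambda>n. M \<cdot> ipow R I n) (take t as)"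
proof -
  note MI = M_ideal I
  have perm: "permutable_mod R {\<zero>} (x # as)"
    using ys as(2) d by (intro reduction_permutable[OF U I IM k _ _ _ x as(1) red]) simp_all
  obtain q where q: "colength R (carrier R) (ideal_of R (x # as)) = enat q" "int q \<le> e 1 (d - 1)"
    by (rule colength_le_mixed_multiplicity[OF I x as d perm red poly])
  \<comment> \<open>The colength of I is finite because M^(n+1) I^(n+1), whose colength is given by
    the polynomial, lies in I.\<close>
  have "colength R (carrier R) (bipow R M I (Suc n) (Suc n)) \<noteq> \<infinity>"
    using poly unfolding bhattacharya_polynomial_def by (metis enat.distinct(1) le_SucI order_refl)
  moreover have "bipow R M I (Suc n) (Suc n) \<subseteq> I"
    using bipow_antimono[OF MI, of 0 "Suc n" 1 "Suc n"] ideal_prod_one'[OF I] I by (simp add: bipow_def)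
  then have "colength R (carrier R) I \<le> colength R (carrier R) (bipow R M I (Suc n) (Suc n))"
    by (intro colength_mono(1) oneideal I bipow_ideal[OF MI] ideal_subset_carrier)
  ultimately have fin: "colength R (carrier R) I \<noteq> \<infinity>" by (cases "colength R (carrier R) I") auto
  have "q + length as \<le> \<mu>" using q(2) mu(2) as(2) d by linarith
  then have "M \<cdot> I = (PIdl x) \<cdot> I <+> M \<cdot> ideal_of R as"
    by (rule minimal_multiplicity_product[OF I IM x as(1) fin mu(1) q(1)])
  then show ?thesis by (rule forms_regular_fiber[OF I IM x as(1) t perm _ reg])
qed

lemma bhattacharya_polynomial_of_coeffs:
  assumes I: "ideal I R" and e: "bhattacharya_coeffs R M I d e"
  shows "\<exists>n. bhattacharya_polynomial R M I d e n"
proof -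
  have "module_length R (quot_module R (carrier R) (ideal_power R M r \<cdot> ideal_power R I s)) =
      colength R (carrier R) (bipow R M I r s)" for r s
    unfolding ipow_def[symmetric] bipow_def[symmetric]
    by (intro module_length_quot_module oneideal bipow_ideal M_ideal I ideal_subset_carrier)
  then show ?thesis using e unfolding bhattacharya_coeffs_def bhattacharya_polynomial_def by simp
qed

end

theorem theorem3p6:
  fixes R :: "('a, 'b) ring_scheme" and \<mm> I :: "'a set" and d :: nat
  assumes "cohen_macaulay_local_ring R \<mm>"
    and "krull_dim R = enat d" and "d \<ge> 2"
    and "infinite (carrier (R Quot \<mm>))"
    and "primary_to R \<mm> I"
    and "minimal_mixed_multiplicity R \<mm> I d"
  shows "(\<forall>x as t.
            joint_reduction R (\<mm> # replicate (d - 1) I) (x # as) \<longrightarrow>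
            1 \<le> t \<longrightarrow> t \<le> d - 1 \<longrightarrow>
            regular_sequence (assoc_graded_ring R I) (map (assoc_form R I) (take t as)) \<longrightarrow>
            regular_sequence (fiber_cone R \<mm> I) (map (fiber_form R \<mm> I) (take t as)))
       \<and> (depth_assoc_graded R \<mm> I \<ge> enat (d - 1) \<longrightarrow> depth_fiber_cone R \<mm> I \<ge> enat (d - 1))"
proof -
  have loc: "noetherian_local_ring R \<mm>" and dep: "enat d \<le> depth R \<mm>"
    using assms(1,2) by (simp_all add: cohen_macaulay_local_ring_def)
  interpret noetherian_local R \<mm>
    using loc unfolding noetherian_local_ring_def
    by (intro noetherian_local.intro noetherian_cring.intro noetherian_local_axioms.intro) blast+
  have I: "ideal I R" and rad: "radical_ideal R I = \<mm>" and proper: "I \<noteq> carrier R"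
    using assms(5) by (simp_all add: primary_to_def primary_ideal_def)
  have IM: "I \<subseteq> \<mm>" using I proper by (rule proper_ideal_subset_M)
  obtain k where k: "ipow R \<mm> k \<subseteq> I"
    using ipow_subset_of_radical[OF M_ideal I] rad unfolding radical_ideal_def by blast
  obtain U where U: "unit_differences R U" "infinite U" by (rule exists_infinite_unit_differences[OF assms(4)])
  have d: "d \<ge> 1" "d > 0" "d - 1 > 0" using assms(3) by simp_all
  obtain ys' where ys': "set ys' \<subseteq> \<mm>" "regular_sequence R ys'" "d \<le> length ys'"
    by (rule regular_sequence_of_depth[OF dep d(2)])
  \<comment> \<open>Depth supplies at least d elements; exactly d are kept, as many as a joint
    reduction has.\<close>
  define ys where "ys = take d ys'"
  have "regular_mod R {\<zero>\<^bsub>R\<^esub>} ys'"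
    using ys' regular_sequence_iff[of ys'] ideal_subset_carrier[OF M_ideal] by blast
  then have ys: "set ys \<subseteq> \<mm>" "regular_mod R {\<zero>\<^bsub>R\<^esub>} ys" "length ys = d"
    using ys'(1,3) regular_mod_append[of "{\<zero>\<^bsub>R\<^esub>}" "take d ys'" "drop d ys'"] set_take_subset[of d ys']
    by (auto simp: ys_def)
  obtain e \<mu> where e: "bhattacharya_coeffs R \<mm> I d e"
    and mu: "num_gens R \<mm> I = enat \<mu>" "int \<mu> = e (d - (d - 1)) (d - 1) + int d - 1"
    using assms(6) unfolding minimal_mixed_multiplicity_def has_mixed_multiplicity_def by blast
  have mu': "colength R I (\<mm> \<cdot>\<^bsub>R\<^esub> I) = enat \<mu>" "int \<mu> = e 1 (d - 1) + int d - 1"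
    using mu module_length_quot_module[OF I ideal_prod_is_ideal[OF M_ideal I] ideal_prod_subset_right[OF M_ideal I]]
      assms(3) by (simp_all add: num_gens_def)
  obtain n where poly: "bhattacharya_polynomial R \<mm> I d e n" using bhattacharya_polynomial_of_coeffs[OF I e] by blast
  define K where "K = (\<lambda>n. ipow R I (Suc n))"
  define F where "F = (\<lambda>n. \<mm> \<cdot>\<^bsub>R\<^esub> ipow R I n)"
  interpret A: rees_filtration R I K unfolding K_def using I by (rule rees_filtration_assoc)
  interpret F: rees_filtration R I F
    unfolding F_def
  proof (intro rees_filtration.intro rees_filtration_axioms.intro is_cring I ideal_prod_is_ideal M_ideal ipow_ideal)
    show "\<mm> \<cdot>\<^bsub>R\<^esub> ipow R I n \<subseteq> ipow R I n" for n by (rule ideal_prod_subset_right[OF M_ideal ipow_ideal[OF I]])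
    show "ipow R I i \<cdot>\<^bsub>R\<^esub> (\<mm> \<cdot>\<^bsub>R\<^esub> ipow R I j) \<subseteq> \<mm> \<cdot>\<^bsub>R\<^esub> ipow R I (i + j)" for i j
      using ideal_prod_left_comm[OF ipow_ideal[OF I] M_ideal ipow_ideal[OF I]] by (simp add: ipow_add[OF I])
  qed
  have KF: "assoc_filtration R I = K" "fiber_filtration R \<mm> I = F"
    by (simp_all add: K_def F_def fun_eq_iff assoc_filtration_def fiber_filtration_def ipow_def)
  have defs: "assoc_graded_ring R I = A.G" "fiber_cone R \<mm> I = F.G"
    "assoc_form R I = degree_one_form R K" "fiber_form R \<mm> I = degree_one_form R F"
    by (simp_all add: assoc_graded_ring_def fiber_cone_def assoc_form_def fiber_form_def fun_eq_iff KF)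
  have K0: "K 0 = I" using I by (simp add: K_def)
  have F0: "F 0 = \<mm>" using ideal_prod_one[OF M_ideal] by (simp add: F_def)
  have F0': "F 0 \<noteq> carrier R" using one_notin_M F0 by auto
  \<comment> \<open>Phrased with \<open>reduction_for_large\<close>, so that it serves both a given
    joint reduction and the one constructed for the depth statement.\<close>
  have fiber: "regular_sequence F.G (map (degree_one_form R F) (take t as))"
    if "x \<in> \<mm>" "set as \<subseteq> I" "length as = d - 1" "reduction_for_large R \<mm> I x as" "t \<le> d - 1"
      "forms_regular R I K (take t as)" for x as t
  proof -
    have "forms_regular R I F (take t as)"
      unfolding F_def using that(3,5,6) unfolding K_def
      by (intro minimal_multiplicity_forms_regular_fiber[OF U I IM k ys d(1) poly mu' that(1-4)]) simp_all
    moreover have "set (take t as) \<subseteq> I" using set_take_subset[of t as] that(2) by blast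
    ultimately show ?thesis using F.regular_sequence_forms_iff[OF _ F0'] by blast
  qed
  show ?thesis
  proof (intro conjI allI impI)
    fix x as t
    assume jr: "joint_reduction R (\<mm> # replicate (d - 1) I) (x # as)" and t: "t \<le> d - 1"
      and reg: "regular_sequence (assoc_graded_ring R I) (map (assoc_form R I) (take t as))"
    note red = joint_reduction_reduction_for_large[OF M_ideal I assms(3) jr]
    have tI: "set (take t as) \<subseteq> I" using set_take_subset[of t as] red(2) by blast
    have "forms_regular R I K (take t as)"
      using reg A.regular_sequence_forms_iff[OF tI] K0 proper unfolding defs by simp
    then show "regular_sequence (fiber_cone R \<mm> I) (map (fiber_form R \<mm> I) (take t as))"
      unfolding defs by (rule fiber[OF red t])
  next
    assume dG: "enat (d - 1) \<le> depth_assoc_graded R \<mm> I"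
    let ?MG = "max_homogeneous_ideal R \<mm> I K" and ?MF = "max_homogeneous_ideal R \<mm> I F"
    interpret G: cring A.G by (rule A.G_cring)
    obtain fs where fs: "set fs \<subseteq> ?MG" "regular_sequence A.G fs" "d - 1 \<le> length fs"
      by (rule G.regular_sequence_of_depth[OF dG[unfolded depth_assoc_graded_def KF defs] d(3)])
    have "set fs \<subseteq> carrier A.G" using fs(1) by (auto simp: max_homogeneous_ideal_def)
    then have fsr: "regular_mod A.G {\<zero>\<^bsub>A.G\<^esub>} fs" using fs(2) G.regular_sequence_iff by blast
    obtain x as where x: "x \<in> \<mm>" "set as \<subseteq> I" "length as = d - 1" "reduction_for_large R \<mm> I x as" "forms_regular R I K as"
      unfolding K_def
      by (rule exists_reduction_with_regular_forms[OF U I IM k fs(1)[unfolded K_def] fsr[unfolded K_def] fs(3) d(1) poly])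
    let ?zs = "map (degree_one_form R F) as"
    have "regular_sequence F.G ?zs" using fiber[OF x(1-4), of "d - 1"] x(3,5) by simp
    moreover have "set ?zs \<subseteq> ?MF"
      using F.degree_one_form_carrier x(2) F0 by (auto simp: max_homogeneous_ideal_def degree_one_form_def)
    ultimately have "enat (length ?zs) \<le> depth F.G ?MF" unfolding depth_def by (intro Sup_upper) blast
    then show "enat (d - 1) \<le> depth_fiber_cone R \<mm> I" unfolding depth_fiber_cone_def KF defs using x(3) by simp
  qed
qed

end
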